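(* Let $\omega$ be an $A_1$ weight and $\Omega$ a bounded Lipschitz domain with $\mathrm{diam}(\Omega)\le1$. Let $A$ be a coefficient matrix satisfying the ellipticity condition with constant $\mu$ and $A\in\mathrm{VMO}(\mathbb{R}^d)$. Suppose that for every constant matrix $\overline{A}=\fint_BA$ obtained by averaging $A$ over a ball $B\subset\mathbb{R}^d$, the following holds: for every $f\in L^\infty(\Omega;\mathbb{R}^{m\times d})$ the weak solution $u\in H^1_0(\Omega;\mathbb{R}^m)$ of $-\mathrm{div}(\overline{A}\nabla u)=\mathrm{div}(f)$ in $\Omega$ satisfies $\int_\Omega|\nabla u|^2\omega\,dx\le C_1\int_\Omega|f|^2\omega\,dx$. Then the same holds for $A$: there is a constant $C$ such that for every $f\in L^\infty(\Omega;\mathbb{R}^{m\times d})$ the weak solution $u\in H^1_0(\Omega;\mathbb{R}^m)$ of $-\mathrm{div}(A\nabla u)=\mathrm{div}(f)$ in $\Omega$ satisfies $\int_\Omega|\nabla u|^2\omega\,dx\le C\int_\Omega|f|^2\omega\,dx$.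
   Context: $A=(a^{\alpha\beta}_{ij}(x))$, $1\le i,j\le d$, $1\le\alpha,\beta\le m$, real measurable with $\mu|\xi|^2\le a^{\alpha\beta}_{ij}\xi^\alpha_i\xi^\beta_j$ and $\|A\|_\infty\le\mu^{-1}$ for a.e. $x$ and all $\xi\in\mathbb{R}^{m\times d}$. $\mathrm{div}(A\nabla u)$ has components $\partial_i(a^{\alpha\beta}_{ij}\partial_ju^\beta)$, $\mathrm{div}(f)$ has components $\partial_if^\alpha_i$. $h\in\mathrm{VMO}(\mathbb{R}^d)$ means $\sup_{x\in\mathbb{R}^d,0<t\le r}\fint_{B(x,t)}|h-\fint_{B(x,t)}h|\to0$ as $r\to0$. $\omega\ge0$ in $L^1_{loc}$ is an $A_1$ weight if $\fint_B\omega\le C\inf_B\omega$ for every ball $B$. $\fint$ is Lebesgue average. *)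

theory Defs
  imports "HOL-Analysis.Analysis"
begin

definition avg :: "('d::euclidean_space) set \<Rightarrow> ('d \<Rightarrow> real) \<Rightarrow> real" where
  "avg S h = (LINT x:S|lebesgue. h x) / measure lebesgue S"

definition loc_integrable :: "('d::euclidean_space \<Rightarrow> real) \<Rightarrow> bool" where
  "loc_integrable h \<longleftrightarrow> (\<forall>K. compact K \<longrightarrow> set_integrable lebesgue K h)"

definition VMO :: "('d::euclidean_space \<Rightarrow> real) \<Rightarrow> bool" where
  "VMO h \<longleftrightarrow> h \<in> borel_measurable lebesgue \<and> loc_integrable h \<and>
     (\<forall>e>0. \<exists>r>0. \<forall>x t. 0 < t \<and> t \<le> r \<longrightarrow>
        avg (ball x t) (\<lambda>y. \<bar>h y - avg (ball x t) h\<bar>) \<le> e)"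

text \<open>A_1 weight (inf over the ball understood as essential infimum).\<close>
definition A1_weight :: "('d::euclidean_space \<Rightarrow> real) \<Rightarrow> bool" where
  "A1_weight w \<longleftrightarrow> w \<in> borel_measurable lebesgue \<and> (\<forall>x. 0 \<le> w x) \<and> loc_integrable w \<and>
     (\<exists>C. \<forall>x r. 0 < r \<longrightarrow>
        (AE y in lebesgue. y \<in> ball x r \<longrightarrow> avg (ball x r) w \<le> C * w y))"

definition lipschitz_domain :: "('d::euclidean_space) set \<Rightarrow> bool" where
  "lipschitz_domain \<Omega> \<longleftrightarrow> open \<Omega> \<and> connected \<Omega> \<and> \<Omega> \<noteq> {} \<and>
     (\<forall>p\<in>frontier \<Omega>. \<exists>r>0. \<exists>e L \<phi>. norm e = 1 \<and>
        L-lipschitz_on {v. v \<bullet> e = 0} \<phi> \<and>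
        \<Omega> \<inter> ball p r = {x \<in> ball p r. (x - p) \<bullet> e > \<phi> ((x - p) - ((x - p) \<bullet> e) *\<^sub>R e)})"

text \<open>Jacobian matrix (row alpha = component, column i = variable).\<close>
definition jac :: "(real^'d \<Rightarrow> real^'m) \<Rightarrow> real^'d \<Rightarrow> real^'d^'m" where
  "jac \<phi> x = matrix (frechet_derivative \<phi> (at x))"

definition C1c :: "(real^'d) set \<Rightarrow> (real^'d \<Rightarrow> real^'m) \<Rightarrow> bool" where
  "C1c \<Omega> \<phi> \<longleftrightarrow> (\<forall>x. \<phi> differentiable (at x)) \<and> continuous_on UNIV (jac \<phi>) \<and>
     (\<exists>K. compact K \<and> K \<subseteq> \<Omega> \<and> (\<forall>x. x \<notin> K \<longrightarrow> \<phi> x = 0))"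

text \<open>u lies in H^1_0(Omega;R^m) with weak gradient G: limit in H^1(Omega) of compactly
  supported C^1 functions.\<close>
definition H10 :: "(real^'d) set \<Rightarrow> (real^'d \<Rightarrow> real^'m) \<Rightarrow> (real^'d \<Rightarrow> real^'d^'m) \<Rightarrow> bool" where
  "H10 \<Omega> u G \<longleftrightarrow> u \<in> borel_measurable lebesgue \<and> G \<in> borel_measurable lebesgue \<and>
     (\<exists>\<phi> :: nat \<Rightarrow> real^'d \<Rightarrow> real^'m. (\<forall>k. C1c \<Omega> (\<phi> k)) \<and>
        ((\<lambda>k. \<integral>\<^sup>+ x\<in>\<Omega>. ennreal ((norm (\<phi> k x - u x))\<^sup>2) \<partial>lebesgue) \<longlonglongrightarrow> 0) \<and>
        ((\<lambda>k. \<integral>\<^sup>+ x\<in>\<Omega>. ennreal ((norm (jac (\<phi> k) x - G x))\<^sup>2) \<partial>lebesgue) \<longlonglongrightarrow> 0))"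

text \<open>Ellipticity with constant mu: coercivity and the bound on A (operator-norm reading).\<close>
definition elliptic :: "real \<Rightarrow> (real^'d \<Rightarrow> 'm::finite \<Rightarrow> 'm \<Rightarrow> 'd::finite \<Rightarrow> 'd \<Rightarrow> real) \<Rightarrow> bool" where
  "elliptic \<mu> A \<longleftrightarrow> 0 < \<mu> \<and> (\<forall>\<alpha> \<beta> i j. (\<lambda>x. A x \<alpha> \<beta> i j) \<in> borel_measurable lebesgue) \<and>
     (AE x in lebesgue. \<forall>\<xi> :: real^'d^'m.
        \<mu> * (norm \<xi>)\<^sup>2 \<le> (\<Sum>\<alpha>\<in>UNIV. \<Sum>\<beta>\<in>UNIV. \<Sum>i\<in>UNIV. \<Sum>j\<in>UNIV. A x \<alpha> \<beta> i j * \<xi>$\<alpha>$i * \<xi>$\<beta>$j)) \<and>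
     (AE x in lebesgue. \<forall>\<xi> \<eta> :: real^'d^'m.
        \<bar>\<Sum>\<alpha>\<in>UNIV. \<Sum>\<beta>\<in>UNIV. \<Sum>i\<in>UNIV. \<Sum>j\<in>UNIV. A x \<alpha> \<beta> i j * \<xi>$\<alpha>$i * \<eta>$\<beta>$j\<bar>
          \<le> (1 / \<mu>) * norm \<xi> * norm \<eta>)"

definition Linf :: "(real^'d) set \<Rightarrow> (real^'d \<Rightarrow> real^'d^'m) \<Rightarrow> bool" where
  "Linf \<Omega> f \<longleftrightarrow> f \<in> borel_measurable lebesgue \<and>
     (\<exists>M. AE x in lebesgue. x \<in> \<Omega> \<longrightarrow> norm (f x) \<le> M)"

definition weak_sol :: "(real^'d) set \<Rightarrow> (real^'d \<Rightarrow> 'm::finite \<Rightarrow> 'm \<Rightarrow> 'd::finite \<Rightarrow> 'd \<Rightarrow> real)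
    \<Rightarrow> (real^'d \<Rightarrow> real^'d^'m) \<Rightarrow> (real^'d \<Rightarrow> real^'m) \<Rightarrow> (real^'d \<Rightarrow> real^'d^'m) \<Rightarrow> bool" where
  "weak_sol \<Omega> A f u G \<longleftrightarrow> H10 \<Omega> u G \<and>
     (\<forall>\<phi> :: real^'d \<Rightarrow> real^'m. C1c \<Omega> \<phi> \<longrightarrow>
        (LINT x:\<Omega>|lebesgue. (\<Sum>\<alpha>\<in>UNIV. \<Sum>\<beta>\<in>UNIV. \<Sum>i\<in>UNIV. \<Sum>j\<in>UNIV.
            A x \<alpha> \<beta> i j * G x $\<beta>$j * jac \<phi> x $\<alpha>$i))
        = - (LINT x:\<Omega>|lebesgue. (\<Sum>\<alpha>\<in>UNIV. \<Sum>i\<in>UNIV. f x $\<alpha>$i * jac \<phi> x $\<alpha>$i)))"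

definition weighted_estimate :: "(real^'d) set \<Rightarrow> (real^'d \<Rightarrow> real) \<Rightarrow> real
    \<Rightarrow> (real^'d \<Rightarrow> 'm::finite \<Rightarrow> 'm \<Rightarrow> 'd::finite \<Rightarrow> 'd \<Rightarrow> real) \<Rightarrow> bool" where
  "weighted_estimate \<Omega> w C A \<longleftrightarrow>
     (\<forall>(f :: real^'d \<Rightarrow> real^'d^'m) u G. Linf \<Omega> f \<longrightarrow> weak_sol \<Omega> A f u G \<longrightarrow>
        (\<integral>\<^sup>+ x\<in>\<Omega>. ennreal ((norm (G x))\<^sup>2 * w x) \<partial>lebesgue)
          \<le> ennreal C * (\<integral>\<^sup>+ x\<in>\<Omega>. ennreal ((norm (f x))\<^sup>2 * w x) \<partial>lebesgue))"

end

theory Submission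
 imports Defs
begin

text \<open>
The proof works with the truncated weights \<open>\<sigma> = min w N\<close> and avoids maximal functions: let \<open>U s\<close> be the union
of all balls on which the average of \<open>\<sigma>\<close> exceeds \<open>s\<close>. On a ball whose radius is comparable to the distance to the
complement of \<open>U s\<close>, the solution \<open>u\<close> is compared with the solution \<open>z\<close> of the problem with averaged coefficients.
There \<open>u - z\<close> solves a homogeneous equation, so the weighted estimate for the averaged operator gives it a weighted reverse
Hoelder inequality, while the gradient of \<open>z\<close> is small in the mean because \<open>A\<close> is close to its average off a small set, on
which a Gehring type estimate controls the gradient of \<open>u\<close>. Averaging over a Whitney decomposition of \<open>U s\<close> bounds the sum
over \<open>j \<le> K\<close> of \<open>2^j s\<close> times the energy of \<open>u\<close> in \<open>U (2^j s)\<close> by the energy in \<open>U s\<close> with a constant independent of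
\<open>K\<close>; for large \<open>K\<close> summation over the levels \<open>s\<close> absorbs the energy. All constants are independent of \<open>N\<close>.
\<close>

text \<open>Two constants compete. For the homogeneous part v = u - z the levels cost nothing: the
  A1 condition bounds the sum of \<open>2^j s\<close> times the indicators of the level sets by a
  multiple of \<sigma>, the weighted reverse Hoelder inequality trades the weighted energy of v for
  the average of \<sigma> times its plain energy, and this average is at most a multiple of s
  because a comparable ball leaves \<open>U s\<close> (at the largest scale, because s is large).
  For z no weighted bound is at hand, so it pays the full \<open>2^(K+1) s\<close>; hence the
  freezing error has to be of size \<open>2^-(K+2)\<close>, and K is fixed before the scale of
  freezing. Summation over s counts each high level K times on the left, against a constant that
  does not grow with K. Truncation makes all weighted energies finite, as absorption requires. The
  weighted estimate accepts data in divergence form only, whereas cutting off a solution creates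
  terms without a derivative on the test field; a mean-value formula based on a small ball inside
  the domain, or outside it near the boundary, brings them into divergence form and treats interior
  and boundary alike.\<close>

abbreviation nint :: "('a::euclidean_space => ennreal) => ennreal" where
 "nint f \<equiv> nn_integral lborel f"

abbreviation sint :: "'a::euclidean_space set => ('a => ennreal) => ennreal" where
 "sint S f \<equiv> \<integral>\<^sup>+x\<in>S. f x \<partial>lborel"

abbreviation energy :: "('a::euclidean_space => real) => 'a set => ('a => 'b::euclidean_space) => ennreal" where
 "energy \<sigma> S F \<equiv> sint S (%x. ennreal (\<sigma> x * (norm (F x))^2))"

abbreviation mass :: "'a::euclidean_space set => ('a => 'b::euclidean_space) => ennreal" where
 "mass S F \<equiv> sint S (%x. ennreal (norm (F x)))"

abbreviation esq :: "'a::euclidean_space set => ('a => 'b::euclidean_space) => ennreal" where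
 "esq S F \<equiv> energy (%_. 1) S F"

abbreviation vol :: "'a::euclidean_space set => ennreal" where
 "vol \<equiv> emeasure lborel"

abbreviation borel_fun :: "('a::topological_space => 'b::topological_space) => bool" where
 "borel_fun f \<equiv> f \<in> borel_measurable borel"

abbreviation sum4 :: "('m::finite => 'm => 'd::finite => 'd => real) => real" where
 "sum4 f \<equiv> \<Sum>\<alpha>\<in>UNIV. \<Sum>\<beta>\<in>UNIV. \<Sum>i\<in>UNIV. \<Sum>j\<in>UNIV. f \<alpha> \<beta> i j"

abbreviation seq_tendsto :: "(nat => 'a::topological_space) => 'a => bool" (infixr "~~~>" 60) where
 "X ~~~> L \<equiv> X \<longlonglongrightarrow> L"

section \<open>Whitney averaging\<close>

lemma emeasure_ball_scale:
 fixes x y :: "'a::euclidean_space"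
 assumes "0 <= L" "0 <= r"
 shows "vol (ball x (L * r)) = ennreal (L ^ DIM('a)) * vol (ball y r)" using assms by (simp add: emeasure_ball power_mult_distrib ennreal_mult[symmetric] mult_ac)

text \<open>Tonelli with the density \<open>1 / \<rho> x ^ d\<close> in the centre x replaces the
  choice of a Whitney covering. Slow variation makes \<rho> nearly constant on
  \<open>ball x (L * \<rho> x)\<close>. Hence a point y with \<open>0 < \<rho> y\<close> lies in
  \<open>ball x (\<rho> x)\<close> for centres of total mass at least \<open>v / 4^d\<close>, and in
  \<open>ball x (L * \<rho> x)\<close> for centres of total mass at most
  \<open>v * (2 * L)^d\<close>; the ratio of the two is the constant.\<close>

lemma whitney_average:
 fixes \<rho> :: "'a::euclidean_space => real" and P Q :: "'a => ennreal"
 assumes L: "1 <= L" and nonneg: "!!x. 0 <= \<rho> x"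
  and lip: "!!x y. \<bar>\<rho> x - \<rho> y\<bar> <= dist x y / (8 * L)"
  and [measurable]: "borel_fun P" "borel_fun Q"
  and loc: "!!x. 0 < \<rho> x ==>
   (sint (ball x (\<rho> x)) P) <= sint (ball x (L * \<rho> x)) Q"
 shows "(sint {y. 0 < \<rho> y} P)
   <= ennreal ((8 * L) ^ DIM('a)) * sint {y. 0 < \<rho> y} Q"
proof -
 let ?d = "DIM('a)"
 define v where "v = unit_ball_vol (real ?d)"
 have v: "v > 0" by (simp add: v_def)
 have emb: "vol (ball x r) = ennreal (v * r ^ ?d)" if "0 <= r" for x :: 'a and r using that by (simp add: emeasure_ball v_def)
 have "continuous_on UNIV \<rho>"
 proof (rule lipschitz_on_continuous_on)
  show "(1 / (8 * L))-lipschitz_on UNIV \<rho>" using lip L by (intro lipschitz_onI) (auto simp: dist_real_def)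
 qed
 then have [measurable]: "borel_fun \<rho>" by (rule borel_measurable_continuous_onI)
 define k :: "'a => ennreal" where "k x = (if 0 < \<rho> x then ennreal (1 / \<rho> x ^ ?d) else 0)" for x
 have [measurable]: "borel_fun k" unfolding k_def by measurable
 define I where "I = (%c x y. if dist x y < c * \<rho> x then 1 else 0 :: ennreal)"
 have ball_I: "indicator (ball x (c * \<rho> x)) y = I c x y" for c x y by (auto simp: I_def indicator_def)
 have [measurable]: "(%(x, y). I c x y) \<in> borel_measurable (lborel \<Otimes>\<^sub>M lborel)"
  "(%(y, x). I c x y) \<in> borel_measurable (lborel \<Otimes>\<^sub>M lborel)" for c unfolding I_def by measurable
 have tonelli: "nint (%x. k x * nint (%y. F y * I c x y))
   = nint (%y. F y * nint (%x. k x * I c x y))"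
  if [measurable]: "borel_fun F" for F c
 proof -
  have "nint (%x. k x * nint (%y. F y * I c x y))
    = nint (%x. (nint (%y. k x * (F y * I c x y))))" by (subst nn_integral_cmult[symmetric]) (auto simp: I_def)
  also have "... = nint (%y. (nint (%x. k x * (F y * I c x y))))" unfolding I_def by (rule lborel_pair.Fubini') measurable
  also have "... = nint (%y. (nint (%x. F y * (k x * I c x y))))" by (simp add: mult_ac)
  also have "... = nint (%y. F y * nint (%x. k x * I c x y))" by (subst nn_integral_cmult) (auto simp: I_def)
  finally show ?thesis .
 qed
 \<comment> \<open>Only centres within \<open>\<rho> y / 2\<close> of y are counted. For them
   \<open>\<rho> x <= 2 * \<rho> y\<close>, and the volume of that ball divided by
   \<open>(2 * \<rho> y)^d\<close> leaves \<open>(1/4)^d\<close>.\<close>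
 have lower: "ennreal (v * (1/4) ^ ?d) <= nint (%x. k x * I 1 x y)" if y: "0 < \<rho> y" for y
 proof -
  have pt: "ennreal (1 / (2 * \<rho> y) ^ ?d) * indicator (ball y (\<rho> y / 2)) x <= k x * I 1 x y" for x
  proof (cases "x \<in> ball y (\<rho> y / 2)")
   case True
   then have xy: "dist x y < \<rho> y / 2" by (simp add: dist_commute)
   have "\<bar>\<rho> x - \<rho> y\<bar> <= dist x y / 8" using lip[of x y] L by (smt (verit) frac_le zero_le_dist)
   then have "dist x y < \<rho> x" "\<rho> x <= 2 * \<rho> y" "0 < \<rho> x" using xy y zero_le_dist[of x y] by linarith+
   moreover have "1 / (2 * \<rho> y) ^ ?d <= 1 / \<rho> x ^ ?d" using calculation y by (intro divide_left_mono power_mono mult_pos_pos zero_less_power) auto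
   ultimately have "1 / (2 * \<rho> y) ^ ?d <= 1 / \<rho> x ^ ?d" "I 1 x y = 1" "k x = ennreal (1 / \<rho> x ^ ?d)" by (simp_all add: I_def k_def)
   then show ?thesis using True by (simp add: ennreal_leI)
  qed simp
  have "ennreal (v * (1/4) ^ ?d) = ennreal (1 / (2 * \<rho> y) ^ ?d) * vol (ball y (\<rho> y / 2))"
  proof -
   have "v * (1/4) ^ ?d = 1 / (2 * \<rho> y) ^ ?d * (v * (\<rho> y / 2) ^ ?d)"
   proof -
    have "1 / (2 * \<rho> y) ^ ?d * (\<rho> y / 2) ^ ?d = (1 / (2 * \<rho> y)) ^ ?d * (\<rho> y / 2) ^ ?d" by (simp only: power_one_over)
    also have "... = (1 / (2 * \<rho> y) * (\<rho> y / 2)) ^ ?d" by (rule power_mult_distrib[symmetric])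
    also have "1 / (2 * \<rho> y) * (\<rho> y / 2) = 1/4" using y by simp
    finally show ?thesis by (metis mult.left_commute)
   qed
   then show ?thesis using y v by (simp add: emb ennreal_mult[symmetric])
  qed
  also have "... = nint (%x. ennreal (1 / (2 * \<rho> y) ^ ?d) * indicator (ball y (\<rho> y / 2)) x)" by (rule nn_integral_cmult_indicator[symmetric]) auto
  also have "... <= nint (%x. k x * I 1 x y)" by (intro nn_integral_mono pt)
  finally show ?thesis .
 qed
 have upper: "nint (%x. k x * I L x y) <= ennreal (v * (2 * L) ^ ?d) * indicator {y. 0 < \<rho> y} y" for y
 proof -
  have near: "0 < \<rho> y & \<rho> y <= 9/8 * \<rho> x & dist x y < 8/7 * L * \<rho> y" if "0 < \<rho> x" "dist x y < L * \<rho> x" for x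
  proof -
   have "\<bar>\<rho> x - \<rho> y\<bar> <= dist x y / (8 * L)" using lip[of x y] .
   also have "... <= L * \<rho> x / (8 * L)" using that L by (intro divide_right_mono) auto
   also have "... = \<rho> x / 8" using L by simp
   finally have b: "\<bar>\<rho> x - \<rho> y\<bar> <= \<rho> x / 8" .
   have "\<rho> x <= 8/7 * \<rho> y" using b by linarith
   then have "L * \<rho> x <= L * (8/7 * \<rho> y)" using L by (intro mult_left_mono) auto
   then have "dist x y < 8/7 * L * \<rho> y" using that by simp
   moreover have "0 < \<rho> y" "\<rho> y <= 9/8 * \<rho> x" using b that by linarith+
   ultimately show ?thesis by simp
  qed
  show ?thesis
  proof (cases "0 < \<rho> y")
   case False
   then have "k x * I L x y = 0" for x using near[of x] by (auto simp: k_def I_def)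
   then have "(%x. k x * I L x y) = (%_. 0)" by auto
   then show ?thesis by simp
  next
   case True
   have pt: "k x * I L x y <= ennreal ((9/8) ^ ?d / \<rho> y ^ ?d) * indicator (ball y (8/7 * L * \<rho> y)) x" for x
   proof (cases "0 < \<rho> x & dist x y < L * \<rho> x")
    case True
    note n = near[of x] True
    have "\<rho> y ^ ?d <= (9/8 * \<rho> x) ^ ?d" using n \<open>0 < \<rho> y\<close> by (intro power_mono) auto
    then have "1 / \<rho> x ^ ?d <= (9/8) ^ ?d / \<rho> y ^ ?d" using n \<open>0 < \<rho> y\<close> by (simp add: field_simps power_mult_distrib power_divide)
    moreover have "x \<in> ball y (8/7 * L * \<rho> y)" using n by (simp add: dist_commute)
    ultimately show ?thesis using n by (simp add: k_def I_def ennreal_leI)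
   qed (auto simp: k_def I_def)
   have "nint (%x. k x * I L x y)
     <= nint (%x. ennreal ((9/8) ^ ?d / \<rho> y ^ ?d) * indicator (ball y (8/7 * L * \<rho> y)) x)" by (intro nn_integral_mono pt)
   also have "... = ennreal ((9/8) ^ ?d / \<rho> y ^ ?d) * ennreal (v * (8/7 * L * \<rho> y) ^ ?d)"
    using True L by (subst nn_integral_cmult_indicator) (simp_all add: emb)
   also have "... = ennreal (v * (9/7 * L) ^ ?d)" using True L v by (simp add: ennreal_mult[symmetric] power_mult_distrib power_divide)
   also have "... <= ennreal (v * (2 * L) ^ ?d)" using v L by (intro ennreal_leI mult_left_mono power_mono) auto
   finally show ?thesis using True by simp
  qed
 qed
 have "ennreal (v * (1/4) ^ ?d) * sint {y. 0 < \<rho> y} P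
   = nint (%y. ennreal (v * (1/4) ^ ?d) * (P y * indicator {y. 0 < \<rho> y} y))" by (subst nn_integral_cmult) auto
 also have "... <= nint (%y. P y * nint (%x. k x * I 1 x y))"
 proof (intro nn_integral_mono)
  fix y show "ennreal (v * (1/4) ^ ?d) * (P y * indicator {y. 0 < \<rho> y} y) <= P y * nint (%x. k x * I 1 x y)"
   using mult_left_mono[OF lower[of y], of "P y"] by (cases "0 < \<rho> y") (simp_all add: mult.commute)
 qed
 also have "... = nint (%x. k x * nint (%y. P y * I 1 x y))" by (rule tonelli[symmetric]) measurable
 also have "... <= nint (%x. k x * nint (%y. Q y * I L x y))"
 proof (intro nn_integral_mono)
  fix x show "k x * nint (%y. P y * I 1 x y) <= k x * nint (%y. Q y * I L x y)"
   using loc[of x] ball_I[of x 1] ball_I[of x L] by (cases "0 < \<rho> x") (auto simp: k_def intro!: mult_left_mono)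
 qed
 also have "... = nint (%y. Q y * nint (%x. k x * I L x y))" by (rule tonelli) measurable
 also have "... <= nint (%y. ennreal (v * (2 * L) ^ ?d) * (Q y * indicator {y. 0 < \<rho> y} y))"
 proof (intro nn_integral_mono)
  fix y show "Q y * nint (%x. k x * I L x y) <= ennreal (v * (2 * L) ^ ?d) * (Q y * indicator {y. 0 < \<rho> y} y)"
   using mult_left_mono[OF upper[of y], of "Q y"] by (simp add: mult_ac)
 qed
 also have "... = ennreal (v * (2 * L) ^ ?d) * sint {y. 0 < \<rho> y} Q" by (subst nn_integral_cmult) auto
 finally have main: "ennreal (v * (1/4) ^ ?d) * sint {y. 0 < \<rho> y} P
   <= ennreal (v * (2 * L) ^ ?d) * sint {y. 0 < \<rho> y} Q" .
 have "(sint {y. 0 < \<rho> y} P)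
   = ennreal (4 ^ ?d / v) * (ennreal (v * (1/4) ^ ?d) * (sint {y. 0 < \<rho> y} P))"
  using v by (simp add: mult.assoc[symmetric] ennreal_mult[symmetric] power_one_over)
 also have "... <= ennreal (4 ^ ?d / v) * (ennreal (v * (2 * L) ^ ?d) * (sint {y. 0 < \<rho> y} Q))" by (intro mult_left_mono main) simp
 also have "... = ennreal ((8 * L) ^ ?d) * sint {y. 0 < \<rho> y} Q"
 proof -
  have "(4 ^ ?d / v) * (v * (2 * L) ^ ?d) = (8 * L) ^ ?d"
  proof -
   have "(4 ^ ?d / v) * (v * (2 * L) ^ ?d) = 4 ^ ?d * (2 * L) ^ ?d" using v by simp
   also have "... = (4 * (2 * L)) ^ ?d" by (rule power_mult_distrib[symmetric])
   finally show ?thesis by simp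
  qed
  then show ?thesis using v L by (simp add: mult.assoc[symmetric] ennreal_mult[symmetric])
 qed
 finally show ?thesis .
qed

text \<open>A multiple of the distance to the complement, capped so that the balls stay below a
  given size. The last clause is what the definition is for: unless the cap is reached, a ball of
  comparable radius contains a point outside V, and there the averages are under control.\<close>

definition whitney_scale :: "'a::euclidean_space set => real => real => ('a => real) => bool" where
 "whitney_scale V R N \<rho> \<longleftrightarrow> (\<forall>x. 0 <= \<rho> x) & (\<forall>x y. \<bar>\<rho> x - \<rho> y\<bar> <= dist x y / N) &
   {x. 0 < \<rho> x} = V & (\<forall>x. \<rho> x <= R / N) & (\<forall>x. ball x (N * \<rho> x) \<subseteq> V) &
   (\<forall>x\<in>V. \<rho> x = R / N \<or> (\<exists>y. y \<notin> V & dist x y < 2 * N * \<rho> x))"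

lemma whitney_scale_exists:
 fixes V :: "'a::euclidean_space set"
 assumes "open V" "0 < R" "1 <= N"
 shows "\<exists>\<rho>. whitney_scale V R N \<rho>"
proof (cases "V = UNIV")
 \<comment> \<open>\<open>infdist\<close> to the empty set is 0, so the distance formula fails for
   the whole space and the constant scale is taken instead.\<close>
 case True
 then have "whitney_scale V R N (%_. R / N)" using assms by (auto simp: whitney_scale_def)
 then show ?thesis by blast
next
 case False
 then have ne: "- V \<noteq> {}" by auto
 have cl: "closed (- V)" using assms by auto
 define \<rho> where "\<rho> x = min R (infdist x (- V)) / N" for x
 have pos: "0 < \<rho> x \<longleftrightarrow> x \<in> V" for x using assms in_closed_iff_infdist_zero[OF cl ne, of x] infdist_nonneg[of x "- V"]
  by (auto simp: \<rho>_def zero_less_divide_iff)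
 have "whitney_scale V R N \<rho>" unfolding whitney_scale_def
 proof (intro conjI allI ballI)
  fix x y
  show "0 <= \<rho> x" using assms infdist_nonneg[of x "- V"] by (auto simp: \<rho>_def)
  have "\<bar>infdist x (- V) - infdist y (- V)\<bar> <= dist x y" using infdist_triangle[of x "- V" y] infdist_triangle[of y "- V" x] by (auto simp: dist_commute)
  then have "\<bar>min R (infdist x (- V)) - min R (infdist y (- V))\<bar> <= dist x y" by (auto simp: min_def)
  moreover have "\<bar>\<rho> x - \<rho> y\<bar> = \<bar>min R (infdist x (- V)) - min R (infdist y (- V))\<bar> / N"
   using assms by (simp add: \<rho>_def diff_divide_distrib[symmetric])
  ultimately show "\<bar>\<rho> x - \<rho> y\<bar> <= dist x y / N" using assms by (simp add: divide_right_mono)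
  show "\<rho> x <= R / N" using assms by (auto simp: \<rho>_def intro!: divide_right_mono)
  show "ball x (N * \<rho> x) \<subseteq> V"
  proof
   fix z assume "z \<in> ball x (N * \<rho> x)"
   then have "dist x z < infdist x (- V)" using assms by (auto simp: \<rho>_def)
   then show "z \<in> V" using infdist_le[of z "- V" x] by auto
  qed
 next
  fix x assume xV: "x \<in> V"
  show "\<rho> x = R / N \<or> (\<exists>y. y \<notin> V & dist x y < 2 * N * \<rho> x)"
  proof (cases "R <= infdist x (- V)")
   case False
   obtain y where "y \<in> - V" "infdist x (- V) = dist x y" using infdist_attains_inf[OF cl ne] by auto
   moreover have "0 < infdist x (- V)" using pos[of x] xV False assms by (auto simp: \<rho>_def zero_less_divide_iff)
   moreover have "N * \<rho> x = infdist x (- V)" using False assms by (simp add: \<rho>_def)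
   ultimately have "y \<notin> V & dist x y < 2 * N * \<rho> x" by (simp add: mult.assoc)
   then show ?thesis by blast
  qed (simp add: \<rho>_def)
 qed (use pos in blast)
 then show ?thesis by blast
qed

lemma whitney_scaleD:
 assumes "whitney_scale V R N \<rho>"
 shows "0 <= \<rho> x" "\<bar>\<rho> x - \<rho> y\<bar> <= dist x y / N" "{x. 0 < \<rho> x} = V" "\<rho> x <= R / N"
  "ball x (N * \<rho> x) \<subseteq> V" "x \<in> V ==> \<rho> x = R / N \<or> (\<exists>y. y \<notin> V & dist x y < 2 * N * \<rho> x)"
 using assms unfolding whitney_scale_def by blast+

section \<open>Muckenhoupt weights and their level sets\<close>

lemma ennreal_square_add_le: "(a + b)^2 <= 2 * a^2 + 2 * (b^2 :: ennreal)"
proof (cases "a = top \<or> b = top")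
 case False
 then obtain x y where "a = ennreal x" "b = ennreal y" "0 <= x" "0 <= y" by (metis ennreal_cases)
 moreover have "(x + y)^2 <= 2 * x^2 + 2 * y^2" using zero_le_power2[of "x - y"] by (simp add: power2_eq_square algebra_simps)
 ultimately show ?thesis by (simp add: ennreal_power flip: ennreal_plus ennreal_mult ennreal_numeral)
qed (auto simp: power2_eq_square ennreal_mult_eq_top_iff ennreal_top_mult)

lemma ball_borel[measurable]: "ball (x::'a::metric_space) r \<in> sets borel" by simp

text \<open>The exceptional null set may depend on the ball in this form;
  \<open>AE_A1_maxlevel\<close> and \<open>AE_A1_balls\<close> remove that dependence.\<close>

definition A1 :: "real => ('a::euclidean_space => ennreal) => bool" where
 "A1 c \<sigma> \<longleftrightarrow> \<sigma> \<in> borel_measurable borel & (\<forall>x r. 0 < r --> (AE z in lborel. z \<in> ball x r -->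
   (sint (ball x r) \<sigma>) <= ennreal c * vol (ball x r) * \<sigma> z))"

text \<open>The set where the uncentred Hardy-Littlewood maximal function of f exceeds s, obtained
  as a union of balls and therefore visibly open.\<close>

definition maxlevel :: "('a::euclidean_space => ennreal) => real => 'a set" where
 "maxlevel f s = \<Union>{ball x r | x r. 0 < r & ennreal s * vol (ball x r) < (sint (ball x r) f)}"

lemma open_maxlevel: "open (maxlevel f s)" unfolding maxlevel_def by auto

lemma borel_maxlevel[measurable]: "maxlevel f s \<in> sets borel" using open_maxlevel by (rule borel_open)

lemma not_maxlevelD:
 assumes "y \<notin> maxlevel f s" "y \<in> ball x r"
 shows "sint (ball x r) f <= ennreal s * vol (ball x r)"
proof (rule ccontr)
 assume "~ ?thesis"
 then have "ennreal s * vol (ball x r) < sint (ball x r) f" by simp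
 moreover have "0 < r" using assms(2) by (metis ball_empty empty_iff not_le)
 ultimately have "ball x r \<subseteq> maxlevel f s" unfolding maxlevel_def by blast
 then show False using assms by auto
qed

lemma maxlevel_mono: "s <= t ==> maxlevel f t \<subseteq> maxlevel f s"
proof
 fix y assume "s <= t" "y \<in> maxlevel f t"
 then obtain x r where xr: "y \<in> ball x r" "0 < r"
  "ennreal t * vol (ball x r) < sint (ball x r) f" by (auto simp: maxlevel_def)
 have "ennreal s * vol (ball x r) <= ennreal t * vol (ball x r)" using \<open>s <= t\<close> by (intro mult_right_mono ennreal_leI) auto
 with xr have "ennreal s * vol (ball x r) < sint (ball x r) f" by (rule_tac le_less_trans)
 with xr show "y \<in> maxlevel f s" unfolding maxlevel_def by blast
qed

lemma emeasure_ball_pos: "0 < r ==> 0 < vol (ball (x::'a::euclidean_space) r)" by (simp add: emeasure_ball)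

lemma emeasure_ball_fin: "vol (ball (x::'a::euclidean_space) r) < top" using emeasure_lborel_ball_finite[of x r] by simp

text \<open>By Lindelof each level set is a countable union of its defining balls, so one null set
  serves a whole level; rational levels then serve all levels. The conclusion says that the maximal
  function of an A1 weight is at most c times the weight almost everywhere.\<close>

lemma AE_A1_maxlevel:
 assumes "A1 c \<sigma>"
 shows "AE z in lborel. \<forall>s. z \<in> maxlevel \<sigma> s --> ennreal s <= ennreal c * \<sigma> z"
proof -
 have q: "AE z in lborel. z \<in> maxlevel \<sigma> s --> ennreal s <= ennreal c * \<sigma> z" for s
 proof -
  define \<F> where "\<F> = {ball x r | x r. 0 < r & ennreal s * vol (ball x r) < (sint (ball x r) \<sigma>)}"
  obtain \<G> where G: "\<G> \<subseteq> \<F>" "countable \<G>" "\<Union>\<G> = \<Union>\<F>" using Lindelof[of \<F>] unfolding \<F>_def by auto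
  have "AE z in lborel. \<forall>B\<in>\<G>. z \<in> B --> ennreal s <= ennreal c * \<sigma> z" unfolding AE_ball_countable[OF G(2)]
  proof
   fix B assume "B \<in> \<G>"
   then obtain x r where B: "B = ball x r" "0 < r"
    "ennreal s * vol (ball x r) < (sint (ball x r) \<sigma>)" using G(1) by (auto simp: \<F>_def)
   have "AE z in lborel. z \<in> ball x r -->
     (sint (ball x r) \<sigma>) <= ennreal c * vol (ball x r) * \<sigma> z" using assms B unfolding A1_def by blast
   then show "AE z in lborel. z \<in> B --> ennreal s <= ennreal c * \<sigma> z"
   proof (eventually_elim, intro impI)
    fix z assume z: "z \<in> ball x r -->
     (sint (ball x r) \<sigma>) <= ennreal c * vol (ball x r) * \<sigma> z" "z \<in> B"
    then have "vol (ball x r) * ennreal s <= vol (ball x r) * (ennreal c * \<sigma> z)" using B by (auto simp: mult_ac)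
    then show "ennreal s <= ennreal c * \<sigma> z" using emeasure_ball_pos[OF B(2), of x] emeasure_ball_fin[of x r] by (subst (asm) ennreal_mult_le_mult_iff) auto
   qed
  qed
  then show ?thesis
  proof eventually_elim
   fix z assume *: "\<forall>B\<in>\<G>. z \<in> B --> ennreal s <= ennreal c * \<sigma> z"
   have "maxlevel \<sigma> s = \<Union>\<G>" by (simp only: G(3) maxlevel_def \<F>_def)
   with * show "z \<in> maxlevel \<sigma> s --> ennreal s <= ennreal c * \<sigma> z" by auto
  qed
 qed
 have "AE z in lborel. \<forall>s\<in>\<rat>. z \<in> maxlevel \<sigma> s --> ennreal s <= ennreal c * \<sigma> z"
  using q by (simp add: AE_ball_countable countable_rat)
 then show ?thesis
 proof (eventually_elim, intro allI impI)
  fix z s assume *: "\<forall>s\<in>\<rat>. z \<in> maxlevel \<sigma> s --> ennreal s <= ennreal c * \<sigma> z" "z \<in> maxlevel \<sigma> s"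
  show "ennreal s <= ennreal c * \<sigma> z"
  proof (rule ccontr)
   assume "~ ?thesis"
   then have "ennreal c * \<sigma> z < ennreal s" by simp
   then obtain u where u: "ennreal c * \<sigma> z = ennreal u" "0 <= u" "u < s" using ennreal_less_iff by (metis ennreal_cases not_top_less)
   then obtain q where "q \<in> \<rat>" "u < q" "q < s" using Rats_dense_in_real by blast
   then have "ennreal q <= ennreal c * \<sigma> z" using * maxlevel_mono[of q s \<sigma>] by auto
   then show False using u \<open>u < q\<close> by (simp add: ennreal_le_iff2)
  qed
 qed
qed

text \<open>If the average over a ball through z exceeds s, then z belongs to
  \<open>maxlevel \<sigma> s\<close>. The single null set of \<open>AE_A1_maxlevel\<close> therefore
  works for all balls at once.\<close>

lemma AE_A1_balls:
 assumes "A1 c \<sigma>" and fin: "!!z. \<sigma> z < top"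
 shows "AE z in lborel. \<forall>x r. z \<in> ball x r -->
   (sint (ball x r) \<sigma>) <= ennreal c * vol (ball x r) * \<sigma> z" using AE_A1_maxlevel[OF assms(1)]
proof (eventually_elim, intro allI impI)
 fix z x r assume *: "\<forall>s. z \<in> maxlevel \<sigma> s --> ennreal s <= ennreal c * \<sigma> z" "z \<in> ball x r"
 have "0 < r" using *(2) by (metis ball_empty empty_iff not_le)
 let ?m = "vol (ball x r)"
 obtain m where m: "?m = ennreal m" "0 < m" using emeasure_ball_pos[OF \<open>0 < r\<close>, of x] emeasure_ball_fin[of x r]
  by (metis ennreal_cases ennreal_less_zero_iff less_irrefl)
 obtain u where u: "ennreal c * \<sigma> z = ennreal u" "0 <= u" using fin[of z] by (metis ennreal_cases ennreal_mult_eq_top_iff ennreal_neq_top less_irrefl)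
 show "(sint (ball x r) \<sigma>) <= ennreal c * ?m * \<sigma> z"
 proof (rule ccontr)
  assume "~ ?thesis"
  moreover have "ennreal c * ?m * \<sigma> z = ennreal (u * m)" using u m by (metis (no_types) ennreal_mult less_imp_le mult.assoc mult.commute)
  ultimately have "ennreal (u * m) < (sint (ball x r) \<sigma>)" by simp
  then obtain b' where b': "ennreal (u * m) < b'" "b' < (sint (ball x r) \<sigma>)" using dense by blast
  then obtain b where "b' = ennreal b" "0 <= b" by (metis ennreal_cases not_top_less)
  with b' u m have b: "u * m < b" "ennreal b < (sint (ball x r) \<sigma>)" "0 <= b" by (auto simp: ennreal_less_iff)
  have "ennreal (b / m) * ?m = ennreal b" using b m by (simp add: ennreal_mult'[symmetric])
  then have "ennreal (b / m) * ?m < (sint (ball x r) \<sigma>)" using b by simp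
  then have "z \<in> maxlevel \<sigma> (b / m)" using *(2) \<open>0 < r\<close> unfolding maxlevel_def by blast
  then have "ennreal (b / m) <= ennreal u" using * u by auto
  then have "b / m <= u" using u by simp
  then show False using b m by (simp add: field_simps)
 qed
qed

text \<open>The part of f that stays below s adds at most s to any average, so an average above 2s
  leaves more than s for the part above s.\<close>

lemma maxlevel_truncate:
 assumes [measurable]: "borel_fun f" and s: "0 < s"
 shows "maxlevel f (2 * s) \<subseteq> maxlevel (%x. f x * indicator {x. ennreal s < f x} x) s"
proof
 fix y assume "y \<in> maxlevel f (2 * s)"
 then obtain x r where xr: "y \<in> ball x r" "0 < r"
  "ennreal (2 * s) * vol (ball x r) < sint (ball x r) f" by (auto simp: maxlevel_def)
 let ?m = "vol (ball x r)"
 let ?g = "%x. f x * indicator {x. ennreal s < f x} x"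
 have "sint (ball x r) f <= nint (%y. ?g y * indicator (ball x r) y + ennreal s * indicator (ball x r) y)" by (intro nn_integral_mono) (auto simp: indicator_def)
 also have "... = sint (ball x r) ?g + ennreal s * ?m" by (subst nn_integral_add) (measurable, simp add: nn_integral_cmult_indicator)
 finally have "ennreal s * ?m + ennreal s * ?m < sint (ball x r) ?g + ennreal s * ?m" using xr(3) s by (simp add: distrib_right[symmetric] flip: ennreal_plus)
 then have "ennreal s * ?m < sint (ball x r) ?g" by (meson add_right_mono not_le)
 with xr show "y \<in> maxlevel ?g s" unfolding maxlevel_def by blast
qed

text \<open>Vitali's covering lemma: disjoint balls with large average, enlarged five times, cover
  the level set, and disjointness adds up their integrals to at most the total one.\<close>

lemma weak_type:
 fixes f :: "'a::euclidean_space => ennreal"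
 assumes [measurable]: "borel_fun f" and fin: "nint f < top" and s: "0 < s"
 shows "ennreal s * vol (maxlevel f s) <= ennreal (5 ^ DIM('a)) * nint f"
proof -
 let ?d = "DIM('a)"
 define v where "v = unit_ball_vol (real ?d)"
 have v: "v > 0" by (simp add: v_def)
 define K where "K = {(x, r). 0 < r & ennreal s * vol (ball x r) < (sint (ball x r) f)}"
 obtain T where T: "nint f = ennreal T" "0 <= T" using fin by (metis ennreal_cases less_irrefl)
 have U: "maxlevel f s \<subseteq> (\<Union>p\<in>K. ball (fst p) (snd p))" unfolding maxlevel_def K_def by force
 \<comment> \<open>The covering lemma asks for bounded radii. A ball with average above s has volume
   below \<open>T / s\<close>; this controls \<open>r ^ d\<close>, hence r as soon as
   \<open>1 <= r\<close>.\<close>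
 have bdd: "0 < snd p & snd p <= max 1 (T / (s * v))" if p: "p \<in> K" for p
 proof -
  obtain x r where pr: "p = (x, r)" by force
  have r: "0 < r" and "ennreal s * vol (ball x r) < sint (ball x r) f" using p pr by (auto simp: K_def)
  moreover have "sint (ball x r) f <= nint f" by (intro nn_integral_mono) (auto simp: indicator_def)
  ultimately have "ennreal (s * (v * r ^ ?d)) < ennreal T" using s v r T by (simp add: emeasure_ball v_def ennreal_mult[symmetric])
  then have "s * (v * r ^ ?d) < T" using s v r by (simp add: ennreal_less_iff)
  then have rd: "r ^ ?d < T / (s * v)" using s v by (simp add: field_simps)
  have "r <= max 1 (r ^ ?d)"
  proof (cases "r <= 1")
   case False
   then have "r ^ 1 <= r ^ ?d" by (intro power_increasing) (auto simp: DIM_positive Suc_leI)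
   then show ?thesis by auto
  qed auto
  then show ?thesis using rd r pr by auto
 qed
 obtain C where C: "countable C" "C \<subseteq> K"
   "pairwise (%i j. disjnt (ball (fst i) (snd i)) (ball (fst j) (snd j))) C"
   "maxlevel f s \<subseteq> (\<Union>i\<in>C. ball (fst i) (5 * snd i))" by (rule Vitali_covering_lemma_balls[OF U bdd]) (blast intro: that)+
 let ?B = "%i. ball (fst i) (snd i)"
 have disj: "disjoint_family_on ?B C" using C(3) by (auto simp: disjoint_family_on_def pairwise_def disjnt_def)
 have "ennreal s * vol (maxlevel f s) <= ennreal s * vol (\<Union>i\<in>C. ball (fst i) (5 * snd i))" using C by (intro mult_left_mono emeasure_mono) auto
 also have "... <= ennreal s * (\<integral>\<^sup>+i. vol (ball (fst i) (5 * snd i)) \<partial>count_space C)"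
 proof (rule mult_left_mono)
  let ?D = "%i. ball (fst i) (5 * snd i)"
  have "vol (\<Union>i\<in>C. ?D i) = nint (%y. indicator (\<Union>i\<in>C. ?D i) y)" using C by (intro nn_integral_indicator[symmetric]) auto
  also have "... <= nint (%y. (\<integral>\<^sup>+i. indicator (?D i) y \<partial>count_space C))"
  proof (intro nn_integral_mono)
   fix y show "indicator (\<Union>i\<in>C. ?D i) y <= (\<integral>\<^sup>+i. indicator (?D i) y \<partial>count_space C)"
   proof (cases "y \<in> (\<Union>i\<in>C. ?D i)")
    case True
    then obtain i where "i \<in> C" "y \<in> ?D i" by blast
    then show ?thesis using nn_integral_ge_point[of i C "%i. indicator (?D i) y"] True by simp
   qed simp
  qed
  also have "... = (\<integral>\<^sup>+i. (nint (%y. indicator (?D i) y)) \<partial>count_space C)" using C by (intro nn_integral_count_space_nn_integral) measurable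
  also have "... = (\<integral>\<^sup>+i. vol (?D i) \<partial>count_space C)" by simp
  finally show "vol (\<Union>i\<in>C. ?D i) <= (\<integral>\<^sup>+i. vol (?D i) \<partial>count_space C)" .
 qed simp
 also have "... = (\<integral>\<^sup>+i. ennreal s * vol (ball (fst i) (5 * snd i)) \<partial>count_space C)" by (subst nn_integral_cmult) auto
 also have "... <= (\<integral>\<^sup>+i. ennreal (5 ^ ?d) * (sint (?B i) f) \<partial>count_space C)"
 proof (intro nn_integral_mono)
  fix i assume "i \<in> space (count_space C)"
  then have i: "0 < snd i" "ennreal s * vol (?B i) < sint (?B i) f" using C(2) by (auto simp: K_def)
  have "ennreal s * vol (ball (fst i) (5 * snd i)) = ennreal (5 ^ ?d) * (ennreal s * vol (?B i))"
   using i by (subst emeasure_ball_scale[of 5 _ _ "fst i"]) (auto simp: mult_ac)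
  also have "... <= ennreal (5 ^ ?d) * sint (?B i) f" using i by (intro mult_left_mono) auto
  finally show "ennreal s * vol (ball (fst i) (5 * snd i)) <= ennreal (5 ^ ?d) * sint (?B i) f" .
 qed
 also have "... = ennreal (5 ^ ?d) * (\<integral>\<^sup>+i. (sint (?B i) f) \<partial>count_space C)" by (subst nn_integral_cmult) auto
 also have "(\<integral>\<^sup>+i. (sint (?B i) f) \<partial>count_space C) = (\<integral>\<^sup>+i. emeasure (density lborel f) (?B i) \<partial>count_space C)"
  by (simp add: emeasure_density)
 also have "... = emeasure (density lborel f) (\<Union>i\<in>C. ?B i)" using C disj by (intro emeasure_UN_countable[symmetric]) auto
 also have "... <= emeasure (density lborel f) UNIV" by (intro emeasure_mono) auto
 also have "... = nint f" by (simp add: emeasure_density)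
 finally show ?thesis by (simp add: mult_left_mono)
qed

text \<open>Lebesgue differentiation along the cubes with corner y and side h. Such a cube fits into
  the ball around y of radius \<open>(d + 1) * h\<close>, whose average is at most s; the ratio of
  the two volumes is the constant.\<close>

lemma AE_le_of_not_maxlevel:
 fixes f :: "'a::euclidean_space => real"
 assumes [measurable]: "borel_fun f" and nonneg: "!!x. 0 <= f x"
  and fin: "!!a b. (sint (cbox a b) (%y. ennreal (f y))) < top"
 shows "AE y in lborel. \<forall>s\<ge>0. y \<notin> maxlevel (%x. ennreal (f x)) s -->
   f y <= unit_ball_vol (real DIM('a)) * (DIM('a) + 1) ^ DIM('a) * s"
proof -
 let ?d = "DIM('a)"
 define v where "v = unit_ball_vol (real ?d)"
 have v: "v > 0" by (simp add: v_def)
 have si: "set_integrable lborel (cbox a b) f" for a b unfolding set_integrable_def by (rule integrableI_nonneg)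
   (use fin[of a b] nonneg in \<open>auto simp: ennreal_mult ennreal_indicator mult.commute\<close>)
 have int: "f integrable_on cbox a b" for a b using set_borel_integral_eq_integral(1)[OF si] .
 have eq: "ennreal (integral (cbox a b) f) = sint (cbox a b) (%y. ennreal (f y))" for a b
 proof -
  have "integral (cbox a b) f = (LINT x:cbox a b|lborel. f x)" using set_borel_integral_eq_integral(2)[OF si] by simp
  also have "ennreal ... = nint (%y. ennreal (indicator (cbox a b) y *\<^sub>R f y))" unfolding set_lebesgue_integral_def
   using si nonneg by (intro nn_integral_eq_integral[symmetric]) (auto simp: set_integrable_def)
  also have "... = sint (cbox a b) (%y. ennreal (f y))" by (intro nn_integral_cong) (auto simp: indicator_def)
  finally show ?thesis .
 qed
 obtain N where N: "negligible N" and lim: "!!x e. [|x \<notin> N; 0 < e|] ==>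
   \<exists>d>0. \<forall>h. 0 < h & h < d --> norm (integral (cbox x (x + h *\<^sub>R One)) f /\<^sub>R h ^ ?d - f x) < e"
  using integrable_ccontinuous_explicit[OF int] by metis
 have "AE y in lborel. y \<notin> N" using N unfolding negligible_iff_null_sets by (metis AE_completion_iff AE_not_in)
 then show ?thesis
 proof (eventually_elim, intro allI impI)
  fix y s assume y: "y \<notin> N" "0 <= s" "y \<notin> maxlevel (%x. ennreal (f x)) s"
  show "f y <= unit_ball_vol (real ?d) * (?d + 1) ^ ?d * s"
  proof (rule field_le_epsilon)
   fix e :: real assume "0 < e"
   then obtain d where "d > 0" and d: "!!h. 0 < h ==> h < d ==>
     norm (integral (cbox y (y + h *\<^sub>R One)) f /\<^sub>R h ^ ?d - f y) < e" using lim[OF y(1)] by metis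
   define h where "h = d / 2"
   have h: "0 < h" "h < d" using \<open>d > 0\<close> by (auto simp: h_def)
   define r where "r = (real ?d + 1) * h"
   have r: "0 < r" using h by (simp add: r_def add_pos_pos)
   have sub: "cbox y (y + h *\<^sub>R One) \<subseteq> ball y r"
   proof
    fix z assume z: "z \<in> cbox y (y + h *\<^sub>R One)"
    have "norm (z - y) <= (\<Sum>i\<in>Basis. \<bar>(z - y) \<bullet> i\<bar>)" by (rule norm_le_l1)
    also have "... <= (\<Sum>i\<in>(Basis :: 'a set). h)" using z by (intro sum_mono) (auto simp: mem_box inner_diff_left inner_add_left)
    also have "... = real ?d * h" by simp
    also have "... < r" using h unfolding r_def by (intro mult_strict_right_mono) auto
    finally show "z \<in> ball y r" by (simp add: dist_norm norm_minus_commute)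
   qed
   have "ennreal (integral (cbox y (y + h *\<^sub>R One)) f) <= sint (ball y r) (%y. ennreal (f y))"
    unfolding eq using sub by (intro nn_integral_mono) (auto simp: indicator_def)
   also have "... <= ennreal s * vol (ball y r)" using not_maxlevelD[OF y(3)] r by simp
   also have "... = ennreal (s * (v * r ^ ?d))" using y r v by (simp add: emeasure_ball v_def ennreal_mult)
   finally have "integral (cbox y (y + h *\<^sub>R One)) f <= s * (v * r ^ ?d)" using y r v by (subst (asm) ennreal_le_iff) auto
   then have "integral (cbox y (y + h *\<^sub>R One)) f / h ^ ?d <= s * (v * (real ?d + 1) ^ ?d)"
    using h unfolding r_def by (simp add: power_mult_distrib pos_divide_le_eq mult_ac)
   moreover have "\<bar>integral (cbox y (y + h *\<^sub>R One)) f / h ^ ?d - f y\<bar> < e" using d[OF h] by (simp add: divide_inverse mult.commute)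
   ultimately show "f y <= unit_ball_vol (real ?d) * (?d + 1) ^ ?d * s + e" by (simp add: v_def mult_ac add.commute)
  qed
 qed
qed

section \<open>Riesz potentials and reverse Hoelder inequalities\<close>

text \<open>With X infinite the inequality would carry no information. This is the place where a
  priori finiteness of energies enters, and with it the boundedness of the truncated weight.\<close>

lemma ennreal_absorb:
 fixes X Y :: ennreal
 assumes "X <= ennreal (1/2) * X + Y" "X < top"
 shows "X <= 2 * Y"
proof (cases "Y = top")
 case False
 then obtain x y where xy: "X = ennreal x" "Y = ennreal y" "0 <= x" "0 <= y" using assms(2) by (metis ennreal_cases less_irrefl)
 then have "ennreal x <= ennreal (1/2 * x + y)" using assms(1) by (metis ennreal_mult ennreal_plus mult_nonneg_nonneg zero_le_divide_1_iff zero_le_numeral)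
 then have "x <= 2 * y" using xy by (subst (asm) ennreal_le_iff) auto
 then show ?thesis using xy by (simp add: ennreal_leI flip: ennreal_mult ennreal_numeral)
qed (simp add: ennreal_mult_top)

text \<open>The integral over t is split at \<tau>. For small t, Cauchy-Schwarz in z and in t
  followed by Tonelli leaves the weight of \<open>ball z (6 * \<rho> * t)\<close>, which A1 bounds
  by its volume times \<open>\<sigma> z\<close>; the powers of t cancel and two integrations over an
  interval of length \<tau> give \<open>\<tau>^2\<close>. For large t the kernel is at most
  \<open>1 / \<tau>^d\<close> and the ball integral is at most the total integral of g.\<close>

lemma local_riesz_bound:
 fixes \<sigma> g :: "'a::euclidean_space => ennreal"
 assumes A1: "A1 c \<sigma>" and fin: "!!z. \<sigma> z < top" and c: "0 <= c"
  and [measurable]: "borel_fun g" "S \<in> sets borel"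
  and \<tau>: "0 < \<tau>" "\<tau> <= 1" and \<rho>: "0 < \<rho>"
 defines "v \<equiv> unit_ball_vol (real DIM('a))"
 shows "sint S (%x. \<sigma> x * (sint {0<..<1} (%t. ennreal (1 / t ^ DIM('a)) *
      (sint (ball x (6 * \<rho> * t)) g)))^2)
   <= ennreal (2 * \<tau>^2 * c * (v * (6 * \<rho>) ^ DIM('a))^2) * nint (%z. (g z)^2 * \<sigma> z)
    + ennreal (2 / \<tau> ^ (2 * DIM('a))) * (nint g)^2 * sint S \<sigma>"
proof -
 let ?d = "DIM('a)"
 have v: "v > 0" by (simp add: v_def)
 have [measurable]: "borel_fun \<sigma>" using A1 by (simp add: A1_def)
 define I where "I x t = nint (%z. g z * (if dist x z < 6 * \<rho> * t then 1 else 0))" for x t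
 have I: "sint (ball x (6 * \<rho> * t)) g = I x t" for x t unfolding I_def by (intro nn_integral_cong) (auto simp: indicator_def)
 have [measurable]: "(%(x, t). I x t) \<in> borel_measurable (lborel \<Otimes>\<^sub>M lborel)" unfolding I_def by measurable
 have [measurable]: "(%(t, x). I x t) \<in> borel_measurable (lborel \<Otimes>\<^sub>M lborel)" unfolding I_def by measurable
 have Ix[measurable]: "borel_fun (I x)" for x unfolding I_def by measurable
 have It[measurable]: "borel_fun (%x. I x t)" for t unfolding I_def by measurable
 define a where "a t = (if 0 < t & t < \<tau> then ennreal (1 / t ^ ?d) else 0)" for t
 define b where "b t = (if \<tau> <= t & t < 1 then ennreal (1 / t ^ ?d) else 0)" for t
 have [measurable]: "borel_fun a" "borel_fun b" unfolding a_def b_def by measurable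
 define J1 where "J1 x = nint (%t. a t * I x t)" for x
 define J2 where "J2 x = nint (%t. b t * I x t)" for x
 have [measurable]: "borel_fun J1" unfolding J1_def by measurable
 have J: "(sint {0<..<1} (%t. ennreal (1 / t ^ ?d) * I x t)) = J1 x + J2 x" for x
 proof -
  have "J1 x + J2 x = nint (%t. a t * I x t + b t * I x t)" unfolding J1_def J2_def by (rule nn_integral_add[symmetric]) measurable
  also have "... = sint {0<..<1} (%t. ennreal (1 / t ^ ?d) * I x t)" using \<tau> by (intro nn_integral_cong) (auto simp: a_def b_def indicator_def)
  finally show ?thesis by simp
 qed
 let ?G = "nint (%z. (g z)^2 * \<sigma> z)"
 let ?T = "nint g"
 define w where "w = v * (6 * \<rho>) ^ ?d"
 have w: "0 < w" using v \<rho> by (simp add: w_def)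
 have emb: "vol (ball x (6 * \<rho> * t)) = ennreal (w * t ^ ?d)" if "0 < t" for x :: 'a and t
  using that \<rho> by (simp add: emeasure_ball v_def w_def power_mult_distrib mult_ac)
 have J2: "J2 x <= ennreal (1 / \<tau> ^ ?d) * ?T" for x
 proof -
  have "J2 x <= nint (%t. ennreal (1 / \<tau> ^ ?d) * ?T * indicator {0<..<1::real} t)" unfolding J2_def
  proof (intro nn_integral_mono)
   fix t show "b t * I x t <= ennreal (1 / \<tau> ^ ?d) * ?T * indicator {0<..<1} t"
   proof (cases "\<tau> <= t & t < 1")
    case True
    have "b t <= ennreal (1 / \<tau> ^ ?d)" using True \<tau> by (auto simp: b_def intro!: ennreal_leI divide_left_mono power_mono mult_pos_pos)
    moreover have "I x t <= ?T" unfolding I_def by (intro nn_integral_mono) auto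
    ultimately show ?thesis using True \<tau> by (auto intro!: mult_mono)
   next
    case False
    then have "b t = 0" by (auto simp: b_def)
    then show ?thesis by simp
   qed
  qed
  also have "... = ennreal (1 / \<tau> ^ ?d) * ?T" by (subst nn_integral_cmult_indicator) auto
  finally show ?thesis .
 qed
 define q where "q x t = nint (%z. (g z)^2 * (if dist x z < 6 * \<rho> * t then 1 else 0))" for x t
 have [measurable]: "(%(x, t). q x t) \<in> borel_measurable (lborel \<Otimes>\<^sub>M lborel)"
  "(%(t, x). q x t) \<in> borel_measurable (lborel \<Otimes>\<^sub>M lborel)" unfolding q_def by measurable
 have [measurable]: "borel_fun (q x)" "borel_fun (%x. q x t)" for x t unfolding q_def by measurable
 have Isq: "(I x t)^2 <= ennreal (w * t ^ ?d) * q x t" if t: "0 < t" for x t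
 proof -
  have "(I x t)^2 = (nint (%z. (g z * indicator (ball x (6 * \<rho> * t)) z) * indicator (ball x (6 * \<rho> * t)) z))^2"
   unfolding I_def by (intro arg_cong[where f="%x. x^2"] nn_integral_cong) (auto simp: indicator_def)
  also have "... <= nint (%z. (g z * indicator (ball x (6 * \<rho> * t)) z)^2) * nint (%z. (indicator (ball x (6 * \<rho> * t)) z)^2)"
   by (rule Cauchy_Schwarz_nn_integral) measurable
  also have "nint (%z. (g z * indicator (ball x (6 * \<rho> * t)) z)^2) = q x t" unfolding q_def by (intro nn_integral_cong) (auto simp: indicator_def)
  also have "nint (%z. (indicator (ball x (6 * \<rho> * t)) z)^2) = ennreal (w * t ^ ?d)"
  proof -
   have "nint (%z. (indicator (ball x (6 * \<rho> * t)) z)^2) = nint (%z. indicator (ball x (6 * \<rho> * t)) z)"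
    by (intro nn_integral_cong) (auto simp: indicator_def)
   then show ?thesis using emb[OF t, of x] by simp
  qed
  finally show ?thesis by (simp add: mult.commute)
 qed
 have J1: "(J1 x)^2 <= ennreal (\<tau> * w) * nint (%t. a t * q x t)" for x
 proof -
  have "(J1 x)^2 = (nint (%t. (a t * I x t) * indicator {0<..<\<tau>} t))^2"
   unfolding J1_def by (intro arg_cong[where f="%x. x^2"] nn_integral_cong) (auto simp: a_def indicator_def)
  also have "... <= nint (%t. (a t * I x t)^2) * nint (%t. (indicator {0<..<\<tau>} t)^2)" by (rule Cauchy_Schwarz_nn_integral) measurable
  also have "nint (%t. (indicator {0<..<\<tau>} t)^2) = nint (%t. indicator {0<..<\<tau>} t)" by (intro nn_integral_cong) (auto simp: indicator_def)
  also have "... = ennreal \<tau>" using \<tau> by simp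
  also have "nint (%t. (a t * I x t)^2) <= nint (%t. ennreal w * (a t * q x t))"
  proof (intro nn_integral_mono)
   fix t show "(a t * I x t)^2 <= ennreal w * (a t * q x t)"
   proof (cases "0 < t & t < \<tau>")
    case True
    then have "(a t * I x t)^2 <= (a t)^2 * (ennreal (w * t ^ ?d) * q x t)" unfolding power_mult_distrib by (intro mult_left_mono Isq) auto
    also have "... = (a t * ennreal (w * t ^ ?d)) * (a t * q x t)" by (simp add: power2_eq_square mult_ac)
    also have "a t * ennreal (w * t ^ ?d) = ennreal w" using True w by (simp add: a_def ennreal_mult[symmetric])
    finally show ?thesis .
   next
    case False
    then have "a t = 0" by (auto simp: a_def)
    then show ?thesis by simp
   qed
  qed
  also have "... = ennreal w * nint (%t. a t * q x t)" by (subst nn_integral_cmult) auto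
  finally show ?thesis using \<tau> w by (simp add: ennreal_mult mult_ac mult_right_mono)
 qed
 \<comment> \<open>After Tonelli the weight is integrated over a ball around z, and A1 replaces this
   integral by a pointwise value. Here the weighted norm of g appears on the right.\<close>
 have inner: "nint (%x. \<sigma> x * q x t) <= ennreal (c * w * t ^ ?d) * ?G" if t: "0 < t" for t
 proof -
  have "nint (%x. \<sigma> x * q x t)
    = nint (%x. (nint (%z. \<sigma> x * ((g z)^2 * (if dist x z < 6 * \<rho> * t then 1 else 0)))))" unfolding q_def by (subst nn_integral_cmult) auto
  also have "... = nint (%z. (nint (%x. \<sigma> x * ((g z)^2 * (if dist x z < 6 * \<rho> * t then 1 else 0)))))" by (rule lborel_pair.Fubini') measurable
  also have "... = nint (%z. (nint (%x. (g z)^2 * (\<sigma> x * indicator (ball z (6 * \<rho> * t)) x))))"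
   by (intro nn_integral_cong) (auto simp: indicator_def dist_commute mult_ac)
  also have "... = nint (%z. (g z)^2 * (sint (ball z (6 * \<rho> * t)) \<sigma>))" by (intro nn_integral_cong nn_integral_cmult) measurable
  also have "... <= nint (%z. ennreal (c * w * t ^ ?d) * ((g z)^2 * \<sigma> z))"
  proof (rule nn_integral_mono_AE)
   show "AE z in lborel. (g z)^2 * (sint (ball z (6 * \<rho> * t)) \<sigma>) <= ennreal (c * w * t ^ ?d) * ((g z)^2 * \<sigma> z)" using AE_A1_balls[OF A1 fin]
   proof eventually_elim
    fix z assume *: "\<forall>x r. z \<in> ball x r -->
     (sint (ball x r) \<sigma>) <= ennreal c * vol (ball x r) * \<sigma> z"
    have "(sint (ball z (6 * \<rho> * t)) \<sigma>) <= ennreal c * ennreal (w * t ^ ?d) * \<sigma> z"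
     using *[rule_format, of z "6 * \<rho> * t"] t \<rho> by (simp add: emb)
    also have "ennreal c * ennreal (w * t ^ ?d) = ennreal (c * w * t ^ ?d)" using c w t by (simp add: ennreal_mult[symmetric] mult_ac)
    finally have "(g z)^2 * (sint (ball z (6 * \<rho> * t)) \<sigma>) <= (g z)^2 * (ennreal (c * w * t ^ ?d) * \<sigma> z)" by (rule mult_left_mono) simp
    then show "(g z)^2 * (sint (ball z (6 * \<rho> * t)) \<sigma>) <= ennreal (c * w * t ^ ?d) * ((g z)^2 * \<sigma> z)" by (simp add: mult_ac)
   qed
  qed
  also have "... = ennreal (c * w * t ^ ?d) * ?G" by (subst nn_integral_cmult) auto
  finally show ?thesis .
 qed
 have small: "nint (%x. \<sigma> x * (J1 x)^2) <= ennreal (\<tau>^2 * c * w^2) * ?G"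
 proof -
  have "nint (%x. \<sigma> x * (J1 x)^2) <= nint (%x. \<sigma> x * (ennreal (\<tau> * w) * nint (%t. a t * q x t)))"
   by (intro nn_integral_mono mult_left_mono J1) simp
  also have "... = nint (%x. (nint (%t. ennreal (\<tau> * w) * (\<sigma> x * (a t * q x t)))))"
   by (subst nn_integral_cmult[symmetric], measurable)+ (simp add: mult_ac)
  also have "... = nint (%t. (nint (%x. ennreal (\<tau> * w) * (\<sigma> x * (a t * q x t)))))" by (rule lborel_pair.Fubini') measurable
  also have "... = nint (%t. (nint (%x. (ennreal (\<tau> * w) * a t) * (\<sigma> x * q x t))))" by (simp add: mult_ac)
  also have "... = nint (%t. (ennreal (\<tau> * w) * a t) * nint (%x. \<sigma> x * q x t))" by (intro nn_integral_cong nn_integral_cmult) measurable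
  also have "... <= nint (%t. (ennreal (\<tau> * c * w^2) * ?G) * indicator {0<..<\<tau>} t)"
  proof (intro nn_integral_mono)
   fix t show "(ennreal (\<tau> * w) * a t) * nint (%x. \<sigma> x * q x t) <= (ennreal (\<tau> * c * w^2) * ?G) * indicator {0<..<\<tau>} t"
   proof (cases "0 < t & t < \<tau>")
    case True
    have "(ennreal (\<tau> * w) * a t) * nint (%x. \<sigma> x * q x t) <= (ennreal (\<tau> * w) * a t) * (ennreal (c * w * t ^ ?d) * ?G)"
     using True by (intro mult_left_mono inner) auto
    also have "... = (ennreal (\<tau> * w) * a t * ennreal (c * w * t ^ ?d)) * ?G" by (simp add: mult_ac)
    also have "ennreal (\<tau> * w) * a t * ennreal (c * w * t ^ ?d) = ennreal (\<tau> * c * w^2)"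
    proof -
     have "ennreal (\<tau> * w) * a t * ennreal (c * w * t ^ ?d) = ennreal ((\<tau> * w) * (1 / t ^ ?d) * (c * w * t ^ ?d))"
      unfolding a_def using True \<tau> w c by (subst ennreal_mult, simp, simp)+ simp
     also have "(\<tau> * w) * (1 / t ^ ?d) * (c * w * t ^ ?d) = \<tau> * c * w^2" using True by (simp add: power2_eq_square)
     finally show ?thesis .
    qed
    finally show ?thesis using True by simp
   next
    case False
    then have "a t = 0" by (auto simp: a_def)
    then show ?thesis by simp
   qed
  qed
  also have "... = (ennreal (\<tau> * c * w^2) * ?G) * ennreal \<tau>" using \<tau> by (subst nn_integral_cmult_indicator) auto
  also have "... = ennreal (\<tau>^2 * c * w^2) * ?G"
  proof -
   have "ennreal (\<tau>^2 * c * w^2) = ennreal (\<tau> * c * w^2) * ennreal \<tau>" using \<tau> c by (simp add: ennreal_mult[symmetric] power2_eq_square mult_ac)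
   then show ?thesis by (simp add: mult_ac)
  qed
  finally show ?thesis .
 qed
 have "sint S (%x. \<sigma> x * (J1 x + J2 x)^2)
   <= nint (%x. 2 * (\<sigma> x * (J1 x)^2) + (2 * (ennreal (1 / \<tau> ^ ?d) * ?T)^2) * (\<sigma> x * indicator S x))"
 proof (intro nn_integral_mono)
  fix x
  have "(J1 x + J2 x)^2 <= (J1 x + ennreal (1 / \<tau> ^ ?d) * ?T)^2" by (intro power_mono add_left_mono J2) auto
  also have "... <= 2 * (J1 x)^2 + 2 * (ennreal (1 / \<tau> ^ ?d) * ?T)^2" by (rule ennreal_square_add_le)
  finally have "\<sigma> x * (J1 x + J2 x)^2 <= \<sigma> x * (2 * (J1 x)^2 + 2 * (ennreal (1 / \<tau> ^ ?d) * ?T)^2)" by (intro mult_left_mono) auto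
  then show "\<sigma> x * (J1 x + J2 x)^2 * indicator S x <= 2 * (\<sigma> x * (J1 x)^2) + (2 * (ennreal (1 / \<tau> ^ ?d) * ?T)^2) * (\<sigma> x * indicator S x)"
   by (auto simp: indicator_def distrib_left mult_ac)
 qed
 also have "... = 2 * nint (%x. \<sigma> x * (J1 x)^2) + (2 * (ennreal (1 / \<tau> ^ ?d) * ?T)^2) * sint S \<sigma>" by (simp add: nn_integral_add nn_integral_cmult)
 also have "... <= 2 * (ennreal (\<tau>^2 * c * w^2) * ?G) + (2 * (ennreal (1 / \<tau> ^ ?d) * ?T)^2) * sint S \<sigma>"
  by (intro add_right_mono mult_left_mono small) simp
 also have "2 * (ennreal (\<tau>^2 * c * w^2) * ?G) = ennreal (2 * \<tau>^2 * c * w^2) * ?G"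
 proof -
  have "ennreal (2 * \<tau>^2 * c * w^2) = 2 * ennreal (\<tau>^2 * c * w^2)" using c by (simp add: ennreal_mult mult.assoc)
  then show ?thesis by (simp add: mult_ac)
 qed
 also have "2 * (ennreal (1 / \<tau> ^ ?d) * ?T)^2 = ennreal (2 / \<tau> ^ (2 * ?d)) * ?T^2"
 proof -
  have "ennreal (2 / \<tau> ^ (2 * ?d)) = ennreal (2 * (1 / \<tau> ^ ?d)^2)" by (simp add: power_divide power_mult[symmetric] mult.commute)
  also have "... = 2 * (ennreal (1 / \<tau> ^ ?d))^2" using \<tau> by (simp add: ennreal_mult ennreal_power)
  finally show ?thesis by (simp add: power_mult_distrib mult_ac)
 qed
 finally show ?thesis unfolding I J w_def .
qed

text \<open>The term with the factor \<open>\<tau>^2\<close> lives on a larger ball, so it cannot be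
  absorbed ball by ball. It can be absorbed after averaging over balls whose radius is proportional
  to the distance to the sphere of radius 4r, with the energy multiplied by a power of this
  distance. The value of \<tau> makes the total factor at most 1/2.\<close>

lemma reverse_holder_absorb:
 fixes \<sigma> h f :: "'a::euclidean_space => ennreal"
 assumes C: "0 <= C" and r: "0 < r"
  and [measurable]: "borel_fun \<sigma>" "borel_fun h" "borel_fun f"
  and fin: "sint (ball x0 (4 * r)) (%x. \<sigma> x * (h x)^2) < top"
  and loc: "!!x \<rho> \<tau>. 0 < \<rho> ==> ball x (3 * \<rho>) \<subseteq> ball x0 (4 * r) ==> 0 < \<tau> ==> \<tau> <= 1 ==>
   (sint (ball x \<rho>) (%y. \<sigma> y * (h y)^2)) <= ennreal C * (ennreal (\<tau>^2) * sint (ball x (3 * \<rho>)) (%y. \<sigma> y * (h y)^2)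
    + ennreal (1 / (\<tau> * \<rho>) ^ (2 * DIM('a))) * (sint (ball x (3 * \<rho>)) h)^2 * (sint (ball x (3 * \<rho>)) \<sigma>)
    + ennreal (1 / \<tau> ^ (2 * DIM('a))) * sint (ball x (3 * \<rho>)) f)"
 defines "\<tau> \<equiv> sqrt (1 / (1 + 2 * 24 ^ DIM('a) * C * (9/7) ^ (2 * DIM('a))))"
 shows "sint (ball x0 r) (%x. \<sigma> x * (h x)^2) <=
   ennreal (2 * 24 ^ DIM('a) * C * 5 ^ (2 * DIM('a)) * (24 / \<tau>) ^ (2 * DIM('a))) *
   (ennreal (1 / r ^ (2 * DIM('a))) * (sint (ball x0 (4 * r)) h)^2 * (sint (ball x0 (4 * r)) \<sigma>)
    + sint (ball x0 (4 * r)) f)"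
proof -
 let ?d = "DIM('a)" and ?m = "2 * DIM('a)"
 let ?S = "ball x0 (4 * r)"
 let ?X = "sint ?S h"
 let ?H = "%y. \<sigma> y * (h y)^2"
 have den: "1 <= 1 + 2 * 24 ^ ?d * C * (9/7) ^ ?m" using C by simp
 have \<tau>: "0 < \<tau>" "\<tau> <= 1" "\<tau>^2 = 1 / (1 + 2 * 24 ^ ?d * C * (9/7) ^ ?m)"
 proof -
  have p: "0 < 1 / (1 + 2 * 24 ^ ?d * C * (9/7) ^ ?m)" "1 / (1 + 2 * 24 ^ ?d * C * (9/7) ^ ?m) <= 1"
  proof -
   have "0 < 1 / X & 1 / X <= 1" if "1 <= X" for X :: real using that by simp
   then show "0 < 1 / (1 + 2 * 24 ^ ?d * C * (9/7) ^ ?m)" "1 / (1 + 2 * 24 ^ ?d * C * (9/7) ^ ?m) <= 1" using den by blast+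
  qed
  show "0 < \<tau>" unfolding \<tau>_def using p by (simp only: real_sqrt_gt_0_iff)
  show "\<tau> <= 1" unfolding \<tau>_def using p by (simp only: real_sqrt_le_1_iff)
  show "\<tau>^2 = 1 / (1 + 2 * 24 ^ ?d * C * (9/7) ^ ?m)" unfolding \<tau>_def using p by (intro real_sqrt_pow2) simp
 qed
 define D where "D x = max 0 (4 * r - dist x0 x)" for x
 have D0: "0 <= D x" "D x <= 4 * r" for x using r by (auto simp: D_def)
 have Dlip: "\<bar>D x - D y\<bar> <= dist x y" for x y using dist_triangle[of x0 x y] dist_triangle[of x0 y x] by (auto simp: D_def dist_commute max_def)
 have [measurable]: "borel_fun D" unfolding D_def by measurable
 \<comment> \<open>The exponent 2d cancels the factor \<open>1 / \<rho>^(2d)\<close> of the middle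
   term, which would otherwise blow up towards the sphere; only \<open>1 / r^(2d)\<close>
   remains.\<close>
 define \<delta> where "\<delta> x = ennreal ((D x / r) ^ ?m)" for x
 have [measurable]: "borel_fun \<delta>" unfolding \<delta>_def by measurable
 define \<rho> where "\<rho> x = D x / 24" for x
 have pos: "0 < \<rho> x \<longleftrightarrow> x \<in> ?S" for x by (auto simp: \<rho>_def D_def)
 define P where "P x = \<delta> x * ?H x" for x
 have [measurable]: "borel_fun P" unfolding P_def by measurable
 \<comment> \<open>On \<open>ball x (3 * \<rho> x)\<close> the function D lies between
   \<open>7/8 * D x\<close> and \<open>9/8 * D x\<close>, whence \<open>9/7\<close>. In
   \<open>c2\<close>, the number 5 exceeds 9/8 times 4, and 4 bounds \<open>D x / r\<close>.\<close>
 define c1 where "c1 = C * (9/7) ^ ?m * \<tau>^2"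
 define c2 where "c2 = C * 5 ^ ?m * (24 / \<tau>) ^ ?m"
 have c: "0 <= c1" "0 <= c2" using C \<tau> by (auto simp: c1_def c2_def)
 define Q where "Q x = ennreal c1 * P x + ennreal c2 * (ennreal (1 / r ^ ?m) * ?X^2 * \<sigma> x + f x)" for x
 have [measurable]: "borel_fun Q" unfolding Q_def by measurable
 have wh: "(sint {y. 0 < \<rho> y} P) <= ennreal ((8 * 3) ^ ?d) * sint {y. 0 < \<rho> y} Q"
 proof (rule whitney_average)
  show "\<bar>\<rho> x - \<rho> y\<bar> <= dist x y / (8 * 3)" for x y using Dlip[of x y] by (simp add: \<rho>_def diff_divide_distrib[symmetric])
  fix x assume "0 < \<rho> x"
  then have Dx: "0 < D x" and xS: "x \<in> ?S" using pos by (auto simp: \<rho>_def)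
  have near: "7/8 * D x <= D y & D y <= 9/8 * D x" if "dist x y < 3 * \<rho> x" for y using Dlip[of x y] that by (auto simp: \<rho>_def)
  have sub: "ball x (3 * \<rho> x) \<subseteq> ?S"
  proof
   fix y assume "y \<in> ball x (3 * \<rho> x)"
   then have "0 < D y" using near[of y] Dx by auto
   then show "y \<in> ?S" by (auto simp: D_def)
  qed
  let ?e = "D x / r"
  have e: "0 < ?e" "?e <= 4" using Dx r D0[of x] by (auto simp: field_simps)
  let ?B = "ball x (3 * \<rho> x)"
  have L: "sint (ball x (\<rho> x)) P <= ennreal ((9/8 * ?e) ^ ?m) * sint (ball x (\<rho> x)) ?H"
  proof -
   have "sint (ball x (\<rho> x)) P <= nint (%y. ennreal ((9/8 * ?e) ^ ?m) * (?H y * indicator (ball x (\<rho> x)) y))"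
   proof (intro nn_integral_mono)
    fix y show "P y * indicator (ball x (\<rho> x)) y <= ennreal ((9/8 * ?e) ^ ?m) * (?H y * indicator (ball x (\<rho> x)) y)"
    proof (cases "y \<in> ball x (\<rho> x)")
     case True
     then have "D y <= 9/8 * D x" using near[of y] \<open>0 < \<rho> x\<close> by auto
     then have "\<delta> y <= ennreal ((9/8 * ?e) ^ ?m)" unfolding \<delta>_def using r D0[of y] by (intro ennreal_leI power_mono) (auto simp: field_simps)
     then show ?thesis using True by (simp add: P_def mult_right_mono)
    qed simp
   qed
   then show ?thesis by (simp add: nn_integral_cmult)
  qed
  have PH: "ennreal ((9/8 * ?e) ^ ?m) * sint ?B ?H <= ennreal ((9/7) ^ ?m) * sint ?B P"
  proof -
   have "nint (%y. ennreal ((9/8 * ?e) ^ ?m) * (?H y * indicator ?B y)) <= nint (%y. ennreal ((9/7) ^ ?m) * (P y * indicator ?B y))"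
   proof (intro nn_integral_mono)
    fix y show "ennreal ((9/8 * ?e) ^ ?m) * (?H y * indicator ?B y) <= ennreal ((9/7) ^ ?m) * (P y * indicator ?B y)"
    proof (cases "y \<in> ?B")
     case True
     then have "7/8 * D x <= D y" using near[of y] by auto
     then have "(9/8 * ?e) ^ ?m <= (9/7 * (D y / r)) ^ ?m" using r e by (intro power_mono) (auto simp: field_simps)
     then have "ennreal ((9/8 * ?e) ^ ?m) <= ennreal ((9/7) ^ ?m) * \<delta> y" unfolding \<delta>_def using r D0[of y]
      by (subst ennreal_mult[symmetric], simp, simp) (simp only: power_mult_distrib[of "9/7"] ennreal_leI)
     then show ?thesis using True by (simp add: P_def mult_right_mono mult.assoc[symmetric])
    qed simp
   qed
   then show ?thesis by (simp add: nn_integral_cmult)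
  qed
  have "sint (ball x (\<rho> x)) P <= ennreal ((9/8 * ?e) ^ ?m) * (ennreal C * (ennreal (\<tau>^2) * sint ?B ?H
    + ennreal (1 / (\<tau> * \<rho> x) ^ ?m) * (sint ?B h)^2 * sint ?B \<sigma>
    + ennreal (1 / \<tau> ^ ?m) * sint ?B f))" using L loc[OF \<open>0 < \<rho> x\<close> sub \<tau>(1,2)] by (meson mult_left_mono order_trans zero_le)
  also have "... = ennreal (C * \<tau>^2) * (ennreal ((9/8 * ?e) ^ ?m) * sint ?B ?H)
    + ennreal (C * ((9/8 * ?e) ^ ?m * (1 / (\<tau> * \<rho> x) ^ ?m))) * (sint ?B h)^2 * sint ?B \<sigma>
    + ennreal (C * ((9/8 * ?e) ^ ?m * (1 / \<tau> ^ ?m))) * sint ?B f"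
  proof -
   have alg: "ennreal a * (ennreal C * (ennreal t * H + ennreal k * X * S + ennreal l * F))
    = ennreal (C * t) * (ennreal a * H) + ennreal (C * (a * k)) * X * S + ennreal (C * (a * l)) * F"
    if "0 <= a" "0 <= t" "0 <= k" "0 <= l" for a t k l and H X S F :: ennreal using that C by (simp add: ennreal_mult distrib_left mult_ac)
   show ?thesis by (rule alg) (use e(1) \<tau>(1) \<open>0 < \<rho> x\<close> in auto)
  qed
  also have "... <= ennreal (C * \<tau>^2) * (ennreal ((9/7) ^ ?m) * sint ?B P)
    + ennreal (c2 * (1 / r ^ ?m)) * ?X^2 * sint ?B \<sigma>
    + ennreal c2 * sint ?B f"
  proof -
   have X:  "sint ?B h <= ?X" using sub by (intro nn_integral_mono) (auto simp: indicator_def)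
   have "(9/8 * ?e) ^ ?m * (1 / (\<tau> * \<rho> x) ^ ?m) = (9/8 * ?e * (1 / (\<tau> * \<rho> x))) ^ ?m"
    by (simp only: power_one_over power_mult_distrib[of "9/8 * ?e"])
   also have "9/8 * ?e * (1 / (\<tau> * \<rho> x)) = 9/8 * (24 / \<tau>) * (1 / r)" using Dx r \<tau> by (simp add: \<rho>_def field_simps)
   also have "(9/8 * (24 / \<tau>) * (1 / r)) ^ ?m <= (5 * (24 / \<tau>) * (1 / r)) ^ ?m" using \<tau> r by (intro power_mono mult_right_mono) auto
   finally have "C * ((9/8 * ?e) ^ ?m * (1 / (\<tau> * \<rho> x) ^ ?m)) <= C * (5 * (24 / \<tau>) * (1 / r)) ^ ?m" using C by (intro mult_left_mono) auto
   also have "... = c2 * (1 / r ^ ?m)" unfolding c2_def by (simp only: power_mult_distrib power_one_over mult.assoc)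
   finally have k2: "C * ((9/8 * ?e) ^ ?m * (1 / (\<tau> * \<rho> x) ^ ?m)) <= c2 * (1 / r ^ ?m)" .
   have "(9/8 * ?e) ^ ?m * (1 / \<tau> ^ ?m) <= 5 ^ ?m * (24 / \<tau>) ^ ?m"
   proof (intro mult_mono)
    show "(9/8 * ?e) ^ ?m <= 5 ^ ?m" using e by (intro power_mono) auto
    have "1 / \<tau> ^ ?m = (1 / \<tau>) ^ ?m" by (simp only: power_one_over)
    also have "... <= (24 / \<tau>) ^ ?m" using \<tau> by (intro power_mono divide_right_mono) auto
    finally show "1 / \<tau> ^ ?m <= (24 / \<tau>) ^ ?m" .
   qed (use \<tau> in auto)
   then have k3: "C * ((9/8 * ?e) ^ ?m * (1 / \<tau> ^ ?m)) <= c2" using C unfolding c2_def mult.assoc by (intro mult_left_mono) simp_all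
   show ?thesis using power_mono[OF X, of 2] by (intro add_mono mult_mono mult_left_mono[OF PH] ennreal_leI[OF k2] ennreal_leI[OF k3]) auto
  qed
  also have "... = sint ?B Q"
  proof -
   have "sint ?B Q = nint (%y. ennreal c1 * (P y * indicator ?B y)
     + (ennreal c2 * (ennreal (1 / r ^ ?m) * ?X^2) * (\<sigma> y * indicator ?B y) + ennreal c2 * (f y * indicator ?B y)))"
    unfolding Q_def by (intro nn_integral_cong) (simp add: distrib_left distrib_right mult_ac)
   also have "... = ennreal c1 * sint ?B P + (ennreal c2 * (ennreal (1 / r ^ ?m) * ?X^2) * sint ?B \<sigma>
     + ennreal c2 * sint ?B f)" by (simp add: nn_integral_add nn_integral_cmult)
   also have "ennreal c1 = ennreal (C * \<tau>^2) * ennreal ((9/7) ^ ?m)" unfolding c1_def using C by (simp add: ennreal_mult[symmetric] mult_ac)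
   finally have eqQ: "sint ?B Q = ennreal (C * \<tau>^2) * ennreal ((9/7) ^ ?m) * sint ?B P
     + (ennreal c2 * (ennreal (1 / r ^ ?m) * ?X^2) * sint ?B \<sigma> + ennreal c2 * sint ?B f)"
    .
    have alg: "ennreal a * (ennreal b * H) + ennreal (c2 * k) * X * S + ennreal c2 * F
      = ennreal a * ennreal b * H + (ennreal c2 * (ennreal k * X) * S + ennreal c2 * F)"
     if "0 <= k" for a b k and H X S F :: ennreal using that c by (simp add: ennreal_mult mult_ac add_ac)
   show ?thesis unfolding eqQ by (rule alg) (use r in simp)
  qed
  finally show "sint (ball x (\<rho> x)) P <= sint (ball x (3 * \<rho> x)) Q" .
 qed (use D0 in \<open>auto simp: \<rho>_def\<close>)
 have "{y. 0 < \<rho> y} = ?S" using pos by blast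
 note wh[unfolded this]
 then have main: "sint ?S P <= ennreal (24 ^ ?d) * sint ?S Q" by simp
 let ?R = "ennreal (1 / r ^ ?m) * ?X^2 * sint ?S \<sigma> + sint ?S f"
 have Qint: "sint ?S Q = ennreal c1 * sint ?S P + ennreal c2 * ?R"
 proof -
  have "sint ?S Q = nint (%y. ennreal c1 * (P y * indicator ?S y)
    + (ennreal c2 * (ennreal (1 / r ^ ?m) * ?X^2) * (\<sigma> y * indicator ?S y) + ennreal c2 * (f y * indicator ?S y)))"
   unfolding Q_def by (intro nn_integral_cong) (simp add: distrib_left distrib_right mult_ac)
  also have "... = ennreal c1 * sint ?S P + (ennreal c2 * (ennreal (1 / r ^ ?m) * ?X^2) * sint ?S \<sigma>
    + ennreal c2 * sint ?S f)" by (simp add: nn_integral_add nn_integral_cmult)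
  finally show ?thesis by (simp add: distrib_left mult_ac)
 qed
 have Pfin: "sint ?S P < top"
 proof -
  have "sint ?S P <= nint (%y. ennreal (4 ^ ?m) * (?H y * indicator ?S y))"
  proof (intro nn_integral_mono)
   fix y
   have "\<delta> y <= ennreal (4 ^ ?m)" unfolding \<delta>_def using D0[of y] r by (intro ennreal_leI power_mono) (auto simp: field_simps)
   then show "P y * indicator ?S y <= ennreal (4 ^ ?m) * (?H y * indicator ?S y)" by (simp add: P_def mult_right_mono mult.assoc)
  qed
  also have "... = ennreal (4 ^ ?m) * sint ?S ?H" by (simp add: nn_integral_cmult)
  also have "... < top" using fin by (simp add: ennreal_mult_less_top)
  finally show ?thesis .
 qed
 have c1: "24 ^ ?d * c1 <= 1/2"
 proof -
  define q where "q = 24 ^ ?d * C * (9/7) ^ ?m"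
  have "24 ^ ?d * c1 = q * (1 / (1 + 2 * q))" unfolding c1_def \<tau>(3) q_def by (simp only: mult_ac)
  moreover have "0 <= q" using C by (simp add: q_def)
  moreover from this have "q * (1 / (1 + 2 * q)) <= 1/2" by (simp add: field_simps)
  ultimately show ?thesis by (simp only:)
 qed
 have "sint ?S P <= ennreal (24 ^ ?d * c1) * sint ?S P + ennreal (24 ^ ?d * c2) * ?R" using main c unfolding Qint by (simp add: ennreal_mult distrib_left mult_ac)
 also have "... <= ennreal (1/2) * sint ?S P + ennreal (24 ^ ?d * c2) * ?R" using c1 by (intro add_right_mono mult_right_mono ennreal_leI) auto
 finally have m1: "sint ?S P <= 2 * (ennreal (24 ^ ?d * c2) * ?R)" using ennreal_absorb Pfin by blast
 have m2: "sint (ball x0 r) ?H <= sint ?S P"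
 proof (intro nn_integral_mono)
  fix y show "?H y * indicator (ball x0 r) y <= P y * indicator ?S y"
  proof (cases "y \<in> ball x0 r")
   case True
   then have "r <= D y" by (auto simp: D_def)
   then have "1 <= \<delta> y" unfolding \<delta>_def using r by (simp add: one_le_power)
   then have "1 * ?H y <= \<delta> y * ?H y" by (intro mult_right_mono) auto
   then show ?thesis using True r by (simp add: P_def indicator_def)
  qed simp
 qed
 have m3: "2 * (ennreal (24 ^ ?d * c2) * ?R) = ennreal (2 * 24 ^ ?d * C * 5 ^ ?m * (24 / \<tau>) ^ ?m) * ?R"
 proof -
  have "ennreal (2 * 24 ^ ?d * C * 5 ^ ?m * (24 / \<tau>) ^ ?m) = 2 * ennreal (24 ^ ?d * c2)"
   using c unfolding c2_def by (simp add: ennreal_mult mult.assoc flip: ennreal_numeral)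
  then show ?thesis by (simp add: mult.assoc)
 qed
 show ?thesis using order_trans[OF m2 m1] unfolding m3 .
qed

section \<open>Higher integrability on small sets\<close>

lemma dyadic_sum_below:
 fixes t y :: real
 assumes "0 < t" "0 <= y"
 shows "(\<Sum>k<n. 2 ^ k * t * (if 2 ^ k * t < y then 1 else 0)) <= 2 * y"
proof -
 have full: "(\<Sum>k<n. 2 ^ k * t) <= 2 ^ n * t" for n
 proof -
  have "(\<Sum>k<n. 2 ^ k) = 2 ^ n - (1::real)" by (induction n) auto
  then have "(\<Sum>k<n. 2 ^ k * t) = (2 ^ n - 1) * t" by (simp add: sum_distrib_right[symmetric])
  then show ?thesis using assms by (simp add: algebra_simps)
 qed
 show ?thesis
 proof (induction n)
  case (Suc n)
  show ?case
  proof (cases "2 ^ n * t < y")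
   case True
   have "(\<Sum>k<Suc n. 2 ^ k * t * (if 2 ^ k * t < y then 1 else 0)) <= (\<Sum>k<Suc n. 2 ^ k * t)" using assms by (intro sum_mono) auto
   also have "... <= 2 * (2 ^ n * t)" using full[of "Suc n"] by simp
   also have "... <= 2 * y" using True by simp
   finally show ?thesis .
  qed (use Suc in simp)
 qed (use assms in simp)
qed

text \<open>Pigeonhole over K levels. This is how a small constant is produced without any
  integrability exponent above 2.\<close>

lemma exists_le_average:
 fixes f :: "nat => ennreal"
 assumes "0 < K"
 shows "\<exists>k<K. of_nat K * f k <= (\<Sum>k<K. f k)"
proof (rule ccontr)
 assume "~ ?thesis"
 then have lt: "(\<Sum>k<K. f k) < of_nat K * f k" if "k < K" for k using that by auto
 have "Min (f ` {..<K}) \<in> f ` {..<K}" using assms by (intro Min_in) auto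
 then obtain k where k: "k < K" "f k = Min (f ` {..<K})" by auto
 have "of_nat (card {..<K}) * f k <= (\<Sum>k<K. f k)" by (rule sum_bounded_below) (simp add: k(2))
 then show False using lt[OF k(1)] by simp
qed

text \<open>On the level set at height 2s, h is at most s plus its part above s, and the weak type
  bound for that part controls s times the volume. So one level costs a multiple of the integral of
  h over \<open>h > s\<close>. Multiplied by s and summed over dyadic s, each point contributes
  \<open>h x\<close> times a geometric sum below \<open>2 * h x\<close>.\<close>

lemma maxlevel_weighted_sum:
 fixes h :: "'a::euclidean_space => real"
 assumes [measurable]: "borel_fun h" and nonneg: "!!x. 0 <= h x"
  and fin: "nint (%x. ennreal (h x)) < top" and t: "0 < t"
 shows "(\<Sum>k<n. ennreal (2 ^ k * t) * sint (maxlevel (%x. ennreal (h x)) (2 * (2 ^ k * t))) (%x. ennreal (h x)))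
  <= ennreal (2 * (5 ^ DIM('a) + 1)) * nint (%x. (ennreal (h x))^2)"
proof -
 let ?h = "%x. ennreal (h x)"
 define g where "g s x = ?h x * indicator {x. ennreal s < ?h x} x" for s x
 have [measurable]: "borel_fun (g s)" for s unfolding g_def by measurable
 have one: "sint (maxlevel ?h (2 * s)) ?h <= ennreal (5 ^ DIM('a) + 1) * nint (%x. g s x)"
  if s: "0 < s" for s
 proof -
  have gfin: "nint (%x. g s x) < top" using fin by (rule le_less_trans[rotated]) (auto intro!: nn_integral_mono simp: g_def indicator_def)
  have "sint (maxlevel ?h (2 * s)) ?h <= nint (%x. ennreal s * indicator (maxlevel ?h (2 * s)) x + g s x)"
   by (intro nn_integral_mono) (auto simp: g_def indicator_def)
  also have "... = ennreal s * vol (maxlevel ?h (2 * s)) + nint (%x. g s x)" by (subst nn_integral_add) (auto simp: nn_integral_cmult_indicator)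
  also have "ennreal s * vol (maxlevel ?h (2 * s)) <= ennreal s * vol (maxlevel (g s) s)"
   using maxlevel_truncate[of ?h s] s unfolding g_def by (intro mult_left_mono emeasure_mono) auto
  also have "... <= ennreal (5 ^ DIM('a)) * nint (%x. g s x)" by (rule weak_type) (use gfin s in auto)
  finally have "sint (maxlevel ?h (2 * s)) ?h <= ennreal (5 ^ DIM('a)) * nint (%x. g s x) + nint (%x. g s x)" by (simp add: add_right_mono)
  also have "... = ennreal (5 ^ DIM('a) + 1) * nint (%x. g s x)" by (simp add: distrib_right)
  finally show ?thesis .
 qed
 have "(\<Sum>k<n. ennreal (2 ^ k * t) * sint (maxlevel ?h (2 * (2 ^ k * t))) ?h)
  <= (\<Sum>k<n. ennreal (2 ^ k * t) * (ennreal (5 ^ DIM('a) + 1) * nint (%x. g (2 ^ k * t) x)))" using t by (intro sum_mono mult_left_mono one) auto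
 also have "... = ennreal (5 ^ DIM('a) + 1) * nint (%x. (\<Sum>k<n. ennreal (2 ^ k * t) * g (2 ^ k * t) x))"
  by (simp add: nn_integral_sum nn_integral_cmult sum_distrib_left mult_ac)
 also have "nint (%x. (\<Sum>k<n. ennreal (2 ^ k * t) * g (2 ^ k * t) x)) <= nint (%x. 2 * (?h x)^2)"
 proof (intro nn_integral_mono)
  fix x
  have "(\<Sum>k<n. ennreal (2 ^ k * t) * g (2 ^ k * t) x) = (\<Sum>k<n. ennreal (h x * (2 ^ k * t * (if 2 ^ k * t < h x then 1 else 0))))"
   using t nonneg[of x] by (intro sum.cong) (auto simp: g_def indicator_def ennreal_less_iff ennreal_mult[symmetric] mult_ac)
  also have "... = ennreal (h x * (\<Sum>k<n. 2 ^ k * t * (if 2 ^ k * t < h x then 1 else 0)))"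
   unfolding sum_distrib_left using t nonneg[of x] by (intro sum_ennreal) auto
  also have "... <= ennreal (h x * (2 * h x))" using dyadic_sum_below[OF t nonneg[of x]] nonneg[of x] by (intro ennreal_leI mult_left_mono)
  also have "... = 2 * (?h x)^2" using nonneg[of x] by (simp add: power2_eq_square ennreal_mult mult_ac)
  finally show "(\<Sum>k<n. ennreal (2 ^ k * t) * g (2 ^ k * t) x) <= 2 * (?h x)^2" .
 qed
 also have "... = 2 * nint (%x. (?h x)^2)" by (simp add: nn_integral_cmult)
 finally have "(\<Sum>k<n. ennreal (2 ^ k * t) * sint (maxlevel ?h (2 * (2 ^ k * t))) ?h)
  <= ennreal (5 ^ DIM('a) + 1) * (2 * nint (%x. (?h x)^2))" by (simp add: mult_left_mono)
 also have "... = ennreal (2 * (5 ^ DIM('a) + 1)) * nint (%x. (?h x)^2)"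
 proof -
  have "ennreal (2 * (5 ^ DIM('a) + 1)) = ennreal 2 * ennreal (5 ^ DIM('a) + 1)" by (rule ennreal_mult) auto
  then show ?thesis by (simp only: ennreal_numeral mult_ac)
 qed
 finally show ?thesis .
qed

lemma nn_integral_square_le:
 fixes h :: "'a::euclidean_space => ennreal"
 assumes [measurable]: "borel_fun h" "S \<in> sets borel"
 shows "(sint S h)^2 <= vol S * sint S (%x. (h x)^2)"
proof -
 have "(nint (%x. (h x * indicator S x) * indicator S x))^2
   <= nint (%x. (h x * indicator S x)^2) * nint (%x. (indicator S x)^2)" by (rule Cauchy_Schwarz_nn_integral) measurable
 also have "nint (%x. (h x * indicator S x)^2) = sint S (%x. (h x)^2)" by (intro nn_integral_cong) (auto simp: indicator_def)
 also have "nint (%x. (indicator S x)^2) = nint (%x. indicator S x)" by (intro nn_integral_cong) (auto simp: indicator_def)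
 also have "nint (%x. (h x * indicator S x) * indicator S x) = sint S h" by (intro nn_integral_cong) (auto simp: indicator_def)
 finally show ?thesis by (simp add: mult.commute)
qed

text \<open>The volume on the right is the integral of the weight 1: the inequality has the shape of
  the weighted one, whose case \<sigma> = 1 is used later. Up to constants the first term is the
  volume times the squared mean of h.\<close>

definition reverse_holder_on :: "'a::euclidean_space => real => real => ('a => real) => ('a => ennreal) => bool" where
 "reverse_holder_on x0 r C h F \<longleftrightarrow> (\<forall>x \<rho>. 0 < \<rho> --> ball x (4 * \<rho>) \<subseteq> ball x0 (4 * r) -->
   (sint (ball x \<rho>) (%y. (ennreal (h y))^2)) <= ennreal C *
    (ennreal (1 / \<rho> ^ (2 * DIM('a))) * (sint (ball x (4 * \<rho>)) (%y. ennreal (h y)))^2 * vol (ball x (4 * \<rho>))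
     + sint (ball x (4 * \<rho>)) F))"

text \<open>On a Whitney ball of the level set the integral of h is at most a constant times
  \<open>s * \<rho>^d\<close>, since a comparable ball leaves the level set. Using this for one of
  the two factors in the squared integral turns the quadratic right-hand side into s times a linear
  one.\<close>

lemma gehring_level:
 fixes h :: "'a::euclidean_space => real" and F :: "'a => ennreal"
 assumes C: "0 <= C" and r: "0 < r" and [measurable]: "borel_fun h" "borel_fun F"
  and nonneg: "!!x. 0 <= h x" and supp: "!!x. x \<notin> ball x0 (4 * r) ==> h x = 0"
  and rh: "reverse_holder_on x0 r C h F"
  and s: "0 < s" "nint (%y. ennreal (h y)) <= ennreal (s * r ^ DIM('a))"
 defines "v \<equiv> unit_ball_vol (real DIM('a))"
 shows "sint (maxlevel (%x. ennreal (h x)) s \<inter> ball x0 r) (%y. (ennreal (h y))^2)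
  <= ennreal (32 ^ DIM('a) * C * v * 4 ^ DIM('a) * (64 ^ DIM('a) * (1 + v))) *
     (ennreal s * sint (maxlevel (%x. ennreal (h x)) s) (%y. ennreal (h y)))
   + ennreal (32 ^ DIM('a) * C) * sint (ball x0 (4 * r)) F"
proof -
 let ?d = "DIM('a)"
 have v: "0 < v" by (simp add: v_def)
 let ?h = "%x. ennreal (h x)"
 let ?V = "maxlevel ?h s"
 \<comment> \<open>Large enough for both kinds of scale: \<open>32^d\<close> when the cap is
   reached, so that \<open>r = 32 * \<rho> x\<close>, and \<open>v * 64^d\<close> when the ball of
   radius \<open>64 * \<rho> x\<close> contains a point outside the level set.\<close>
 define M where "M = 64 ^ ?d * (1 + v)"
 have M: "0 < M" "32 ^ ?d <= M" "v * 64 ^ ?d <= M"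
 proof -
  show "0 < M" using v by (simp add: M_def)
  have "32 ^ ?d <= (64::real) ^ ?d" by (intro power_mono) auto
  also have "... <= M" using v by (simp add: M_def distrib_left)
  finally show "32 ^ ?d <= M" .
  show "v * 64 ^ ?d <= M" by (simp add: M_def distrib_left)
 qed
 obtain \<rho> where ws: "whitney_scale ?V r (8 * 4) \<rho>" using whitney_scale_exists[OF open_maxlevel[of ?h s] r, of "8 * 4"] by auto
 note \<rho> = whitney_scaleD[OF ws]
 define P where "P y = (?h y)^2 * indicator (ball x0 r) y" for y
 define Q where "Q y = ennreal (C * v * 4 ^ ?d * M * s) * ?h y + ennreal C * (F y * indicator (ball x0 (4 * r)) y)" for y
 have [measurable]: "borel_fun P" "borel_fun Q" unfolding P_def Q_def by measurable
 have wh: "(sint {y. 0 < \<rho> y} P) <= ennreal ((8 * 4) ^ ?d) * sint {y. 0 < \<rho> y} Q"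
 proof (rule whitney_average)
  fix x assume px: "0 < \<rho> x"
  show "sint (ball x (\<rho> x)) P <= sint (ball x (4 * \<rho> x)) Q"
  proof (cases "ball x (\<rho> x) \<inter> ball x0 r = {}")
   case True
   then have "sint (ball x (\<rho> x)) P = (\<integral>\<^sup>+y. 0 \<partial>(lborel :: 'a measure))"
    unfolding P_def by (intro nn_integral_cong) (auto simp: indicator_def)
   then show ?thesis by simp
  next
   case False
   then obtain z where z: "dist x z < \<rho> x" "dist x0 z < r" by auto
   let ?B = "ball x (4 * \<rho> x)"
   have sub: "?B \<subseteq> ball x0 (4 * r)"
   proof
    fix y assume y: "y \<in> ?B"
    have "dist x0 y <= dist x0 z + dist z x + dist x y" using dist_triangle[of x0 y z] dist_triangle[of z y x] by linarith
    also have "... < r + \<rho> x + 4 * \<rho> x" using z y by (simp add: dist_commute)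
    also have "... <= 4 * r" using \<rho>(4)[of x] r by simp
    finally show "y \<in> ball x0 (4 * r)" by simp
   qed
   let ?I = "sint ?B ?h"
   have I: "?I <= ennreal (M * \<rho> x ^ ?d * s)"
   proof -
    have "x \<in> ?V" using px \<rho>(3) by auto
    then consider "\<rho> x = r / (8 * 4)" | y where "y \<notin> ?V" "dist x y < 2 * (8 * 4) * \<rho> x" using \<rho>(6) by blast
    then show ?thesis
    proof cases
     case 1
     have "?I <= nint ?h" by (intro nn_integral_mono) (auto simp: indicator_def)
     also have "... <= ennreal (s * r ^ ?d)" by (rule s(2))
     also have "s * r ^ ?d = 32 ^ ?d * \<rho> x ^ ?d * s"
     proof -
      have "r = 32 * \<rho> x" using 1 by simp
      then have "r ^ ?d = 32 ^ ?d * \<rho> x ^ ?d" by (simp only: power_mult_distrib)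
      then show ?thesis by simp
     qed
     also have "... <= M * \<rho> x ^ ?d * s" using M px s by (intro mult_right_mono) auto
     finally show ?thesis by (simp add: ennreal_leI)
    next
     case 2
     have "?I <= sint (ball x (64 * \<rho> x)) ?h" using px by (intro nn_integral_mono) (auto simp: indicator_def)
     also have "... <= ennreal s * vol (ball x (64 * \<rho> x))" using 2 by (intro not_maxlevelD[of y]) auto
     also have "... = ennreal (v * 64 ^ ?d * \<rho> x ^ ?d * s)" using px s v by (simp add: emeasure_ball v_def ennreal_mult[symmetric] power_mult_distrib mult_ac)
     also have "... <= ennreal (M * \<rho> x ^ ?d * s)" using M px s by (intro ennreal_leI mult_right_mono) auto
     finally show ?thesis .
    qed
   qed
   have "sint (ball x (\<rho> x)) P <= sint (ball x (\<rho> x)) (%y. (?h y)^2)" unfolding P_def by (intro nn_integral_mono) (auto simp: indicator_def)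
   also have "... <= ennreal C * (ennreal (1 / \<rho> x ^ (2 * ?d)) * ?I^2 * vol ?B + sint ?B F)" using rh px sub unfolding reverse_holder_on_def by blast
   also have "ennreal (1 / \<rho> x ^ (2 * ?d)) * ?I^2 * vol ?B <= ennreal (v * 4 ^ ?d * M * s) * ?I"
   proof -
    have "ennreal (1 / \<rho> x ^ (2 * ?d)) * ?I^2 * vol ?B
      = (ennreal (1 / \<rho> x ^ (2 * ?d)) * vol ?B) * (?I * ?I)" by (simp add: power2_eq_square mult_ac)
    also have "ennreal (1 / \<rho> x ^ (2 * ?d)) * vol ?B = ennreal (v * 4 ^ ?d / \<rho> x ^ ?d)"
    proof -
     have "1 / \<rho> x ^ (2 * ?d) * (v * (4 * \<rho> x) ^ ?d) = v * 4 ^ ?d / \<rho> x ^ ?d" using px by (simp add: power_mult_distrib mult_2 power_add)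
     then show ?thesis using px v by (simp add: emeasure_ball v_def ennreal_mult[symmetric])
    qed
    also have "ennreal (v * 4 ^ ?d / \<rho> x ^ ?d) * (?I * ?I) <= ennreal (v * 4 ^ ?d / \<rho> x ^ ?d) * (ennreal (M * \<rho> x ^ ?d * s) * ?I)"
     by (intro mult_left_mono mult_right_mono I) auto
    also have "... = ennreal (v * 4 ^ ?d / \<rho> x ^ ?d * (M * \<rho> x ^ ?d * s)) * ?I" using px v M s by (subst ennreal_mult) (auto simp: mult_ac)
    also have "v * 4 ^ ?d / \<rho> x ^ ?d * (M * \<rho> x ^ ?d * s) = v * 4 ^ ?d * M * s" using px by simp
    finally show ?thesis .
   qed
   also have "ennreal C * (ennreal (v * 4 ^ ?d * M * s) * ?I + sint ?B F)
     = sint ?B Q"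
   proof -
    have "sint ?B Q = nint (%y. ennreal (C * v * 4 ^ ?d * M * s) * (?h y * indicator ?B y) + ennreal C * (F y * indicator ?B y))"
     unfolding Q_def using sub by (intro nn_integral_cong) (auto simp: indicator_def)
    also have "... = ennreal (C * (v * 4 ^ ?d * M * s)) * ?I + ennreal C * sint ?B F" by (simp add: nn_integral_add nn_integral_cmult mult.assoc)
    also have "ennreal (C * (v * 4 ^ ?d * M * s)) = ennreal C * ennreal (v * 4 ^ ?d * M * s)" using C v M s by (intro ennreal_mult) auto
    finally show ?thesis by (simp only: distrib_left mult.assoc)
   qed
   finally show ?thesis by (simp add: mult_left_mono add_right_mono)
  qed
 qed (use \<rho> in auto)
 note wh = wh[unfolded \<rho>(3)]
 have "sint (?V \<inter> ball x0 r) (%y. (?h y)^2) = sint ?V P" unfolding P_def by (intro nn_integral_cong) (auto simp: indicator_def)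
 also have "... <= ennreal (32 ^ ?d) * sint ?V Q" using wh by simp
 also have "sint ?V Q <= nint (%y. ennreal (C * v * 4 ^ ?d * M * s) * (?h y * indicator ?V y)
   + ennreal C * (F y * indicator (ball x0 (4 * r)) y))" unfolding Q_def by (intro nn_integral_mono) (auto simp: indicator_def)
 also have "... = ennreal (C * v * 4 ^ ?d * M * s) * sint ?V ?h + ennreal C * sint (ball x0 (4 * r)) F" by (simp add: nn_integral_add nn_integral_cmult)
 finally have "sint (?V \<inter> ball x0 r) (%y. (?h y)^2) <= ennreal (32 ^ ?d) *
  (ennreal (C * v * 4 ^ ?d * M * s) * sint ?V ?h + ennreal C * sint (ball x0 (4 * r)) F)" by (simp add: mult_left_mono)
 also have "... = ennreal (32 ^ ?d * C * v * 4 ^ ?d * M) * (ennreal s * sint ?V ?h) + ennreal (32 ^ ?d * C) * sint (ball x0 (4 * r)) F"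
 proof -
  have "ennreal a * (ennreal (b * s) * X + ennreal C * Y) = ennreal (a * b) * (ennreal s * X) + ennreal (a * C) * Y"
   if "0 <= a" "0 <= b" for a b and X Y :: ennreal using that s C by (simp add: ennreal_mult distrib_left mult_ac)
  from this[of "32 ^ ?d" "C * v * 4 ^ ?d * M"] show ?thesis using C v M by (simp add: mult.assoc)
 qed
 finally show ?thesis unfolding M_def .
qed

text \<open>Gehring's self-improvement in the form of uniform absolute continuity. Among K dyadic
  levels above the mean, one carries at most the K-th part of the dyadic sum, so by
  \<open>gehring_level\<close> the energy over that level set is small up to the data term. Off the
  level set h is bounded by a fixed multiple of its mean, so a set of small volume carries little
  energy there.\<close>

lemma gehring_small_sets:
 fixes C \<epsilon> :: real
 assumes C: "0 <= C" and \<epsilon>: "0 < \<epsilon>"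
 shows "\<exists>\<eta>>0. \<forall>(x0::'a::euclidean_space) r h F E. 0 < r --> h \<in> borel_measurable borel --> F \<in> borel_measurable borel -->
  (\<forall>x. 0 <= h x) --> (\<forall>x. x \<notin> ball x0 (4 * r) --> h x = 0) --> reverse_holder_on x0 r C h F -->
  (nint (%y. (ennreal (h y))^2)) < top --> E \<in> sets borel --> E \<subseteq> ball x0 r -->
  vol E <= ennreal (\<eta> * r ^ DIM('a)) -->
  (sint E (%y. (ennreal (h y))^2)) <= ennreal \<epsilon> * nint (%y. (ennreal (h y))^2)
   + ennreal (32 ^ DIM('a) * C) * sint (ball x0 (4 * r)) F"
proof -
 let ?d = "DIM('a)"
 define v where "v = unit_ball_vol (real ?d)"
 have v: "0 < v" by (simp add: v_def)
 define c3 where "c3 = 32 ^ ?d * C * v * 4 ^ ?d * (64 ^ ?d * (1 + v))"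
 define c4 where "c4 = 2 * ((5::real) ^ ?d + 1)"
 define cd where "cd = v * (real ?d + 1) ^ ?d"
 have c34: "0 <= c3" "0 <= c4" "0 <= cd" using C v by (auto simp: c3_def c4_def cd_def)
 obtain K :: nat where K: "4 * c3 * c4 / \<epsilon> < real K" using reals_Archimedean2 by blast
 have K0: "0 < K"
 proof -
  have "0 <= 4 * c3 * c4 / \<epsilon>" using c34 \<epsilon> by auto
  then have "0 < real K" using K by linarith
  then show ?thesis by simp
 qed
 \<comment> \<open>The bound \<open>cd * 2^K * t\<close> for h off the chosen level set, squared,
   with the mean t estimated by the energy through Cauchy-Schwarz on the ball of radius 4r.\<close>
 define D where "D = (cd * 2 ^ K)^2 * (v * 4 ^ ?d)"
 have D: "0 <= D" using v by (simp add: D_def)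
 define \<eta> where "\<eta> = \<epsilon> / (2 * (D + 1))"
 have \<eta>: "0 < \<eta>" "D * \<eta> <= \<epsilon> / 2" using \<epsilon> D by (auto simp: \<eta>_def field_simps)
 show ?thesis
 proof (intro exI[of _ \<eta>] conjI allI impI \<eta>(1))
  fix x0 :: 'a and r :: real and h :: "'a => real" and F E
  assume r: "0 < r" and [measurable]: "borel_fun h" "borel_fun F"
   and nn: "\<forall>x. 0 <= h x" and supp: "\<forall>x. x \<notin> ball x0 (4 * r) --> h x = 0" and rh: "reverse_holder_on x0 r C h F"
   and fin: "nint (%y. (ennreal (h y))^2) < top" and [measurable]: "E \<in> sets borel" and E: "E \<subseteq> ball x0 r"
   and small: "vol E <= ennreal (\<eta> * r ^ ?d)"
  let ?h = "%y. ennreal (h y)"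
  let ?H = "nint (%y. (?h y)^2)"
  let ?F = "sint (ball x0 (4 * r)) F"
  have ball_h: "?h y * indicator (ball x0 (4 * r)) y = ?h y" for y using supp by (auto simp: indicator_def)
  have ball_h2: "(?h y)^2 * indicator (ball x0 (4 * r)) y = (?h y)^2" for y using supp by (auto simp: indicator_def)
  have CS: "(nint ?h)^2 <= ennreal (v * (4 * r) ^ ?d) * ?H" using nn_integral_square_le[of ?h "ball x0 (4 * r)"] r
   unfolding ball_h ball_h2 by (simp add: emeasure_ball v_def)
  have "(nint ?h)^2 < top" using CS by (rule le_less_trans) (use fin in \<open>simp add: ennreal_mult_less_top\<close>)
  then have hfin: "nint ?h < top"
  proof (rule_tac ccontr)
   assume sq: "(nint ?h)^2 < top" and "~ (nint ?h) < top"
   then have "nint ?h = top" by (metis less_top)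
   then show False using sq by (simp add: power2_eq_square)
  qed
  then obtain T where T: "nint ?h = ennreal T" "0 <= T" by (metis ennreal_cases less_irrefl)
  show "sint E (%y. (?h y)^2) <= ennreal \<epsilon> * ?H + ennreal (32 ^ ?d * C) * ?F"
  proof (cases "T = 0")
   case True
   then have "AE y in lborel. ?h y = 0" using T nn_integral_0_iff_AE[of ?h lborel] by simp
   then have "sint E (%y. (?h y)^2) = (\<integral>\<^sup>+y. 0 \<partial>(lborel :: 'a measure))" by (intro nn_integral_cong_AE) auto
   then show ?thesis by simp
  next
   case False
   \<comment> \<open>The normalised mean of h, so that every level in use satisfies the size
     condition of \<open>gehring_level\<close>.\<close>
   define t where "t = T / r ^ ?d"
   have t: "0 < t" using False T r by (simp add: t_def)
   \<comment> \<open>The additional factor 2 is the one in the levels of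
     \<open>maxlevel_weighted_sum\<close>.\<close>
   define s where "s k = 2 * (2 ^ k * t)" for k :: nat
   have s: "0 < s k" for k using t by (simp add: s_def)
   let ?V = "%k. maxlevel ?h (s k)"
   define \<alpha> where "\<alpha> k = ennreal (2 ^ k * t) * sint (?V k) ?h" for k
   have "(\<Sum>k<K. \<alpha> k) <= ennreal c4 * ?H" unfolding \<alpha>_def s_def c4_def using nn by (intro maxlevel_weighted_sum hfin t) auto
   moreover obtain k where k: "k < K" "of_nat K * \<alpha> k <= (\<Sum>k<K. \<alpha> k)" using exists_le_average[OF K0] by blast
   ultimately have K\<alpha>: "of_nat K * \<alpha> k <= ennreal c4 * ?H" by (metis order_trans)
   have \<alpha>: "\<alpha> k <= ennreal (c4 / real K) * ?H"
   proof -
    have "\<alpha> k = ennreal (1 / real K) * (of_nat K * \<alpha> k)"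
     using K0 by (simp add: mult.assoc[symmetric] ennreal_of_nat_eq_real_of_nat ennreal_mult[symmetric])
    also have "... <= ennreal (1 / real K) * (ennreal c4 * ?H)" by (intro mult_left_mono K\<alpha>) simp
    also have "... = ennreal (c4 / real K) * ?H"
    proof -
     have "ennreal (c4 / real K) = ennreal (1 / real K) * ennreal c4" using c34 by (simp add: ennreal_mult[symmetric])
     then show ?thesis by (simp add: mult.assoc)
    qed
    finally show ?thesis .
   qed
   have sk: "s k <= 2 ^ K * t"
   proof -
    have "s k = 2 ^ Suc k * t" by (simp add: s_def)
    also have "... <= 2 ^ K * t" using k t by (intro mult_right_mono power_increasing) auto
    finally show ?thesis .
   qed
   have good: "sint (?V k \<inter> ball x0 r) (%y. (?h y)^2) <= ennreal (\<epsilon> / 2) * ?H + ennreal (32 ^ ?d * C) * ?F"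
   proof -
    have "T = t * r ^ ?d" using r by (simp add: t_def)
    also have "... <= s k * r ^ ?d"
    proof -
     have "1 * t <= 2 ^ Suc k * t" using t by (intro mult_right_mono one_le_power) auto
     then have "t <= s k" by (simp add: s_def)
     then show ?thesis using r by (intro mult_right_mono) auto
    qed
    finally have Ts: "nint ?h <= ennreal (s k * r ^ ?d)" unfolding T by (rule ennreal_leI)
    have "sint (?V k \<inter> ball x0 r) (%y. (?h y)^2)
     <= ennreal c3 * (ennreal (s k) * sint (?V k) ?h) + ennreal (32 ^ ?d * C) * ?F"
     unfolding c3_def v_def using nn supp by (intro gehring_level[OF C r _ _ _ _ rh s Ts]) auto
    also have "ennreal (s k) * sint (?V k) ?h = 2 * \<alpha> k" unfolding \<alpha>_def s_def using t by (subst ennreal_mult) (auto simp: mult.assoc)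
    also have "ennreal c3 * (2 * \<alpha> k) <= ennreal c3 * (2 * (ennreal (c4 / real K) * ?H))" by (intro mult_left_mono \<alpha>) auto
    also have "... = ennreal (2 * c3 * (c4 / real K)) * ?H"
    proof -
     have "ennreal (2 * c3 * q) = ennreal c3 * (2 * ennreal q)" if "0 <= q" for q using that c34 by (simp add: ennreal_mult mult_ac)
     from this[of "c4 / real K"] show ?thesis using c34 by (simp add: mult.assoc)
    qed
    also have "... <= ennreal (\<epsilon> / 2) * ?H"
    proof (intro mult_right_mono ennreal_leI)
     have "4 * c3 * c4 <= \<epsilon> * real K" using K \<epsilon> by (simp add: field_simps)
     then show "2 * c3 * (c4 / real K) <= \<epsilon> / 2" using K0 by (simp add: field_simps)
    qed simp
    finally show ?thesis by (simp add: add_right_mono)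
   qed
   have rest: "sint (E - ?V k) (%y. (?h y)^2) <= ennreal (\<epsilon> / 2) * ?H"
   proof -
    have "AE y in lborel. \<forall>s\<ge>0. y \<notin> maxlevel ?h s --> h y <= unit_ball_vol (real ?d) * (?d + 1) ^ ?d * s"
    proof (rule AE_le_of_not_maxlevel)
     show "sint (cbox a b) ?h < top" for a b using hfin by (rule le_less_trans[rotated]) (auto intro!: nn_integral_mono simp: indicator_def)
    qed (use nn in auto)
    then have ae: "AE y in lborel. (?h y)^2 * indicator (E - ?V k) y <= ennreal ((cd * (2 ^ K * t))^2) * indicator E y"
    proof eventually_elim
     fix y assume *: "\<forall>s\<ge>0. y \<notin> maxlevel ?h s --> h y <= unit_ball_vol (real ?d) * (?d + 1) ^ ?d * s"
     show "(?h y)^2 * indicator (E - ?V k) y <= ennreal ((cd * (2 ^ K * t))^2) * indicator E y"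
     proof (cases "y \<in> E - ?V k")
      case True
      then have "h y <= cd * s k" using *[rule_format, of "s k"] s[of k] by (simp add: cd_def v_def add.commute)
      also have "... <= cd * (2 ^ K * t)" using sk c34 by (intro mult_left_mono)
      finally have "(h y)^2 <= (cd * (2 ^ K * t))^2" using nn by (intro power_mono) auto
      then show ?thesis using True nn by (simp add: ennreal_power ennreal_leI)
     qed simp
    qed
    have "sint (E - ?V k) (%y. (?h y)^2) <= nint (%y. ennreal ((cd * (2 ^ K * t))^2) * indicator E y)" by (rule nn_integral_mono_AE[OF ae])
    also have "... = ennreal ((cd * (2 ^ K * t))^2) * vol E" by (rule nn_integral_cmult_indicator) auto
    also have "... <= ennreal ((cd * (2 ^ K * t))^2) * ennreal (\<eta> * r ^ ?d)" by (intro mult_left_mono small) simp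
    also have "... = ennreal ((cd * 2 ^ K)^2 * \<eta> / r ^ ?d) * (ennreal T)^2"
    proof -
     have "(cd * (2 ^ K * t))^2 * (\<eta> * r ^ ?d) = ((cd * 2 ^ K)^2 * \<eta> / r ^ ?d) * T^2"
      using r by (simp add: t_def power_mult_distrib power_divide power2_eq_square)
     then show ?thesis using \<eta> r T by (simp add: ennreal_mult[symmetric] ennreal_power)
    qed
    also have "... <= ennreal ((cd * 2 ^ K)^2 * \<eta> / r ^ ?d) * (ennreal (v * (4 * r) ^ ?d) * ?H)" using CS unfolding T by (intro mult_left_mono) auto
    also have "... = ennreal (D * \<eta>) * ?H"
    proof -
     have "((cd * 2 ^ K)^2 * \<eta> / r ^ ?d) * (v * (4 * r) ^ ?d) = D * \<eta>" using r by (simp add: D_def power_mult_distrib)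
     moreover have "ennreal ((cd * 2 ^ K)^2 * \<eta> / r ^ ?d) * ennreal (v * (4 * r) ^ ?d) = ennreal (((cd * 2 ^ K)^2 * \<eta> / r ^ ?d) * (v * (4 * r) ^ ?d))"
      using \<eta> r v by (intro ennreal_mult[symmetric]) auto
     ultimately show ?thesis by (simp add: mult.assoc[symmetric])
    qed
    also have "... <= ennreal (\<epsilon> / 2) * ?H" by (intro mult_right_mono ennreal_leI \<eta>) simp
    finally show ?thesis .
   qed
   have "sint E (%y. (?h y)^2) <= nint (%y. (?h y)^2 * indicator (?V k \<inter> ball x0 r) y + (?h y)^2 * indicator (E - ?V k) y)"
    using E by (intro nn_integral_mono) (auto simp: indicator_def)
   also have "... = sint (?V k \<inter> ball x0 r) (%y. (?h y)^2) + sint (E - ?V k) (%y. (?h y)^2)" by (rule nn_integral_add) measurable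
   also have "... <= (ennreal (\<epsilon> / 2) * ?H + ennreal (32 ^ ?d * C) * ?F) + ennreal (\<epsilon> / 2) * ?H" by (intro add_mono good rest)
   also have "... = (ennreal (\<epsilon> / 2) + ennreal (\<epsilon> / 2)) * ?H + ennreal (32 ^ ?d * C) * ?F" by (simp only: distrib_right add_ac)
   also have "ennreal (\<epsilon> / 2) + ennreal (\<epsilon> / 2) = ennreal \<epsilon>" using \<epsilon> by (simp flip: ennreal_plus)
   finally show ?thesis .
  qed
 qed
qed

text \<open>A local estimate for all balls on which the weight has average of order s is averaged
  over the Whitney balls of the level set of \<sigma>. At the largest scale no point outside the
  level set is near, and the average is controlled by assumption instead; balls that miss the
  support of g contribute nothing. The loss \<open>(8 * L)^d\<close> does not depend on K.\<close>

lemma level_step: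
 fixes \<sigma> g F :: "'a::euclidean_space => ennreal"
 assumes L: "4 <= L" and R: "0 < R" and C: "0 <= C" "0 <= CK" and s: "0 < s"
  and [measurable]: "borel_fun g" "borel_fun F"
  and supp: "!!x. x \<notin> \<Omega> ==> g x = 0"
  and s0: "!!x. ball x R \<inter> \<Omega> \<noteq> {} ==>
   (sint (ball x (4 * R)) \<sigma>) <= ennreal (unit_ball_vol (real DIM('a)) * (16 * L) ^ DIM('a) * s * R ^ DIM('a))"
  and loc: "!!x \<rho>. 0 < \<rho> ==> \<rho> <= R ==>
   (sint (ball x (4 * \<rho>)) \<sigma>) <= ennreal (unit_ball_vol (real DIM('a)) * (16 * L) ^ DIM('a) * s * \<rho> ^ DIM('a)) ==>
   (\<Sum>j\<le>K. ennreal (2 ^ j * s) * sint (ball x \<rho> \<inter> maxlevel \<sigma> (2 ^ j * s)) g)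
    <= ennreal (C * s) * sint (ball x (L * \<rho>)) g + ennreal (CK * s) * sint (ball x (L * \<rho>)) F"
 shows "(\<Sum>j\<le>K. ennreal (2 ^ j * s) * sint (maxlevel \<sigma> (2 ^ j * s)) g)
  <= ennreal ((8 * L) ^ DIM('a)) * (ennreal (C * s) * sint (maxlevel \<sigma> s) g + ennreal (CK * s) * sint (maxlevel \<sigma> s) F)"
proof -
 let ?d = "DIM('a)"
 define v where "v = unit_ball_vol (real ?d)"
 have v: "0 < v" by (simp add: v_def)
 let ?V = "maxlevel \<sigma> s"
 let ?W = "%j. maxlevel \<sigma> (2 ^ j * s)"
 have WV: "?W j \<subseteq> ?V" for j
 proof -
  have "1 * s <= 2 ^ j * s" using s by (intro mult_right_mono one_le_power) auto
  then show ?thesis using maxlevel_mono by auto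
 qed
 \<comment> \<open>The cap is chosen as \<open>8 * L * R\<close> so that the scale itself stops at
   R. A nearby point outside the level set lies within \<open>16 * L * \<rho> x\<close>, which
   explains the constant in the hypothesis on averages.\<close>
 obtain \<rho> where ws: "whitney_scale ?V (8 * L * R) (8 * L) \<rho>"
  using whitney_scale_exists[OF open_maxlevel[of \<sigma> s], of "8 * L * R" "8 * L"] R L by auto
 note \<rho> = whitney_scaleD[OF ws]
 define P where "P y = (\<Sum>j\<le>K. ennreal (2 ^ j * s) * (g y * indicator (?W j) y))" for y
 define Q where "Q y = ennreal (C * s) * g y + ennreal (CK * s) * F y" for y
 have [measurable]: "borel_fun P" "borel_fun Q" unfolding P_def Q_def by measurable
 have Pint: "sint S P = (\<Sum>j\<le>K. ennreal (2 ^ j * s) * sint (S \<inter> ?W j) g)"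
  if [measurable]: "S \<in> sets borel" for S
 proof -
  have "sint S P = nint (%y. (\<Sum>j\<le>K. ennreal (2 ^ j * s) * (g y * indicator (S \<inter> ?W j) y)))"
   unfolding P_def sum_distrib_right by (intro nn_integral_cong sum.cong) (auto simp: indicator_def)
  also have "... = (\<Sum>j\<le>K. ennreal (2 ^ j * s) * sint (S \<inter> ?W j) g)" by (simp add: nn_integral_sum nn_integral_cmult)
  finally show ?thesis .
 qed
 have Qint: "sint S Q = ennreal (C * s) * sint S g + ennreal (CK * s) * sint S F"
  if [measurable]: "S \<in> sets borel" for S
 proof -
  have "sint S Q = nint (%y. ennreal (C * s) * (g y * indicator S y) + ennreal (CK * s) * (F y * indicator S y))"
   unfolding Q_def by (intro nn_integral_cong) (simp add: distrib_right mult.assoc)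
  then show ?thesis by (simp add: nn_integral_add nn_integral_cmult)
 qed
 have wh: "(sint {y. 0 < \<rho> y} P) <= ennreal ((8 * L) ^ ?d) * sint {y. 0 < \<rho> y} Q"
 proof (rule whitney_average)
  fix x assume px: "0 < \<rho> x"
  have \<rho>R: "\<rho> x <= R" using \<rho>(4)[of x] L by simp
  show "sint (ball x (\<rho> x)) P <= sint (ball x (L * \<rho> x)) Q"
  proof (cases "ball x (\<rho> x) \<inter> \<Omega> = {}")
   case True
   have "P y * indicator (ball x (\<rho> x)) y = 0" for y
   proof (cases "y \<in> \<Omega>")
    case False
    then show ?thesis using supp[of y] by (simp add: P_def)
   next
    case True
    then have "y \<notin> ball x (\<rho> x)" using \<open>ball x (\<rho> x) \<inter> \<Omega> = {}\<close> by blast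
    then show ?thesis by simp
   qed
   then have "(%y. P y * indicator (ball x (\<rho> x)) y) = (%_. 0)" by auto
   then show ?thesis by simp
  next
   case False
   have "x \<in> ?V" using px \<rho>(3) by blast
   then consider "\<rho> x = 8 * L * R / (8 * L)" | y where "y \<notin> ?V" "dist x y < 2 * (8 * L) * \<rho> x" using \<rho>(6) by blast
   then have "(sint (ball x (4 * \<rho> x)) \<sigma>) <= ennreal (unit_ball_vol (real ?d) * (16 * L) ^ ?d * s * \<rho> x ^ ?d)"
   proof cases
    case 1
    then have "\<rho> x = R" using L by simp
    then show ?thesis using s0[of x] False by simp
   next
    case 2
    have "4 * \<rho> x <= 16 * L * \<rho> x" using L px by (intro mult_right_mono) auto
    then have "(sint (ball x (4 * \<rho> x)) \<sigma>) <= (sint (ball x (16 * L * \<rho> x)) \<sigma>)" by (intro nn_integral_mono) (auto simp: indicator_def)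
    also have "... <= ennreal s * vol (ball x (16 * L * \<rho> x))" using 2 by (intro not_maxlevelD[of y]) auto
    also have "... = ennreal (unit_ball_vol (real ?d) * (16 * L) ^ ?d * s * \<rho> x ^ ?d)"
     using px s v L by (simp add: emeasure_ball ennreal_mult[symmetric] power_mult_distrib mult_ac)
    finally show ?thesis .
   qed
   from loc[OF px \<rho>R this] show ?thesis by (simp add: Pint Qint)
  qed
 qed (use \<rho> L in auto)
 note wh = wh[unfolded \<rho>(3)]
 have "?V \<inter> ?W j = ?W j" for j using WV by blast
 then show ?thesis using wh by (simp add: Pint Qint)
qed

section \<open>Summation over levels\<close>

text \<open>Summing the recursion over k counts every index from K on K times on the left but only
  once, with factor C, on the right; \<open>2 * C <= K\<close> lets the right side be absorbed. The
  indices below K are bounded by the recursion at 0. Working with finite n needs no prior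
  summability.\<close>

lemma sum_recursive_bound:
 fixes a b :: "nat => real"
 assumes a: "!!i. 0 <= a i" and b: "!!i. 0 <= b i" and C: "0 <= C" and K: "1 <= K" "2 * C <= real K"
  and rec: "!!k. (\<Sum>j\<le>K. a (k + j)) <= C * a k + b k"
 shows "(\<Sum>i<n. a i) <= 2 * C * a 0 + 4 * (\<Sum>i<n. b i)"
proof (cases "n = 0")
 case True
 then show ?thesis using C a by simp
next
 case n0: False
 let ?B = "\<Sum>i<n. b i"
 have B: "0 <= ?B" "b 0 <= ?B"
 proof -
  show "0 <= ?B" using b by (simp add: sum_nonneg)
  have "b 0 = sum b {0}" by simp
  also have "... <= ?B" using n0 b by (intro sum_mono2) auto
  finally show "b 0 <= ?B" .
 qed
 have first: "(\<Sum>j\<le>K. a j) <= C * a 0 + b 0" using rec[of 0] by simp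
 show ?thesis
 proof (cases "n <= K")
  case True
  have "(\<Sum>i<n. a i) <= (\<Sum>j\<le>K. a j)" using True a by (intro sum_mono2) auto
  then show ?thesis using first B C a[of 0] mult_nonneg_nonneg[OF C a[of 0]] by linarith
 next
  case False
  define H where "H = (\<Sum>i<K. a i)"
  define S where "S = (\<Sum>i\<in>{K..<n}. a i)"
  have HS: "(\<Sum>i<n. a i) = H + S" using sum.atLeastLessThan_concat[of 0 K n a] False by (simp add: lessThan_atLeast0 H_def S_def)
  have H: "H <= C * a 0 + ?B"
  proof -
   have "H <= (\<Sum>j\<le>K. a j)" unfolding H_def using a by (intro sum_mono2) auto
   then show ?thesis using first B by linarith
  qed
  have S0: "0 <= S" "0 <= H" unfolding S_def H_def using a by (auto intro: sum_nonneg)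
  \<comment> \<open>For each shift j between 1 and K, the indices \<open>k + j\<close> with
    \<open>k < n\<close> cover the whole range from K to n.\<close>
  have "real K * S = (\<Sum>j\<in>{1..K}. S)" by simp
  also have "... <= (\<Sum>j\<in>{1..K}. \<Sum>k<n. a (k + j))"
  proof (intro sum_mono)
   fix j assume j: "j \<in> {1..K}"
   have "S = sum a ((%k. k + j) ` {K - j..<n - j})" unfolding S_def using j False by (subst image_add_atLeastLessThan') auto
   also have "... = (\<Sum>k\<in>{K - j..<n - j}. a (k + j))" by (subst sum.reindex) auto
   also have "... <= (\<Sum>k<n. a (k + j))" using a by (intro sum_mono2) auto
   finally show "S <= (\<Sum>k<n. a (k + j))" .
  qed
  also have "... <= (\<Sum>j\<le>K. \<Sum>k<n. a (k + j))" using a by (intro sum_mono2) (auto intro: sum_nonneg)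
  also have "... = (\<Sum>k<n. \<Sum>j\<le>K. a (k + j))" by (rule sum.swap)
  also have "... <= (\<Sum>k<n. C * a k + b k)" by (intro sum_mono rec)
  also have "... = C * (H + S) + ?B" by (simp add: sum.distrib sum_distrib_left[symmetric] HS)
  finally have 1: "real K * S <= C * (H + S) + ?B" .
  have "C * (H + S) <= real K / 2 * (H + S)" using K S0 by (intro mult_right_mono) auto
  with 1 have "real K * S <= real K * H + 2 * ?B" by (simp add: algebra_simps)
  also have "... <= real K * (H + 2 * ?B)"
  proof -
   have "1 * (2 * ?B) <= real K * (2 * ?B)" using B K by (intro mult_right_mono) auto
   then show ?thesis by (simp add: distrib_left)
  qed
  finally have "S <= H + 2 * ?B" using K by simp
  then show ?thesis using H HS C by (simp add: algebra_simps)
 qed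
qed

text \<open>Layer-cake comparison in both directions. Lebesgue differentiation bounds \<sigma> by
  \<open>cd * s0\<close> plus a dyadic sum over level sets, which turns the weighted energy of g
  into the sum of the level energies; A1 bounds the dyadic sum by a multiple of \<sigma>, which
  turns the level sums of the data back into a weighted integral. The recursion between levels
  connects the two.\<close>

lemma weighted_energy_sum:
 fixes \<sigma> :: "'a::euclidean_space => real" and g F :: "'a => ennreal"
 assumes A1: "A1 c (%x. ennreal (\<sigma> x))" and c: "0 <= c" and \<sigma>: "!!x. 0 <= \<sigma> x" "!!x. \<sigma> x <= N"
  and [measurable]: "borel_fun \<sigma>" "borel_fun g" "borel_fun F"
  and fin: "nint g < top" "nint F < top"
  and s0: "0 < s0" and C: "0 <= C" "0 <= CK" and K: "1 <= K" "2 * C <= real K"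
  and step: "!!s. s0 <= s ==>
   (\<Sum>j\<le>K. ennreal (2 ^ j * s) * sint (maxlevel (%x. ennreal (\<sigma> x)) (2 ^ j * s)) g)
    <= ennreal (C * s) * sint (maxlevel (%x. ennreal (\<sigma> x)) s) g + ennreal (CK * s) * sint (maxlevel (%x. ennreal (\<sigma> x)) s) F"
 defines "cd \<equiv> unit_ball_vol (real DIM('a)) * (DIM('a) + 1) ^ DIM('a)"
 shows "nint (%x. g x * ennreal (\<sigma> x)) <= ennreal (cd * s0 * (1 + 4 * C)) * nint g
   + ennreal (32 * cd * CK * c) * nint (%x. F x * ennreal (\<sigma> x))"
proof -
 let ?\<sigma> = "%x. ennreal (\<sigma> x)"
 let ?V = "%k. maxlevel ?\<sigma> (2 ^ k * s0)"
 have cd: "0 <= cd" by (simp add: cd_def)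
 define \<alpha> where "\<alpha> k = ennreal (2 ^ k * s0) * sint (?V k) g" for k
 define \<beta> where "\<beta> k = ennreal (2 ^ k * s0) * sint (?V k) F" for k
 have le: "sint (?V k) f <= nint f" for f k by (intro nn_integral_mono) (auto simp: indicator_def)
 have \<alpha>fin: "\<alpha> k < top" for k unfolding \<alpha>_def using le_less_trans[OF le fin(1), of k] by (simp add: ennreal_mult_less_top)
 have \<beta>fin: "\<beta> k < top" for k unfolding \<beta>_def using le_less_trans[OF le fin(2), of k] by (simp add: ennreal_mult_less_top)
 define a where "a k = enn2real (\<alpha> k)" for k
 define b where "b k = enn2real (\<beta> k)" for k
 have a: "\<alpha> k = ennreal (a k)" "0 <= a k" for k using \<alpha>fin[of k] by (auto simp: a_def)
 have b: "\<beta> k = ennreal (b k)" "0 <= b k" for k using \<beta>fin[of k] by (auto simp: b_def)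
 have rec: "(\<Sum>j\<le>K. a (k + j)) <= C * a k + CK * b k" for k
 proof -
  have "1 * s0 <= 2 ^ k * s0" using s0 by (intro mult_right_mono one_le_power) auto
  then have ks: "s0 <= 2 ^ k * s0" by simp
  have "(\<Sum>j\<le>K. \<alpha> (k + j)) <= ennreal C * \<alpha> k + ennreal CK * \<beta> k"
  proof -
   have e: "2 ^ j * (2 ^ k * s0) = 2 ^ (k + j) * s0" for j by (simp add: power_add)
   have "ennreal (C * (2 ^ k * s0)) = ennreal C * ennreal (2 ^ k * s0)"
    "ennreal (CK * (2 ^ k * s0)) = ennreal CK * ennreal (2 ^ k * s0)" using C s0 by (auto intro: ennreal_mult)
   then show ?thesis using step[OF ks] unfolding e \<alpha>_def \<beta>_def by (simp add: mult.assoc)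
  qed
  then have "ennreal (\<Sum>j\<le>K. a (k + j)) <= ennreal (C * a k + CK * b k)" using C a(2) b(2) by (simp add: a(1) b(1) sum_ennreal ennreal_mult)
  then show ?thesis using C a(2)[of k] b(2)[of k] by (subst (asm) ennreal_le_iff) auto
 qed
 have AEm: "AE z in lborel. \<forall>s. z \<in> maxlevel ?\<sigma> s --> ennreal s <= ennreal c * ?\<sigma> z" by (rule AE_A1_maxlevel[OF A1])
 have sumb: "ennreal (\<Sum>k<n. b k) <= ennreal (4 * c) * nint (%x. F x * ?\<sigma> x)" for n
 proof -
  have "ennreal (\<Sum>k<n. b k) = (\<Sum>k<n. \<beta> k)" using b by (simp add: sum_ennreal)
  also have "... = nint (%x. (\<Sum>k<n. ennreal (2 ^ k * s0) * (F x * indicator (?V k) x)))" unfolding \<beta>_def by (simp add: nn_integral_sum nn_integral_cmult)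
  also have "... <= nint (%x. ennreal (4 * c) * (F x * ?\<sigma> x))"
  proof (rule nn_integral_mono_AE)
   show "AE x in lborel. (\<Sum>k<n. ennreal (2 ^ k * s0) * (F x * indicator (?V k) x)) <= ennreal (4 * c) * (F x * ?\<sigma> x)" using AEm
   proof eventually_elim
    fix x assume *: "\<forall>s. x \<in> maxlevel ?\<sigma> s --> ennreal s <= ennreal c * ?\<sigma> x"
    have "(\<Sum>k<n. ennreal (2 ^ k * s0) * (F x * indicator (?V k) x)) = F x * (\<Sum>k<n. ennreal (2 ^ k * s0) * indicator (?V k) x)"
     unfolding sum_distrib_left by (intro sum.cong refl) (simp only: mult_ac)
    also have "(\<Sum>k<n. ennreal (2 ^ k * s0) * indicator (?V k) x) <= ennreal (4 * (c * \<sigma> x))"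
    proof -
     \<comment> \<open>The A1 bound is not strict, while \<open>dyadic_sum_below\<close> counts
       levels strictly below a number. Doubling the number to \<open>2 * (c * \<sigma> x)\<close>
       repairs this and yields the final factor 4.\<close>
     have "(\<Sum>k<n. ennreal (2 ^ k * s0) * indicator (?V k) x) <= (\<Sum>k<n. ennreal (2 ^ k * s0 * (if 2 ^ k * s0 < 2 * (c * \<sigma> x) then 1 else 0)))"
     proof (intro sum_mono)
      fix k
      show "ennreal (2 ^ k * s0) * indicator (?V k) x <= ennreal (2 ^ k * s0 * (if 2 ^ k * s0 < 2 * (c * \<sigma> x) then 1 else 0))"
      proof (cases "x \<in> ?V k")
       case True
       then have "ennreal (2 ^ k * s0) <= ennreal (c * \<sigma> x)" using * c \<sigma>(1)[of x] by (simp add: ennreal_mult)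
       then have "2 ^ k * s0 <= c * \<sigma> x" using c \<sigma>(1)[of x] by (subst (asm) ennreal_le_iff) auto
       moreover have "0 < 2 ^ k * s0" using s0 by simp
       ultimately have "2 ^ k * s0 < 2 * (c * \<sigma> x)" by linarith
       then show ?thesis using True by simp
      qed simp
     qed
     also have "... = ennreal (\<Sum>k<n. 2 ^ k * s0 * (if 2 ^ k * s0 < 2 * (c * \<sigma> x) then 1 else 0))" using s0 by (intro sum_ennreal) auto
     also have "... <= ennreal (2 * (2 * (c * \<sigma> x)))" using c \<sigma>(1)[of x] by (intro ennreal_leI dyadic_sum_below s0) auto
     finally show ?thesis by simp
    qed
    also have "F x * ennreal (4 * (c * \<sigma> x)) = ennreal (4 * c) * (F x * ?\<sigma> x)"
     using c \<sigma>(1)[of x] by (subst mult.assoc[symmetric], subst ennreal_mult) (auto simp: mult_ac)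
    finally show "(\<Sum>k<n. ennreal (2 ^ k * s0) * (F x * indicator (?V k) x)) <= ennreal (4 * c) * (F x * ?\<sigma> x)" by (simp add: mult_left_mono)
   qed
  qed
  also have "... = ennreal (4 * c) * nint (%x. F x * ?\<sigma> x)" by (rule nn_integral_cmult) measurable
  finally show ?thesis .
 qed
 let ?G = "nint g" and ?F = "nint (%x. F x * ?\<sigma> x)"
 have suma: "(\<Sum>k<n. \<alpha> k) <= ennreal (2 * C * s0) * ?G + ennreal (16 * CK * c) * ?F" for n
 proof -
  have "(\<Sum>i<n. a i) <= 2 * C * a 0 + 4 * (\<Sum>i<n. CK * b i)" using a b C rec by (intro sum_recursive_bound[OF _ _ C(1) K]) auto
  then have "ennreal (\<Sum>k<n. a k) <= ennreal (2 * C * a 0 + (4 * CK) * (\<Sum>i<n. b i))" by (intro ennreal_leI) (simp add: sum_distrib_left mult.assoc)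
  also have "... = ennreal (2 * C) * \<alpha> 0 + ennreal (4 * CK) * ennreal (\<Sum>i<n. b i)"
  proof -
   have "0 <= (\<Sum>i<n. b i)" using b by (simp add: sum_nonneg)
   then show ?thesis using C a(2)[of 0] by (simp add: a(1) ennreal_mult)
  qed
  also have "... <= ennreal (2 * C) * (ennreal s0 * ?G) + ennreal (4 * CK) * (ennreal (4 * c) * ?F)"
  proof (intro add_mono mult_left_mono sumb)
   show "\<alpha> 0 <= ennreal s0 * ?G" unfolding \<alpha>_def using le[of g 0] by (simp add: mult_left_mono)
  qed auto
  also have "... = ennreal (2 * C * s0) * ?G + ennreal (16 * CK * c) * ?F"
  proof -
   have "ennreal (2 * C * s0) = ennreal (2 * C) * ennreal s0" using C s0 by (intro ennreal_mult) auto
   moreover have "ennreal (16 * CK * c) = ennreal (4 * CK) * ennreal (4 * c)" using C c by (subst ennreal_mult[symmetric]) auto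
   ultimately show ?thesis by (simp add: mult.assoc)
  qed
  also have "ennreal (\<Sum>k<n. a k) = (\<Sum>k<n. \<alpha> k)" using a by (simp add: sum_ennreal)
  finally show ?thesis .
 qed
 have total: "(\<Sum>k. \<alpha> k) <= ennreal (2 * C * s0) * ?G + ennreal (16 * CK * c) * ?F" using suma by (intro suminf_le_const) (auto intro: summableI)
 have dom: "AE x in lborel. ?\<sigma> x <= ennreal (cd * s0) + (\<Sum>k. ennreal (2 * cd * (2 ^ k * s0)) * indicator (?V k) x)"
 proof -
  have "AE x in lborel. \<forall>s\<ge>0. x \<notin> maxlevel ?\<sigma> s --> \<sigma> x <= unit_ball_vol (real DIM('a)) * (DIM('a) + 1) ^ DIM('a) * s"
  proof (rule AE_le_of_not_maxlevel)
   fix l u :: 'a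
   have "(sint (cbox l u) ?\<sigma>) <= nint (%y. ennreal N * indicator (cbox l u) y)" using \<sigma>(2) by (intro nn_integral_mono mult_right_mono ennreal_leI) auto
   also have "... = ennreal N * vol (cbox l u)" by (rule nn_integral_cmult_indicator) auto
   also have "... < top" using emeasure_lborel_cbox_finite[of l u] by (simp add: ennreal_mult_less_top)
   finally show "(sint (cbox l u) ?\<sigma>) < top" .
  qed (use \<sigma> in auto)
  with AEm show ?thesis
  proof eventually_elim
   fix x assume 1: "\<forall>s. x \<in> maxlevel ?\<sigma> s --> ennreal s <= ennreal c * ?\<sigma> x"
    and "\<forall>s\<ge>0. x \<notin> maxlevel ?\<sigma> s --> \<sigma> x <= unit_ball_vol (real DIM('a)) * (DIM('a) + 1) ^ DIM('a) * s"
   then have 2: "x \<notin> maxlevel ?\<sigma> s ==> 0 <= s ==> \<sigma> x <= cd * s" for s by (simp add: cd_def)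
   let ?S = "\<Sum>k. ennreal (2 * cd * (2 ^ k * s0)) * indicator (?V k) x"
   show "?\<sigma> x <= ennreal (cd * s0) + ?S"
   proof (cases "x \<in> ?V 0")
    case False
    then have "\<sigma> x <= cd * s0" using 2[of s0] s0 by simp
    then have "?\<sigma> x <= ennreal (cd * s0)" by (rule ennreal_leI)
    then show ?thesis by (simp add: add_increasing2)
   next
    case True
    obtain n :: nat where "c * \<sigma> x / s0 < real n" using reals_Archimedean2 by blast
    also have "real n <= 2 ^ n" using of_nat_less_two_power[of n] by (simp add: less_imp_le)
    finally have "c * \<sigma> x < 2 ^ n * s0" using s0 by (simp add: field_simps)
    then have "~ ennreal (2 ^ n * s0) <= ennreal c * ?\<sigma> x" using c \<sigma>(1)[of x] s0 by (simp add: ennreal_mult[symmetric] ennreal_le_iff not_le)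
    then have n: "x \<notin> ?V n" using 1 by blast
    \<comment> \<open>A1 forces x out of the level sets at height about
      \<open>c * \<sigma> x\<close>. At the first level that x leaves, \<open>\<sigma> x\<close> is
      at most cd times its height, which is twice the height of the preceding level; hence the
      factor \<open>2 * cd\<close>.\<close>
    define m where "m = (LEAST n. x \<notin> ?V n)"
    have m: "x \<notin> ?V m" unfolding m_def using n by (rule LeastI)
    then have "m \<noteq> 0" using True by (metis)
    then obtain k where k: "m = Suc k" by (cases m) auto
    then have xk: "x \<in> ?V k" using not_less_Least[of k "%n. x \<notin> ?V n"] m_def by auto
    have "\<sigma> x <= cd * (2 ^ m * s0)" using 2[OF m] s0 by simp
    define f where "f k = ennreal (2 * cd * (2 ^ k * s0)) * indicator (?V k) x" for k
    have "?\<sigma> x <= f k" using xk k \<open>\<sigma> x <= cd * (2 ^ m * s0)\<close> unfolding f_def by (simp add: ennreal_leI mult_ac)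
    also have "f k = sum f {k}" by simp
    also have "... <= suminf f" by (rule sum_le_suminf) (auto intro: summableI)
    also have "suminf f = ?S" by (rule arg_cong[where f=suminf]) (rule ext, rule f_def)
    finally show ?thesis by (simp add: add_increasing)
   qed
  qed
 qed
 have "nint (%x. g x * ?\<sigma> x) <= nint (%x. ennreal (cd * s0) * g x + (\<Sum>k. ennreal (2 * cd) * (ennreal (2 ^ k * s0) * (g x * indicator (?V k) x))))"
 proof (rule nn_integral_mono_AE)
  show "AE x in lborel. g x * ?\<sigma> x <= ennreal (cd * s0) * g x + (\<Sum>k. ennreal (2 * cd) * (ennreal (2 ^ k * s0) * (g x * indicator (?V k) x)))" using dom
  proof eventually_elim
   fix x assume "?\<sigma> x <= ennreal (cd * s0) + (\<Sum>k. ennreal (2 * cd * (2 ^ k * s0)) * indicator (?V k) x)"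
   then have "g x * ?\<sigma> x <= g x * (ennreal (cd * s0) + (\<Sum>k. ennreal (2 * cd * (2 ^ k * s0)) * indicator (?V k) x))" by (rule mult_left_mono) simp
   also have "... = ennreal (cd * s0) * g x + (\<Sum>k. g x * (ennreal (2 * cd * (2 ^ k * s0)) * indicator (?V k) x))" by (simp add: distrib_left mult.commute)
   also have "(\<Sum>k. g x * (ennreal (2 * cd * (2 ^ k * s0)) * indicator (?V k) x)) = (\<Sum>k. ennreal (2 * cd) * (ennreal (2 ^ k * s0) * (g x * indicator (?V k) x)))"
   proof (intro suminf_cong)
    fix k
    have "ennreal (2 * cd * (2 ^ k * s0)) = ennreal (2 * cd) * ennreal (2 ^ k * s0)" using cd s0 by (intro ennreal_mult) auto
    then show "g x * (ennreal (2 * cd * (2 ^ k * s0)) * indicator (?V k) x) = ennreal (2 * cd) * (ennreal (2 ^ k * s0) * (g x * indicator (?V k) x))"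
     by (simp only: mult_ac)
   qed
   finally show "g x * ?\<sigma> x <= ennreal (cd * s0) * g x + (\<Sum>k. ennreal (2 * cd) * (ennreal (2 ^ k * s0) * (g x * indicator (?V k) x)))" .
  qed
 qed
 also have "... = ennreal (cd * s0) * ?G + ennreal (2 * cd) * (\<Sum>k. \<alpha> k)"
  unfolding \<alpha>_def by (subst nn_integral_add, measurable) (simp add: nn_integral_cmult nn_integral_suminf)
 also have "... <= ennreal (cd * s0) * ?G + ennreal (2 * cd) * (ennreal (2 * C * s0) * ?G + ennreal (8 * CK * c) * ?F + ennreal (8 * CK * c) * ?F)"
 proof -
  have "ennreal (16 * CK * c) = ennreal (8 * CK * c) + ennreal (8 * CK * c)" using C c by (simp flip: ennreal_plus)
  then show ?thesis using total by (intro add_left_mono mult_left_mono) (auto simp: distrib_right add_ac)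
 qed
 also have "... = ennreal (cd * s0 * (1 + 4 * C)) * ?G + ennreal (32 * cd * CK * c) * ?F"
 proof -
  have e1: "ennreal (cd * s0 * (1 + 4 * C)) = ennreal (cd * s0) + ennreal (2 * cd) * ennreal (2 * C * s0)"
   using cd C s0 by (simp add: ennreal_mult[symmetric] algebra_simps flip: ennreal_plus)
  have e2: "ennreal (32 * cd * CK * c) = ennreal (2 * cd) * (ennreal (8 * CK * c) + ennreal (8 * CK * c))"
   using cd C c by (simp add: ennreal_mult[symmetric] algebra_simps flip: ennreal_plus)
  show ?thesis unfolding e1 e2 by (simp only: distrib_left distrib_right mult.assoc add.assoc)
 qed
 finally show ?thesis by simp
qed

section \<open>Square integrable vector fields\<close>

definition L2 :: "('a::euclidean_space => 'b::euclidean_space) => bool" where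
 "L2 F \<longleftrightarrow> F \<in> borel_measurable borel & nint (%x. ennreal ((norm (F x))^2)) < top"

definition ip :: "('a::euclidean_space => 'b::euclidean_space) => ('a => 'b) => real" where
 "ip F H = (LINT x|lborel. F x \<bullet> H x)"

definition n2 :: "('a::euclidean_space => 'b::euclidean_space) => real" where
 "n2 F = sqrt (ip F F)"

lemma L2_meas[measurable_dest]: "L2 F ==> F \<in> borel_measurable borel" by (simp add: L2_def)

lemma norm_add_square_le: "(norm (a + b))^2 <= 2 * (norm a)^2 + 2 * (norm (b::'b::real_normed_vector))^2"
proof -
 have "(norm (a + b))^2 <= (norm a + norm b)^2" by (intro power_mono norm_triangle_ineq) auto
 also have "... <= 2 * (norm a)^2 + 2 * (norm b)^2" using zero_le_power2[of "norm a - norm b"] by (simp add: power2_eq_square algebra_simps)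
 finally show ?thesis .
qed

lemma L2_dominated:
 assumes "borel_fun F" "!!x. norm (F x) <= C * norm (H x)" "L2 H"
 shows "L2 F"
proof -
 have [measurable]: "borel_fun H" using assms by (simp add: L2_def)
 have "nint (%x. ennreal ((norm (F x))^2)) <= nint (%x. ennreal (C^2) * ennreal ((norm (H x))^2))"
 proof (intro nn_integral_mono)
  fix x have "(norm (F x))^2 <= (C * norm (H x))^2" using assms(2) by (intro power_mono) auto
  then show "ennreal ((norm (F x))^2) <= ennreal (C^2) * ennreal ((norm (H x))^2)" by (simp add: ennreal_mult[symmetric] power_mult_distrib ennreal_leI)
 qed
 also have "... = ennreal (C^2) * nint (%x. ennreal ((norm (H x))^2))" by (rule nn_integral_cmult) measurable
 also have "... < top" using assms(3) by (simp add: L2_def ennreal_mult_less_top)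
 finally show ?thesis using assms by (simp add: L2_def)
qed

lemma L2_add: assumes "L2 F" "L2 H" shows "L2 (%x. F x + H x)"
proof -
 have [measurable]: "borel_fun F" "borel_fun H" using assms by (auto simp: L2_def)
 have "nint (%x. ennreal ((norm (F x + H x))^2)) <= nint (%x. 2 * ennreal ((norm (F x))^2) + 2 * ennreal ((norm (H x))^2))"
 proof (intro nn_integral_mono)
  fix x show "ennreal ((norm (F x + H x))^2) <= 2 * ennreal ((norm (F x))^2) + 2 * ennreal ((norm (H x))^2)"
   using norm_add_square_le[of "F x" "H x"] by (simp add: ennreal_leI flip: ennreal_plus ennreal_mult ennreal_numeral)
 qed
 also have "... = 2 * nint (%x. ennreal ((norm (F x))^2)) + 2 * nint (%x. ennreal ((norm (H x))^2))" by (simp add: nn_integral_add nn_integral_cmult)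
 also have "... < top" using assms by (simp add: L2_def ennreal_mult_less_top)
 finally show ?thesis by (simp add: L2_def)
qed

lemma L2_scaleR: assumes "L2 F" shows "L2 (%x. c *\<^sub>R F x)"
 by (rule L2_dominated[OF _ _ assms, of _ "\<bar>c\<bar>"]) (use assms in \<open>auto simp: L2_def\<close>)

lemma L2_diff: assumes "L2 F" "L2 H" shows "L2 (%x. F x - H x)" using L2_add[OF assms(1) L2_scaleR[OF assms(2), of "-1"]] by simp

lemma L2_zero: "L2 (%x. 0)" by (simp add: L2_def)

lemma L2_sq_integrable: assumes "L2 F" shows "integrable lborel (%x. (norm (F x))^2)" using assms by (intro integrableI_nonneg) (auto simp: L2_def)

lemma L2_inner_integrable:
 assumes "L2 F" "L2 H" shows "integrable lborel (%x. F x \<bullet> H x)"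
proof (rule Bochner_Integration.integrable_bound)
 show "integrable lborel (%x. (norm (F x))^2 + (norm (H x))^2)" using assms by (intro Bochner_Integration.integrable_add L2_sq_integrable)
 show "(%x. F x \<bullet> H x) \<in> borel_measurable lborel" using assms by (auto simp: L2_def)
 show "AE x in lborel. norm (F x \<bullet> H x) <= norm ((norm (F x))^2 + (norm (H x))^2)"
 proof (intro AE_I2)
  fix x
  have "\<bar>F x \<bullet> H x\<bar> <= norm (F x) * norm (H x)" by (rule Cauchy_Schwarz_ineq2)
  also have "... <= (norm (F x))^2 + (norm (H x))^2"
  proof -
   have "2 * (norm (F x) * norm (H x)) <= (norm (F x))^2 + (norm (H x))^2"
    using zero_le_power2[of "norm (F x) - norm (H x)"] by (simp add: power2_eq_square algebra_simps)
   moreover have "0 <= norm (F x) * norm (H x)" by simp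
   ultimately show ?thesis by linarith
  qed
  finally show "norm (F x \<bullet> H x) <= norm ((norm (F x))^2 + (norm (H x))^2)" by simp
 qed
qed

lemma ip_add: assumes "L2 F" "L2 G" "L2 H"
 shows "ip (%x. F x + G x) H = ip F H + ip G H" "ip H (%x. F x + G x) = ip H F + ip H G"
 using assms by (auto simp: ip_def inner_add_left inner_add_right Bochner_Integration.integral_add L2_inner_integrable)

lemma ip_diff: assumes "L2 F" "L2 G" "L2 H"
 shows "ip (%x. F x - G x) H = ip F H - ip G H" "ip H (%x. F x - G x) = ip H F - ip H G"
 using assms by (auto simp: ip_def inner_diff_left inner_diff_right Bochner_Integration.integral_diff L2_inner_integrable)

lemma ip_scaleR: "ip (%x. c *\<^sub>R F x) H = c * ip F H" "ip H (%x. c *\<^sub>R F x) = c * ip H F" by (auto simp: ip_def)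

lemma ip_commute: "ip F H = ip H F" by (simp add: ip_def inner_commute)

lemma ip_self_nonneg: "0 <= ip F F" unfolding ip_def by (rule integral_nonneg_AE) auto

lemma n2_nonneg: "0 <= n2 F" by (simp add: n2_def ip_self_nonneg)

lemma n2_sq: "(n2 F)^2 = ip F F" by (simp add: n2_def ip_self_nonneg)

lemma nn_integral_n2: assumes "L2 F" shows "nint (%x. ennreal ((norm (F x))^2)) = ennreal ((n2 F)^2)"
 using nn_integral_eq_integral[OF L2_sq_integrable[OF assms]] by (simp add: n2_sq ip_def power2_norm_eq_inner)

lemma ip_CS: assumes "L2 F" "L2 H" shows "\<bar>ip F H\<bar> <= n2 F * n2 H"
proof -
 have "\<bar>ip F H\<bar> <= (LINT x|lborel. norm (F x \<bullet> H x))" unfolding ip_def using integral_norm_bound[of lborel "%x. F x \<bullet> H x"] by simp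
 also have "... <= (LINT x|lborel. norm (F x) * norm (H x))"
 proof (rule integral_mono)
  show "integrable lborel (%x. norm (F x \<bullet> H x))" using L2_inner_integrable[OF assms] by (rule integrable_norm)
  have "L2 (%x. norm (F x))" "L2 (%x. norm (H x))" using assms by (auto simp: L2_def)
  from L2_inner_integrable[OF this] show "integrable lborel (%x. norm (F x) * norm (H x))" by simp
 qed (auto simp: Cauchy_Schwarz_ineq2)
 finally have 1: "\<bar>ip F H\<bar> <= (LINT x|lborel. norm (F x) * norm (H x))" .
 have [measurable]: "borel_fun F" "borel_fun H" using assms by (auto simp: L2_def)
 define Z where "Z = (LINT x|lborel. norm (F x) * norm (H x))"
 have Z0: "0 <= Z" unfolding Z_def by (rule integral_nonneg_AE) auto
 have ZN: "nint (%x. ennreal (norm (F x)) * ennreal (norm (H x))) = ennreal Z"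
 proof -
  have "L2 (%x. norm (F x))" "L2 (%x. norm (H x))" using assms by (auto simp: L2_def)
  from L2_inner_integrable[OF this] have "integrable lborel (%x. norm (F x) * norm (H x))" by simp
  from nn_integral_eq_integral[OF this] show ?thesis by (simp add: ennreal_mult Z_def)
 qed
 have "(ennreal Z)^2 <= nint (%x. (ennreal (norm (F x)))^2) * nint (%x. (ennreal (norm (H x)))^2)"
  unfolding ZN[symmetric] by (rule Cauchy_Schwarz_nn_integral) measurable
 also have "... = ennreal ((n2 F * n2 H)^2)" using assms by (simp add: ennreal_power nn_integral_n2 power_mult_distrib ennreal_mult)
 finally have "Z^2 <= (n2 F * n2 H)^2" using Z0 by (simp add: ennreal_power)
 then have "Z <= n2 F * n2 H" by (rule power2_le_imp_le) (simp add: n2_nonneg)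
 with 1 show ?thesis unfolding Z_def by linarith
qed

lemma n2_add_le: assumes "L2 F" "L2 H" shows "n2 (%x. F x + H x) <= n2 F + n2 H"
proof (rule power2_le_imp_le)
 have "(n2 (%x. F x + H x))^2 = ip F F + 2 * ip F H + ip H H" using assms by (simp add: n2_sq ip_add L2_add ip_commute[of H F])
 also have "... <= (n2 F)^2 + 2 * (n2 F * n2 H) + (n2 H)^2" using ip_CS[OF assms] by (simp add: n2_sq)
 finally show "(n2 (%x. F x + H x))^2 <= (n2 F + n2 H)^2" by (simp add: power2_eq_square algebra_simps)
qed (simp add: n2_nonneg)

lemma n2_scaleR: "n2 (%x. c *\<^sub>R F x) = \<bar>c\<bar> * n2 F"
proof -
 have "ip (%x. c *\<^sub>R F x) (%x. c *\<^sub>R F x) = c^2 * ip F F" by (simp add: ip_scaleR power2_eq_square)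
 then show ?thesis by (simp add: n2_def real_sqrt_mult)
qed

lemma n2_diff_commute: "n2 (%x. F x - H x) = n2 (%x. H x - F x)" using n2_scaleR[of "-1" "%x. H x - F x"] by simp

lemma n2_diff_triangle: assumes "L2 F" "L2 G" "L2 H"
 shows "n2 (%x. F x - H x) <= n2 (%x. F x - G x) + n2 (%x. G x - H x)" using n2_add_le[OF L2_diff[OF assms(1,2)] L2_diff[OF assms(2,3)]] by simp

lemma n2_mono: assumes "L2 F" "L2 H" "!!x. norm (F x) <= C * norm (H x)" "0 <= C"
 shows "n2 F <= C * n2 H"
proof (rule power2_le_imp_le)
 have "(n2 F)^2 <= ip (%x. C *\<^sub>R H x) (%x. C *\<^sub>R H x)" unfolding n2_sq ip_def
 proof (rule integral_mono[OF L2_inner_integrable[OF assms(1,1)] L2_inner_integrable[OF L2_scaleR[OF assms(2)] L2_scaleR[OF assms(2)]]])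
  fix x have "(norm (F x))^2 <= (C * norm (H x))^2" using assms(3) by (intro power_mono) auto
  then show "F x \<bullet> F x <= C *\<^sub>R H x \<bullet> C *\<^sub>R H x" by (simp add: power_mult_distrib power2_norm_eq_inner power2_eq_square[of C] mult.assoc)
 qed
 then show "(n2 F)^2 <= (C * n2 H)^2" by (simp add: ip_scaleR power_mult_distrib n2_sq power2_eq_square[of C] mult.assoc)
qed (simp add: assms n2_nonneg)

lemma ip_tendsto:
 assumes "!!k. L2 (F k)" "L2 G" "L2 H" "(%k. n2 (%x. F k x - G x)) ~~~> 0"
 shows "(%k. ip (F k) H) ~~~> ip G H"
proof (rule LIM_zero_cancel, rule Lim_null_comparison)
 show "\<forall>\<^sub>F k in sequentially. norm (ip (F k) H - ip G H) <= n2 (%x. F k x - G x) * n2 H"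
 proof (intro always_eventually allI)
  fix k
  have "ip (F k) H - ip G H = ip (%x. F k x - G x) H" using assms by (simp add: ip_diff)
  then show "norm (ip (F k) H - ip G H) <= n2 (%x. F k x - G x) * n2 H" using ip_CS[OF L2_diff[OF assms(1)[of k] assms(2)] assms(3)] by simp
 qed
 show "(%k. n2 (%x. F k x - G x) * n2 H) ~~~> 0" using tendsto_mult_left_zero[OF assms(4)] .
qed

text \<open>Only geometrically fast sequences are treated, which is all that minimisation and
  fixed-point iteration produce. The factor \<open>1 / q^n\<close> still leaves a convergent series
  of squared norms, so almost everywhere the increments decay like \<open>sqrt q ^ n\<close> and the
  sequence converges pointwise; Fatou identifies the limit in the mean.\<close>

lemma L2_complete:
 fixes F :: "nat => 'a::euclidean_space => 'b::euclidean_space"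
 assumes F: "!!n. L2 (F n)" and q: "0 < q" "q < 1" and C: "0 <= C"
  and fast: "!!n. n2 (%x. F (Suc n) x - F n x) <= C * q ^ n"
 shows "\<exists>G. L2 G & (%n. n2 (%x. F n x - G x)) ~~~> 0"
proof -
 have [measurable]: "borel_fun (F n)" for n using F by (simp add: L2_def)
 let ?D = "%n x. F (Suc n) x - F n x"
 have D: "L2 (?D n)" for n by (intro L2_diff F)
 have "nint (%x. (\<Sum>n. ennreal (1 / q ^ n) * ennreal ((norm (?D n x))^2))) = (\<Sum>n. ennreal (1 / q ^ n) * ennreal ((n2 (?D n))^2))"
  by (subst nn_integral_suminf) (auto simp: nn_integral_cmult nn_integral_n2[OF D])
 also have "... <= (\<Sum>n. ennreal (C^2 * q ^ n))"
 proof (intro suminf_le allI)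
  fix n
  have "(n2 (?D n))^2 <= (C * q ^ n)^2" using fast by (intro power_mono n2_nonneg) auto
  then have "1 / q ^ n * (n2 (?D n))^2 <= 1 / q ^ n * (C * q ^ n)^2" using q by (intro mult_left_mono) auto
  also have "... = C^2 * q ^ n" using q by (simp add: power2_eq_square)
  finally show "ennreal (1 / q ^ n) * ennreal ((n2 (?D n))^2) <= ennreal (C^2 * q ^ n)" using q by (simp add: ennreal_mult[symmetric] ennreal_leI)
 qed (auto intro: summableI)
 also have "... < top" using q C by (subst suminf_ennreal2) (auto intro!: summable_mult summable_geometric)
 finally have "(nint (%x. (\<Sum>n. ennreal (1 / q ^ n) * ennreal ((norm (?D n x))^2)))) \<noteq> \<infinity>" by simp
 then have "AE x in lborel. (\<Sum>n. ennreal (1 / q ^ n) * ennreal ((norm (?D n x))^2)) \<noteq> \<infinity>" by (intro nn_integral_PInf_AE) auto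
 then have conv: "AE x in lborel. convergent (%n. F n x)"
 proof eventually_elim
  fix x assume fin: "(\<Sum>n. ennreal (1 / q ^ n) * ennreal ((norm (?D n x))^2)) \<noteq> \<infinity>"
  then obtain T where T: "(\<Sum>n. ennreal (1 / q ^ n) * ennreal ((norm (?D n x))^2)) = ennreal T" "0 <= T"
   by (cases "\<Sum>n. ennreal (1 / q ^ n) * ennreal ((norm (?D n x))^2)" rule: ennreal_cases) auto
  have bound: "norm (?D n x) <= sqrt T * sqrt q ^ n" for n
  proof -
   define f where "f n = ennreal (1 / q ^ n) * ennreal ((norm (?D n x))^2)" for n
   have "f n = sum f {n}" by simp
   also have "... <= suminf f" by (rule sum_le_suminf) (auto intro: summableI)
   also have "suminf f = ennreal T" unfolding T(1)[symmetric] by (rule arg_cong[where f=suminf]) (rule ext, rule f_def)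
   finally have "1 / q ^ n * (norm (?D n x))^2 <= T" using q T by (simp add: f_def ennreal_mult[symmetric])
   then have "(norm (?D n x))^2 <= T * q ^ n" using q by (simp add: field_simps)
   also have "... = (sqrt T * sqrt q ^ n)^2"
   proof -
    have "(sqrt q ^ n)^2 = ((sqrt q)^2) ^ n" by (metis mult.commute power_mult)
    then show ?thesis using T q by (simp add: power_mult_distrib)
   qed
   finally show ?thesis by (rule power2_le_imp_le) (use T q in auto)
  qed
  have "summable (%n. ?D n x)"
  proof (rule summable_comparison_test')
   show "summable (%n. sqrt T * sqrt q ^ n)" using q by (intro summable_mult summable_geometric) auto
   show "norm (?D n x) <= sqrt T * sqrt q ^ n" if "0 <= n" for n by (rule bound)
  qed
  then have "convergent (%n. \<Sum>k<n. ?D k x)" by (simp add: summable_iff_convergent)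
  then have "convergent (%n. F n x - F 0 x)" using sum_lessThan_telescope[of "%n. F n x"] by simp
  then have "convergent (%n. (F n x - F 0 x) + F 0 x)" by (intro convergent_add convergent_const)
  then show "convergent (%n. F n x)" by simp
 qed
 define G where "G x = lim (%n. F n x)" for x
 have [measurable]: "borel_fun G" unfolding G_def by (rule borel_measurable_lim_metric) measurable
 have lim: "AE x in lborel. (%n. F n x) ~~~> G x" using conv by eventually_elim (simp add: G_def convergent_LIMSEQ_iff)
 have tri: "n2 (%x. F (n + m) x - F n x) <= C * q ^ n / (1 - q)" for n m
 proof -
  have "n2 (%x. F (n + m) x - F n x) <= (\<Sum>k<m. C * q ^ (n + k))"
  proof (induction m)
   case 0
   have "n2 (%x::'a. 0::'b) = 0" by (simp add: n2_def ip_def)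
   then show ?case by simp
  next
   case (Suc m)
   have "n2 (%x. F (n + Suc m) x - F n x) <= n2 (%x. F (n + Suc m) x - F (n + m) x) + n2 (%x. F (n + m) x - F n x)" by (intro n2_diff_triangle F)
   also have "... <= C * q ^ (n + m) + (\<Sum>k<m. C * q ^ (n + k))" using fast[of "n + m"] Suc by auto
   finally show ?case by simp
  qed
  also have "... = C * q ^ n * (\<Sum>k<m. q ^ k)" by (simp add: sum_distrib_left power_add mult_ac)
  also have "(\<Sum>k<m. q ^ k) <= (\<Sum>k. q ^ k)" using q by (intro sum_le_suminf summable_geometric) auto
  also have "(\<Sum>k. q ^ k) = 1 / (1 - q)" using q by (intro suminf_geometric) auto
  finally show ?thesis using q C by (simp add: mult_left_mono)
 qed
 have FG: "nint (%x. ennreal ((norm (F n x - G x))^2)) <= ennreal ((C * q ^ n / (1 - q))^2)" for n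
 proof -
  have "nint (%x. ennreal ((norm (F n x - G x))^2)) = nint (%x. liminf (%m. ennreal ((norm (F n x - F (n + m) x))^2)))"
  proof (intro nn_integral_cong_AE)
   show "AE x in lborel. ennreal ((norm (F n x - G x))^2) = liminf (%m. ennreal ((norm (F n x - F (n + m) x))^2))" using lim
   proof eventually_elim
    fix x assume "(%n. F n x) ~~~> G x"
    then have "(%m. F (m + n) x) ~~~> G x" by (rule LIMSEQ_ignore_initial_segment)
    then have "(%m. ennreal ((norm (F n x - F (n + m) x))^2)) ~~~> ennreal ((norm (F n x - G x))^2)"
     by (intro tendsto_ennrealI tendsto_power tendsto_norm tendsto_diff tendsto_const) (simp add: add.commute)
    then show "ennreal ((norm (F n x - G x))^2) = liminf (%m. ennreal ((norm (F n x - F (n + m) x))^2))" by (intro lim_imp_Liminf[symmetric]) auto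
   qed
  qed
  also have "... <= liminf (%m. nint (%x. ennreal ((norm (F n x - F (n + m) x))^2)))" by (intro nn_integral_liminf) measurable
  also have "... = liminf (%m. ennreal ((n2 (%x. F n x - F (n + m) x))^2))" by (subst nn_integral_n2[OF L2_diff[OF F F]]) simp
  also have "... <= liminf (%m. ennreal ((C * q ^ n / (1 - q))^2))"
  proof (intro Liminf_mono always_eventually allI ennreal_leI power_mono n2_nonneg)
   fix m show "n2 (%x. F n x - F (n + m) x) <= C * q ^ n / (1 - q)" using tri[of n m] by (simp add: n2_diff_commute)
  qed
  also have "... = ennreal ((C * q ^ n / (1 - q))^2)" by (simp add: Liminf_const)
  finally show ?thesis .
 qed
 have FGL: "L2 (%x. F n x - G x)" for n using FG[of n] by (auto simp: L2_def intro: le_less_trans)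
 have "L2 (%x. F 0 x - (F 0 x - G x))" by (intro L2_diff F FGL)
 then have G: "L2 G" by simp
 have n2FG: "n2 (%x. F n x - G x) <= C * q ^ n / (1 - q)" for n
 proof (rule power2_le_imp_le)
  show "(n2 (%x. F n x - G x))^2 <= (C * q ^ n / (1 - q))^2" using FG[of n] unfolding nn_integral_n2[OF FGL] by (subst (asm) ennreal_le_iff) auto
 qed (use q C in auto)
 have "(%n. C * q ^ n / (1 - q)) ~~~> C * 0 / (1 - q)" using q by (intro tendsto_intros LIMSEQ_realpow_zero) auto
 then have lim0: "(%n. C * q ^ n / (1 - q)) ~~~> 0" by simp
 have "(%n. n2 (%x. F n x - G x)) ~~~> 0"
 proof (rule tendsto_sandwich[OF _ _ tendsto_const lim0])
  show "\<forall>\<^sub>F n in sequentially. 0 <= n2 (%x. F n x - G x)" by (intro always_eventually allI n2_nonneg)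
  show "\<forall>\<^sub>F n in sequentially. n2 (%x. F n x - G x) <= C * q ^ n / (1 - q)" by (intro always_eventually allI n2FG)
 qed
 with G show ?thesis by blast
qed

section \<open>Orthogonal projection and the Lax-Milgram theorem\<close>

definition L2_subspace :: "('a::euclidean_space => 'b::euclidean_space) set => bool" where
 "L2_subspace V \<longleftrightarrow> (\<forall>F\<in>V. L2 F) & (%x. 0) \<in> V &
   (\<forall>F\<in>V. \<forall>H\<in>V. \<forall>c d. (%x. c *\<^sub>R F x + d *\<^sub>R H x) \<in> V)"

definition L2_closure :: "('a::euclidean_space => 'b::euclidean_space) set => ('a => 'b) set" where
 "L2_closure V = {G. L2 G & (\<exists>\<phi>. (\<forall>k. \<phi> k \<in> V) & (%k. n2 (%x. \<phi> k x - G x)) ~~~> 0)}"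

context
 fixes V :: "('a::euclidean_space => 'b::euclidean_space) set"
 assumes V: "L2_subspace V"
begin

lemma subspace_L2: "F \<in> V ==> L2 F" using V by (auto simp: L2_subspace_def)

lemma subspace_comb: "F \<in> V ==> H \<in> V ==> (%x. c *\<^sub>R F x + d *\<^sub>R H x) \<in> V" using V by (auto simp: L2_subspace_def)

lemma closure_comb:
 assumes "G \<in> L2_closure V" "H \<in> L2_closure V"
 shows "(%x. c *\<^sub>R G x + d *\<^sub>R H x) \<in> L2_closure V"
proof -
 obtain \<phi> \<psi> where \<phi>: "!!k. \<phi> k \<in> V" "(%k. n2 (%x. \<phi> k x - G x)) ~~~> 0"
  and \<psi>: "!!k. \<psi> k \<in> V" "(%k. n2 (%x. \<psi> k x - H x)) ~~~> 0" and GH: "L2 G" "L2 H" using assms by (auto simp: L2_closure_def)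
 define \<theta> where "\<theta> k = (%x. c *\<^sub>R \<phi> k x + d *\<^sub>R \<psi> k x)" for k
 have \<theta>: "\<theta> k \<in> V" for k unfolding \<theta>_def by (intro subspace_comb \<phi> \<psi>)
 have b: "n2 (%x. \<theta> k x - (c *\<^sub>R G x + d *\<^sub>R H x)) <= \<bar>c\<bar> * n2 (%x. \<phi> k x - G x) + \<bar>d\<bar> * n2 (%x. \<psi> k x - H x)" for k
 proof -
  have "(%x. \<theta> k x - (c *\<^sub>R G x + d *\<^sub>R H x)) = (%x. c *\<^sub>R (\<phi> k x - G x) + d *\<^sub>R (\<psi> k x - H x))"
   by (auto simp: \<theta>_def algebra_simps)
  moreover have "n2 (%x. c *\<^sub>R (\<phi> k x - G x) + d *\<^sub>R (\<psi> k x - H x)) <= n2 (%x. c *\<^sub>R (\<phi> k x - G x)) + n2 (%x. d *\<^sub>R (\<psi> k x - H x))"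
   by (intro n2_add_le L2_scaleR L2_diff GH subspace_L2 \<phi> \<psi>)
  ultimately show ?thesis by (simp add: n2_scaleR)
 qed
 have lim0: "(%k. \<bar>c\<bar> * n2 (%x. \<phi> k x - G x) + \<bar>d\<bar> * n2 (%x. \<psi> k x - H x)) ~~~> 0"
  using tendsto_add[OF tendsto_mult_right_zero[OF \<phi>(2)] tendsto_mult_right_zero[OF \<psi>(2)], of "\<bar>c\<bar>" "\<bar>d\<bar>"] by simp
 have "(%k. n2 (%x. \<theta> k x - (c *\<^sub>R G x + d *\<^sub>R H x))) ~~~> 0"
 proof (rule tendsto_sandwich[OF _ _ tendsto_const lim0])
  show "\<forall>\<^sub>F k in sequentially. 0 <= n2 (%x. \<theta> k x - (c *\<^sub>R G x + d *\<^sub>R H x))" by (intro always_eventually allI n2_nonneg)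
  show "\<forall>\<^sub>F k in sequentially. n2 (%x. \<theta> k x - (c *\<^sub>R G x + d *\<^sub>R H x)) <= \<bar>c\<bar> * n2 (%x. \<phi> k x - G x) + \<bar>d\<bar> * n2 (%x. \<psi> k x - H x)"
   by (intro always_eventually allI b)
 qed
 with \<theta> show ?thesis unfolding L2_closure_def by (auto intro!: L2_add L2_scaleR GH)
qed

lemma closure_diff: "G \<in> L2_closure V ==> H \<in> L2_closure V ==> (%x. G x - H x) \<in> L2_closure V" using closure_comb[of G H 1 "-1"] by simp

lemma closure_orthogonal:
 assumes "L2 X" "!!H. H \<in> V ==> ip X H = 0" "G \<in> L2_closure V"
 shows "ip X G = 0"
proof -
 obtain \<phi> where \<phi>: "!!k. \<phi> k \<in> V" "(%k. n2 (%x. \<phi> k x - G x)) ~~~> 0" and G: "L2 G" using assms(3) by (auto simp: L2_closure_def)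
 have "(%k. ip (\<phi> k) X) ~~~> ip G X" by (rule ip_tendsto[OF subspace_L2[OF \<phi>(1)] G assms(1) \<phi>(2)])
 moreover have "ip (\<phi> k) X = 0" for k using assms(2)[OF \<phi>(1)] by (simp add: ip_commute)
 ultimately have "(%k::nat. 0::real) ~~~> ip G X" by simp
 then show ?thesis by (simp add: LIMSEQ_const_iff ip_commute)
qed

lemma closure_closed:
 assumes G: "!!n. G n \<in> L2_closure V" and H: "L2 H" and lim: "(%n. n2 (%x. G n x - H x)) ~~~> 0"
 shows "H \<in> L2_closure V"
proof -
 have "\<exists>\<phi>\<in>V. n2 (%x. \<phi> x - G n x) < inverse (real (Suc n))" for n
 proof -
  obtain \<phi> where \<phi>: "!!k. \<phi> k \<in> V" "(%k. n2 (%x. \<phi> k x - G n x)) ~~~> 0" using G[of n] by (auto simp: L2_closure_def)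
  have "\<forall>\<^sub>F k in sequentially. n2 (%x. \<phi> k x - G n x) < inverse (real (Suc n))" using order_tendstoD(2)[OF \<phi>(2)] by simp
  then obtain k where "n2 (%x. \<phi> k x - G n x) < inverse (real (Suc n))" by (auto simp: eventually_sequentially)
  then show ?thesis using \<phi>(1) by blast
 qed
 then obtain \<phi> where \<phi>: "!!n. \<phi> n \<in> V" "!!n. n2 (%x. \<phi> n x - G n x) < inverse (real (Suc n))" by metis
 have GL: "L2 (G n)" for n using G[of n] by (auto simp: L2_closure_def)
 have b: "n2 (%x. \<phi> n x - H x) <= inverse (real (Suc n)) + n2 (%x. G n x - H x)" for n
  using n2_diff_triangle[OF subspace_L2[OF \<phi>(1)] GL H, of n n] \<phi>(2)[of n] by linarith
 have lim0: "(%n. inverse (real (Suc n)) + n2 (%x. G n x - H x)) ~~~> 0" using tendsto_add[OF LIMSEQ_inverse_real_of_nat lim] by simp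
 have "(%n. n2 (%x. \<phi> n x - H x)) ~~~> 0"
 proof (rule tendsto_sandwich[OF _ _ tendsto_const lim0])
  show "\<forall>\<^sub>F n in sequentially. 0 <= n2 (%x. \<phi> n x - H x)" by (intro always_eventually allI n2_nonneg)
  show "\<forall>\<^sub>F n in sequentially. n2 (%x. \<phi> n x - H x) <= inverse (real (Suc n)) + n2 (%x. G n x - H x)" by (intro always_eventually allI b)
 qed
 with \<phi> H show ?thesis unfolding L2_closure_def by auto
qed

lemma subset_closure: "F \<in> V ==> F \<in> L2_closure V"
proof -
 assume F: "F \<in> V"
 have "n2 (%x::'a. 0::'b) = 0" by (simp add: n2_def ip_def)
 with F show ?thesis using subspace_L2 unfolding L2_closure_def by (auto intro!: exI[of _ "%_. F"])
qed

text \<open>A minimising sequence whose excess over the infimum is below \<open>4^-n\<close> is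
  geometrically Cauchy by the parallelogram identity. Orthogonality follows by perturbing the
  minimiser in the direction H.\<close>

lemma L2_projection:
 assumes F: "L2 F"
 shows "\<exists>G\<in>L2_closure V. \<forall>H\<in>V. ip (%x. G x - F x) H = 0"
proof -
 define E where "E \<phi> = (n2 (%x. \<phi> x - F x))^2" for \<phi>
 define \<delta> where "\<delta> = Inf (E ` V)"
 have ne: "E ` V \<noteq> {}" using V by (auto simp: L2_subspace_def)
 have bdd: "bdd_below (E ` V)" by (rule bdd_belowI[of _ 0]) (auto simp: E_def)
 have \<delta>: "\<delta> <= E \<phi>" if "\<phi> \<in> V" for \<phi> unfolding \<delta>_def using that bdd by (intro cInf_lower) auto
 have "\<exists>\<phi>\<in>V. E \<phi> < \<delta> + (1/4) ^ n" for n :: nat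
 proof -
  have "Inf (E ` V) < \<delta> + (1/4) ^ n" by (simp add: \<delta>_def)
  then show ?thesis using cInf_lessD[OF ne] by auto
 qed
 then obtain \<phi> where \<phi>: "!!n. \<phi> n \<in> V" "!!n. E (\<phi> n) < \<delta> + (1/4) ^ n" by metis
 have \<phi>L: "L2 (\<phi> n)" for n by (intro subspace_L2 \<phi>)
 have fast: "n2 (%x. \<phi> (Suc n) x - \<phi> n x) <= 2 * (1/2) ^ n" for n
 proof (rule power2_le_imp_le)
  let ?a = "%x. \<phi> (Suc n) x - F x" and ?b = "%x. \<phi> n x - F x"
  let ?m = "%x. (1/2) *\<^sub>R \<phi> (Suc n) x + (1/2) *\<^sub>R \<phi> n x"
  have L: "L2 ?a" "L2 ?b" by (intro L2_diff \<phi>L F)+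
  have "\<delta> <= E ?m" by (intro \<delta> subspace_comb \<phi>)
  also have "E ?m = (n2 (%x. (1/2) *\<^sub>R (?a x + ?b x)))^2"
  proof -
   have "(%x. ?m x - F x) = (%x. (1/2) *\<^sub>R (?a x + ?b x))"
   proof
    fix x
    have "(1/2) *\<^sub>R F x + (1/2) *\<^sub>R F x = F x" by (simp flip: scaleR_add_left)
    moreover have "(1/2) *\<^sub>R (?a x + ?b x) = ?m x - ((1/2) *\<^sub>R F x + (1/2) *\<^sub>R F x)" by (simp add: scaleR_diff_right scaleR_add_right)
    ultimately show "?m x - F x = (1/2) *\<^sub>R (?a x + ?b x)" by simp
   qed
   then show ?thesis by (simp only: E_def)
  qed
  also have "... = 1/4 * ip (%x. ?a x + ?b x) (%x. ?a x + ?b x)" by (simp add: n2_sq ip_scaleR)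
  also have "... = 1/4 * (ip ?a ?a + 2 * ip ?a ?b + ip ?b ?b)" using ip_add[OF L L2_add[OF L]] ip_add(2)[OF L L(1)] ip_add(2)[OF L L(2)] ip_commute[of ?b ?a] by simp
  finally have m: "4 * \<delta> <= ip ?a ?a + 2 * ip ?a ?b + ip ?b ?b" by simp
  have "(n2 (%x. \<phi> (Suc n) x - \<phi> n x))^2 = ip (%x. ?a x - ?b x) (%x. ?a x - ?b x)" by (simp add: n2_sq)
  also have "... = ip ?a ?a - 2 * ip ?a ?b + ip ?b ?b" using ip_diff[OF L L2_diff[OF L]] ip_diff(2)[OF L L(1)] ip_diff(2)[OF L L(2)] ip_commute[of ?b ?a] by simp
  also have "... <= 2 * (ip ?a ?a + ip ?b ?b) - 4 * \<delta>" using m by simp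
  also have "ip ?a ?a = E (\<phi> (Suc n))" by (simp add: E_def n2_sq)
  also have "ip ?b ?b = E (\<phi> n)" by (simp add: E_def n2_sq)
  also have "2 * (E (\<phi> (Suc n)) + E (\<phi> n)) - 4 * \<delta> <= 2 * ((1/4) ^ Suc n + (1/4) ^ n)"
  proof -
   have "2 * (x + y) - 4 * \<delta> <= 2 * (p + q)" if "x < \<delta> + p" "y < \<delta> + q" for x y p q :: real
    using add_strict_mono[OF that] by (simp add: algebra_simps)
   then show ?thesis using \<phi>(2)[of n] \<phi>(2)[of "Suc n"] by blast
  qed
  also have "... <= 4 * (1/4) ^ n" by simp
  also have "... = (2 * (1/2) ^ n)^2"
  proof -
   have "((1/2::real) ^ n)^2 = ((1/2)^2) ^ n" by (metis mult.commute power_mult)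
   then show ?thesis by (simp add: power_mult_distrib power2_eq_square)
  qed
  finally show "(n2 (%x. \<phi> (Suc n) x - \<phi> n x))^2 <= (2 * (1/2) ^ n)^2" .
 qed simp
 obtain G where G: "L2 G" "(%n. n2 (%x. \<phi> n x - G x)) ~~~> 0" using L2_complete[of \<phi> "1/2" 2] \<phi>L fast by auto
 have Gcl: "G \<in> L2_closure V" using G \<phi>(1) by (auto simp: L2_closure_def)
 have "ip (%x. G x - F x) H = 0" if H: "H \<in> V" for H
 proof -
  have HL: "L2 H" by (rule subspace_L2[OF H])
  have ineq: "0 <= 2 * t * ip (%x. G x - F x) H + t^2 * ip H H" for t
  proof -
   have 1: "0 <= (1/4) ^ n + 2 * t * ip (%x. \<phi> n x - F x) H + t^2 * ip H H" for n
   proof -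
    let ?b = "%x. \<phi> n x - F x" and ?H = "%x. t *\<^sub>R H x"
    have L: "L2 ?b" "L2 ?H" by (intro L2_diff \<phi>L F L2_scaleR HL)+
    have "\<delta> <= E (%x. 1 *\<^sub>R \<phi> n x + t *\<^sub>R H x)" by (intro \<delta> subspace_comb \<phi> H)
    also have "... = ip (%x. ?b x + ?H x) (%x. ?b x + ?H x)" by (simp add: E_def n2_sq algebra_simps)
    also have "... = ip ?b ?b + 2 * ip ?b ?H + ip ?H ?H" using ip_add[OF L L2_add[OF L]] ip_add(2)[OF L L(1)] ip_add(2)[OF L L(2)] ip_commute[of ?H ?b] by simp
    also have "ip ?b ?b = E (\<phi> n)" by (simp add: E_def n2_sq)
    finally show ?thesis using \<phi>(2)[of n] by (simp add: ip_scaleR power2_eq_square mult.assoc)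
   qed
   have "(%n. ip (\<phi> n) H - ip F H) ~~~> ip G H - ip F H" by (intro tendsto_diff ip_tendsto[OF \<phi>L G(1) HL G(2)] tendsto_const)
   then have "(%n. ip (%x. \<phi> n x - F x) H) ~~~> ip (%x. G x - F x) H" by (simp add: ip_diff \<phi>L F HL G)
   then have "(%n. (1/4) ^ n + 2 * t * ip (%x. \<phi> n x - F x) H + t^2 * ip H H) ~~~> 0 + 2 * t * ip (%x. G x - F x) H + t^2 * ip H H"
    by (intro tendsto_intros LIMSEQ_realpow_zero) auto
   then have "0 <= 0 + 2 * t * ip (%x. G x - F x) H + t^2 * ip H H" by (rule LIMSEQ_le_const) (use 1 in auto)
   then show ?thesis by simp
  qed
  let ?X = "ip (%x. G x - F x) H" and ?Y = "ip H H"
  have Y: "0 <= ?Y" by (rule ip_self_nonneg)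
  \<comment> \<open>Almost the minimiser of the quadratic polynomial in t; the summand 1 keeps the
    denominator positive when H vanishes almost everywhere.\<close>
  define t where "t = - ?X / (?Y + 1)"
  have X: "?X = - (t * (?Y + 1))" using Y by (simp add: t_def)
  have "0 <= 2 * t * ?X + t^2 * ?Y" by (rule ineq)
  also have "... = - (t^2 * (?Y + 2))" unfolding X by (simp add: power2_eq_square algebra_simps)
  finally have "t^2 * (?Y + 2) <= 0" by simp
  then have "t = 0" using Y by (simp add: mult_le_0_iff)
  then show ?thesis using X by simp
 qed
 with Gcl show ?thesis by blast
qed

text \<open>Picard iteration for X mapped to the projection of \<open>X - \<tau> (a X + F)\<close>.
  The coefficient map acts pointwise, so the inner map contracts already at each point, and the
  projection does not expand distances. At the fixed point, orthogonality to V is the weak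
  equation.\<close>

lemma lax_milgram:
 assumes F: "L2 F" and lin: "linear a" and \<mu>: "0 < \<mu>" and M: "!!\<xi>. norm (a \<xi>) <= M * norm \<xi>"
  and coer: "!!\<xi>. \<mu> * (norm \<xi>)^2 <= a \<xi> \<bullet> (\<xi>::'b)"
 shows "\<exists>G\<in>L2_closure V. \<forall>H\<in>V. ip (%x. a (G x) + F x) H = 0"
proof -
 have "\<exists>b::'b. b \<noteq> 0" using nonempty_Basis nonzero_Basis by blast
 then obtain b :: 'b where b: "b \<noteq> 0" by blast
 have muM: "\<mu> <= M"
 proof -
  have "\<mu> * (norm b)^2 <= a b \<bullet> b" by (rule coer)
  also have "... <= norm (a b) * norm b" by (rule norm_cauchy_schwarz)
  also have "... <= M * norm b * norm b" by (intro mult_right_mono M) auto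
  finally show ?thesis using b by (simp add: power2_eq_square)
 qed
 then have M0: "0 < M" using \<mu> by simp
 have lin_meas: "borel_fun (%x. a (X x))" if "borel_fun X" for X :: "'a => 'b"
  using measurable_compose[OF that borel_measurable_continuous_onI[OF linear_continuous_on[OF lin[unfolded linear_conv_bounded_linear]]]] .
 have aL2: "L2 (%x. a (X x))" if "L2 X" for X :: "'a => 'b" by (rule L2_dominated[OF lin_meas M that]) (use that in \<open>simp add: L2_def\<close>)
 \<comment> \<open>The projection is determined only up to null sets, so a representative has to be
   selected.\<close>
 define P where "P X = (SOME G. G \<in> L2_closure V & (\<forall>H\<in>V. ip (%x. G x - X x) H = 0))" for X
 have P: "P X \<in> L2_closure V" "!!H. H \<in> V ==> ip (%x. P X x - X x) H = 0" if "L2 X" for X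
  using someI_ex[of "%G. G \<in> L2_closure V & (\<forall>H\<in>V. ip (%x. G x - X x) H = 0)"] L2_projection[OF that] unfolding P_def by blast+
 have PL: "L2 (P X)" if "L2 X" for X using P(1)[OF that] by (simp add: L2_closure_def)
 have contr: "n2 (%x. P X x - P Y x) <= n2 (%x. X x - Y x)" if X: "L2 X" and Y: "L2 Y" for X Y
 proof -
  let ?D = "%x. P X x - P Y x"
  have Dc: "?D \<in> L2_closure V" by (intro closure_diff P X Y)
  have D: "L2 ?D" by (intro L2_diff PL X Y)
  have "ip (%x. P X x - X x) ?D = 0" by (rule closure_orthogonal[OF _ P(2)[OF X] Dc]) (auto intro!: L2_diff PL X)
  moreover have "ip (%x. P Y x - Y x) ?D = 0" by (rule closure_orthogonal[OF _ P(2)[OF Y] Dc]) (auto intro!: L2_diff PL Y)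
  ultimately have "ip ?D ?D = ip (%x. X x - Y x) ?D"
   by (simp add: ip_diff(1)[OF PL[OF X] X D] ip_diff(1)[OF PL[OF Y] Y D] ip_diff(1)[OF X Y D] ip_diff(1)[OF PL[OF X] PL[OF Y] D])
  also have "... <= n2 (%x. X x - Y x) * n2 ?D" using ip_CS[OF L2_diff[OF X Y] D] by simp
  finally have "n2 ?D * n2 ?D <= n2 (%x. X x - Y x) * n2 ?D" by (simp add: n2_sq[symmetric] power2_eq_square)
  then show ?thesis using n2_nonneg[of ?D] n2_nonneg[of "%x. X x - Y x"] by (cases "n2 ?D = 0") (auto simp: mult_le_cancel_right)
 qed
 \<comment> \<open>This value minimises \<open>1 - 2 \<tau> \<mu> + \<tau>^2 M^2\<close>, the bound
   for the squared contraction factor.\<close>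
 define \<tau> where "\<tau> = \<mu> / M^2"
 have \<tau>: "0 < \<tau>" using \<mu> M0 by (simp add: \<tau>_def)
 define T where "T X = (%x. X x - \<tau> *\<^sub>R (a (X x) + F x))" for X
 have TL: "L2 (T X)" if "L2 X" for X unfolding T_def by (intro L2_diff L2_scaleR L2_add aL2 that F)
 \<comment> \<open>The maximum with 1/2 keeps the rate positive, as the completeness lemma
   requires.\<close>
 define q where "q = max (1/2) (sqrt (1 - \<mu>^2 / M^2))"
 have q1: "\<mu>^2 / M^2 <= 1" "0 < \<mu>^2 / M^2" using muM \<mu> M0 by (auto simp: power_mono)
 have q: "0 < q" "q < 1" using q1 by (auto simp: q_def real_sqrt_lt_1_iff)
 have Tcontr: "n2 (%x. T X x - T Y x) <= q * n2 (%x. X x - Y x)" if X: "L2 X" and Y: "L2 Y" for X Y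
 proof (rule n2_mono)
  fix x
  let ?e = "X x - Y x"
  have "T X x - T Y x = ?e - \<tau> *\<^sub>R a ?e" by (simp add: T_def linear_diff[OF lin] algebra_simps)
  then have "(norm (T X x - T Y x))^2 = (norm ?e)^2 - 2 * \<tau> * (a ?e \<bullet> ?e) + \<tau>^2 * (norm (a ?e))^2"
  proof -
   have "(norm (e - t *\<^sub>R w))^2 = (norm e)^2 - 2 * t * (w \<bullet> e) + t^2 * (norm w)^2" for e w :: 'b and t unfolding power2_norm_eq_inner
    by (simp add: inner_diff_left inner_diff_right inner_commute[of e w] power2_eq_square algebra_simps)
   then show ?thesis using \<open>T X x - T Y x = ?e - \<tau> *\<^sub>R a ?e\<close> by simp
  qed
  also have "... <= (norm ?e)^2 - 2 * \<tau> * (\<mu> * (norm ?e)^2) + \<tau>^2 * (M * norm ?e)^2"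
   using \<tau> by (intro add_mono diff_mono mult_left_mono coer power_mono M) auto
  also have "... = (1 - \<mu>^2 / M^2) * (norm ?e)^2" using M0 by (simp add: \<tau>_def power2_eq_square field_simps)
  also have "... = (sqrt (1 - \<mu>^2 / M^2) * norm ?e)^2" using q1 by (simp add: power_mult_distrib)
  finally have "norm (T X x - T Y x) <= sqrt (1 - \<mu>^2 / M^2) * norm ?e" by (rule power2_le_imp_le) (use q1 in auto)
  also have "... <= q * norm ?e" by (intro mult_right_mono) (auto simp: q_def)
  finally show "norm (T X x - T Y x) <= q * norm ?e" .
 qed (use q in \<open>auto intro!: L2_diff TL X Y\<close>)
 define G where "G n = ((%X. P (T X)) ^^ n) (%x. 0)" for n
 have GS: "G (Suc n) = P (T (G n))" for n by (simp add: G_def)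
 have "(%x. 0) \<in> L2_closure V" using V by (intro subset_closure) (auto simp: L2_subspace_def)
 then have Gc: "G n \<in> L2_closure V" for n
 proof (induction n)
  case (Suc n)
  then have "L2 (G n)" by (auto simp: L2_closure_def)
  then show ?case unfolding GS by (intro P TL)
 qed (simp add: G_def)
 then have GL: "L2 (G n)" for n by (auto simp: L2_closure_def)
 define C where "C = n2 (%x. G 1 x - G 0 x)"
 have fast: "n2 (%x. G (Suc n) x - G n x) <= C * q ^ n" for n
 proof (induction n)
  case (Suc n)
  have "n2 (%x. G (Suc (Suc n)) x - G (Suc n) x) <= n2 (%x. T (G (Suc n)) x - T (G n) x)" unfolding GS[of "Suc n"] GS[of n] by (rule contr) (auto intro!: TL PL GL)
  also have "... <= q * n2 (%x. G (Suc n) x - G n x)" by (intro Tcontr GL)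
  also have "... <= q * (C * q ^ n)" using Suc q by (intro mult_left_mono) auto
  finally show ?case by (simp add: mult_ac)
 qed (simp add: C_def)
 obtain H where H: "L2 H" "(%n. n2 (%x. G n x - H x)) ~~~> 0" using L2_complete[OF GL q _ fast] n2_nonneg unfolding C_def by blast
 have Hc: "H \<in> L2_closure V" by (rule closure_closed[OF Gc H])
 have Hfix: "ip (%x. H x - T H x) K = 0" if K: "K \<in> V" for K
 proof -
  have KL: "L2 K" by (rule subspace_L2[OF K])
  have "ip (G (Suc n)) K = ip (T (G n)) K" for n using P(2)[OF TL[OF GL[of n]] K] ip_diff(1)[OF PL[OF TL[OF GL[of n]]] TL[OF GL[of n]] KL] unfolding GS by simp
  moreover have "(%n. ip (G (Suc n)) K) ~~~> ip H K" using ip_tendsto[OF GL H(1) KL H(2)] by (rule LIMSEQ_Suc)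
  moreover have "(%n. ip (T (G n)) K) ~~~> ip (T H) K"
  proof (rule ip_tendsto[OF TL[OF GL] TL[OF H(1)] KL])
   have lim0: "(%n. q * n2 (%x. G n x - H x)) ~~~> 0" by (rule tendsto_mult_right_zero[OF H(2)])
   show "(%k. n2 (%x. T (G k) x - T H x)) ~~~> 0"
   proof (rule tendsto_sandwich[OF _ _ tendsto_const lim0])
    show "\<forall>\<^sub>F n in sequentially. 0 <= n2 (%x. T (G n) x - T H x)" by (intro always_eventually allI n2_nonneg)
    show "\<forall>\<^sub>F n in sequentially. n2 (%x. T (G n) x - T H x) <= q * n2 (%x. G n x - H x)" by (intro always_eventually allI Tcontr GL H)
   qed
  qed
  ultimately have "ip H K = ip (T H) K" using LIMSEQ_unique by simp
  then show ?thesis by (simp add: ip_diff(1)[OF H(1) TL[OF H(1)] KL])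
 qed
 have "ip (%x. a (H x) + F x) K = 0" if K: "K \<in> V" for K
 proof -
  have "(%x. H x - T H x) = (%x. \<tau> *\<^sub>R (a (H x) + F x))" by (auto simp: T_def)
  then have "\<tau> * ip (%x. a (H x) + F x) K = 0" using Hfix[OF K] by (simp add: ip_scaleR)
  then show ?thesis using \<tau> by simp
 qed
 with Hc show ?thesis by blast
qed

end

section \<open>Poincare inequalities\<close>

lemma lborel_integral_affine:
 fixes f :: "'a::euclidean_space => real"
 assumes [measurable]: "borel_fun f" and c: "c \<noteq> 0"
 shows "(LINT y|lborel. f y) = \<bar>c\<bar> ^ DIM('a) * (LINT z|lborel. f (t + c *\<^sub>R z))"
proof -
 have "(LINT y|lborel. f y) = (LINT y|density (distr lborel borel (%x. t + c *\<^sub>R x)) (%_. \<bar>c\<bar> ^ DIM('a)). f y)"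
  by (subst lborel_affine[OF c, of t]) simp
 also have "... = \<bar>c\<bar> ^ DIM('a) * (LINT z|lborel. f (t + c *\<^sub>R z))" by (simp add: integral_density integral_distr)
 finally show ?thesis .
qed

text \<open>The kernel arising when \<open>\<psi> x - \<psi> y\<close>, written as the integral of
  the derivative along the segment from x to y, is averaged over y in b and y is replaced by
  \<open>z = x + t (y - x)\<close>. The substitution contributes \<open>1 / t^d\<close>, and
  \<open>x - y = (x - z) / t\<close> one more power.\<close>

definition kern :: "'a::euclidean_space set => 'a => 'a => real => real" where
 "kern b z x t = (if 0 < t & t < 1 & x + (1 / t) *\<^sub>R (z - x) \<in> b then 1 / (measure lborel b * t ^ Suc DIM('a)) else 0)"

definition bavg :: "'a::euclidean_space set => ('a => 'b::euclidean_space) => 'b" where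
 "bavg b \<phi> = (1 / measure lborel b) *\<^sub>R (LINT y|lborel. indicator b y *\<^sub>R \<phi> y)"

lemma kern_nonneg: "0 <= kern b z x t" by (simp add: kern_def)

lemma kern_measurable:
 assumes [measurable]: "b \<in> sets borel" "f \<in> borel_measurable M" "g \<in> borel_measurable M" "h \<in> borel_measurable M"
 shows "(%w. kern b (f w) (g w) (h w)) \<in> borel_measurable M" unfolding kern_def by measurable

lemma kern_support:
 fixes x0 :: "'a::euclidean_space"
 assumes "kern b z x t \<noteq> 0" "b \<subseteq> ball x0 R" "x \<in> ball x0 R"
 shows "0 < t" "t < 1" "z \<in> ball x0 R" "dist x z < 2 * R * t"
proof -
 define y where "y = x + (1 / t) *\<^sub>R (z - x)"
 have t: "0 < t" "t < 1" and y: "y \<in> b" using assms(1) by (auto simp: kern_def y_def split: if_splits)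
 then show "0 < t" "t < 1" by auto
 have zx: "z - x = t *\<^sub>R (y - x)" using t by (simp add: y_def)
 have yR: "y \<in> ball x0 R" using y assms(2) by blast
 have "z = (1 - t) *\<^sub>R x + t *\<^sub>R y" using zx by (simp add: algebra_simps)
 then show "z \<in> ball x0 R" using convexD[OF convex_ball assms(3) yR, of "1 - t" t] t by simp
 have "dist x y <= dist x x0 + dist x0 y" by (rule dist_triangle)
 also have "... < 2 * R" using yR assms(3) by (simp add: dist_commute)
 finally have "norm (y - x) < 2 * R" by (simp add: dist_norm norm_minus_commute)
 then have "t * norm (y - x) < t * (2 * R)" using t by simp
 moreover have "dist x z = t * norm (y - x)" using zx t by (metis abs_of_pos dist_commute dist_norm norm_scaleR)
 ultimately show "dist x z < 2 * R * t" by (simp add: mult_ac)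
qed

text \<open>The fundamental theorem of calculus along segments, averaged over the ball b. The
  averaging ball may lie anywhere: later it sits either inside the domain or in its complement,
  where the average vanishes.\<close>

lemma kern_representation:
 fixes \<psi> :: "'a::euclidean_space => real" and g :: "'a => 'a"
 assumes deriv: "!!z. (\<psi> has_derivative (%h. g z \<bullet> h)) (at z)" and cont: "continuous_on UNIV g"
  and bdd: "!!z. norm (g z) <= B" and s: "0 < s" and b: "b = ball q s"
 shows "\<psi> x - bavg b \<psi> = (LINT t|lborel. (LINT z|lborel. kern b z x t * (g z \<bullet> (x - z))))"
proof -
 let ?d = "DIM('a)"
 let ?m = "measure lborel b"
 have m: "0 < ?m" using s unfolding b by (simp add: content_ball_pos)
 have [measurable]: "b \<in> sets borel" unfolding b by simp
 have bfin: "vol b < \<infinity>" unfolding b using emeasure_lborel_ball_finite by auto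
 have cont\<psi>: "continuous_on UNIV \<psi>" using deriv has_derivative_continuous by (intro continuous_at_imp_continuous_on) blast
 have [measurable]: "borel_fun g" "borel_fun \<psi>" using cont cont\<psi> borel_measurable_continuous_onI by auto
 define D where "D y t = g (x + t *\<^sub>R (y - x)) \<bullet> (x - y)" for y t
 have ftc: "\<psi> x - \<psi> y = (LINT t|lborel. indicator {0<..<1} t * D y t)" for y
 proof -
  have d: "((%t. - \<psi> (x + t *\<^sub>R (y - x))) has_vector_derivative D y t) (at t within {0..1})" for t :: real
  proof -
   have "((%t. \<psi> (x + t *\<^sub>R (y - x))) has_derivative (%h. g (x + t *\<^sub>R (y - x)) \<bullet> (h *\<^sub>R (y - x)))) (at t within {0..1})"
    by (rule has_derivative_compose[OF _ deriv]) (auto intro!: derivative_eq_intros)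
   then have "((%t. - \<psi> (x + t *\<^sub>R (y - x))) has_derivative (%h. - (g (x + t *\<^sub>R (y - x)) \<bullet> (h *\<^sub>R (y - x))))) (at t within {0..1})"
    by (rule has_derivative_minus)
   then show ?thesis unfolding has_vector_derivative_def D_def by (simp add: inner_diff_right algebra_simps)
  qed
  have cD: "continuous_on {0..1} (D y)" unfolding D_def by (intro continuous_intros continuous_on_compose2[OF cont]) auto
  have "(LINT t|lborel. indicator {0..1} t *\<^sub>R D y t) = - \<psi> (x + 1 *\<^sub>R (y - x)) - (- \<psi> (x + 0 *\<^sub>R (y - x)))"
   by (rule integral_FTC_Icc[OF _ d cD]) simp
  also have "(LINT t|lborel. indicator {0..1} t *\<^sub>R D y t) = (LINT t|lborel. indicator {0<..<1} t * D y t)"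
  proof (rule integral_cong_AE)
   show "AE t in lborel. indicator {0..1} t *\<^sub>R D y t = indicator {0<..<1} t * D y t" using AE_lborel_singleton[of "0::real"] AE_lborel_singleton[of "1::real"]
    by eventually_elim (auto simp: indicator_def)
  qed (auto simp: D_def)
  finally show ?thesis by simp
 qed
 define f where "f y t = indicator b y * (indicator {0<..<1} t * D y t)" for y t
 have fbound: "\<bar>f y t\<bar> <= B * (norm (x - q) + s)" if y: "y \<in> b" for y t
 proof -
  have "\<bar>D y t\<bar> <= norm (g (x + t *\<^sub>R (y - x))) * norm (x - y)" unfolding D_def by (rule Cauchy_Schwarz_ineq2)
  also have "... <= B * (norm (x - q) + s)"
  proof (intro mult_mono bdd)
   have "norm (x - y) <= norm (x - q) + norm (q - y)" using norm_triangle_ineq[of "x - q" "q - y"] by simp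
   then show "norm (x - y) <= norm (x - q) + s" using y by (auto simp: b dist_norm)
   show "0 <= B" using norm_ge_zero bdd order_trans by blast
  qed auto
  finally have D: "\<bar>D y t\<bar> <= B * (norm (x - q) + s)" .
  have "\<bar>f y t\<bar> <= \<bar>D y t\<bar>" unfolding f_def by (auto simp: indicator_def)
  with D show ?thesis by simp
 qed
 have int: "integrable (lborel \<Otimes>\<^sub>M lborel) (%(y, t). f y t)"
 proof (rule integrableI_bounded_set[where A="b \<times> {0<..<1}" and B="B * (norm (x - q) + s)"])
  show "b \<times> {0<..<1::real} \<in> sets (lborel \<Otimes>\<^sub>M lborel)" by (intro pair_measureI) auto
  show "(%(y, t). f y t) \<in> borel_measurable (lborel \<Otimes>\<^sub>M lborel)" unfolding f_def D_def by measurable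
  show "emeasure (lborel \<Otimes>\<^sub>M lborel) (b \<times> {0<..<1::real}) < \<infinity>"
   using bfin by (subst lborel.emeasure_pair_measure_Times) (auto simp: ennreal_mult_less_top)
  show "AE p in lborel \<Otimes>\<^sub>M lborel. p \<in> b \<times> {0<..<1} --> norm ((%(y, t). f y t) p) <= B * (norm (x - q) + s)"
   by (intro AE_I2) (auto simp: fbound)
  show "AE p in lborel \<Otimes>\<^sub>M lborel. p \<notin> b \<times> {0<..<1} --> (%(y, t). f y t) p = 0" by (intro AE_I2) (auto simp: f_def indicator_def)
 qed
 have swap: "(LINT y|lborel. (LINT t|lborel. f y t)) = (LINT t|lborel. (LINT y|lborel. f y t))" using lborel_pair.Fubini_integral[OF int] by simp
 have inner: "(LINT y|lborel. f y t) = ?m * (LINT z|lborel. kern b z x t * (g z \<bullet> (x - z)))" for t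
 proof (cases "0 < t & t < 1")
  case False
  then have "f y t = 0" "kern b y x t = 0" for y by (auto simp: f_def kern_def)
  then show ?thesis by simp
 next
  case True
  have [measurable]: "borel_fun (%y. f y t)" unfolding f_def D_def by measurable
  have "(LINT y|lborel. f y t) = \<bar>1/t\<bar> ^ ?d * (LINT z|lborel. f ((x - (1/t) *\<^sub>R x) + (1/t) *\<^sub>R z) t)"
   using True by (intro lborel_integral_affine) auto
  also have "... = (LINT z|lborel. (1/t) ^ ?d * f ((x - (1/t) *\<^sub>R x) + (1/t) *\<^sub>R z) t)" using True by simp
  also have "... = (LINT z|lborel. ?m * (kern b z x t * (g z \<bullet> (x - z))))"
  proof (intro Bochner_Integration.integral_cong refl)
   fix z
   let ?y = "(x - (1/t) *\<^sub>R x) + (1/t) *\<^sub>R z"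
   have y: "?y = x + (1/t) *\<^sub>R (z - x)" by (simp add: algebra_simps)
   have 1: "x + t *\<^sub>R (?y - x) = z" using True unfolding y by simp
   have 2: "x - ?y = (1/t) *\<^sub>R (x - z)" unfolding y by (simp add: algebra_simps)
   have "D ?y t = (1/t) * (g z \<bullet> (x - z))" unfolding D_def 1 2 by simp
   then show "(1/t) ^ ?d * f ?y t = ?m * (kern b z x t * (g z \<bullet> (x - z)))"
    using True m unfolding f_def kern_def y[symmetric] by (simp add: indicator_def power_divide)
  qed
  finally show ?thesis by simp
 qed
 have "integrable lborel (%y. indicator b y * \<psi> y)"
 proof -
  have "bounded (\<psi> ` cball q s)" by (intro compact_imp_bounded compact_continuous_image continuous_on_subset[OF cont\<psi>]) auto
  then obtain c where c: "!!y. y \<in> cball q s ==> norm (\<psi> y) <= c" unfolding bounded_iff by blast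
  show ?thesis by (rule integrableI_bounded_set[where A=b and B=c]) (use bfin c in \<open>auto simp: b indicator_def intro!: AE_I2\<close>)
 qed
 moreover have "integrable lborel (%y. indicator b y * \<psi> x)" using bfin by (intro integrable_mult_left) (auto simp: integrable_indicator_iff)
 ultimately have "(LINT y|lborel. indicator b y * (\<psi> x - \<psi> y)) = ?m * \<psi> x - (LINT y|lborel. indicator b y * \<psi> y)"
  by (simp add: right_diff_distrib)
 then have "\<psi> x - bavg b \<psi> = (1 / ?m) * (LINT y|lborel. indicator b y * (\<psi> x - \<psi> y))" using m by (simp add: bavg_def field_simps)
 also have "(LINT y|lborel. indicator b y * (\<psi> x - \<psi> y)) = (LINT y|lborel. (LINT t|lborel. f y t))" unfolding ftc f_def by simp
 also note swap
 finally show ?thesis unfolding inner using m by simp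
qed

section \<open>Jacobian matrices and compactly supported C^1 fields\<close>

lemma ennreal_norm_integral_le:
 "ennreal (norm (integral\<^sup>L M f)) <= (\<integral>\<^sup>+x. ennreal (norm (f x)) \<partial>M)"
 by (cases "integrable M f") (auto simp: integral_norm_bound_ennreal not_integrable_integral_eq)

lemma norm_matrix_vector_le: "norm (A *v h) <= norm (A :: real^'d^'m) * norm h"
proof (rule power2_le_imp_le)
 have "(norm (A *v h))^2 = (\<Sum>i\<in>UNIV. ((A *v h) $ i)^2)" unfolding power2_norm_eq_inner by (simp add: inner_vec_def power2_eq_square)
 also have "... <= (\<Sum>i\<in>UNIV. (norm (A $ i))^2 * (norm h)^2)"
 proof (intro sum_mono)
  fix i
  have "\<bar>(A *v h) $ i\<bar> <= norm (A $ i) * norm h" using Cauchy_Schwarz_ineq2[of "A $ i" h] by (simp add: matrix_vector_mult_def inner_vec_def)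
  then show "((A *v h) $ i)^2 <= (norm (A $ i))^2 * (norm h)^2"
   using power_mono[of "\<bar>(A *v h) $ i\<bar>" "norm (A $ i) * norm h" 2] by (simp add: power_mult_distrib)
 qed
 also have "... = (norm A * norm h)^2"
 proof -
  have "(norm A)^2 = (\<Sum>i\<in>UNIV. (norm (A $ i))^2)" by (simp only: power2_norm_eq_inner inner_vec_def[of A A])
  then show ?thesis by (simp only: power_mult_distrib sum_distrib_right)
 qed
 finally show "(norm (A *v h))^2 <= (norm A * norm h)^2" .
qed simp

text \<open>The rank-one matrix by which the Jacobian of a cutoff times a field differs from the
  cutoff times the Jacobian.\<close>

definition outer :: "real^'m => real^'d => real^'d^'m" where
 "outer \<gamma> h = (\<chi> \<alpha> i. \<gamma> $ \<alpha> * h $ i)"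

lemma inner_outer: "outer \<gamma> h \<bullet> B = \<gamma> \<bullet> (B *v h)"
 by (simp add: outer_def inner_vec_def matrix_vector_mult_def sum_distrib_left mult_ac)

lemma norm_outer: "norm (outer \<gamma> h) = norm \<gamma> * norm h"
proof -
 have "outer \<gamma> h *v h = (norm h)^2 *\<^sub>R \<gamma>"
  by (simp add: vec_eq_iff outer_def matrix_vector_mult_def power2_norm_eq_inner inner_vec_def sum_distrib_left mult_ac)
 then have "(norm (outer \<gamma> h))^2 = (norm \<gamma> * norm h)^2"
  by (simp add: power2_norm_eq_inner[of "outer \<gamma> h"] inner_outer power_mult_distrib power2_norm_eq_inner[of \<gamma>])
 then show ?thesis by (simp add: power2_eq_iff_nonneg)
qed

lemma outer_measurable[measurable (raw)]:
 assumes [measurable]: "f \<in> borel_measurable M" "g \<in> borel_measurable M"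
 shows "(%x. outer (f x :: real^'m) (g x :: real^'d)) \<in> borel_measurable M"
proof -
 have "continuous_on UNIV (%p. outer (fst p :: real^'m) (snd p :: real^'d))" unfolding outer_def by (intro continuous_intros)
 then have "borel_fun (%p. outer (fst p :: real^'m) (snd p :: real^'d))" by (rule borel_measurable_continuous_onI)
 from measurable_compose[OF borel_measurable_Pair[OF assms] this] show ?thesis by simp
qed

lemma matrix_vector_measurable[measurable (raw)]:
 assumes [measurable]: "f \<in> borel_measurable M" "g \<in> borel_measurable M"
 shows "(%x. (f x :: real^'d^'m) *v (g x :: real^'d)) \<in> borel_measurable M"
proof -
 have "continuous_on UNIV (%p. (fst p :: real^'d^'m) *v (snd p :: real^'d))" unfolding matrix_vector_mult_def by (intro continuous_intros)
 then have "borel_fun (%p. (fst p :: real^'d^'m) *v (snd p :: real^'d))" by (rule borel_measurable_continuous_onI)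
 from measurable_compose[OF borel_measurable_Pair[OF assms] this] show ?thesis by simp
qed

lemma jac_derivative:
 assumes "\<phi> differentiable (at x)"
 shows "(\<phi> has_derivative (%h. jac \<phi> x *v h)) (at x)"
proof -
 have d: "(\<phi> has_derivative frechet_derivative \<phi> (at x)) (at x)" using assms frechet_derivative_works by blast
 then have "linear (frechet_derivative \<phi> (at x))" by (rule has_derivative_linear)
 then have "frechet_derivative \<phi> (at x) = (%h. jac \<phi> x *v h)" unfolding jac_def by (simp add: matrix_works)
 with d show ?thesis by simp
qed

lemma jac_eqI:
 assumes "(\<phi> has_derivative (%h. B *v h)) (at x)"
 shows "jac \<phi> x = B" using frechet_derivative_at[OF assms] unfolding jac_def by (metis matrix_of_matrix_vector_mul)

lemma C1cD:
 assumes "C1c \<Omega> (\<phi> :: real^'d => real^'m)"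
 obtains K where "compact K" "K \<subseteq> \<Omega>" "!!x. x \<notin> K ==> \<phi> x = 0" "!!x. x \<notin> K ==> jac \<phi> x = 0"
proof -
 obtain K where K: "compact K" "K \<subseteq> \<Omega>" "!!x. x \<notin> K ==> \<phi> x = 0" using assms unfolding C1c_def by auto
 have "jac \<phi> x = 0" if x: "x \<notin> K" for x
 proof (rule jac_eqI)
  have op: "open (- K)" using compact_imp_closed[OF K(1)] by auto
  have "((%x. 0) has_derivative (%h. 0)) (at x)" by simp
  then have "(\<phi> has_derivative (%h. 0)) (at x)" by (rule has_derivative_transform_within_open[OF _ op]) (use x K in auto)
  then show "(\<phi> has_derivative (%h. 0 *v h)) (at x)" by simp
 qed
 with K that show thesis by blast
qed

lemma L2_bounded_support:
 fixes F :: "'a::euclidean_space => 'b::euclidean_space"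
 assumes "borel_fun F" "!!x. norm (F x) <= B" "!!x. x \<notin> K ==> F x = 0" "bounded K"
 shows "L2 F"
proof -
 obtain r where r: "K \<subseteq> ball 0 r" using bounded_subset_ballD[OF assms(4)] by blast
 have "nint (%x. ennreal ((norm (F x))^2)) <= nint (%x. ennreal (B^2) * indicator (ball (0::'a) r) x)"
 proof (intro nn_integral_mono)
  fix x show "ennreal ((norm (F x))^2) <= ennreal (B^2) * indicator (ball 0 r) x"
   using assms(2)[of x] assms(3)[of x] r by (cases "x \<in> K") (auto intro!: ennreal_leI power_mono simp: indicator_def)
 qed
 also have "... = ennreal (B^2) * vol (ball (0::'a) r)" by (rule nn_integral_cmult_indicator) simp
 also have "... < top" using emeasure_ball_fin[of "0::'a" r] by (simp add: ennreal_mult_less_top)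
 finally show ?thesis using assms(1) by (simp add: L2_def)
qed

lemma C1c_regular:
 assumes C: "C1c \<Omega> (\<phi> :: real^'d => real^'m)"
 shows "continuous_on UNIV \<phi>" "continuous_on UNIV (jac \<phi>)" "borel_fun \<phi>" "borel_fun (jac \<phi>)"
  "L2 \<phi>" "L2 (jac \<phi>)" "\<exists>B. \<forall>x. norm (jac \<phi> x) <= B"
proof -
 show c: "continuous_on UNIV \<phi>" using C unfolding C1c_def by (intro continuous_at_imp_continuous_on) (auto intro: differentiable_imp_continuous_within)
 show j: "continuous_on UNIV (jac \<phi>)" using C unfolding C1c_def by auto
 show m: "borel_fun \<phi>" "borel_fun (jac \<phi>)" using c j borel_measurable_continuous_onI by auto
 obtain K where K: "compact K" "!!x. x \<notin> K ==> \<phi> x = 0" "!!x. x \<notin> K ==> jac \<phi> x = 0" using C1cD[OF C] by metis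
 have bd: "\<exists>B. \<forall>x. norm (f x) <= B" if "continuous_on UNIV f" "!!x. x \<notin> K ==> f x = 0" for f :: "real^'d => 'b::real_normed_vector"
 proof -
  have "bounded (f ` K)" by (intro compact_imp_bounded compact_continuous_image continuous_on_subset[OF that(1)] K) auto
  then obtain B where "!!x. x \<in> K ==> norm (f x) <= B" by (auto simp: bounded_iff)
  then have "norm (f x) <= max B 0" for x using that(2)[of x] by (cases "x \<in> K") (auto simp: le_max_iff_disj)
  then show ?thesis by blast
 qed
 show "\<exists>B. \<forall>x. norm (jac \<phi> x) <= B" by (rule bd[OF j K(3)])
 then show "L2 (jac \<phi>)" using L2_bounded_support[OF m(2) _ K(3) compact_imp_bounded[OF K(1)]] by blast
 show "L2 \<phi>" using bd[OF c K(2)] L2_bounded_support[OF m(1) _ K(2) compact_imp_bounded[OF K(1)]] by blast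
qed

text \<open>A substitute for the Riesz potential of order one: the integral over t of
  \<open>t^-d\<close> on \<open>|x - z| < 6 \<rho> t\<close> behaves like
  \<open>|x - z|^(1 - d)\<close> near the diagonal when d > 1. Keeping t as a variable allows the A1
  condition to be applied ball by ball.\<close>

definition riesz :: "real => ('a::euclidean_space => ennreal) => 'a => ennreal" where
 "riesz \<rho> g x = sint {0<..<1} (%t. ennreal (1 / t ^ DIM('a)) * sint (ball x (6 * \<rho> * t)) g)"

lemma riesz_borel:
 fixes g :: "'a::euclidean_space => ennreal"
 assumes [measurable]: "borel_fun g"
 shows "borel_fun (riesz \<rho> g)"
proof -
 have "riesz \<rho> g = (%z. sint {0<..<1} (%t. ennreal (1 / t ^ DIM('a)) *
   (nint (%x. g x * (if dist z x < 6 * \<rho> * t then 1 else 0)))))"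
 proof
  fix z
  have "sint (ball z (6 * \<rho> * t)) g = nint (%x. g x * (if dist z x < 6 * \<rho> * t then 1 else 0))" for t
   by (intro nn_integral_cong) (auto simp: indicator_def)
  then show "riesz \<rho> g z = sint {0<..<1} (%t. ennreal (1 / t ^ DIM('a)) *
   (nint (%x. g x * (if dist z x < 6 * \<rho> * t then 1 else 0))))" unfolding riesz_def by simp
 qed
 also have "borel_fun (...)" by measurable
 finally show ?thesis .
qed

lemma bavg_inner:
 fixes \<phi> :: "'a::euclidean_space => 'b::euclidean_space"
 assumes "continuous_on UNIV \<phi>"
 shows "w \<bullet> bavg (ball q s) \<phi> = bavg (ball q s) (%x. w \<bullet> \<phi> x)"
proof -
 have "integrable lborel (%y. indicator (ball q s) y *\<^sub>R \<phi> y)"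
 proof -
  have "bounded (\<phi> ` cball q s)" by (intro compact_imp_bounded compact_continuous_image continuous_on_subset[OF assms]) auto
  then obtain B where "\<forall>y\<in>\<phi> ` cball q s. norm y <= B" unfolding bounded_iff by blast
  then show ?thesis using borel_measurable_continuous_onI[OF assms] emeasure_lborel_ball_finite[of q s]
   by (intro integrableI_bounded_set_indicator[where B=B]) (auto intro!: AE_I2)
 qed
 then show ?thesis unfolding bavg_def by (simp add: integral_inner_right[symmetric] del: integral_inner_right)
qed

context
 fixes x0 q :: "real^'d" and \<rho> s :: real and \<Omega> :: "(real^'d) set"
 assumes \<rho>: "0 < \<rho>" and s: "0 < s" and sub: "ball q s \<subseteq> ball x0 (3 * \<rho>)"
begin

lemma kern_bound:
 assumes "x \<in> ball x0 (3 * \<rho>)"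
 shows "ennreal (kern (ball q s) z x t * norm (x - z)) <= ennreal (6 * \<rho> / measure lborel (ball q s)) *
   (ennreal (1 / t ^ CARD('d)) * indicator {0<..<1} t * indicator (ball x (6 * \<rho> * t)) z * indicator (ball x0 (3 * \<rho>)) z)"
proof (cases "kern (ball q s) z x t = 0")
 case False
 note k = kern_support[OF False sub assms]
 have m: "0 < measure lborel (ball q s)" using s by (simp add: content_ball_pos)
 have "kern (ball q s) z x t * norm (x - z) <= 1 / (measure lborel (ball q s) * t ^ Suc CARD('d)) * (6 * \<rho> * t)"
  using k m by (intro mult_mono) (auto simp: kern_def dist_norm)
 also have "... = 6 * \<rho> / measure lborel (ball q s) * (1 / t ^ CARD('d))" using k by simp
 finally have "ennreal (kern (ball q s) z x t * norm (x - z)) <= ennreal (6 * \<rho> / measure lborel (ball q s)) * ennreal (1 / t ^ CARD('d))"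
  using k m \<rho> by (subst ennreal_mult[symmetric]) (auto intro!: ennreal_leI)
 then show ?thesis using k by simp
qed simp

lemma kern_representation_vec:
 assumes C: "C1c \<Omega> (\<phi> :: real^'d => real^'m)"
 shows "w \<bullet> (\<phi> x - bavg (ball q s) \<phi>) = (LINT t|lborel. (LINT z|lborel. kern (ball q s) z x t * (w \<bullet> (jac \<phi> z *v (x - z)))))"
proof -
 obtain B where B: "!!x. norm (jac \<phi> x) <= B" using C1c_regular(7)[OF C] by blast
 let ?g = "%z. w v* jac \<phi> z"
 have "(%x. w \<bullet> \<phi> x) x - bavg (ball q s) (%x. w \<bullet> \<phi> x)
   = (LINT t|lborel. (LINT z|lborel. kern (ball q s) z x t * (?g z \<bullet> (x - z))))"
 proof (rule kern_representation[where B="norm w * B"])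
  fix z
  have "(\<phi> has_derivative (%h. jac \<phi> z *v h)) (at z)" using C by (intro jac_derivative) (auto simp: C1c_def)
  then have "((%x. w \<bullet> \<phi> x) has_derivative (%h. w \<bullet> (jac \<phi> z *v h))) (at z)" by (rule has_derivative_inner_right)
  then show "((%x. w \<bullet> \<phi> x) has_derivative (%h. ?g z \<bullet> h)) (at z)" by (simp add: dot_lmul_matrix)
  have "(norm (?g z))^2 = w \<bullet> (jac \<phi> z *v ?g z)" by (simp add: power2_norm_eq_inner dot_lmul_matrix)
  also have "... <= norm w * norm (jac \<phi> z *v ?g z)" by (rule norm_cauchy_schwarz)
  also have "... <= norm w * (norm (jac \<phi> z) * norm (?g z))" by (intro mult_left_mono norm_matrix_vector_le) auto
  also have "... <= norm w * (B * norm (?g z))" using B by (intro mult_left_mono mult_right_mono) auto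
  finally have "norm (?g z) * norm (?g z) <= (norm w * B) * norm (?g z)" by (simp add: power2_eq_square mult_ac)
  moreover have "0 <= B" using B norm_ge_zero order_trans by blast
  ultimately show "norm (?g z) <= norm w * B" by (cases "norm (?g z) = 0") (auto simp: mult_le_cancel_right)
  show "continuous_on UNIV ?g" unfolding vector_matrix_mult_def by (intro continuous_intros C1c_regular(2)[OF C])
 qed (use s in auto)
 moreover have "w \<bullet> (\<phi> x - bavg (ball q s) \<phi>) = w \<bullet> \<phi> x - bavg (ball q s) (%x. w \<bullet> \<phi> x)"
  unfolding inner_diff_right bavg_inner[OF C1c_regular(1)[OF C]] ..
 ultimately show ?thesis by (simp only: dot_lmul_matrix)
qed

text \<open>The representation formula is scalar, so it is tested with the vector
  \<open>\<phi> x - bavg b \<phi>\<close> itself. This gives its squared norm on the left, and one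
  factor of the norm cancels.\<close>

lemma poincare_pointwise:
 assumes C: "C1c \<Omega> (\<phi> :: real^'d => real^'m)" and x: "x \<in> ball x0 (3 * \<rho>)"
 shows "ennreal (norm (\<phi> x - bavg (ball q s) \<phi>)) <= ennreal (6 * \<rho> / measure lborel (ball q s)) *
  riesz \<rho> (%z. ennreal (norm (jac \<phi> z)) * indicator (ball x0 (3 * \<rho>)) z) x"
proof -
 let ?b = "ball q s" and ?S = "ball x0 (3 * \<rho>)"
 let ?w = "\<phi> x - bavg ?b \<phi>"
 let ?c = "ennreal (6 * \<rho> / measure lborel ?b)"
 let ?h = "%z. ennreal (norm (jac \<phi> z)) * indicator ?S z"
 have [measurable]: "borel_fun (jac \<phi>)" by (rule C1c_regular[OF C])
 have pt: "ennreal (norm (kern ?b z x t * (?w \<bullet> (jac \<phi> z *v (x - z)))))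
   <= (ennreal (norm ?w) * ?c * (ennreal (1 / t ^ CARD('d)) * indicator {0<..<1} t)) * (?h z * indicator (ball x (6 * \<rho> * t)) z)" for z t
 proof -
  have "norm (kern ?b z x t * (?w \<bullet> (jac \<phi> z *v (x - z)))) <= kern ?b z x t * (norm ?w * (norm (jac \<phi> z) * norm (x - z)))"
  proof -
   have "\<bar>?w \<bullet> (jac \<phi> z *v (x - z))\<bar> <= norm ?w * norm (jac \<phi> z *v (x - z))" by (rule Cauchy_Schwarz_ineq2)
   also have "... <= norm ?w * (norm (jac \<phi> z) * norm (x - z))" by (intro mult_left_mono norm_matrix_vector_le) auto
   finally show ?thesis using kern_nonneg[of ?b z x t] by (simp add: abs_mult mult_left_mono)
  qed
  also have "... = (norm ?w * norm (jac \<phi> z)) * (kern ?b z x t * norm (x - z))" by (simp only: mult_ac)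
  finally have "ennreal (norm (kern ?b z x t * (?w \<bullet> (jac \<phi> z *v (x - z)))))
    <= ennreal ((norm ?w * norm (jac \<phi> z)) * (kern ?b z x t * norm (x - z)))" by (rule ennreal_leI)
  also have "... = ennreal (norm ?w) * ennreal (norm (jac \<phi> z)) * ennreal (kern ?b z x t * norm (x - z))"
   using kern_nonneg[of ?b z x t] by (subst ennreal_mult) (auto simp: ennreal_mult)
  also have "... <= ennreal (norm ?w) * ennreal (norm (jac \<phi> z)) * (?c *
   (ennreal (1 / t ^ CARD('d)) * indicator {0<..<1} t * indicator (ball x (6 * \<rho> * t)) z * indicator ?S z))" by (intro mult_left_mono kern_bound[OF x]) auto
  finally show ?thesis by (simp only: mult_ac)
 qed
 have "ennreal (norm ?w) * ennreal (norm ?w) = ennreal (norm (?w \<bullet> ?w))"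
  by (simp add: ennreal_mult[symmetric] power2_norm_eq_inner[symmetric] power2_eq_square)
 also have "... <= nint (%t. ennreal (norm (LINT z|lborel. kern ?b z x t * (?w \<bullet> (jac \<phi> z *v (x - z))))))"
  unfolding kern_representation_vec[OF C, of ?w x] by (rule ennreal_norm_integral_le)
 also have "... <= nint (%t. (nint (%z. ennreal (norm (kern ?b z x t * (?w \<bullet> (jac \<phi> z *v (x - z))))))))"
  by (intro nn_integral_mono ennreal_norm_integral_le)
 also have "... <= nint (%t. (nint (%z. (ennreal (norm ?w) * ?c * (ennreal (1 / t ^ CARD('d)) * indicator {0<..<1} t)) * (?h z * indicator (ball x (6 * \<rho> * t)) z))))"
  by (intro nn_integral_mono pt)
 also have "... = nint (%t. (ennreal (norm ?w) * ?c * (ennreal (1 / t ^ CARD('d)) * indicator {0<..<1} t)) * sint (ball x (6 * \<rho> * t)) ?h)"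
  by (intro nn_integral_cong nn_integral_cmult) measurable
 also have "... = nint (%t. (ennreal (norm ?w) * ?c) * (ennreal (1 / t ^ CARD('d)) * sint (ball x (6 * \<rho> * t)) ?h * indicator {0<..<1} t))"
  by (intro nn_integral_cong) (simp only: mult_ac)
 also have "... = (ennreal (norm ?w) * ?c) * riesz \<rho> ?h x"
 proof -
  have "(%t. (sint (ball x (6 * \<rho> * t)) ?h)) = (%t. (nint (%z. ?h z * (if dist x z < 6 * \<rho> * t then 1 else 0))))"
   by (intro ext nn_integral_cong) (auto simp: indicator_def)
  also have "borel_fun (...)" by measurable
  finally have [measurable]: "borel_fun (%t. (sint (ball x (6 * \<rho> * t)) ?h))" .
  have "nint (%t. (ennreal (norm ?w) * ?c) * (ennreal (1 / t ^ CARD('d)) * sint (ball x (6 * \<rho> * t)) ?h * indicator {0<..<1} t))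
   = (ennreal (norm ?w) * ?c) * sint {0<..<1} (%t. ennreal (1 / t ^ CARD('d)) * sint (ball x (6 * \<rho> * t)) ?h)" by (rule nn_integral_cmult) measurable
  then show ?thesis unfolding riesz_def by simp
 qed
 finally have main: "ennreal (norm ?w) * ennreal (norm ?w) <= ennreal (norm ?w) * (?c * riesz \<rho> ?h x)" by (simp only: mult.assoc)
 show ?thesis
 proof (cases "?w = 0")
  case False
  then show ?thesis using main by (subst (asm) ennreal_mult_le_mult_iff) auto
 qed simp
qed

end

lemma A1_const: "1 <= c ==> A1 c (%_::'a::euclidean_space. 1)"
proof -
 assume c: "1 <= c"
 have "vol (ball x r) <= ennreal c * vol (ball x r)" for x :: 'a and r using mult_right_mono[of 1 "ennreal c" "vol (ball x r)"] c by simp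
 then show ?thesis by (simp add: A1_def)
qed

section \<open>The potential dual to the mean-value representation\<close>

lemma borel_measurable_fst[measurable]: "borel_fun (fst :: 'a::euclidean_space \<times> 'b::euclidean_space => 'a)"
 by (intro borel_measurable_continuous_onI continuous_intros)

lemma borel_measurable_snd[measurable]: "borel_fun (snd :: 'a::euclidean_space \<times> 'b::euclidean_space => 'b)"
 by (intro borel_measurable_continuous_onI continuous_intros)

lemma nn_integral_lborel_prod:
 fixes F :: "'a::euclidean_space \<times> 'b::euclidean_space => ennreal"
 assumes "borel_fun F"
 shows "nint F = nint (%x. (nint (%y. F (x, y))))"
proof -
 have "F \<in> borel_measurable (lborel \<Otimes>\<^sub>M lborel)" using assms by (simp add: lborel_prod)
 from lborel.nn_integral_fst[OF this] show ?thesis by (simp add: lborel_prod)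
qed

text \<open>For a field \<gamma>, the adjoint of the representation formula yields a matrix field
  whose pairing with \<open>jac \<phi>\<close> equals the pairing of \<gamma> with
  \<open>\<phi> - bavg b \<phi>\<close>. In effect it solves a divergence equation, with a pointwise
  bound by the Riesz potential of \<gamma> and support in the ball of radius
  \<open>3 * \<rho>\<close>.\<close>

locale dual_potential =
 fixes x0 q :: "real^'d" and \<rho> s :: real and \<gamma> :: "real^'d => real^'m"
 assumes \<rho>: "0 < \<rho>" and s: "0 < s" and sub: "ball q s \<subseteq> ball x0 (3 * \<rho>)"
  and \<gamma>: "L2 \<gamma>" and supp: "!!x. x \<notin> ball x0 (3 * \<rho>) ==> \<gamma> x = 0"
begin

definition potential :: "real^'d => real^'d^'m" where
 "potential z = (LINT p|lborel. kern (ball q s) z (fst p) (snd p) *\<^sub>R outer (\<gamma> (fst p)) (fst p - z))"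

lemma gamma_meas[measurable]: "borel_fun \<gamma>" using \<gamma> by (simp add: L2_def)

lemma potential_integrand_measurable:
 "(%(z, p). kern (ball q s) z (fst p) (snd p) *\<^sub>R outer (\<gamma> (fst p)) (fst p - z)) \<in> borel_measurable (lborel \<Otimes>\<^sub>M lborel)"
proof -
 have [measurable]: "(%(z, p). kern (ball q s) z (fst p) (snd p)) \<in> borel_measurable (lborel \<Otimes>\<^sub>M (lborel :: (_ \<times> real) measure))"
  unfolding case_prod_beta by (intro kern_measurable) measurable
 show ?thesis by measurable
qed

lemma potential_measurable[measurable]: "borel_fun potential" unfolding potential_def
 using lborel.borel_measurable_lebesgue_integral[OF potential_integrand_measurable] by simp

text \<open>Absolute convergence of the defining integral. It gives the size of the potential and at
  the same time justifies the interchange of integrals in the duality formula.\<close>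

lemma potential_absolute:
 "nint (%p. ennreal (norm (kern (ball q s) z (fst p) (snd p) *\<^sub>R outer (\<gamma> (fst p)) (fst p - z))))
  <= ennreal (6 * \<rho> / measure lborel (ball q s)) * (riesz \<rho> (%x. ennreal (norm (\<gamma> x))) z * indicator (ball x0 (3 * \<rho>)) z)"
proof -
 let ?b = "ball q s" and ?S = "ball x0 (3 * \<rho>)"
 let ?c = "ennreal (6 * \<rho> / measure lborel ?b)"
 let ?e = "%t::real. ennreal (1 / t ^ CARD('d)) * indicator {0<..<1} t"
 have pt: "ennreal (norm (kern ?b z x t *\<^sub>R outer (\<gamma> x) (x - z)))
   <= (?c * indicator ?S z * ?e t) * (ennreal (norm (\<gamma> x)) * (if dist z x < 6 * \<rho> * t then 1 else 0))" for x t
 proof (cases "x \<in> ?S")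
  case True
  have "ennreal (norm (kern ?b z x t *\<^sub>R outer (\<gamma> x) (x - z))) = ennreal (norm (\<gamma> x)) * ennreal (kern ?b z x t * norm (x - z))"
   using kern_nonneg[of ?b z x t] by (simp add: norm_outer ennreal_mult[symmetric] mult_ac)
  also have "... <= ennreal (norm (\<gamma> x)) * (?c * (?e t * indicator (ball x (6 * \<rho> * t)) z * indicator ?S z))"
   by (intro mult_left_mono kern_bound[OF \<rho> s sub True]) auto
  also have "indicator (ball x (6 * \<rho> * t)) z = (if dist z x < 6 * \<rho> * t then 1 else 0 :: ennreal)" by (simp add: indicator_def dist_commute)
  finally show ?thesis by (simp only: mult_ac)
 next
  case False
  then have "outer (\<gamma> x) (x - z) = 0" using norm_outer[of "\<gamma> x" "x - z"] supp[OF False] by simp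
  then show ?thesis by simp
 qed
 have "nint (%p. ennreal (norm (kern ?b z (fst p) (snd p) *\<^sub>R outer (\<gamma> (fst p)) (fst p - z))))
  <= (\<integral>\<^sup>+p. (?c * indicator ?S z * ?e (snd p)) * (ennreal (norm (\<gamma> (fst p))) * (if dist z (fst p) < 6 * \<rho> * snd p then 1 else 0)) \<partial>(lborel :: ((real^'d) \<times> real) measure))"
  by (intro nn_integral_mono pt)
 also have "... = nint (%x. (nint (%t. (?c * indicator ?S z * ?e t) * (ennreal (norm (\<gamma> x)) * (if dist z x < 6 * \<rho> * t then 1 else 0)))))"
 proof -
  let ?F = "%p. (?c * indicator ?S z * ?e (snd p)) * (ennreal (norm (\<gamma> (fst p))) * (if dist z (fst p) < 6 * \<rho> * snd p then 1 else 0))"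
  have e: "borel_fun ?e" by measurable
  have n: "borel_fun (%x. ennreal (norm (\<gamma> x)))" by measurable
  have "open {p :: (real^'d) \<times> real. dist z (fst p) < 6 * \<rho> * snd p}" by (intro open_Collect_less continuous_intros)
  then have "indicator {p. dist z (fst p) < 6 * \<rho> * snd p} \<in> borel_measurable (borel :: ((real^'d) \<times> real) measure)"
   by (intro borel_measurable_indicator borel_open)
  then have i: "(%p. if dist z (fst p) < 6 * \<rho> * snd p then 1 else 0 :: ennreal) \<in> borel_measurable (borel :: ((real^'d) \<times> real) measure)"
   by (simp add: indicator_def of_bool_def)
  have "?F \<in> borel_measurable (borel :: ((real^'d) \<times> real) measure)" by (intro borel_measurable_times_ennreal borel_measurable_const i
     measurable_compose[OF borel_measurable_snd e] measurable_compose[OF borel_measurable_fst n])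
  from nn_integral_lborel_prod[OF this] show ?thesis by (simp only: fst_conv snd_conv)
 qed
 also have "... = nint (%t. (nint (%x. (?c * indicator ?S z * ?e t) * (ennreal (norm (\<gamma> x)) * (if dist z x < 6 * \<rho> * t then 1 else 0)))))"
  by (rule lborel_pair.Fubini') measurable
 also have "... = nint (%t. (?c * indicator ?S z * ?e t) * nint (%x. ennreal (norm (\<gamma> x)) * (if dist z x < 6 * \<rho> * t then 1 else 0)))"
  by (intro nn_integral_cong nn_integral_cmult) measurable
 also have "... = nint (%t. (?c * indicator ?S z) * (ennreal (1 / t ^ CARD('d)) * nint (%x. ennreal (norm (\<gamma> x)) * (if dist z x < 6 * \<rho> * t then 1 else 0)) * indicator {0<..<1} t))"
  by (intro nn_integral_cong) (simp only: mult_ac)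
 also have "... = (?c * indicator ?S z) * (sint {0<..<1} (%t. ennreal (1 / t ^ CARD('d)) * nint (%x. ennreal (norm (\<gamma> x)) * (if dist z x < 6 * \<rho> * t then 1 else 0))))"
  by (rule nn_integral_cmult) measurable
 also have "(sint {0<..<1} (%t. ennreal (1 / t ^ CARD('d)) * nint (%x. ennreal (norm (\<gamma> x)) * (if dist z x < 6 * \<rho> * t then 1 else 0))))
   = riesz \<rho> (%x. ennreal (norm (\<gamma> x))) z"
 proof -
  have "nint (%x. ennreal (norm (\<gamma> x)) * (if dist z x < 6 * \<rho> * t then 1 else 0)) = (mass (ball z (6 * \<rho> * t)) \<gamma>)" for t
   by (intro nn_integral_cong) (auto simp: indicator_def)
  then show ?thesis unfolding riesz_def by simp
 qed
 finally show ?thesis by (simp only: mult_ac)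
qed

lemma potential_bound:
 "ennreal (norm (potential z)) <= ennreal (6 * \<rho> / measure lborel (ball q s)) *
   (riesz \<rho> (%x. ennreal (norm (\<gamma> x))) z * indicator (ball x0 (3 * \<rho>)) z)"
 unfolding potential_def by (rule order_trans[OF ennreal_norm_integral_le potential_absolute])

lemma riesz_measurable: "borel_fun (riesz \<rho> (%x. ennreal (norm (\<gamma> x))))" by (intro riesz_borel) measurable

text \<open>The case of the constant weight 1 and \<tau> = 1 of
  \<open>local_riesz_bound\<close>.\<close>

lemma riesz_square_finite: "sint (ball x0 (3 * \<rho>)) (%z. (riesz \<rho> (%x. ennreal (norm (\<gamma> x))) z)^2) < top"
proof -
 let ?S = "ball x0 (3 * \<rho>)" and ?g = "%x. ennreal (norm (\<gamma> x))"
 have "sint ?S (%x. 1 * (sint {0<..<1} (%t. ennreal (1 / t ^ DIM(real^'d)) * sint (ball x (6 * \<rho> * t)) ?g))^2)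
   <= ennreal (2 * 1^2 * 1 * (unit_ball_vol (real DIM(real^'d)) * (6 * \<rho>) ^ DIM(real^'d))^2) * nint (%z. (?g z)^2 * 1)
    + ennreal (2 / 1 ^ (2 * DIM(real^'d))) * (nint ?g)^2 * sint ?S (%x. 1)" by (rule local_riesz_bound[OF A1_const]) (use \<rho> in auto)
 also have "... < top"
 proof -
  have g2: "nint (%z. (?g z)^2) < top" using \<gamma> by (simp add: L2_def ennreal_power)
  have gS: "?g z * indicator ?S z = ?g z" "(?g z)^2 * indicator ?S z = (?g z)^2" for z using supp[of z] by (auto simp: indicator_def)
  have "(nint ?g)^2 <= vol ?S * nint (%z. (?g z)^2)" using nn_integral_square_le[of ?g ?S] unfolding gS by simp
  also have "... < top" using g2 emeasure_ball_fin[of x0 "3 * \<rho>"] by (simp add: ennreal_mult_less_top)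
  finally have "(nint ?g)^2 < top" .
  then show ?thesis using g2 emeasure_ball_fin[of x0 "3 * \<rho>"] by (simp add: ennreal_mult_less_top)
 qed
 finally show ?thesis unfolding riesz_def by simp
qed

lemma L2_potential: "L2 potential"
proof -
 let ?S = "ball x0 (3 * \<rho>)" and ?R = "riesz \<rho> (%x. ennreal (norm (\<gamma> x)))"
 let ?c = "ennreal (6 * \<rho> / measure lborel (ball q s))"
 have [measurable]: "borel_fun ?R" by (rule riesz_measurable)
 have "nint (%z. ennreal ((norm (potential z))^2)) <= nint (%z. ?c^2 * ((?R z)^2 * indicator ?S z))"
 proof (intro nn_integral_mono)
  fix z
  have "ennreal ((norm (potential z))^2) <= (?c * (?R z * indicator ?S z))^2" using power_mono[OF potential_bound[of z], of 2] by (simp add: ennreal_power)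
  also have "... = ?c^2 * ((?R z)^2 * indicator ?S z)" by (auto simp: power_mult_distrib indicator_def)
  finally show "ennreal ((norm (potential z))^2) <= ?c^2 * ((?R z)^2 * indicator ?S z)" .
 qed
 also have "... = ?c^2 * sint ?S (%z. (?R z)^2)" by (rule nn_integral_cmult) measurable
 also have "... < top" using riesz_square_finite by (simp add: ennreal_mult_less_top power2_eq_square)
 finally show ?thesis by (simp add: L2_def)
qed

text \<open>Fubini applied to the representation formula for \<phi>, paired with \<gamma>. Square
  integrability of the Riesz potential on a bounded ball gives its integrability there, and
  \<open>jac \<phi>\<close> is bounded, so the triple integral converges absolutely.\<close>

lemma potential_duality:
 assumes C: "C1c \<Omega> (\<phi> :: real^'d => real^'m)"
 shows "(LINT x|lborel. \<gamma> x \<bullet> (\<phi> x - bavg (ball q s) \<phi>)) = ip potential (jac \<phi>)"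
proof -
 let ?b = "ball q s" and ?S = "ball x0 (3 * \<rho>)"
 let ?c = "ennreal (6 * \<rho> / measure lborel ?b)"
 let ?R = "riesz \<rho> (%x. ennreal (norm (\<gamma> x)))"
 have [measurable]: "borel_fun ?R" by (rule riesz_measurable)
 have [measurable]: "borel_fun (jac \<phi>)" by (rule C1c_regular[OF C])
 obtain B where B: "!!x. norm (jac \<phi> x) <= B" using C1c_regular(7)[OF C] by blast
 define f where "f = (%(z, p). kern ?b z (fst p) (snd p) *\<^sub>R outer (\<gamma> (fst p)) (fst p - z))"
 have [measurable]: "f \<in> borel_measurable (lborel \<Otimes>\<^sub>M (lborel :: ((real^'d) \<times> real) measure))"
  unfolding f_def by (rule potential_integrand_measurable)
 have Rfin: "sint ?S ?R < top"
 proof -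
  have "(sint ?S ?R)^2 <= vol ?S * sint ?S (%z. (?R z)^2)" by (rule nn_integral_square_le) measurable
  also have "... < top" using riesz_square_finite emeasure_ball_fin[of x0 "3 * \<rho>"] by (simp add: ennreal_mult_less_top)
  finally have sq: "(sint ?S ?R)^2 < top" .
  show ?thesis
  proof (rule ccontr)
   assume "~ ?thesis"
   then have "sint ?S ?R = top" by (metis less_top)
   then show False using sq by (simp add: power2_eq_square)
  qed
 qed
 have fint: "integrable (lborel \<Otimes>\<^sub>M lborel) f"
 proof (rule integrableI_bounded)
  have "(\<integral>\<^sup>+w. ennreal (norm (f w)) \<partial>(lborel \<Otimes>\<^sub>M lborel)) = nint (%z. (nint (%p. ennreal (norm (f (z, p))))))"
   by (rule lborel.nn_integral_fst[symmetric]) measurable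
  also have "... <= nint (%z. ?c * (?R z * indicator ?S z))" unfolding f_def by (intro nn_integral_mono) (simp only: prod.case potential_absolute)
  also have "... = ?c * sint ?S ?R" by (rule nn_integral_cmult) measurable
  also have "... < top" using Rfin by (simp add: ennreal_mult_less_top)
  finally show "(\<integral>\<^sup>+w. ennreal (norm (f w)) \<partial>(lborel \<Otimes>\<^sub>M lborel)) < \<infinity>" by simp
 qed measurable
 define g where "g = (%(z, p). f (z, p) \<bullet> jac \<phi> z)"
 have gint: "integrable (lborel \<Otimes>\<^sub>M lborel) g"
 proof (rule Bochner_Integration.integrable_bound)
  show "integrable (lborel \<Otimes>\<^sub>M lborel) (%w. B *\<^sub>R f w)" using fint by simp
  show "g \<in> borel_measurable (lborel \<Otimes>\<^sub>M lborel)" unfolding g_def by measurable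
  have "norm (g w) <= norm (B *\<^sub>R f w)" for w
  proof -
   obtain z p where Pair: "w = (z, p)" using surj_pair[of w] by blast
   have "\<bar>f (z, p) \<bullet> jac \<phi> z\<bar> <= norm (f (z, p)) * norm (jac \<phi> z)" by (rule Cauchy_Schwarz_ineq2)
   also have "... <= norm (f (z, p)) * \<bar>B\<bar>" using B[of z] by (intro mult_left_mono) auto
   finally show ?thesis using Pair by (simp add: g_def mult.commute)
  qed
  then show "AE w in lborel \<Otimes>\<^sub>M lborel. norm (g w) <= norm (B *\<^sub>R f w)" by simp
 qed
 have g_eq: "g (z, (x, t)) = kern ?b z x t * (\<gamma> x \<bullet> (jac \<phi> z *v (x - z)))" for z x t by (simp add: g_def f_def inner_outer)
 have "ip potential (jac \<phi>) = (LINT z|lborel. (LINT p|lborel. g (z, p)))" unfolding ip_def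
 proof (rule integral_cong_AE)
  show "AE z in lborel. potential z \<bullet> jac \<phi> z = (LINT p|lborel. g (z, p))" using lborel_pair.AE_integrable_fst'[OF fint]
  proof eventually_elim
   fix z assume i: "integrable lborel (%p. f (z, p))"
   have "potential z = (LINT p|lborel. f (z, p))" unfolding potential_def f_def by simp
   then show "potential z \<bullet> jac \<phi> z = (LINT p|lborel. g (z, p))" using integral_inner_left[of "jac \<phi> z", OF i] by (simp add: g_def)
  qed
  show "(%z. LINT p|lborel. g (z, p)) \<in> borel_measurable lborel" using borel_measurable_integrable[OF lborel_pair.integrable_fst'[OF gint]] .
 qed measurable
 also have "... = (LINT p|lborel. (LINT z|lborel. g (z, p)))"
 proof -
  have "integrable (lborel \<Otimes>\<^sub>M lborel) (%(z, p). g (z, p))" using gint by simp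
  from lborel_pair.Fubini_integral[OF this] show ?thesis by simp
 qed
 also have "... = (LINT x|lborel. (LINT t|lborel. (LINT z|lborel. g (z, (x, t)))))"
 proof -
  have "integrable (lborel \<Otimes>\<^sub>M lborel) (%(p, z). g (z, p))" by (rule lborel_pair.integrable_product_swap[OF gint])
  from lborel_pair.integrable_fst'[OF this] have "integrable (lborel \<Otimes>\<^sub>M lborel) (%p. LINT z|lborel. g (z, p))" by (simp add: lborel_prod)
  from lborel_pair.integral_fst'[OF this] show ?thesis by (simp add: lborel_prod)
 qed
 also have "... = (LINT x|lborel. \<gamma> x \<bullet> (\<phi> x - bavg ?b \<phi>))" unfolding kern_representation_vec[OF \<rho> s sub C] g_eq ..
 finally show ?thesis by simp
qed

end

section \<open>Cutoffs and Sobolev functions vanishing at the boundary\<close>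

lemma has_derivative_pos_part_square:
 "((%t::real. (max 0 t)^2) has_real_derivative 2 * max 0 t) (at t)"
proof -
 consider "t > 0" | "t < 0" | "t = 0" by linarith
 then show ?thesis
 proof cases
  case 1
  have "((%t::real. t^2) has_real_derivative 2 * max 0 t) (at t)" using 1 by (auto intro!: derivative_eq_intros)
  then show ?thesis by (rule has_field_derivative_transform_within_open[where S="{0<..}"]) (use 1 in auto)
 next
  case 2
  have "((%t::real. 0) has_real_derivative 2 * max 0 t) (at t)" using 2 by (auto intro!: derivative_eq_intros)
  then show ?thesis by (rule has_field_derivative_transform_within_open[where S="{..<0}"]) (use 2 in auto)
 next
  case 3
  have "(%h::real. ((max 0 (0 + h))^2 - (max 0 0)^2) / h) \<midarrow>0\<rightarrow> 0"
  proof (rule Lim_null_comparison)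
   have "norm (((max 0 (0 + h))^2 - (max 0 0)^2) / h) <= \<bar>h\<bar>" for h :: real by (auto simp: max_def power2_eq_square)
   then show "\<forall>\<^sub>F h in at 0. norm (((max 0 (0 + h))^2 - (max 0 0)^2) / h) <= \<bar>h :: real\<bar>" by simp
   show "(%h::real. \<bar>h\<bar>) \<midarrow>0\<rightarrow> 0" using tendsto_rabs_zero[OF tendsto_ident_at[of "0::real" UNIV]] by simp
  qed
  then show ?thesis using 3 by (simp add: DERIV_def)
 qed
qed

text \<open>The gradient is carried along as an explicit vector field because it enters products and
  potentials as a field in its own right.\<close>

definition cutoff :: "'a::euclidean_space => real => ('a => real) => ('a => 'a) => bool" where
 "cutoff x0 \<rho> \<eta> d\<eta> \<longleftrightarrow> (\<forall>x. (\<eta> has_derivative (%h. d\<eta> x \<bullet> h)) (at x)) & continuous_on UNIV d\<eta> &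
   (\<forall>x. 0 <= \<eta> x & \<eta> x <= 1) & (\<forall>x\<in>ball x0 \<rho>. \<eta> x = 1) & (\<forall>x. x \<notin> cball x0 (3/2 * \<rho>) --> \<eta> x = 0 & d\<eta> x = 0) &
   (\<forall>x. norm (d\<eta> x) <= 12 / \<rho>)"

text \<open>With \<open>s x\<close> the squared distance over \<open>\<rho>^2\<close>, two nested
  squares of positive parts produce a C^1 function that is 1 for \<open>s x <= 1\<close> and 0 for
  \<open>s x >= 2\<close>. The radius \<open>3/2 * \<rho>\<close> suffices for the support because
  9/4 exceeds 2, and 12 is 8 times 3/2.\<close>

lemma cutoff_exists:
 fixes x0 :: "'a::euclidean_space"
 assumes \<rho>: "0 < \<rho>"
 shows "\<exists>\<eta> d\<eta>. cutoff x0 \<rho> \<eta> d\<eta>"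
proof -
 define s where "s x = (norm (x - x0))^2 / \<rho>^2" for x
 define p where "p x = (max 0 (s x - 1))^2" for x
 define \<eta> where "\<eta> x = (max 0 (1 - p x))^2" for x
 define c where "c x = - 2 * max 0 (1 - p x) * (2 * max 0 (s x - 1)) * (2 / \<rho>^2)" for x
 define d\<eta> where "d\<eta> x = c x *\<^sub>R (x - x0)" for x
 have ds: "(s has_derivative (%h. 2 / \<rho>^2 * ((x - x0) \<bullet> h))) (at x)" for x
 proof -
  have "((%x. x - x0) has_derivative (%h. h)) (at x)" by (auto intro!: derivative_eq_intros)
  from has_derivative_inner[OF this this]
  have "((%x. (x - x0) \<bullet> (x - x0)) has_derivative (%h. (x - x0) \<bullet> h + h \<bullet> (x - x0))) (at x)" .
  from has_derivative_mult_right[OF this, of "1 / \<rho>^2"]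
  show ?thesis unfolding s_def power2_norm_eq_inner by (simp add: inner_commute)
 qed
 have chain: "((%x. (max 0 (f x))^2) has_derivative (%h. 2 * max 0 (f x) * f' h)) (at x)"
  if "(f has_derivative f') (at x)" for f :: "'a => real" and f' x
  using has_derivative_compose[OF that has_derivative_pos_part_square[unfolded has_field_derivative_def]] by simp
 have dp: "(p has_derivative (%h. 2 * max 0 (s x - 1) * (2 / \<rho>^2 * ((x - x0) \<bullet> h)))) (at x)" for x
  unfolding p_def by (rule chain) (use has_derivative_diff[OF ds has_derivative_const] in simp)
 have d\<eta>: "(\<eta> has_derivative (%h. 2 * max 0 (1 - p x) * (0 - 2 * max 0 (s x - 1) * (2 / \<rho>^2 * ((x - x0) \<bullet> h))))) (at x)" for x
  unfolding \<eta>_def by (rule chain) (rule has_derivative_diff[OF has_derivative_const dp])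
 have s2: "s x >= 2" if "x \<notin> cball x0 (3/2 * \<rho>)" for x
 proof -
  have "3/2 * \<rho> <= norm (x - x0)" using that by (simp add: dist_norm norm_minus_commute)
  then have "(3/2 * \<rho>)^2 <= (norm (x - x0))^2" using \<rho> by (intro power_mono) auto
  then have "9/4 * \<rho>^2 <= (norm (x - x0))^2" by (simp add: power_mult_distrib power_divide)
  moreover have "0 <= \<rho>^2" by simp
  ultimately have "2 * \<rho>^2 <= (norm (x - x0))^2" by linarith
  then show ?thesis using \<rho> by (simp add: s_def le_divide_eq)
 qed
 have p1: "1 <= p x" if "2 <= s x" for x using that power_mono[of 1 "s x - 1" 2] by (simp add: p_def max_def)
 have "cutoff x0 \<rho> \<eta> d\<eta>" unfolding cutoff_def
 proof (intro conjI allI ballI impI)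
  fix x
  show "(\<eta> has_derivative (%h. d\<eta> x \<bullet> h)) (at x)" using d\<eta>[of x] by (simp add: d\<eta>_def c_def mult_ac)
  show "continuous_on UNIV d\<eta>" unfolding d\<eta>_def c_def p_def s_def using \<rho> by (intro continuous_intros) auto
  show "0 <= \<eta> x" by (simp add: \<eta>_def)
  have "0 <= p x" by (simp add: p_def)
  then show "\<eta> x <= 1" by (auto simp: \<eta>_def max_def power_le_one)
  show "norm (d\<eta> x) <= 12 / \<rho>"
  proof (cases "2 <= s x")
   case True
   then show ?thesis using p1[of x] \<rho> by (simp add: d\<eta>_def c_def)
  next
   case False
   have "(norm (x - x0))^2 < 2 * \<rho>^2" using False \<rho> by (simp add: s_def le_divide_eq)
   moreover have "(3/2 * \<rho>)^2 = 9/4 * \<rho>^2" by (simp add: power_mult_distrib power_divide)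
   moreover have "0 <= \<rho>^2" by simp
   ultimately have "(norm (x - x0))^2 <= (3/2 * \<rho>)^2" by linarith
   then have n: "norm (x - x0) <= 3/2 * \<rho>" by (rule power2_le_imp_le) (use \<rho> in auto)
   have "\<bar>c x\<bar> = (2 * max 0 (1 - p x)) * (2 * max 0 (s x - 1)) * (2 / \<rho>^2)" by (simp add: c_def abs_mult)
   also have "... <= (2 * 1) * (2 * 1) * (2 / \<rho>^2)" using False \<open>0 <= p x\<close> by (intro mult_mono mult_right_mono) auto
   finally have "\<bar>c x\<bar> <= 8 / \<rho>^2" by simp
   then have "\<bar>c x\<bar> * norm (x - x0) <= 8 / \<rho>^2 * (3/2 * \<rho>)" using n by (intro mult_mono) auto
   also have "... = 12 / \<rho>" using \<rho> by (simp add: power2_eq_square)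
   finally show ?thesis by (simp add: d\<eta>_def)
  qed
 next
  fix x assume "x \<in> ball x0 \<rho>"
  then have "(norm (x - x0))^2 <= \<rho>^2" by (intro power_mono) (auto simp: dist_norm norm_minus_commute)
  then have "s x <= 1" using \<rho> by (simp add: s_def)
  then show "\<eta> x = 1" by (simp add: \<eta>_def p_def)
 next
  fix x assume "x \<notin> cball x0 (3/2 * \<rho>)"
  then have "1 <= p x" using s2 p1 by blast
  then show "\<eta> x = 0" "d\<eta> x = 0" by (auto simp: \<eta>_def d\<eta>_def c_def)
 qed
 then show ?thesis by blast
qed

lemma cutoff_product:
 fixes \<phi> :: "real^'d => real^'m"
 assumes \<eta>: "cutoff x0 \<rho> \<eta> d\<eta>" and d: "!!x. (\<phi> has_derivative (%h. B x *v h)) (at x)" and cB: "continuous_on UNIV B"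
  and K: "compact K" "K \<subseteq> \<Omega>" "!!x. x \<notin> K ==> \<eta> x *\<^sub>R \<phi> x = 0"
 shows "C1c \<Omega> (%x. \<eta> x *\<^sub>R \<phi> x)" "jac (%x. \<eta> x *\<^sub>R \<phi> x) = (%x. \<eta> x *\<^sub>R B x + outer (\<phi> x) (d\<eta> x))"
proof -
 have dd: "((%x. \<eta> x *\<^sub>R \<phi> x) has_derivative (%h. (\<eta> x *\<^sub>R B x + outer (\<phi> x) (d\<eta> x)) *v h)) (at x)" for x
 proof -
  have "(\<eta> has_derivative (%h. d\<eta> x \<bullet> h)) (at x)" using \<eta> by (simp add: cutoff_def)
  from has_derivative_scaleR[OF this d[of x]]
  have "((%x. \<eta> x *\<^sub>R \<phi> x) has_derivative (%h. \<eta> x *\<^sub>R (B x *v h) + (d\<eta> x \<bullet> h) *\<^sub>R \<phi> x)) (at x)" .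
  moreover have "\<eta> x *\<^sub>R (B x *v h) + (d\<eta> x \<bullet> h) *\<^sub>R \<phi> x = (\<eta> x *\<^sub>R B x + outer (\<phi> x) (d\<eta> x)) *v h" for h
   by (simp add: vec_eq_iff matrix_vector_mult_def outer_def inner_vec_def sum_distrib_left sum_distrib_right sum.distrib algebra_simps)
  ultimately show ?thesis by simp
 qed
 show j: "jac (%x. \<eta> x *\<^sub>R \<phi> x) = (%x. \<eta> x *\<^sub>R B x + outer (\<phi> x) (d\<eta> x))" by (rule ext) (rule jac_eqI[OF dd])
 have c\<phi>: "continuous_on UNIV \<phi>" using d has_derivative_continuous by (intro continuous_at_imp_continuous_on) blast
 have c\<eta>: "continuous_on UNIV \<eta>" using \<eta> has_derivative_continuous unfolding cutoff_def by (intro continuous_at_imp_continuous_on) blast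
 have cd: "continuous_on UNIV d\<eta>" using \<eta> by (simp add: cutoff_def)
 have "continuous_on UNIV (%x. \<eta> x *\<^sub>R B x + outer (\<phi> x) (d\<eta> x))" unfolding outer_def by (intro continuous_intros c\<phi> c\<eta> cd cB)
 then show "C1c \<Omega> (%x. \<eta> x *\<^sub>R \<phi> x)" unfolding C1c_def j using dd K by (auto simp: differentiable_def)
qed

lemma cutoff_regular:
 assumes "cutoff (x0::'a::euclidean_space) \<rho> \<eta> d\<eta>"
 shows "borel_fun \<eta>" "borel_fun d\<eta>"
proof -
 have "continuous_on UNIV \<eta>" using assms has_derivative_continuous unfolding cutoff_def by (intro continuous_at_imp_continuous_on) blast
 then show "borel_fun \<eta>" by (rule borel_measurable_continuous_onI)
 show "borel_fun d\<eta>" using assms unfolding cutoff_def by (intro borel_measurable_continuous_onI) auto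
qed

text \<open>A whole-space form of \<open>H10\<close>: the function and its gradient are Borel,
  square integrable and equal to 0 at every point outside the domain, so that integrals over the
  domain become integrals over the space and differences stay in the class.\<close>

definition h1 :: "(real^'d) set => (real^'d => real^'m) => (real^'d => real^'d^'m) => bool" where
 "h1 \<Omega> U G \<longleftrightarrow> L2 U & L2 G & (\<forall>x. x \<notin> \<Omega> --> U x = 0 & G x = 0) &
   (\<exists>\<phi>. (\<forall>k. C1c \<Omega> (\<phi> k)) & (%k. n2 (%x. \<phi> k x - U x)) ~~~> 0 & (%k. n2 (%x. jac (\<phi> k) x - G x)) ~~~> 0)"

text \<open>Both components are used with the Hilbert space lemmas throughout.\<close>

lemma h1_L2: "h1 \<Omega> U G ==> L2 U" "h1 \<Omega> U G ==> L2 G" by (auto simp: h1_def)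

lemma h1_test:
 assumes "L2 F" "!!\<phi>. C1c \<Omega> \<phi> ==> ip F (jac \<phi>) = 0" "h1 \<Omega> U G"
 shows "ip F G = 0"
proof -
 obtain \<phi> where \<phi>: "!!k. C1c \<Omega> (\<phi> k)" "(%k. n2 (%x. jac (\<phi> k) x - G x)) ~~~> 0" using assms(3) by (auto simp: h1_def)
 have "(%k. ip (jac (\<phi> k)) F) ~~~> ip G F" by (rule ip_tendsto[OF C1c_regular(6)[OF \<phi>(1)] h1_L2(2)[OF assms(3)] assms(1) \<phi>(2)])
 moreover have "ip (jac (\<phi> k)) F = 0" for k using assms(2)[OF \<phi>(1)] by (simp add: ip_commute)
 ultimately have "(%k::nat. 0::real) ~~~> ip G F" by simp
 then show ?thesis by (simp add: LIMSEQ_const_iff ip_commute)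
qed

lemma C1c_comb:
 assumes "C1c \<Omega> (\<phi> :: real^'d => real^'m)" "C1c \<Omega> \<psi>"
 shows "C1c \<Omega> (%x. c *\<^sub>R \<phi> x + d *\<^sub>R \<psi> x)" "jac (%x. c *\<^sub>R \<phi> x + d *\<^sub>R \<psi> x) = (%x. c *\<^sub>R jac \<phi> x + d *\<^sub>R jac \<psi> x)"
proof -
 have dd: "((%x. c *\<^sub>R \<phi> x + d *\<^sub>R \<psi> x) has_derivative (%h. (c *\<^sub>R jac \<phi> x + d *\<^sub>R jac \<psi> x) *v h)) (at x)" for x
 proof -
  have "((%x. c *\<^sub>R \<phi> x + d *\<^sub>R \<psi> x) has_derivative (%h. c *\<^sub>R (jac \<phi> x *v h) + d *\<^sub>R (jac \<psi> x *v h))) (at x)"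
   using assms by (intro has_derivative_add has_derivative_scaleR_right jac_derivative) (auto simp: C1c_def)
  moreover have "c *\<^sub>R (jac \<phi> x *v h) + d *\<^sub>R (jac \<psi> x *v h) = (c *\<^sub>R jac \<phi> x + d *\<^sub>R jac \<psi> x) *v h" for h
   by (simp add: vec_eq_iff matrix_vector_mult_def sum_distrib_left sum.distrib algebra_simps)
  ultimately show ?thesis by simp
 qed
 show j: "jac (%x. c *\<^sub>R \<phi> x + d *\<^sub>R \<psi> x) = (%x. c *\<^sub>R jac \<phi> x + d *\<^sub>R jac \<psi> x)" by (rule ext) (rule jac_eqI[OF dd])
 obtain K where K: "compact K" "K \<subseteq> \<Omega>" "!!x. x \<notin> K ==> \<phi> x = 0" using C1cD[OF assms(1)] by metis
 obtain L where L: "compact L" "L \<subseteq> \<Omega>" "!!x. x \<notin> L ==> \<psi> x = 0" using C1cD[OF assms(2)] by metis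
 have "continuous_on UNIV (%x. c *\<^sub>R jac \<phi> x + d *\<^sub>R jac \<psi> x)"
  by (intro continuous_intros C1c_regular(2)[OF assms(1)] C1c_regular(2)[OF assms(2)])
 moreover have "\<exists>K'. compact K' & K' \<subseteq> \<Omega> & (\<forall>x. x \<notin> K' --> c *\<^sub>R \<phi> x + d *\<^sub>R \<psi> x = 0)"
  using K L by (intro exI[of _ "K \<union> L"]) (auto intro: compact_Un)
 ultimately show "C1c \<Omega> (%x. c *\<^sub>R \<phi> x + d *\<^sub>R \<psi> x)" unfolding C1c_def j using dd by (auto simp: differentiable_def)
qed

lemma n2_tendsto_zeroI:
 assumes "!!k. n2 (F k) <= b k" "b ~~~> 0"
 shows "(%k. n2 (F k)) ~~~> 0"
proof (rule tendsto_sandwich[OF _ _ tendsto_const assms(2)])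
 show "\<forall>\<^sub>F n in sequentially. 0 <= n2 (F n)" by (intro always_eventually allI n2_nonneg)
 show "\<forall>\<^sub>F n in sequentially. n2 (F n) <= b n" by (intro always_eventually allI assms)
qed

lemma h1_diff:
 fixes U :: "real^'d => real^'m"
 assumes "h1 \<Omega> U G" "h1 \<Omega> W H"
 shows "h1 \<Omega> (%x. U x - W x) (%x. G x - H x)"
proof -
 obtain \<phi> where \<phi>: "!!k. C1c \<Omega> (\<phi> k)" "(%k. n2 (%x. \<phi> k x - U x)) ~~~> 0" "(%k. n2 (%x. jac (\<phi> k) x - G x)) ~~~> 0"
  using assms(1) by (auto simp: h1_def)
 obtain \<psi> where \<psi>: "!!k. C1c \<Omega> (\<psi> k)" "(%k. n2 (%x. \<psi> k x - W x)) ~~~> 0" "(%k. n2 (%x. jac (\<psi> k) x - H x)) ~~~> 0"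
  using assms(2) by (auto simp: h1_def)
 have L: "L2 U" "L2 G" "L2 W" "L2 H" using assms by (auto simp: h1_def)
 define \<theta> where "\<theta> k = (%x. 1 *\<^sub>R \<phi> k x + (-1) *\<^sub>R \<psi> k x)" for k
 have \<theta>: "C1c \<Omega> (\<theta> k)" "jac (\<theta> k) = (%x. 1 *\<^sub>R jac (\<phi> k) x + (-1) *\<^sub>R jac (\<psi> k) x)" for k
  unfolding \<theta>_def by (rule C1c_comb[OF \<phi>(1) \<psi>(1)])+
 have tri: "n2 (%x. (f x - g x) - (f' x - g' x)) <= n2 (%x. f x - f' x) + n2 (%x. g x - g' x)"
  if "L2 f" "L2 g" "L2 f'" "L2 g'" for f g f' g' :: "real^'d => 'b::euclidean_space"
 proof -
  have "(%x. (f x - g x) - (f' x - g' x)) = (%x. (f x - f' x) + (-1) *\<^sub>R (g x - g' x))" by (auto simp: algebra_simps)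
  moreover have "n2 (%x. (f x - f' x) + (-1) *\<^sub>R (g x - g' x)) <= n2 (%x. f x - f' x) + n2 (%x. (-1) *\<^sub>R (g x - g' x))"
   using that by (intro n2_add_le L2_diff L2_scaleR)
  ultimately show ?thesis by (simp only: n2_scaleR)
 qed
 have "(%k. n2 (%x. \<theta> k x - (U x - W x))) ~~~> 0"
 proof (rule n2_tendsto_zeroI)
  show "n2 (%x. \<theta> k x - (U x - W x)) <= n2 (%x. \<phi> k x - U x) + n2 (%x. \<psi> k x - W x)" for k
   using tri[OF C1c_regular(5)[OF \<phi>(1)[of k]] C1c_regular(5)[OF \<psi>(1)[of k]] L(1,3)] by (simp add: \<theta>_def)
  show "(%k. n2 (%x. \<phi> k x - U x) + n2 (%x. \<psi> k x - W x)) ~~~> 0" using tendsto_add[OF \<phi>(2) \<psi>(2)] by simp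
 qed
 moreover have "(%k. n2 (%x. jac (\<theta> k) x - (G x - H x))) ~~~> 0"
 proof (rule n2_tendsto_zeroI)
  show "n2 (%x. jac (\<theta> k) x - (G x - H x)) <= n2 (%x. jac (\<phi> k) x - G x) + n2 (%x. jac (\<psi> k) x - H x)" for k
   using tri[OF C1c_regular(6)[OF \<phi>(1)[of k]] C1c_regular(6)[OF \<psi>(1)[of k]] L(2,4)] by (simp add: \<theta>(2))
  show "(%k. n2 (%x. jac (\<phi> k) x - G x) + n2 (%x. jac (\<psi> k) x - H x)) ~~~> 0" using tendsto_add[OF \<phi>(3) \<psi>(3)] by simp
 qed
 ultimately show ?thesis using assms \<theta>(1) unfolding h1_def by (auto intro!: L2_diff exI[of _ \<theta>])
qed

text \<open>Subtracting a constant destroys the zero boundary values unless the cutoff is supported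
  inside the domain. Hence the alternative: near the boundary the constant has to be 0.\<close>

lemma h1_cutoff:
 fixes U :: "real^'d => real^'m"
 assumes h: "h1 \<Omega> U G" and \<eta>: "cutoff x0 \<rho> \<eta> d\<eta>" and \<rho>: "0 < \<rho>"
  and c: "c = 0 \<or> cball x0 (3/2 * \<rho>) \<subseteq> \<Omega>"
 shows "h1 \<Omega> (%x. \<eta> x *\<^sub>R (U x - c)) (%x. \<eta> x *\<^sub>R G x + outer (U x - c) (d\<eta> x))"
proof -
 obtain \<phi> where \<phi>: "!!k. C1c \<Omega> (\<phi> k)" "(%k. n2 (%x. \<phi> k x - U x)) ~~~> 0" "(%k. n2 (%x. jac (\<phi> k) x - G x)) ~~~> 0"
  using h by (auto simp: h1_def)
 have L: "L2 U" "L2 G" using h by (auto simp: h1_def)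
 have [measurable]: "borel_fun U" "borel_fun G" using L by (auto simp: L2_def)
 have [measurable]: "borel_fun \<eta>" "borel_fun d\<eta>" using cutoff_regular[OF \<eta>] by auto
 have \<eta>1: "\<bar>\<eta> x\<bar> <= 1" for x using \<eta> by (simp add: cutoff_def)
 have d\<eta>1: "norm (d\<eta> x) <= 12 / \<rho>" for x using \<eta> by (simp add: cutoff_def)
 have out: "\<eta> x = 0" "d\<eta> x = 0" if "x \<notin> cball x0 (3/2 * \<rho>)" for x using \<eta> that by (auto simp: cutoff_def)
 define \<theta> where "\<theta> k = (%x. \<eta> x *\<^sub>R (\<phi> k x - c))" for k
 have \<theta>: "C1c \<Omega> (\<theta> k) & jac (\<theta> k) = (%x. \<eta> x *\<^sub>R jac (\<phi> k) x + outer (\<phi> k x - c) (d\<eta> x))" for k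
 proof -
  have d: "((%x. \<phi> k x - c) has_derivative (%h. jac (\<phi> k) x *v h)) (at x)" for x
  proof -
   have "\<phi> k differentiable at x" using \<phi>(1)[of k] by (simp add: C1c_def)
   from has_derivative_diff[OF jac_derivative[OF this] has_derivative_const[of c]] show ?thesis by simp
  qed
  obtain K where K: "compact K" "K \<subseteq> \<Omega>" "!!x. x \<notin> K ==> \<phi> k x = 0" using C1cD[OF \<phi>(1)] by metis
  define K' where "K' = (if c = 0 then K else cball x0 (3/2 * \<rho>))"
  have "compact K'" "K' \<subseteq> \<Omega>" "!!x. x \<notin> K' ==> \<eta> x *\<^sub>R (\<phi> k x - c) = 0" using K c out by (auto simp: K'_def split: if_splits)
  from cutoff_product[OF \<eta> d C1c_regular(2)[OF \<phi>(1)[of k]] this] show ?thesis unfolding \<theta>_def by blast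
 qed
 have no: "norm (outer a (d\<eta> x)) <= 12 / \<rho> * norm a" for a :: "real^'m" and x
  using mult_left_mono[OF d\<eta>1[of x], of "norm a"] by (simp add: norm_outer mult.commute)
 have no': "norm (\<eta> x *\<^sub>R a) <= 1 * norm a" for a :: "'c::real_normed_vector" and x using mult_right_mono[OF \<eta>1[of x], of "norm a"] by simp
 have LO: "L2 (%x. outer (f x) (d\<eta> x))" if "L2 f" for f :: "real^'d => real^'m"
  by (rule L2_dominated[OF _ no that]) (use that in \<open>auto simp: L2_def\<close>)
 have LE: "L2 (%x. \<eta> x *\<^sub>R f x)" if "L2 f" for f :: "real^'d => 'c::euclidean_space"
  by (rule L2_dominated[OF _ no' that]) (use that in \<open>auto simp: L2_def\<close>)
 have Lc: "L2 (%x. \<eta> x *\<^sub>R c)" "L2 (%x. outer c (d\<eta> x))"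
 proof -
  show "L2 (%x. \<eta> x *\<^sub>R c)" using no'[of _ c] out by (intro L2_bounded_support[where K="cball x0 (3/2 * \<rho>)" and B="norm c"]) auto
  have "outer c (0::real^'d) = 0" using norm_outer[of c "0::real^'d"] by simp
  then show "L2 (%x. outer c (d\<eta> x))" using no[of c] out by (intro L2_bounded_support[where K="cball x0 (3/2 * \<rho>)" and B="12 / \<rho> * norm c"]) auto
 qed
 have outer_diff: "outer (a - b) h = outer a h - outer b h" for a b :: "real^'m" and h :: "real^'d" by (simp add: outer_def vec_eq_iff algebra_simps)
 have L1: "L2 (%x. \<eta> x *\<^sub>R (U x - c))" using L2_diff[OF LE[OF L(1)] Lc(1)] by (simp add: scaleR_diff_right)
 have L2': "L2 (%x. \<eta> x *\<^sub>R G x + outer (U x - c) (d\<eta> x))" using L2_add[OF LE[OF L(2)] L2_diff[OF LO[OF L(1)] Lc(2)]] by (simp add: outer_diff)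
 have LU: "L2 (%x. \<phi> k x - U x)" "L2 (%x. jac (\<phi> k) x - G x)" for k by (intro L2_diff L C1c_regular[OF \<phi>(1)])+
 have "(%k. n2 (%x. \<theta> k x - \<eta> x *\<^sub>R (U x - c))) ~~~> 0"
 proof (rule n2_tendsto_zeroI)
  fix k
  have "(%x. \<theta> k x - \<eta> x *\<^sub>R (U x - c)) = (%x. \<eta> x *\<^sub>R (\<phi> k x - U x))" by (auto simp: \<theta>_def algebra_simps)
  then show "n2 (%x. \<theta> k x - \<eta> x *\<^sub>R (U x - c)) <= 1 * n2 (%x. \<phi> k x - U x)" by (simp only:) (rule n2_mono[OF LE[OF LU(1)] LU(1) no'], simp)
 qed (use \<phi>(2) in simp)
 moreover have "(%k. n2 (%x. jac (\<theta> k) x - (\<eta> x *\<^sub>R G x + outer (U x - c) (d\<eta> x)))) ~~~> 0"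
 proof (rule n2_tendsto_zeroI)
  fix k
  have "(%x. jac (\<theta> k) x - (\<eta> x *\<^sub>R G x + outer (U x - c) (d\<eta> x)))
    = (%x. \<eta> x *\<^sub>R (jac (\<phi> k) x - G x) + outer (\<phi> k x - U x) (d\<eta> x))" using \<theta>[of k] by (auto simp: outer_diff algebra_simps)
  moreover have "n2 (%x. \<eta> x *\<^sub>R (jac (\<phi> k) x - G x) + outer (\<phi> k x - U x) (d\<eta> x))
    <= n2 (%x. \<eta> x *\<^sub>R (jac (\<phi> k) x - G x)) + n2 (%x. outer (\<phi> k x - U x) (d\<eta> x))" by (intro n2_add_le LE LO LU)
  moreover have "n2 (%x. \<eta> x *\<^sub>R (jac (\<phi> k) x - G x)) <= 1 * n2 (%x. jac (\<phi> k) x - G x)" by (rule n2_mono[OF LE[OF LU(2)] LU(2) no']) simp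
  moreover have "n2 (%x. outer (\<phi> k x - U x) (d\<eta> x)) <= 12 / \<rho> * n2 (%x. \<phi> k x - U x)"
   by (rule n2_mono[OF LO[OF LU(1)] LU(1) no]) (use \<rho> in simp)
  ultimately show "n2 (%x. jac (\<theta> k) x - (\<eta> x *\<^sub>R G x + outer (U x - c) (d\<eta> x))) <= n2 (%x. jac (\<phi> k) x - G x) + 12 / \<rho> * n2 (%x. \<phi> k x - U x)"
   by simp
 next
  show "(%k. n2 (%x. jac (\<phi> k) x - G x) + 12 / \<rho> * n2 (%x. \<phi> k x - U x)) ~~~> 0"
   using tendsto_add[OF \<phi>(3) tendsto_mult_right_zero[OF \<phi>(2), of "12 / \<rho>"]] by simp
 qed
 moreover have "\<eta> x *\<^sub>R (U x - c) = 0 & \<eta> x *\<^sub>R G x + outer (U x - c) (d\<eta> x) = 0" if "x \<notin> \<Omega>" for x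
 proof -
  have U: "U x = 0" "G x = 0" using h that by (auto simp: h1_def)
  have "outer (U x - c) (d\<eta> x) = 0 & \<eta> x *\<^sub>R c = 0"
  proof (cases "c = 0")
   case True
   then show ?thesis using U norm_outer[of "0::real^'m" "d\<eta> x"] by simp
  next
   case False
   then have "x \<notin> cball x0 (3/2 * \<rho>)" using c that by blast
   then have "\<eta> x = 0" "d\<eta> x = 0" by (rule out)+
   then show ?thesis using norm_outer[of "U x - c" "0::real^'d"] by simp
  qed
  then show ?thesis using U by simp
 qed
 ultimately show ?thesis unfolding h1_def using L1 L2' \<theta> by blast
qed

section \<open>Exterior balls at a Lipschitz boundary\<close>

definition outer_balls :: "(real^'d) set => real => real => bool" where
 "outer_balls \<Omega> \<kappa> r1 \<longleftrightarrow> (\<forall>p\<in>frontier \<Omega>. \<forall>t. 0 < t & t <= r1 --> (\<exists>q. ball q (\<kappa> * t) \<subseteq> ball p t & ball q (\<kappa> * t) \<inter> \<Omega> = {}))"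

text \<open>From a boundary point one moves down by t/2 along the axis of its graph chart. The
  defining function of the graph changes at rate at most 1 + L, so a ball of radius
  \<open>t / (2 * (1 + L))\<close> around the new point stays below the graph. Compactness of the
  boundary makes radius and constant uniform.\<close>

lemma lipschitz_domain_outer_balls:
 assumes dom: "lipschitz_domain \<Omega>" and bdd: "bounded \<Omega>"
 shows "\<exists>\<kappa> r1. 0 < \<kappa> & \<kappa> <= 1/2 & 0 < r1 & outer_balls \<Omega> \<kappa> r1"
proof -
 have op: "open \<Omega>" using dom by (simp add: lipschitz_domain_def)
 have loc: "\<exists>r>0. \<exists>L\<ge>0. \<forall>p'\<in>frontier \<Omega> \<inter> ball p r. \<forall>t. 0 < t & t <= r -->
   (\<exists>q. ball q (t / (2 * (1 + L))) \<subseteq> ball p' t & ball q (t / (2 * (1 + L))) \<inter> \<Omega> = {})" if p: "p \<in> frontier \<Omega>" for p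
 proof -
  obtain r e L \<phi> where r: "0 < r" and e: "norm e = 1" and lip: "L-lipschitz_on {v. v \<bullet> e = 0} \<phi>"
   and graph: "\<Omega> \<inter> ball p r = {x \<in> ball p r. (x - p) \<bullet> e > \<phi> ((x - p) - ((x - p) \<bullet> e) *\<^sub>R e)}"
  proof -
   have "\<forall>p\<in>frontier \<Omega>. \<exists>r>0. \<exists>e L \<phi>. norm e = 1 & L-lipschitz_on {v. v \<bullet> e = 0} \<phi> &
    \<Omega> \<inter> ball p r = {x \<in> ball p r. (x - p) \<bullet> e > \<phi> ((x - p) - ((x - p) \<bullet> e) *\<^sub>R e)}"
    using dom unfolding lipschitz_domain_def by (elim conjE)
   from bspec[OF this p] show thesis by (elim exE conjE) (rule that)
  qed
  have L: "0 <= L" using lip by (rule lipschitz_on_nonneg)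
  have ee: "e \<bullet> e = 1" using e by (simp add: power2_norm_eq_inner[symmetric])
  define \<pi> where "\<pi> x = (x - p) - ((x - p) \<bullet> e) *\<^sub>R e" for x
  have \<pi>0: "\<pi> x \<bullet> e = 0" for x by (simp add: \<pi>_def inner_diff_left ee)
  have \<pi>lip: "norm (\<pi> x - \<pi> y) <= norm (x - y)" for x y
  proof -
   have d: "\<pi> x - \<pi> y = (x - y) - ((x - y) \<bullet> e) *\<^sub>R e" by (simp add: \<pi>_def inner_diff_left algebra_simps)
   have "(norm (\<pi> x - \<pi> y))^2 = (norm (x - y))^2 - ((x - y) \<bullet> e)^2"
    unfolding d power2_norm_eq_inner by (simp add: inner_diff_left inner_diff_right ee inner_commute power2_eq_square)
   also have "... <= (norm (x - y))^2" by simp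
   finally show ?thesis by (rule power2_le_imp_le) simp
  qed
  have \<phi>lip: "\<bar>\<phi> (\<pi> x) - \<phi> (\<pi> y)\<bar> <= L * norm (x - y)" for x y
  proof -
   have "\<bar>\<phi> (\<pi> x) - \<phi> (\<pi> y)\<bar> <= L * norm (\<pi> x - \<pi> y)"
    using lipschitz_onD[OF lip, of "\<pi> x" "\<pi> y"] \<pi>0 by (simp add: dist_norm)
   also have "... <= L * norm (x - y)" using L \<pi>lip by (intro mult_left_mono) auto
   finally show ?thesis .
  qed
  define F where "F x = (x - p) \<bullet> e - \<phi> (\<pi> x)" for x
  have inside: "x \<in> \<Omega> \<longleftrightarrow> 0 < F x" if "x \<in> ball p r" for x
  proof -
   have "x \<in> \<Omega> \<longleftrightarrow> x \<in> \<Omega> \<inter> ball p r" using that by blast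
   also have "... \<longleftrightarrow> 0 < F x" unfolding graph using that by (simp add: F_def \<pi>_def)
   finally show ?thesis .
  qed
  have "\<exists>q. ball q (t / (2 * (1 + L))) \<subseteq> ball p' t & ball q (t / (2 * (1 + L))) \<inter> \<Omega> = {}"
   if p': "p' \<in> frontier \<Omega>" "p' \<in> ball p (r/2)" and t: "0 < t" "t <= r/2" for p' t
  proof -
   have "p' \<notin> \<Omega>" using p'(1) op by (simp add: frontier_def interior_open)
   then have Fp': "F p' <= 0" using inside[of p'] p'(2) r by force
   define q where "q = p' - (t/2) *\<^sub>R e"
   define k where "k = t / (2 * (1 + L))"
   have k: "0 < k" "k <= t/2" "(1 + L) * k = t/2" using t L by (auto simp: k_def field_simps)
   have sub: "ball q k \<subseteq> ball p' t"
   proof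
    fix x assume "x \<in> ball q k"
    moreover have "dist p' q = t/2" using t e by (simp add: q_def dist_norm)
    ultimately show "x \<in> ball p' t" using k dist_triangle[of p' x q] by simp
   qed
   have "x \<notin> \<Omega>" if x: "x \<in> ball q k" for x
   proof -
    have "x \<in> ball p' t" using sub x by blast
    then have xp: "x \<in> ball p r" using p'(2) t dist_triangle[of p x p'] by simp
    have n: "norm (x - q) < k" using x by (simp add: dist_norm norm_minus_commute)
    have "(x - p) \<bullet> e = (p' - p) \<bullet> e - t/2 + (x - q) \<bullet> e" by (simp add: q_def inner_diff_left inner_add_left ee)
    moreover have "(x - q) \<bullet> e <= norm (x - q)" using norm_cauchy_schwarz[of "x - q" e] e by simp
    moreover have "\<phi> (\<pi> p') - \<phi> (\<pi> x) <= L * norm (x - q)"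
    proof -
     have "\<pi> q = \<pi> p'" by (simp add: \<pi>_def q_def inner_diff_left ee algebra_simps)
     then show ?thesis using \<phi>lip[of x q] by simp
    qed
    ultimately have "F x <= F p' - t/2 + (1 + L) * norm (x - q)" by (simp add: F_def algebra_simps)
    also have "... <= F p' - t/2 + (1 + L) * k" using L n by (intro add_left_mono mult_left_mono) auto
    also have "... <= 0" using Fp' k by simp
    finally show ?thesis using inside[OF xp] by simp
   qed
   then show ?thesis using sub unfolding k_def by blast
  qed
  then show ?thesis using r L by (intro exI[of _ "r/2"] conjI exI[of _ L]) auto
 qed
 then obtain R L where R: "!!p. p \<in> frontier \<Omega> ==> 0 < R p" and L: "!!p. p \<in> frontier \<Omega> ==> 0 <= L p"
  and cone: "!!p p' t. p \<in> frontier \<Omega> ==> p' \<in> frontier \<Omega> \<inter> ball p (R p) ==> 0 < t ==> t <= R p ==>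
   (\<exists>q. ball q (t / (2 * (1 + L p))) \<subseteq> ball p' t & ball q (t / (2 * (1 + L p))) \<inter> \<Omega> = {})" by metis
 \<comment> \<open>Finitely many charts suffice. The smallest chart radius and the largest Lipschitz
   constant among them give \<open>r1\<close> and \<kappa>; inserting 1 and 0 takes care of an empty
   selection.\<close>
 have "compact (frontier \<Omega>)" using bdd by (rule compact_frontier_bounded)
 moreover have "frontier \<Omega> \<subseteq> (\<Union>p\<in>frontier \<Omega>. ball p (R p))" using R by force
 ultimately obtain T where T: "T \<subseteq> frontier \<Omega>" "finite T" "frontier \<Omega> \<subseteq> (\<Union>p\<in>T. ball p (R p))"
  using compactE_image[of "frontier \<Omega>" "frontier \<Omega>" "%p. ball p (R p)"] by auto
 define r1 where "r1 = Min (insert 1 (R ` T))"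
 define LL where "LL = Max (insert 0 (L ` T))"
 define \<kappa> where "\<kappa> = 1 / (2 * (1 + LL))"
 have LL: "0 <= LL" "!!p. p \<in> T ==> L p <= LL" using T by (auto simp: LL_def)
 have r1: "0 < r1" "!!p. p \<in> T ==> r1 <= R p" using T R by (auto simp: r1_def)
 have "\<exists>q. ball q (\<kappa> * t) \<subseteq> ball p' t & ball q (\<kappa> * t) \<inter> \<Omega> = {}" if p': "p' \<in> frontier \<Omega>" and t: "0 < t" "t <= r1" for p' t
 proof -
  obtain p where p: "p \<in> T" "p' \<in> ball p (R p)" using T p' by blast
  then have pf: "p \<in> frontier \<Omega>" using T by blast
  obtain q where q: "ball q (t / (2 * (1 + L p))) \<subseteq> ball p' t" "ball q (t / (2 * (1 + L p))) \<inter> \<Omega> = {}"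
   using cone[OF pf, of p' t] p p' t r1(2)[OF p(1)] by auto
  have "\<kappa> * t <= t / (2 * (1 + L p))"
  proof -
   have "1 / (2 * (1 + LL)) <= 1 / (2 * (1 + L p))" using LL L[OF pf] p by (intro divide_left_mono) auto
   then show ?thesis using mult_right_mono[of _ _ t] t unfolding \<kappa>_def by fastforce
  qed
  then have "ball q (\<kappa> * t) \<subseteq> ball q (t / (2 * (1 + L p)))" by (rule subset_ball)
  then show ?thesis using q by blast
 qed
 then have "outer_balls \<Omega> \<kappa> r1" unfolding outer_balls_def by blast
 moreover have "0 < \<kappa>" "\<kappa> <= 1/2" using LL by (auto simp: \<kappa>_def field_simps)
 ultimately show ?thesis using r1 by blast
qed

section \<open>Coefficient fields, energy estimates and bounded weights\<close>

definition coef :: "real => ('a::euclidean_space => 'b::euclidean_space => 'b) => bool" where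
 "coef M a \<longleftrightarrow> 0 <= M & (\<forall>x. linear (a x)) & (\<forall>x \<xi>. norm (a x \<xi>) <= M * norm \<xi>) &
   (\<forall>\<xi>. (%x. a x \<xi>) \<in> borel_measurable borel)"

lemma coef_measurable:
 assumes "coef M a" and [measurable]: "borel_fun G"
 shows "borel_fun (%x. a x (G x))"
proof -
 have lin: "linear (a x)" for x using assms by (simp add: coef_def)
 have "a x (G x) = (\<Sum>b\<in>Basis. (G x \<bullet> b) *\<^sub>R a x b)" for x
 proof -
  have "a x (G x) = a x (\<Sum>b\<in>Basis. (G x \<bullet> b) *\<^sub>R b)" by (simp add: euclidean_representation)
  also have "... = (\<Sum>b\<in>Basis. (G x \<bullet> b) *\<^sub>R a x b)" using lin by (simp add: linear_sum linear_scale)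
  finally show ?thesis .
 qed
 moreover have [measurable]: "borel_fun (%x. a x b)" for b using assms by (simp add: coef_def)
 ultimately show ?thesis by simp
qed

lemma coef_L2:
 assumes "coef M a" "L2 G" shows "L2 (%x. a x (G x))"
proof (rule L2_dominated[OF _ _ assms(2)])
 show "borel_fun (%x. a x (G x))" using assms coef_measurable by (auto simp: L2_def)
 show "norm (a x (G x)) <= M * norm (G x)" for x using assms by (simp add: coef_def)
qed

text \<open>The weighted estimate as the local theory consumes it: for arbitrary square integrable
  data in divergence form and on the whole domain. Localisation is achieved by cutting off
  solutions, not by changing the domain.\<close>

definition energy_est :: "(real^'d) set => (real^'d => real^'d^'m => real^'d^'m) => (real^'d => real) => real => bool" where
 "energy_est \<Omega> a \<sigma> C \<longleftrightarrow> (\<forall>Z GZ F. h1 \<Omega> Z GZ --> L2 F -->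
   (\<forall>\<phi>. C1c \<Omega> \<phi> --> ip (%x. a x (GZ x) + F x) (jac \<phi>) = 0) -->
   (nint (%x. ennreal (\<sigma> x * (norm (GZ x))^2))) <= ennreal C * nint (%x. ennreal (\<sigma> x * (norm (F x))^2)))"

definition weak_on :: "(real^'d) set => (real^'d => real^'d^'m => real^'d^'m) => (real^'d => real^'d^'m) => (real^'d => real^'d^'m) => bool" where
 "weak_on D a f G \<longleftrightarrow> (\<forall>\<phi>. C1c D \<phi> --> ip (%x. a x (G x) + f x) (jac \<phi>) = 0)"

locale weight =
 fixes ca N :: real and \<sigma> :: "'a::euclidean_space => real"
 assumes ca: "0 <= ca" and A1: "A1 ca (%x. ennreal (\<sigma> x))" and nonneg: "!!x. 0 <= \<sigma> x" and bdd: "!!x. \<sigma> x <= N"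
  and meas[measurable]: "borel_fun \<sigma>"
begin

lemma N0: "0 <= N" using nonneg bdd order_trans by blast

lemma ball_fin: "sint (ball x0 r) (%x. ennreal (\<sigma> x)) < top"
proof -
 have "sint (ball x0 r) (%x. ennreal (\<sigma> x)) <= nint (%x. ennreal N * indicator (ball x0 r) x)"
  using bdd by (intro nn_integral_mono mult_right_mono ennreal_leI) auto
 also have "... = ennreal N * vol (ball x0 r)" by (rule nn_integral_cmult_indicator) simp
 also have "... < top" using emeasure_ball_fin[of x0 r] by (simp add: ennreal_mult_less_top)
 finally show ?thesis .
qed

lemma L2_weight_bound:
 assumes "L2 F"
 shows "nint (%x. ennreal (\<sigma> x * (norm (F x))^2)) <= ennreal (N * (n2 F)^2)"
proof -
 have [measurable]: "borel_fun F" using assms by (simp add: L2_def)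
 have "nint (%x. ennreal (\<sigma> x * (norm (F x))^2)) <= nint (%x. ennreal N * ennreal ((norm (F x))^2))"
  using bdd N0 by (intro nn_integral_mono) (simp add: ennreal_mult[symmetric] ennreal_leI mult_right_mono)
 also have "... = ennreal N * ennreal ((n2 F)^2)" by (subst nn_integral_cmult) (simp_all add: nn_integral_n2[OF assms])
 finally show ?thesis using N0 by (simp add: ennreal_mult)
qed

text \<open>The split estimate with the normalising factor of the Poincare inequality included.
  Since \<open>measure lborel b\<close> is of order \<open>\<rho>^d\<close>, all powers of \<rho>
  combine to the single factor \<open>\<rho>^2\<close> and the scale-invariant middle term.\<close>

lemma riesz_weighted:
 fixes g :: "'a => ennreal" and q :: 'a
 assumes g[measurable]: "borel_fun g" and S[measurable]: "S \<in> sets borel"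
  and \<tau>: "0 < \<tau>" "\<tau> <= 1" and \<rho>: "0 < \<rho>" and \<kappa>: "0 < \<kappa>"
 defines "v \<equiv> unit_ball_vol (real DIM('a))"
 defines "Cp \<equiv> 72 / \<kappa> ^ (2 * DIM('a)) * (ca * 6 ^ (2 * DIM('a)) + 1 / v^2)"
 shows "sint S (%x. ennreal (\<sigma> x) * (ennreal (6 * \<rho> / measure lborel (ball q (\<kappa> * \<rho>))) * riesz \<rho> g x)^2)
  <= ennreal (Cp * \<rho>^2) * (ennreal (\<tau>^2) * nint (%z. (g z)^2 * ennreal (\<sigma> z))
    + ennreal (1 / (\<tau> * \<rho>) ^ (2 * DIM('a))) * (nint g)^2 * sint S (%x. ennreal (\<sigma> x)))"
proof -
 let ?d = "DIM('a)" and ?m = "2 * DIM('a)"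
 have v: "0 < v" by (simp add: v_def)
 let ?I = "nint (%z. (g z)^2 * ennreal (\<sigma> z))" and ?T = "(nint g)^2" and ?W = "sint S (%x. ennreal (\<sigma> x))"
 define c where "c = 6 * \<rho> / (v * (\<kappa> * \<rho>) ^ ?d)"
 have c: "0 < c" "6 * \<rho> / measure lborel (ball q (\<kappa> * \<rho>)) = c" using \<rho> \<kappa> v by (auto simp: c_def v_def content_ball)
 have [measurable]: "borel_fun (riesz \<rho> g)" by (rule riesz_borel) measurable
 have "sint S (%x. ennreal (\<sigma> x) * (ennreal c * riesz \<rho> g x)^2)
   = nint (%x. ennreal (c^2) * (ennreal (\<sigma> x) * (riesz \<rho> g x)^2 * indicator S x))"
  using c by (intro nn_integral_cong) (simp add: power_mult_distrib ennreal_power mult_ac)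
 also have "... = ennreal (c^2) * sint S (%x. ennreal (\<sigma> x) * (riesz \<rho> g x)^2)" by (rule nn_integral_cmult) measurable
 also have "... <= ennreal (c^2) * (ennreal (2 * \<tau>^2 * ca * (v * (6 * \<rho>) ^ ?d)^2) * ?I + ennreal (2 / \<tau> ^ ?m) * ?T * ?W)"
  unfolding riesz_def v_def by (intro mult_left_mono local_riesz_bound[OF A1] ca \<tau> \<rho>) auto
 also have "... = ennreal (c^2 * (2 * \<tau>^2 * ca * (v * (6 * \<rho>) ^ ?d)^2)) * ?I + ennreal (c^2 * (2 / \<tau> ^ ?m)) * ?T * ?W"
 proof -
  have "ennreal a * (ennreal b * X + ennreal b' * Y * Z) = ennreal (a * b) * X + ennreal (a * b') * Y * Z"
   if "0 <= a" "0 <= b" "0 <= b'" for a b b' and X Y Z :: ennreal using that by (simp add: ennreal_mult distrib_left mult_ac)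
  then show ?thesis using ca v \<tau> by simp
 qed
 also have "... <= ennreal (Cp * \<rho>^2 * \<tau>^2) * ?I + ennreal (Cp * \<rho>^2 * (1 / (\<tau> * \<rho>) ^ ?m)) * ?T * ?W"
 proof (intro add_mono mult_right_mono ennreal_leI)
  have c2: "c^2 = 36 * \<rho>^2 / (v^2 * \<kappa> ^ ?m * \<rho> ^ ?m)"
   by (simp add: c_def power_mult_distrib power_divide power_mult[symmetric] mult.commute[of 2] mult.assoc)
  have six: "(v * (6 * \<rho>) ^ ?d)^2 = v^2 * 6 ^ ?m * \<rho> ^ ?m" by (simp add: power_mult_distrib power_mult[symmetric] mult.commute[of 2])
  have "c^2 * (2 * \<tau>^2 * ca * (v * (6 * \<rho>) ^ ?d)^2) = 72 / \<kappa> ^ ?m * (ca * 6 ^ ?m) * (\<rho>^2 * \<tau>^2)"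
   unfolding c2 six using v \<rho> by (simp add: field_simps)
  also have "... <= Cp * (\<rho>^2 * \<tau>^2)" unfolding Cp_def using \<kappa> v by (intro mult_right_mono mult_left_mono) auto
  finally show "c^2 * (2 * \<tau>^2 * ca * (v * (6 * \<rho>) ^ ?d)^2) <= Cp * \<rho>^2 * \<tau>^2" by (simp only: mult.assoc)
  have "c^2 * (2 / \<tau> ^ ?m) = 72 / \<kappa> ^ ?m * (1 / v^2) * (\<rho>^2 * (1 / (\<tau> * \<rho>) ^ ?m))"
   unfolding c2 power_mult_distrib[of \<tau>] using v \<rho> by (simp add: field_simps)
  also have "... <= Cp * (\<rho>^2 * (1 / (\<tau> * \<rho>) ^ ?m))" unfolding Cp_def using \<kappa> ca \<tau> \<rho> by (intro mult_right_mono mult_left_mono) auto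
  finally show "c^2 * (2 / \<tau> ^ ?m) <= Cp * \<rho>^2 * (1 / (\<tau> * \<rho>) ^ ?m)" by (simp only: mult.assoc)
 qed auto
 also have "... = ennreal (Cp * \<rho>^2) * (ennreal (\<tau>^2) * ?I + ennreal (1 / (\<tau> * \<rho>) ^ ?m) * ?T * ?W)"
 proof -
  have alg: "ennreal (a * b) * X + ennreal (a * b') * Y * Z = ennreal a * (ennreal b * X + ennreal b' * Y * Z)"
   if "0 <= a" "0 <= b" "0 <= b'" for a b b' and X Y Z :: ennreal using that by (simp add: ennreal_mult distrib_left mult_ac)
  have "0 <= Cp * \<rho>^2" unfolding Cp_def using ca \<kappa> by auto
  then show ?thesis by (rule alg) (use \<tau> \<rho> in auto)
 qed
 finally show ?thesis unfolding c(2) .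
qed

text \<open>Cauchy-Schwarz without weight, after which A1 moves the weight of the ball under the
  integral as a pointwise factor. It serves to remove the mean of the data, which may be replaced by
  their weighted energy.\<close>

lemma ball_integral_sq_le:
 fixes f :: "'a => ennreal"
 assumes [measurable]: "borel_fun f" and r: "0 < r"
 shows "(sint (ball x0 r) f)^2 * sint (ball x0 r) (%x. ennreal (\<sigma> x))
  <= ennreal (ca * (unit_ball_vol (real DIM('a)) * r ^ DIM('a))^2) * sint (ball x0 r) (%x. ennreal (\<sigma> x) * (f x)^2)"
proof -
 let ?S = "ball x0 r"
 let ?V = "unit_ball_vol (real DIM('a)) * r ^ DIM('a)"
 let ?W = "sint ?S (%x. ennreal (\<sigma> x))"
 have em: "vol ?S = ennreal ?V" using r by (simp add: emeasure_ball)
 have V: "0 <= ?V" using r by simp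
 have "sint ?S (%x. (f x)^2) * ?W = nint (%x. ?W * ((f x)^2 * indicator ?S x))" by (subst nn_integral_cmult) (auto simp: mult.commute)
 also have "... <= nint (%x. ennreal (ca * ?V) * (ennreal (\<sigma> x) * (f x)^2 * indicator ?S x))"
 proof (rule nn_integral_mono_AE)
  show "AE x in lborel. ?W * ((f x)^2 * indicator ?S x) <= ennreal (ca * ?V) * (ennreal (\<sigma> x) * (f x)^2 * indicator ?S x)"
   using AE_A1_balls[OF A1 ennreal_less_top]
  proof eventually_elim
   fix x assume *: "\<forall>y r. x \<in> ball y r --> sint (ball y r) (%z. ennreal (\<sigma> z)) <= ennreal ca * vol (ball y r) * ennreal (\<sigma> x)"
   show "?W * ((f x)^2 * indicator ?S x) <= ennreal (ca * ?V) * (ennreal (\<sigma> x) * (f x)^2 * indicator ?S x)"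
   proof (cases "x \<in> ?S")
    case True
    then have "?W <= ennreal (ca * ?V) * ennreal (\<sigma> x)" using *[rule_format, of x0 r] ca V unfolding em by (simp add: ennreal_mult)
    then have "?W * (f x)^2 <= ennreal (ca * ?V) * ennreal (\<sigma> x) * (f x)^2" by (rule mult_right_mono) simp
    then show ?thesis using True by (simp add: mult.assoc)
   qed simp
  qed
 qed
 also have "... = ennreal (ca * ?V) * sint ?S (%x. ennreal (\<sigma> x) * (f x)^2)" by (rule nn_integral_cmult) measurable
 finally have 1: "sint ?S (%x. (f x)^2) * ?W <= ennreal (ca * ?V) * sint ?S (%x. ennreal (\<sigma> x) * (f x)^2)" .
 have "(sint ?S f)^2 * ?W <= (ennreal ?V * sint ?S (%x. (f x)^2)) * ?W" using nn_integral_square_le[of f ?S] unfolding em by (intro mult_right_mono) auto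
 also have "... <= ennreal ?V * (ennreal (ca * ?V) * sint ?S (%x. ennreal (\<sigma> x) * (f x)^2))"
  using mult_left_mono[OF 1, of "ennreal ?V"] by (simp only: mult.assoc zero_le)
 also have "... = ennreal (ca * ?V^2) * sint ?S (%x. ennreal (\<sigma> x) * (f x)^2)"
 proof -
  have "ennreal (ca * ?V^2) = ennreal ?V * ennreal (ca * ?V)" using V ca by (subst ennreal_mult[symmetric]) (auto simp: power2_eq_square mult_ac)
  then show ?thesis by (simp only: mult.assoc)
 qed
 finally show ?thesis .
qed

end

section \<open>Weighted Poincare inequality\<close>

lemma bavg_L2_bound:
 fixes F :: "'a::euclidean_space => 'b::euclidean_space"
 assumes F: "L2 F" and s: "0 < s"
 shows "(norm (bavg (ball q s) F))^2 <= (n2 F)^2 / measure lborel (ball q s)"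
proof -
 let ?b = "ball q s"
 have [measurable]: "borel_fun F" using F by (simp add: L2_def)
 have m: "0 < measure lborel ?b" using s by (simp add: content_ball_pos)
 have em: "vol ?b = ennreal (measure lborel ?b)" using emeasure_ball_fin[of q s] by (intro emeasure_eq_ennreal_measure) auto
 let ?I = "LINT y|lborel. indicator ?b y *\<^sub>R F y"
 have "ennreal (norm ?I) <= nint (%y. ennreal (norm (indicator ?b y *\<^sub>R F y)))" by (rule ennreal_norm_integral_le)
 also have "... = mass ?b F" by (intro nn_integral_cong) (auto simp: indicator_def)
 finally have "(ennreal (norm ?I))^2 <= (mass ?b F)^2" by (intro power_mono) auto
 also have "... <= vol ?b * sint ?b (%y. (ennreal (norm (F y)))^2)" by (rule nn_integral_square_le) measurable
 also have "sint ?b (%y. (ennreal (norm (F y)))^2) <= nint (%y. ennreal ((norm (F y))^2))" by (intro nn_integral_mono) (auto simp: indicator_def ennreal_power)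
 also have "... = ennreal ((n2 F)^2)" by (rule nn_integral_n2[OF F])
 finally have "ennreal ((norm ?I)^2) <= ennreal (measure lborel ?b * (n2 F)^2)" using m by (simp add: em ennreal_mult ennreal_power mult_left_mono)
 then have I: "(norm ?I)^2 <= measure lborel ?b * (n2 F)^2" using m by (subst (asm) ennreal_le_iff) auto
 have "(norm (bavg ?b F))^2 = (norm ?I)^2 / (measure lborel ?b)^2" by (simp add: bavg_def power_divide)
 also have "... <= (measure lborel ?b * (n2 F)^2) / (measure lborel ?b)^2" by (intro divide_right_mono I) simp
 also have "... = (n2 F)^2 / measure lborel ?b" using m by (simp add: power2_eq_square)
 finally show ?thesis .
qed

lemma L2_ball_integrable:
 fixes F :: "'a::euclidean_space => 'b::euclidean_space"
 assumes F: "L2 F" shows "integrable lborel (%y. indicator (ball q s) y *\<^sub>R F y)"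
proof -
 have [measurable]: "borel_fun F" using F by (simp add: L2_def)
 have "nint (%y. ennreal (norm (indicator (ball q s) y *\<^sub>R F y))) <= nint (%y. ennreal ((norm (F y))^2) + indicator (ball q s) y)"
 proof (intro nn_integral_mono)
  fix y
  have "norm (F y) <= (norm (F y))^2 + 1"
  proof -
   have "2 * norm (F y) <= (norm (F y))^2 + 1" using zero_le_power2[of "norm (F y) - 1"] by (simp add: power2_eq_square algebra_simps)
   then show ?thesis using norm_ge_zero[of "F y"] by linarith
  qed
  then have "ennreal (norm (F y)) <= ennreal ((norm (F y))^2) + 1" by (simp add: ennreal_leI flip: ennreal_plus ennreal_1)
  then show "ennreal (norm (indicator (ball q s) y *\<^sub>R F y)) <= ennreal ((norm (F y))^2) + indicator (ball q s) y" by (auto simp: indicator_def)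
 qed
 also have "... = nint (%y. ennreal ((norm (F y))^2)) + vol (ball q s)" by (simp add: nn_integral_add)
 also have "... < top" using F emeasure_ball_fin[of q s] by (simp add: L2_def)
 finally show ?thesis by (intro integrableI_bounded) auto
qed

lemma bavg_diff:
 fixes F :: "'a::euclidean_space => 'b::euclidean_space"
 assumes "L2 F" "L2 H" shows "bavg (ball q s) (%x. F x - H x) = bavg (ball q s) F - bavg (ball q s) H"
proof -
 have "(LINT y|lborel. indicator (ball q s) y *\<^sub>R (F y - H y)) = (LINT y|lborel. indicator (ball q s) y *\<^sub>R F y - indicator (ball q s) y *\<^sub>R H y)"
  by (simp add: scaleR_diff_right)
 also have "... = (LINT y|lborel. indicator (ball q s) y *\<^sub>R F y) - (LINT y|lborel. indicator (ball q s) y *\<^sub>R H y)"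
  by (rule Bochner_Integration.integral_diff[OF L2_ball_integrable[OF assms(1)] L2_ball_integrable[OF assms(2)]])
 finally show ?thesis by (simp add: bavg_def scaleR_diff_right)
qed

lemma norm_sum3_sq_le: "(norm (a + b + c))^2 <= 3 * (norm a)^2 + 3 * (norm b)^2 + 3 * (norm (c::'b::real_normed_vector))^2"
proof -
 have "norm (a + b + c) <= norm a + norm b + norm c" by (rule order_trans[OF norm_triangle_ineq]) (simp add: norm_triangle_ineq)
 then have "(norm (a + b + c))^2 <= (norm a + norm b + norm c)^2" by (intro power_mono) auto
 also have "... <= 3 * (norm a)^2 + 3 * (norm b)^2 + 3 * (norm c)^2"
  using zero_le_power2[of "norm a - norm b"] zero_le_power2[of "norm b - norm c"] zero_le_power2[of "norm a - norm c"] by (simp add: power2_eq_square algebra_simps)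
 finally show ?thesis .
qed

lemma nn_integral_set_finite_real:
 assumes "(\<integral>\<^sup>+x. f x \<partial>M) < top" obtains r where "0 <= r" "(\<integral>\<^sup>+x. f x \<partial>M) = ennreal r"
 using assms by (metis ennreal_cases less_irrefl)

text \<open>For smooth fields this is the pointwise bound combined with
  \<open>riesz_weighted\<close>. Since \<sigma> is bounded, convergence in the mean square implies
  convergence of the weighted energies, so the inequality passes to limits; N occurs only in error
  terms that tend to 0.\<close>

lemma poincare_weighted:
 fixes U :: "real^'d => real^'m"
 assumes w: "weight ca N \<sigma>" and h: "h1 \<Omega> U G" and \<tau>: "0 < \<tau>" "\<tau> <= 1" and \<rho>: "0 < \<rho>" and \<kappa>: "0 < \<kappa>"
  and sub: "ball q (\<kappa> * \<rho>) \<subseteq> ball x0 (3 * \<rho>)"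
 defines "Cp \<equiv> 72 / \<kappa> ^ (2 * CARD('d)) * (ca * 6 ^ (2 * CARD('d)) + 1 / (unit_ball_vol (real CARD('d)))^2)"
 shows "sint (ball x0 (3 * \<rho>)) (%x. ennreal (\<sigma> x * (norm (U x - bavg (ball q (\<kappa> * \<rho>)) U))^2))
  <= ennreal (6 * Cp * \<rho>^2) * (ennreal (\<tau>^2) * (energy \<sigma> (ball x0 (3 * \<rho>)) G)
    + ennreal (1 / (\<tau> * \<rho>) ^ (2 * CARD('d))) * (mass (ball x0 (3 * \<rho>)) G)^2 * sint (ball x0 (3 * \<rho>)) (%x. ennreal (\<sigma> x)))"
proof -
 interpret weight ca N \<sigma> by (rule w)
 let ?S = "ball x0 (3 * \<rho>)" and ?b = "ball q (\<kappa> * \<rho>)"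
 have s: "0 < \<kappa> * \<rho>" using \<kappa> \<rho> by simp
 have mb: "0 < measure lborel ?b" using s by (simp add: content_ball_pos)
 obtain \<phi> where \<phi>: "!!k. C1c \<Omega> (\<phi> k)" "(%k. n2 (%x. \<phi> k x - U x)) ~~~> 0" "(%k. n2 (%x. jac (\<phi> k) x - G x)) ~~~> 0"
  using h by (auto simp: h1_def)
 have L: "L2 U" "L2 G" using h by (auto simp: h1_def)
 have [measurable]: "borel_fun U" "borel_fun G" using L by (auto simp: L2_def)
 have L\<phi>: "L2 (\<phi> k)" "L2 (jac (\<phi> k))" for k using C1c_regular[OF \<phi>(1)] by auto
 have [measurable]: "borel_fun (\<phi> k)" "borel_fun (jac (\<phi> k))" for k using C1c_regular[OF \<phi>(1)] by auto
 have Cp: "0 <= Cp" unfolding Cp_def using ca \<kappa> by auto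
 define e where "e k = n2 (%x. \<phi> k x - U x)" for k
 define \<delta> where "\<delta> k = n2 (%x. jac (\<phi> k) x - G x)" for k
 obtain W where W: "0 <= W" "sint ?S (%x. ennreal (\<sigma> x)) = ennreal W" by (rule nn_integral_set_finite_real[OF ball_fin])
 have "(energy \<sigma> ?S G) < top"
 proof -
  have "(energy \<sigma> ?S G) <= nint (%x. ennreal (\<sigma> x * (norm (G x))^2))" by (intro nn_integral_mono) (auto simp: indicator_def)
  also have "... <= ennreal (N * (n2 G)^2)" by (rule L2_weight_bound[OF L(2)])
  finally show ?thesis by (rule le_less_trans) simp
 qed
 then obtain I where I: "0 <= I" "(energy \<sigma> ?S G) = ennreal I" by (rule nn_integral_set_finite_real)
 have "mass ?S G < top"
 proof -
  have "mass ?S G = nint (%x. ennreal (norm (indicator ?S x *\<^sub>R G x)))" by (intro nn_integral_cong) (auto simp: indicator_def)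
  also have "... < \<infinity>" using L2_ball_integrable[OF L(2)] by (simp add: integrable_iff_bounded)
  finally show ?thesis by simp
 qed
 then obtain H where H: "0 <= H" "mass ?S G = ennreal H" by (rule nn_integral_set_finite_real)
 define mS where "mS = measure lborel ?S"
 have emS: "vol ?S = ennreal mS" "0 <= mS" unfolding mS_def using emeasure_ball_fin[of x0 "3 * \<rho>"] by (auto intro!: emeasure_eq_ennreal_measure)
 define T where "T = 1 / (\<tau> * \<rho>) ^ (2 * CARD('d))"
 have T: "0 <= T" using \<tau> \<rho> by (simp add: T_def)
 have jI: "sint ?S (%x. ennreal (\<sigma> x * (norm (jac (\<phi> k) x))^2)) <= ennreal (2 * I + 2 * (N * (\<delta> k)^2))" for k
 proof -
  let ?D = "%x. jac (\<phi> k) x - G x"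
  have D: "L2 ?D" by (intro L2_diff L L\<phi>)
  have "sint ?S (%x. ennreal (\<sigma> x * (norm (jac (\<phi> k) x))^2))
    <= nint (%x. 2 * (ennreal (\<sigma> x * (norm (G x))^2) * indicator ?S x) + 2 * ennreal (\<sigma> x * (norm (?D x))^2))"
  proof (intro nn_integral_mono)
   fix x
   have "\<sigma> x * (norm (G x + ?D x))^2 <= \<sigma> x * (2 * (norm (G x))^2 + 2 * (norm (?D x))^2)" by (intro mult_left_mono norm_add_square_le nonneg)
   then have "ennreal (\<sigma> x * (norm (jac (\<phi> k) x))^2) <= ennreal (2 * (\<sigma> x * (norm (G x))^2) + 2 * (\<sigma> x * (norm (?D x))^2))"
    by (intro ennreal_leI) (simp add: algebra_simps)
   also have "... = 2 * ennreal (\<sigma> x * (norm (G x))^2) + 2 * ennreal (\<sigma> x * (norm (?D x))^2)" using nonneg[of x] by (simp add: ennreal_mult)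
   finally show "ennreal (\<sigma> x * (norm (jac (\<phi> k) x))^2) * indicator ?S x <= 2 * (ennreal (\<sigma> x * (norm (G x))^2) * indicator ?S x) + 2 * ennreal (\<sigma> x * (norm (?D x))^2)"
    by (auto simp: indicator_def)
  qed
  also have "... = 2 * ennreal I + 2 * nint (%x. ennreal (\<sigma> x * (norm (?D x))^2))" unfolding I(2)[symmetric] by (simp add: nn_integral_add nn_integral_cmult)
  also have "... <= 2 * ennreal I + 2 * ennreal (N * (\<delta> k)^2)" unfolding \<delta>_def by (intro add_left_mono mult_left_mono L2_weight_bound D) auto
  also have "... = ennreal (2 * I + 2 * (N * (\<delta> k)^2))" using I N0 by (simp add: ennreal_mult)
  finally show ?thesis .
 qed
 have jH: "(sint ?S (%x. ennreal (norm (jac (\<phi> k) x))))^2 <= ennreal (2 * H^2 + 2 * (mS * (\<delta> k)^2))" for k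
 proof -
  let ?D = "%x. jac (\<phi> k) x - G x"
  have D: "L2 ?D" by (intro L2_diff L L\<phi>)
  have "sint ?S (%x. ennreal (norm (jac (\<phi> k) x))) <= nint (%x. ennreal (norm (G x)) * indicator ?S x + ennreal (norm (?D x)) * indicator ?S x)"
  proof (intro nn_integral_mono)
   fix x
   have "norm (jac (\<phi> k) x) <= norm (G x) + norm (?D x)" using norm_triangle_ineq[of "G x" "?D x"] by simp
   then have "ennreal (norm (jac (\<phi> k) x)) <= ennreal (norm (G x)) + ennreal (norm (?D x))" by (simp add: ennreal_leI flip: ennreal_plus)
   then show "ennreal (norm (jac (\<phi> k) x)) * indicator ?S x <= ennreal (norm (G x)) * indicator ?S x + ennreal (norm (?D x)) * indicator ?S x"
    by (auto simp: indicator_def)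
  qed
  also have "... = ennreal H + sint ?S (%x. ennreal (norm (?D x)))" unfolding H(2)[symmetric] by (rule nn_integral_add) measurable
  finally have "(sint ?S (%x. ennreal (norm (jac (\<phi> k) x))))^2 <= (ennreal H + sint ?S (%x. ennreal (norm (?D x))))^2" by (intro power_mono) auto
  also have "... <= 2 * (ennreal H)^2 + 2 * (sint ?S (%x. ennreal (norm (?D x))))^2" by (rule ennreal_square_add_le)
  also have "(sint ?S (%x. ennreal (norm (?D x))))^2 <= vol ?S * sint ?S (%x. (ennreal (norm (?D x)))^2)" by (rule nn_integral_square_le) measurable
  also have "sint ?S (%x. (ennreal (norm (?D x)))^2) <= nint (%x. ennreal ((norm (?D x))^2))" by (intro nn_integral_mono) (auto simp: indicator_def ennreal_power)
  also have "... = ennreal ((\<delta> k)^2)" unfolding \<delta>_def by (rule nn_integral_n2[OF D])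
  finally have "(sint ?S (%x. ennreal (norm (jac (\<phi> k) x))))^2 <= 2 * (ennreal H)^2 + 2 * (ennreal mS * ennreal ((\<delta> k)^2))"
   unfolding emS by (simp add: add_left_mono mult_left_mono)
  also have "... = ennreal (2 * H^2 + 2 * (mS * (\<delta> k)^2))" using H emS by (simp add: ennreal_mult ennreal_power)
  finally show ?thesis .
 qed
 have smooth: "sint ?S (%x. ennreal (\<sigma> x * (norm (\<phi> k x - bavg ?b (\<phi> k)))^2))
   <= ennreal (Cp * \<rho>^2 * (\<tau>^2 * (2 * I + 2 * (N * (\<delta> k)^2)) + T * (2 * H^2 + 2 * (mS * (\<delta> k)^2)) * W))" for k
 proof -
  let ?g = "%z. ennreal (norm (jac (\<phi> k) z)) * indicator ?S z"
  have "sint ?S (%x. ennreal (\<sigma> x * (norm (\<phi> k x - bavg ?b (\<phi> k)))^2))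
    <= sint ?S (%x. ennreal (\<sigma> x) * (ennreal (6 * \<rho> / measure lborel ?b) * riesz \<rho> ?g x)^2)"
  proof (intro nn_integral_mono)
   fix x
   show "ennreal (\<sigma> x * (norm (\<phi> k x - bavg ?b (\<phi> k)))^2) * indicator ?S x <= ennreal (\<sigma> x) * (ennreal (6 * \<rho> / measure lborel ?b) * riesz \<rho> ?g x)^2 * indicator ?S x"
   proof (cases "x \<in> ?S")
    case True
    have "(ennreal (norm (\<phi> k x - bavg ?b (\<phi> k))))^2 <= (ennreal (6 * \<rho> / measure lborel ?b) * riesz \<rho> ?g x)^2"
     by (intro power_mono poincare_pointwise[OF \<rho> s sub \<phi>(1) True]) auto
    then show ?thesis using True nonneg[of x] by (simp add: ennreal_mult ennreal_power mult_left_mono)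
   qed simp
  qed
  also have "... <= ennreal (Cp * \<rho>^2) * (ennreal (\<tau>^2) * nint (%z. (?g z)^2 * ennreal (\<sigma> z))
    + ennreal T * (nint ?g)^2 * sint ?S (%x. ennreal (\<sigma> x)))"
   using riesz_weighted[of ?g ?S \<tau> \<rho> \<kappa> q] \<tau> \<rho> \<kappa> unfolding Cp_def T_def by simp
  also have "nint (%z. (?g z)^2 * ennreal (\<sigma> z)) = sint ?S (%x. ennreal (\<sigma> x * (norm (jac (\<phi> k) x))^2))"
   using nonneg by (intro nn_integral_cong) (auto simp: indicator_def ennreal_mult ennreal_power mult.commute)
  also have "ennreal (Cp * \<rho>^2) * (ennreal (\<tau>^2) * sint ?S (%x. ennreal (\<sigma> x * (norm (jac (\<phi> k) x))^2)) + ennreal T * (nint ?g)^2 * sint ?S (%x. ennreal (\<sigma> x)))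
    <= ennreal (Cp * \<rho>^2) * (ennreal (\<tau>^2) * ennreal (2 * I + 2 * (N * (\<delta> k)^2)) + ennreal T * ennreal (2 * H^2 + 2 * (mS * (\<delta> k)^2)) * ennreal W)"
   unfolding W(2) by (intro mult_left_mono add_mono mult_right_mono jI jH) auto
  also have "... = ennreal (Cp * \<rho>^2 * (\<tau>^2 * (2 * I + 2 * (N * (\<delta> k)^2)) + T * (2 * H^2 + 2 * (mS * (\<delta> k)^2)) * W))"
  proof -
   have alg: "ennreal a * (ennreal b * ennreal b' + ennreal t * ennreal t' * ennreal u) = ennreal (a * (b * b' + t * t' * u))"
    if "0 <= a" "0 <= b" "0 <= b'" "0 <= t" "0 <= t'" "0 <= u" for a b b' t t' u using that by (simp add: ennreal_mult)
   show ?thesis by (rule alg) (use Cp I N0 T W emS in auto)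
  qed
  finally show ?thesis .
 qed
 let ?c = "bavg ?b U"
 define r where "r k = 3 * (Cp * \<rho>^2 * (\<tau>^2 * (2 * I + 2 * (N * (\<delta> k)^2)) + T * (2 * H^2 + 2 * (mS * (\<delta> k)^2)) * W))
   + 3 * (N * (e k)^2) + 3 * ((e k)^2 / measure lborel ?b) * W" for k
 have bound: "sint ?S (%x. ennreal (\<sigma> x * (norm (U x - ?c))^2)) <= ennreal (r k)" for k
 proof -
  let ?D = "%x. \<phi> k x - U x"
  have D: "L2 ?D" by (intro L2_diff L L\<phi>)
  have cd: "(norm (bavg ?b (\<phi> k) - ?c))^2 <= (e k)^2 / measure lborel ?b" using bavg_L2_bound[OF D s, of q] unfolding bavg_diff[OF L\<phi>(1) L(1)] e_def .
  have "sint ?S (%x. ennreal (\<sigma> x * (norm (U x - ?c))^2))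
   <= nint (%x. 3 * (ennreal (\<sigma> x * (norm (\<phi> k x - bavg ?b (\<phi> k)))^2) * indicator ?S x) + (3 * ennreal (\<sigma> x * (norm (?D x))^2)
     + ennreal (3 * ((e k)^2 / measure lborel ?b)) * (ennreal (\<sigma> x) * indicator ?S x)))"
  proof (intro nn_integral_mono)
   fix x
   have dec: "U x - ?c = (\<phi> k x - bavg ?b (\<phi> k)) + (- ?D x) + (bavg ?b (\<phi> k) - ?c)" by simp
   have "(norm (U x - ?c))^2 <= 3 * (norm (\<phi> k x - bavg ?b (\<phi> k)))^2 + 3 * (norm (?D x))^2 + 3 * (norm (bavg ?b (\<phi> k) - ?c))^2"
    using norm_sum3_sq_le[of "\<phi> k x - bavg ?b (\<phi> k)" "- ?D x" "bavg ?b (\<phi> k) - ?c"] unfolding dec[symmetric] norm_minus_cancel .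
   also have "... <= 3 * (norm (\<phi> k x - bavg ?b (\<phi> k)))^2 + 3 * (norm (?D x))^2 + 3 * ((e k)^2 / measure lborel ?b)" using cd by simp
   finally have "\<sigma> x * (norm (U x - ?c))^2 <= \<sigma> x * (3 * (norm (\<phi> k x - bavg ?b (\<phi> k)))^2 + 3 * (norm (?D x))^2 + 3 * ((e k)^2 / measure lborel ?b))"
    using nonneg by (intro mult_left_mono)
   also have "... = 3 * (\<sigma> x * (norm (\<phi> k x - bavg ?b (\<phi> k)))^2) + (3 * (\<sigma> x * (norm (?D x))^2) + (3 * ((e k)^2 / measure lborel ?b)) * \<sigma> x)"
    by (simp add: algebra_simps)
   finally have "ennreal (\<sigma> x * (norm (U x - ?c))^2) <= ennreal (3 * (\<sigma> x * (norm (\<phi> k x - bavg ?b (\<phi> k)))^2) + (3 * (\<sigma> x * (norm (?D x))^2) + (3 * ((e k)^2 / measure lborel ?b)) * \<sigma> x))"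
    by (rule ennreal_leI)
   also have "... = 3 * ennreal (\<sigma> x * (norm (\<phi> k x - bavg ?b (\<phi> k)))^2) + (3 * ennreal (\<sigma> x * (norm (?D x))^2) + ennreal (3 * ((e k)^2 / measure lborel ?b)) * ennreal (\<sigma> x))"
   proof -
    have alg: "ennreal (3 * a + (3 * b + t * u)) = 3 * ennreal a + (3 * ennreal b + ennreal t * ennreal u)"
     if "0 <= a" "0 <= b" "0 <= t" "0 <= u" for a b t u using that by (simp add: ennreal_mult)
    show ?thesis by (rule alg) (use nonneg[of x] mb in auto)
   qed
   finally show "ennreal (\<sigma> x * (norm (U x - ?c))^2) * indicator ?S x <= 3 * (ennreal (\<sigma> x * (norm (\<phi> k x - bavg ?b (\<phi> k)))^2) * indicator ?S x) + (3 * ennreal (\<sigma> x * (norm (?D x))^2)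
     + ennreal (3 * ((e k)^2 / measure lborel ?b)) * (ennreal (\<sigma> x) * indicator ?S x))" by (simp add: indicator_def)
  qed
  also have "... = 3 * sint ?S (%x. ennreal (\<sigma> x * (norm (\<phi> k x - bavg ?b (\<phi> k)))^2)) + (3 * nint (%x. ennreal (\<sigma> x * (norm (?D x))^2))
     + ennreal (3 * ((e k)^2 / measure lborel ?b)) * ennreal W)" unfolding W(2)[symmetric] by (simp add: nn_integral_add nn_integral_cmult)
  also have "... <= 3 * ennreal (Cp * \<rho>^2 * (\<tau>^2 * (2 * I + 2 * (N * (\<delta> k)^2)) + T * (2 * H^2 + 2 * (mS * (\<delta> k)^2)) * W))
    + (3 * ennreal (N * (e k)^2) + ennreal (3 * ((e k)^2 / measure lborel ?b)) * ennreal W)"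
   unfolding e_def by (intro add_mono mult_left_mono smooth L2_weight_bound D order_refl) auto
  also have "... = ennreal (r k)"
  proof -
   have alg: "3 * ennreal a + (3 * ennreal b + ennreal t * ennreal u) = ennreal (3 * a + 3 * b + t * u)"
    if "0 <= a" "0 <= b" "0 <= t" "0 <= u" for a b t u using that by (simp add: ennreal_mult)
   show ?thesis unfolding r_def by (rule alg) (use Cp I N0 T W emS mb in auto)
  qed
  finally show ?thesis .
 qed
 \<comment> \<open>The limit of the bounds, with all approximation errors equal to 0. The factor 6
   is 3, from splitting into three summands, times 2, from replacing the approximating gradients by
   G.\<close>
 define r0 where "r0 = 3 * (Cp * \<rho>^2 * (\<tau>^2 * (2 * I + 2 * (N * 0^2)) + T * (2 * H^2 + 2 * (mS * 0^2)) * W))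
   + 3 * (N * 0^2) + 3 * (0^2 / measure lborel ?b) * W"
 have "r ~~~> r0" unfolding r_def r0_def by (intro tendsto_intros) (use \<phi>(2,3) mb in \<open>auto simp: e_def \<delta>_def\<close>)
 then have "(%k. ennreal (r k)) ~~~> ennreal r0" by (rule tendsto_ennrealI)
 then have "sint ?S (%x. ennreal (\<sigma> x * (norm (U x - ?c))^2)) <= ennreal r0" by (rule LIMSEQ_le_const) (use bound in auto)
 also have "r0 = 6 * Cp * \<rho>^2 * (\<tau>^2 * I + T * H^2 * W)" by (simp add: r0_def algebra_simps)
 also have "ennreal (6 * Cp * \<rho>^2 * (\<tau>^2 * I + T * H^2 * W)) = ennreal (6 * Cp * \<rho>^2) * (ennreal (\<tau>^2) * ennreal I + ennreal T * (ennreal H)^2 * ennreal W)"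
 proof -
  have "ennreal (a * (b * b' + t * t' * u)) = ennreal a * (ennreal b * ennreal b' + ennreal t * ennreal t' * ennreal u)"
   if "0 <= a" "0 <= b" "0 <= b'" "0 <= t" "0 <= t'" "0 <= u" for a b b' t t' u using that by (simp add: ennreal_mult)
  then show ?thesis using Cp I T W H by (simp add: ennreal_power)
 qed
 finally show ?thesis unfolding I(2) H(2) W(2) T_def .
qed

section \<open>Local estimates for solutions\<close>

lemma cutoff_derivative_zero:
 assumes \<eta>: "cutoff x0 \<rho> \<eta> d\<eta>" and x: "x \<in> ball x0 \<rho>"
 shows "d\<eta> x = 0"
proof -
 have "((%_. 1) has_derivative (%h. d\<eta> x \<bullet> h)) (at x)"
  by (rule has_derivative_transform_within_open[of \<eta> _ _ _ "ball x0 \<rho>"]) (use \<eta> x in \<open>auto simp: cutoff_def\<close>)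
 then have "(%h. d\<eta> x \<bullet> h) = (%h. 0)" by (rule has_derivative_unique) (rule has_derivative_const)
 then show ?thesis by (metis inner_eq_zero_iff)
qed

text \<open>Testing with \<open>\<eta> (\<phi> - bavg b \<phi>)\<close> turns the terms without derivative of \<open>\<phi>\<close> into the divergence of a potential.\<close>

lemma cutoff_equation:
 fixes U :: "real^'d => real^'m" and c :: "real^'m"
 assumes G: "L2 G" and a: "coef M a" and f: "L2 f" and \<rho>: "0 < \<rho>" and s: "0 < s"
  and \<eta>: "cutoff x0 \<rho> \<eta> d\<eta>" and sub: "ball q s \<subseteq> ball x0 (3 * \<rho>)"
  and alt: "cball x0 (3/2 * \<rho>) \<subseteq> \<Omega> \<or> ball q s \<inter> \<Omega> = {}"
  and weak: "weak_on (\<Omega> \<inter> ball x0 (3 * \<rho>)) a f G" and \<phi>: "C1c \<Omega> \<phi>"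
 defines "\<gamma> \<equiv> %x. (f x + a x (G x)) *v d\<eta> x"
 shows "dual_potential x0 q \<rho> s \<gamma>"
  and "L2 (%x. outer (U x - c) (d\<eta> x)) ==> ip (%x. a x (\<eta> x *\<^sub>R G x + outer (U x - c) (d\<eta> x))
   + (\<eta> x *\<^sub>R f x + dual_potential.potential q s \<gamma> x - a x (outer (U x - c) (d\<eta> x)))) (jac \<phi>) = 0"
proof -
 have [measurable]: "borel_fun \<eta>" "borel_fun d\<eta>" using cutoff_regular[OF \<eta>] by auto
 define X where "X x = a x (G x) + f x" for x
 have Xe: "X = (%x. a x (G x) + f x)" by (simp add: X_def fun_eq_iff)
 have X: "L2 X" unfolding Xe by (intro L2_add coef_L2[OF a] G f)
 have [measurable]: "borel_fun X" using X by (simp add: L2_def)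
 have \<gamma>X: "\<gamma> = (%x. X x *v d\<eta> x)" by (simp add: \<gamma>_def X_def add.commute)
 have n\<gamma>: "norm (\<gamma> x) <= 12 / \<rho> * norm (X x)" for x
 proof -
  have "norm (\<gamma> x) <= norm (X x) * norm (d\<eta> x)" unfolding \<gamma>X by (rule norm_matrix_vector_le)
  also have "... <= norm (X x) * (12 / \<rho>)" using \<eta> by (intro mult_left_mono) (auto simp: cutoff_def)
  finally show ?thesis by (simp only: mult.commute)
 qed
 show dp: "dual_potential x0 q \<rho> s \<gamma>"
 proof
  show "L2 \<gamma>" by (rule L2_dominated[OF _ n\<gamma> X]) (simp add: \<gamma>X)
  show "\<gamma> x = 0" if "x \<notin> ball x0 (3 * \<rho>)" for x
  proof -
   have "x \<notin> cball x0 (3/2 * \<rho>)" using that \<rho> by auto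
   then show ?thesis using \<eta> by (simp add: cutoff_def \<gamma>X)
  qed
 qed (use \<rho> s sub in auto)
 interpret dual_potential x0 q \<rho> s \<gamma> by (rule dp)
 assume Lo: "L2 (%x. outer (U x - c) (d\<eta> x))"
 obtain K where K: "compact K" "K \<subseteq> \<Omega>" "!!x. x \<notin> K ==> \<phi> x = 0" using \<phi> unfolding C1c_def by blast
 let ?k = "bavg (ball q s) \<phi>"
 define \<psi> where "\<psi> x = \<phi> x - ?k" for x
 have d\<psi>: "(\<psi> has_derivative (%h. jac \<phi> x *v h)) (at x)" for x
  unfolding \<psi>_def using has_derivative_diff[OF jac_derivative[of \<phi> x] has_derivative_const[of ?k]] \<phi> by (auto simp: C1c_def)
 \<comment> \<open>The test field has to vanish near the boundary. If the cutoff lives inside the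
   domain this is clear; if the averaging ball is outside the domain, the average of \<phi> is 0 and
   \<psi> is \<phi> itself.\<close>
 have "\<exists>K'. compact K' & K' \<subseteq> \<Omega> \<inter> ball x0 (3 * \<rho>) & (\<forall>x. x \<notin> K' --> \<eta> x *\<^sub>R \<psi> x = 0)" using alt
 proof
  assume "cball x0 (3/2 * \<rho>) \<subseteq> \<Omega>"
  then show ?thesis using \<eta> \<rho> by (intro exI[of _ "cball x0 (3/2 * \<rho>)"]) (auto simp: cutoff_def)
 next
  assume d: "ball q s \<inter> \<Omega> = {}"
  have "\<phi> x = 0" if "x \<in> ball q s" for x using K d that by blast
  then have "(%x. indicator (ball q s) x *\<^sub>R \<phi> x) = (%x. 0)" by (auto simp: indicator_def)
  then have "?k = 0" by (simp add: bavg_def)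
  then show ?thesis using \<eta> \<rho> K by (intro exI[of _ "K \<inter> cball x0 (3/2 * \<rho>)"]) (auto simp: cutoff_def \<psi>_def)
 qed
 then obtain K' where K': "compact K'" "K' \<subseteq> \<Omega> \<inter> ball x0 (3 * \<rho>)" "!!x. x \<notin> K' ==> \<eta> x *\<^sub>R \<psi> x = 0" by blast
 have P: "C1c (\<Omega> \<inter> ball x0 (3 * \<rho>)) (%x. \<eta> x *\<^sub>R \<psi> x)"
  "jac (%x. \<eta> x *\<^sub>R \<psi> x) = (%x. \<eta> x *\<^sub>R jac \<phi> x + outer (\<psi> x) (d\<eta> x))"
  by (rule cutoff_product[OF \<eta> d\<psi> C1c_regular(2)[OF \<phi>] K'(1,2)], erule K'(3))+
 have L\<eta>X: "L2 (%x. \<eta> x *\<^sub>R X x)" by (rule L2_dominated[OF _ _ X, of _ 1]) (use \<eta> in \<open>auto simp: cutoff_def mult_left_le_one_le\<close>)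
 have L\<eta>j: "L2 (%x. \<eta> x *\<^sub>R jac \<phi> x)"
  by (rule L2_dominated[OF _ _ C1c_regular(6)[OF \<phi>], of _ 1]) (use \<eta> C1c_regular(4)[OF \<phi>] in \<open>auto simp: cutoff_def mult_left_le_one_le\<close>)
 have L\<psi>: "L2 (%x. outer (\<psi> x) (d\<eta> x))"
 proof -
  have "outer (\<psi> x) (d\<eta> x) = jac (%x. \<eta> x *\<^sub>R \<psi> x) x - \<eta> x *\<^sub>R jac \<phi> x" for x unfolding P(2) by simp
  then show ?thesis using L2_diff[OF C1c_regular(6)[OF P(1)] L\<eta>j] by simp
 qed
 have "0 = ip X (jac (%x. \<eta> x *\<^sub>R \<psi> x))" using weak P(1) unfolding weak_on_def Xe by simp
 also have "... = ip X (%x. \<eta> x *\<^sub>R jac \<phi> x) + ip X (%x. outer (\<psi> x) (d\<eta> x))" unfolding P(2) by (rule ip_add(2)[OF L\<eta>j L\<psi> X])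
 \<comment> \<open>This is the term without derivative on the test field. It pairs \<gamma> with
   \<open>\<phi> - bavg b \<phi>\<close>, which is exactly what the dual potential rewrites in
   divergence form.\<close>
 also have "ip X (%x. outer (\<psi> x) (d\<eta> x)) = (LINT x|lborel. \<gamma> x \<bullet> \<psi> x)"
  unfolding ip_def \<gamma>X by (simp add: inner_commute[of "X _"] inner_outer) (simp add: inner_commute)
 also have "... = ip potential (jac \<phi>)" unfolding \<psi>_def by (rule potential_duality[OF \<phi>])
 also have "ip X (%x. \<eta> x *\<^sub>R jac \<phi> x) = ip (%x. \<eta> x *\<^sub>R X x) (jac \<phi>)" by (simp add: ip_def)
 also have "ip (%x. \<eta> x *\<^sub>R X x) (jac \<phi>) + ip potential (jac \<phi>) = ip (%x. \<eta> x *\<^sub>R X x + potential x) (jac \<phi>)"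
  by (rule ip_add(1)[OF L\<eta>X L2_potential C1c_regular(6)[OF \<phi>], symmetric])
 also have "(%x. \<eta> x *\<^sub>R X x + potential x) = (%x. a x (\<eta> x *\<^sub>R G x + outer (U x - c) (d\<eta> x))
   + (\<eta> x *\<^sub>R f x + potential x - a x (outer (U x - c) (d\<eta> x))))"
 proof
  fix x
  have "linear (a x)" using a by (simp add: coef_def)
  then show "\<eta> x *\<^sub>R X x + potential x = a x (\<eta> x *\<^sub>R G x + outer (U x - c) (d\<eta> x))
   + (\<eta> x *\<^sub>R f x + potential x - a x (outer (U x - c) (d\<eta> x)))" by (simp add: X_def linear_add linear_scale scaleR_add_right)
 qed
 finally show "ip (%x. a x (\<eta> x *\<^sub>R G x + outer (U x - c) (d\<eta> x))
   + (\<eta> x *\<^sub>R f x + potential x - a x (outer (U x - c) (d\<eta> x)))) (jac \<phi>) = 0" by simp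
qed

text \<open>The potential has size \<rho> times the Riesz bound, while \<gamma> carries
  \<open>12 / \<rho>\<close> from the cutoff, so the estimate is scale invariant. The part of
  \<gamma> coming from the solution keeps the factor \<open>\<tau>^2\<close> in front of its energy,
  which later permits absorption; the part coming from the data need not be small.\<close>

lemma energy_potential:
 fixes f G :: "real^'d => real^'d^'m" and S :: "(real^'d) set"
 assumes w: "weight ca N \<sigma>" and a: "coef M a" and G: "L2 G" and f: "L2 f" and \<tau>: "0 < \<tau>" "\<tau> <= 1" and \<rho>: "0 < \<rho>"
  and \<kappa>: "0 < \<kappa>" and \<eta>: "cutoff x0 \<rho> \<eta> d\<eta>"
 defines "S \<equiv> ball x0 (3 * \<rho>)"
  and "Cp \<equiv> 72 / \<kappa> ^ (2 * CARD('d)) * (ca * 6 ^ (2 * CARD('d)) + 1 / (unit_ball_vol (real CARD('d)))^2)"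
  and "cf \<equiv> 1 + ca * (unit_ball_vol (real CARD('d)) * 3 ^ CARD('d))^2"
  and "\<gamma> \<equiv> %x. (f x + a x (G x)) *v d\<eta> x"
 assumes dp: "dual_potential x0 q \<rho> (\<kappa> * \<rho>) \<gamma>"
 shows "energy \<sigma> UNIV (dual_potential.potential q (\<kappa> * \<rho>) \<gamma>)
  <= ennreal (288 * Cp * (cf + M^2)) * ((ennreal (\<tau>^2) * energy \<sigma> S G + ennreal (1 / (\<tau> * \<rho>) ^ (2 * CARD('d))) * (mass S G)^2 * sint S (%x. ennreal (\<sigma> x)))
    + ennreal (1 / \<tau> ^ (2 * CARD('d))) * energy \<sigma> S f)"
proof -
 interpret weight ca N \<sigma> by (rule w)
 interpret dual_potential x0 q \<rho> "\<kappa> * \<rho>" \<gamma> by (rule dp)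
 let ?d = "CARD('d)" let ?v = "unit_ball_vol (real CARD('d))"
 let ?W = "sint S (%x. ennreal (\<sigma> x))"
 have M: "0 <= M" and Mb: "!!x \<xi>. norm (a x \<xi>) <= M * norm \<xi>" using a by (auto simp: coef_def)
 have [measurable]: "borel_fun f" "borel_fun G" using f G by (auto simp: L2_def)
 have [measurable]: "S \<in> sets borel" by (simp add: S_def)
 have Cp: "0 <= Cp" unfolding Cp_def using \<kappa> ca by auto
 have cf: "1 <= cf" unfolding cf_def using ca by simp
 let ?g = "%x. ennreal (norm (\<gamma> x))"
 let ?T = "1 / (\<tau> * \<rho>) ^ (2 * ?d)" and ?t = "1 / \<tau> ^ (2 * ?d)"
 have n\<gamma>: "norm (\<gamma> x) <= 12 / \<rho> * (norm (f x) + M * norm (G x)) * indicator S x" for x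
 proof (cases "x \<in> S")
  case True
  have "norm (\<gamma> x) <= norm (f x + a x (G x)) * norm (d\<eta> x)" unfolding \<gamma>_def by (rule norm_matrix_vector_le)
  also have "... <= (norm (f x) + M * norm (G x)) * (12 / \<rho>)"
  proof (intro mult_mono)
   show "norm (f x + a x (G x)) <= norm (f x) + M * norm (G x)" using norm_triangle_ineq[of "f x" "a x (G x)"] Mb[of x "G x"] by linarith
   show "norm (d\<eta> x) <= 12 / \<rho>" using \<eta> by (simp add: cutoff_def)
  qed (use M in auto)
  finally show ?thesis using True by (simp add: mult.commute)
 qed (use supp in \<open>auto simp: S_def\<close>)
 have g2: "nint (%x. (?g x)^2 * ennreal (\<sigma> x)) <= ennreal (288 / \<rho>^2) * (energy \<sigma> S f + ennreal (M^2) * energy \<sigma> S G)"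
 proof -
  have "nint (%x. (?g x)^2 * ennreal (\<sigma> x)) <=
    (nint (%x. ennreal (288 / \<rho>^2) * (ennreal (\<sigma> x * (norm (f x))^2) * indicator S x + ennreal (M^2) * (ennreal (\<sigma> x * (norm (G x))^2) * indicator S x))))"
  proof (rule nn_integral_mono)
   fix x
   have alg: "ennreal (c * (s * u + m * (s * w)) ) = ennreal c * (ennreal (s * u) + ennreal m * ennreal (s * w))"
    if "0 <= c" "0 <= s" "0 <= u" "0 <= m" "0 <= w" for c s u m w using that by (simp add: ennreal_mult)
   have alg2: "(12 / \<rho> * s * i)^2 = 144 / \<rho>^2 * s^2 * i" if "i = 0 \<or> i = 1" for s i :: real using that by (auto simp: power_mult_distrib power_divide)
   have "(norm (\<gamma> x))^2 <= (12 / \<rho> * (norm (f x) + M * norm (G x)) * indicator S x)^2" by (intro power_mono n\<gamma>) auto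
   also have "... = 144 / \<rho>^2 * (norm (f x) + M * norm (G x))^2 * indicator S x" by (rule alg2) (simp add: indicator_def)
   also have "... <= 144 / \<rho>^2 * (2 * (norm (f x))^2 + 2 * (M^2 * (norm (G x))^2)) * indicator S x"
    using norm_add_square_le[of "norm (f x)" "M * norm (G x)"] by (intro mult_right_mono mult_left_mono) (auto simp: power_mult_distrib)
   finally have "(norm (\<gamma> x))^2 <= 144 / \<rho>^2 * (2 * (norm (f x))^2 + 2 * (M^2 * (norm (G x))^2)) * indicator S x" .
   from mult_right_mono[OF this nonneg[of x]]
   have "(norm (\<gamma> x))^2 * \<sigma> x <= 288 / \<rho>^2 * (\<sigma> x * (norm (f x))^2 + M^2 * (\<sigma> x * (norm (G x))^2)) * indicator S x"
    by (simp add: algebra_simps)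
   then have "ennreal ((norm (\<gamma> x))^2 * \<sigma> x) <= ennreal (288 / \<rho>^2 * (\<sigma> x * (norm (f x))^2 + M^2 * (\<sigma> x * (norm (G x))^2)) * indicator S x)" by (rule ennreal_leI)
   moreover have "ennreal (288 / \<rho>^2 * (\<sigma> x * (norm (f x))^2 + M^2 * (\<sigma> x * (norm (G x))^2)))
    = ennreal (288 / \<rho>^2) * (ennreal (\<sigma> x * (norm (f x))^2) + ennreal (M^2) * ennreal (\<sigma> x * (norm (G x))^2))" by (rule alg) (use nonneg in auto)
   ultimately show "(?g x)^2 * ennreal (\<sigma> x) <= ennreal (288 / \<rho>^2) * (ennreal (\<sigma> x * (norm (f x))^2) * indicator S x + ennreal (M^2) * (ennreal (\<sigma> x * (norm (G x))^2) * indicator S x))"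
    by (cases "x \<in> S") (simp_all add: ennreal_mult ennreal_power nonneg)
  qed
  also have "... = ennreal (288 / \<rho>^2) * (energy \<sigma> S f + ennreal (M^2) * energy \<sigma> S G)" by (simp add: nn_integral_cmult nn_integral_add)
  finally show ?thesis .
 qed
 have g1: "(nint ?g)^2 <= ennreal (288 / \<rho>^2) * ((mass S f)^2 + ennreal (M^2) * (mass S G)^2)"
 proof -
  have "nint ?g <= nint (%x. ennreal (12 / \<rho>) * (ennreal (norm (f x)) * indicator S x + ennreal M * (ennreal (norm (G x)) * indicator S x)))"
  proof (rule nn_integral_mono)
   fix x
   have "?g x <= ennreal (12 / \<rho> * (norm (f x) + M * norm (G x)) * indicator S x)" by (intro ennreal_leI n\<gamma>)
   also have "... = ennreal (12 / \<rho>) * (ennreal (norm (f x)) * indicator S x + ennreal M * (ennreal (norm (G x)) * indicator S x))"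
    using \<rho> M by (cases "x \<in> S") (simp_all add: ennreal_mult'[symmetric] flip: ennreal_plus)
   finally show "?g x <= ennreal (12 / \<rho>) * (ennreal (norm (f x)) * indicator S x + ennreal M * (ennreal (norm (G x)) * indicator S x))" .
  qed
  also have "... = ennreal (12 / \<rho>) * (mass S f + ennreal M * mass S G)" by (simp add: nn_integral_cmult nn_integral_add)
  finally have "(nint ?g)^2 <= (ennreal (12 / \<rho>) * (mass S f + ennreal M * mass S G))^2" by (rule power_mono) simp
  also have "... = ennreal (144 / \<rho>^2) * (mass S f + ennreal M * mass S G)^2" using \<rho> by (simp add: power_mult_distrib ennreal_power power_divide)
  also have "... <= ennreal (144 / \<rho>^2) * (2 * ((mass S f)^2 + (ennreal M * mass S G)^2))"
   by (intro mult_left_mono) (simp_all only: distrib_left ennreal_square_add_le zero_le)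
  also have "... = ennreal (288 / \<rho>^2) * ((mass S f)^2 + ennreal (M^2) * (mass S G)^2)"
  proof -
   have "ennreal (288 / \<rho>^2) = ennreal (144 / \<rho>^2) * 2" using ennreal_mult[of "144 / \<rho>^2" 2] by simp
   then show ?thesis using M by (simp only: power_mult_distrib ennreal_power mult.assoc)
  qed
  finally show ?thesis .
 qed
 \<comment> \<open>Removes the mean of f in favour of its weighted energy; the cost is the constant
   \<open>cf\<close>.\<close>
 have fW: "(mass S f)^2 * ?W <= ennreal (ca * (?v * (3 * \<rho>) ^ ?d)^2) * energy \<sigma> S f"
  using ball_integral_sq_le[of "%x. ennreal (norm (f x))" "3 * \<rho>" x0] \<rho> nonneg by (simp add: S_def ennreal_mult ennreal_power)
 have r: "ennreal (6 * \<rho> / measure lborel (ball q (\<kappa> * \<rho>))) * riesz \<rho> ?g z * indicator S z = ennreal (6 * \<rho> / measure lborel (ball q (\<kappa> * \<rho>))) * (riesz \<rho> ?g z * indicator S z)" for z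
  by (simp only: mult.assoc)
 have "energy \<sigma> UNIV potential <= sint S (%x. ennreal (\<sigma> x) * (ennreal (6 * \<rho> / measure lborel (ball q (\<kappa> * \<rho>))) * riesz \<rho> ?g x)^2)"
 proof (rule nn_integral_mono)
  fix x
  have "ennreal (\<sigma> x * (norm (potential x))^2) * indicator UNIV x = ennreal (\<sigma> x) * (ennreal (norm (potential x)))^2"
   using nonneg by (simp add: ennreal_mult ennreal_power)
  also have "... <= ennreal (\<sigma> x) * (ennreal (6 * \<rho> / measure lborel (ball q (\<kappa> * \<rho>))) * riesz \<rho> ?g x * indicator S x)^2"
   unfolding r using potential_bound[of x] by (intro mult_left_mono power_mono) (auto simp: S_def)
  also have "... = ennreal (\<sigma> x) * (ennreal (6 * \<rho> / measure lborel (ball q (\<kappa> * \<rho>))) * riesz \<rho> ?g x)^2 * indicator S x"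
   by (cases "x \<in> S") simp_all
  finally show "ennreal (\<sigma> x * (norm (potential x))^2) * indicator UNIV x <= ..." .
 qed
 also have "... <= ennreal (Cp * \<rho>^2) * (ennreal (\<tau>^2) * nint (%z. (?g z)^2 * ennreal (\<sigma> z)) + ennreal ?T * (nint ?g)^2 * ?W)"
  using riesz_weighted[of ?g S \<tau> \<rho> \<kappa> q] \<tau> \<rho> \<kappa> by (simp add: Cp_def)
 also have "... <= ennreal (Cp * \<rho>^2) * (ennreal (\<tau>^2) * (ennreal (288 / \<rho>^2) * (energy \<sigma> S f + ennreal (M^2) * energy \<sigma> S G))
   + ennreal ?T * (ennreal (288 / \<rho>^2) * ((mass S f)^2 + ennreal (M^2) * (mass S G)^2)) * ?W)" by (intro mult_left_mono add_mono mult_right_mono g1 g2) auto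
 also have "... = ennreal (288 * Cp) * (ennreal (\<tau>^2) * energy \<sigma> S f + ennreal ?T * ((mass S f)^2 * ?W) + ennreal (M^2) * (ennreal (\<tau>^2) * energy \<sigma> S G + ennreal ?T * (mass S G)^2 * ?W))"
 proof -
  have alg: "p * (t * (c * (If + m * IG)) + T * (c * (f2 + m * G2)) * W) = (p * c) * (t * If + T * (f2 * W) + m * (t * IG + T * G2 * W))"
   for p t c If m IG T f2 G2 W :: ennreal by (simp add: distrib_left distrib_right mult_ac add_ac)
  have "ennreal (Cp * \<rho>^2) * ennreal (288 / \<rho>^2) = ennreal (288 * Cp)" using Cp \<rho> by (simp add: ennreal_mult'[symmetric])
  then show ?thesis unfolding alg by simp
 qed
 also have "... <= ennreal (288 * Cp) * (ennreal ?t * energy \<sigma> S f + ennreal ?T * (ennreal (ca * (?v * (3 * \<rho>) ^ ?d)^2) * energy \<sigma> S f) + ennreal (M^2) * (ennreal (\<tau>^2) * energy \<sigma> S G + ennreal ?T * (mass S G)^2 * ?W))"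
 proof (intro mult_left_mono add_mono mult_right_mono fW ennreal_leI order_refl)
  have "\<tau>^2 <= 1" "\<tau> ^ (2 * ?d) <= 1" using \<tau> by (auto intro!: power_le_one)
  then show "\<tau>^2 <= ?t" using \<tau> by (simp add: order_trans[of _ 1])
 qed auto
 also have "... = ennreal (288 * Cp) * (ennreal cf * (ennreal ?t * energy \<sigma> S f) + ennreal (M^2) * (ennreal (\<tau>^2) * energy \<sigma> S G + ennreal ?T * (mass S G)^2 * ?W))"
 proof -
  have p: "(3 * \<rho>) ^ ?d * ((3 * \<rho>) ^ ?d) = (3 ^ ?d * 3 ^ ?d) * \<rho> ^ (?d * 2)" by (simp add: power_mult_distrib power_mult power2_eq_square mult_ac)
  have "?T * (ca * (?v * (3 * \<rho>) ^ ?d)^2) = (cf - 1) * ?t"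
  proof -
   have "(?v * (3 * \<rho>) ^ ?d)^2 = ?v * ?v * ((3 * \<rho>) ^ ?d * ((3 * \<rho>) ^ ?d))" by (simp only: power2_eq_square mult_ac)
   then show ?thesis using \<rho> \<tau> unfolding cf_def p by (simp add: power2_eq_square power_mult_distrib[of \<tau>] field_simps)
  qed
  then have "?t + ?T * (ca * (?v * (3 * \<rho>) ^ ?d)^2) = cf * ?t" by (simp only: left_diff_distrib mult_1_left)
  then have 1: "ennreal ?t + ennreal ?T * ennreal (ca * (?v * (3 * \<rho>) ^ ?d)^2) = ennreal cf * ennreal ?t"
   using \<rho> \<tau> ca cf by (simp add: ennreal_mult'[symmetric] flip: ennreal_plus)
  have alg: "t * If + T * (c * If) = (t + T * c) * If" for t If T c :: ennreal by (simp only: distrib_right mult.assoc)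
  show ?thesis unfolding alg 1 by (simp only: mult.assoc)
 qed
 also have "... <= ennreal (288 * Cp) * (ennreal (cf + M^2) * (ennreal ?t * energy \<sigma> S f) + ennreal (cf + M^2) * (ennreal (\<tau>^2) * energy \<sigma> S G + ennreal ?T * (mass S G)^2 * ?W))"
  using cf by (intro mult_left_mono add_mono mult_right_mono ennreal_leI) auto
 also have "... = ennreal (288 * Cp * (cf + M^2)) * ((ennreal (\<tau>^2) * energy \<sigma> S G + ennreal ?T * (mass S G)^2 * ?W) + ennreal ?t * energy \<sigma> S f)"
 proof -
  have alg: "ennreal p * (ennreal c * X + ennreal c * Y) = ennreal (p * c) * (Y + X)" if "0 <= p" "0 <= c" for p c and X Y :: ennreal
   using that by (simp add: ennreal_mult distrib_left mult_ac add_ac)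
  show ?thesis by (rule alg) (use Cp cf in auto)
 qed
 finally show ?thesis .
qed

text \<open>Depends on the weight only through its A1 constant and the constant \<open>Ce\<close> of
  the weighted estimate, not through the bound N; uniformity in the truncation rests on
  this.\<close>

definition local_const :: "nat => real => real => real => real => real" where
 "local_const d ca M \<kappa> Ce = 3 * Ce * (1 + 72 / \<kappa> ^ (2 * d) * (ca * 6 ^ (2 * d) + 1 / (unit_ball_vol (real d))^2)
   * (288 * (1 + ca * (unit_ball_vol (real d) * 3 ^ d)^2 + M^2) + 864 * M^2))"

text \<open>A Caccioppoli inequality obtained without testing by the weighted solution, for which no
  coercivity is available. The cut-off solution \<open>\<eta> (U - c)\<close> solves a global
  equation whose data are the cut-off f, the dual potential and the commutator with \<eta>. The
  global weighted estimate applies, and the Poincare inequality controls the commutator.\<close>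

lemma local_estimate_ball:
 fixes U :: "real^'d => real^'m"
 assumes w: "weight ca N \<sigma>" and h: "h1 \<Omega> U G" and a: "coef M a" and f: "L2 f" and est: "energy_est \<Omega> a \<sigma> Ce" and Ce: "0 <= Ce"
  and \<tau>: "0 < \<tau>" "\<tau> <= 1" and \<rho>: "0 < \<rho>" and \<kappa>: "0 < \<kappa>"
  and sub: "ball q (\<kappa> * \<rho>) \<subseteq> ball x0 (3 * \<rho>)"
  and alt: "cball x0 (3/2 * \<rho>) \<subseteq> \<Omega> \<or> ball q (\<kappa> * \<rho>) \<inter> \<Omega> = {}"
  and weak: "weak_on (\<Omega> \<inter> ball x0 (3 * \<rho>)) a f G"
 defines "S \<equiv> ball x0 (3 * \<rho>)"
 shows "energy \<sigma> (ball x0 \<rho>) G <= ennreal (local_const CARD('d) ca M \<kappa> Ce) * (ennreal (\<tau>^2) * energy \<sigma> S G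
   + ennreal (1 / (\<tau> * \<rho>) ^ (2 * CARD('d))) * (mass S G)^2 * sint S (%x. ennreal (\<sigma> x)) + ennreal (1 / \<tau> ^ (2 * CARD('d))) * energy \<sigma> S f)"
proof -
 interpret weight ca N \<sigma> by (rule w)
 let ?d = "CARD('d)"
 obtain \<eta> d\<eta> where \<eta>: "cutoff x0 \<rho> \<eta> d\<eta>" using cutoff_exists[OF \<rho>] by blast
 define Cp where "Cp = 72 / \<kappa> ^ (2 * ?d) * (ca * 6 ^ (2 * ?d) + 1 / (unit_ball_vol (real ?d))^2)"
 define cf where "cf = 1 + ca * (unit_ball_vol (real ?d) * 3 ^ ?d)^2"
 have Cp: "0 <= Cp" unfolding Cp_def using \<kappa> ca by auto
 have cf: "1 <= cf" unfolding cf_def using ca by simp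
 define c where "c = bavg (ball q (\<kappa> * \<rho>)) U"
 define \<gamma> where "\<gamma> = (%x. (f x + a x (G x)) *v d\<eta> x)"
 define \<Phi> where "\<Phi> = dual_potential.potential q (\<kappa> * \<rho>) \<gamma>"
 define O1 where "O1 x = outer (U x - c) (d\<eta> x)" for x
 note L = h1_L2[OF h]
 have M: "0 <= M" and Mb: "!!x \<xi>. norm (a x \<xi>) <= M * norm \<xi>" using a by (auto simp: coef_def)
 have \<eta>1: "\<bar>\<eta> x\<bar> <= 1" for x using \<eta> by (simp add: cutoff_def)
 have dp: "dual_potential x0 q \<rho> (\<kappa> * \<rho>) \<gamma>" if "C1c \<Omega> (\<phi>::real^'d => real^'m)" for \<phi>
  unfolding \<gamma>_def by (rule cutoff_equation(1)[OF L(2) a f \<rho> _ \<eta> sub alt weak that]) (use \<kappa> \<rho> in simp)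
 obtain \<phi>0 :: "nat => real^'d => real^'m" where "\<forall>k. C1c \<Omega> (\<phi>0 k)" using h unfolding h1_def by blast
 then have C0: "C1c \<Omega> (\<phi>0 0)" by (rule spec)
 interpret dual_potential x0 q \<rho> "\<kappa> * \<rho>" \<gamma> by (rule dp[OF C0])
 \<comment> \<open>When the averaging ball lies outside the domain, U vanishes on it and the
   subtracted mean is 0, which is the condition for \<open>h1_cutoff\<close>.\<close>
 have c0: "c = 0 \<or> cball x0 (3/2 * \<rho>) \<subseteq> \<Omega>"
 proof (cases "ball q (\<kappa> * \<rho>) \<inter> \<Omega> = {}")
  case True
  have "U x = 0" if "x \<in> ball q (\<kappa> * \<rho>)" for x using h that True unfolding h1_def by blast
  then have "(%x. indicator (ball q (\<kappa> * \<rho>)) x *\<^sub>R U x) = (%x. 0)" by (auto simp: indicator_def)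
  then show ?thesis by (simp add: c_def bavg_def)
 qed (use alt in auto)
 have hZ: "h1 \<Omega> (%x. \<eta> x *\<^sub>R (U x - c)) (%x. \<eta> x *\<^sub>R G x + O1 x)" unfolding O1_def by (rule h1_cutoff[OF h \<eta> \<rho> c0])
 have [measurable]: "borel_fun \<eta>" "borel_fun d\<eta>" using cutoff_regular[OF \<eta>] by auto
 have [measurable]: "borel_fun f" "borel_fun G" "borel_fun U" using f L by (auto simp: L2_def)
 have [measurable]: "S \<in> sets borel" by (simp add: S_def)
 have L\<eta>: "L2 (%x. \<eta> x *\<^sub>R F x)" if "L2 F" for F :: "real^'d => real^'d^'m"
  by (rule L2_dominated[OF _ _ that, of _ 1]) (use \<eta>1 that in \<open>auto simp: mult_right_le_one_le mult.commute[of "\<bar>_\<bar>"]\<close>)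
 have LO: "L2 O1" using L2_diff[OF h1_L2(2)[OF hZ] L\<eta>[OF L(2)]] by simp
 \<comment> \<open>The data of the cut-off equation. The commutator enters with a minus sign because
   it is already contained in the coefficient map applied to the new gradient.\<close>
 define F where "F x = \<eta> x *\<^sub>R f x + \<Phi> x - a x (O1 x)" for x
 have "F = (%x. (\<eta> x *\<^sub>R f x + \<Phi> x) - a x (O1 x))" by (simp add: F_def fun_eq_iff)
 then have LF: "L2 F" unfolding \<Phi>_def by (simp only:) (intro L2_diff L2_add L\<eta> f L2_potential coef_L2[OF a] LO)
 have "ip (%x. a x (\<eta> x *\<^sub>R G x + O1 x) + F x) (jac \<phi>) = 0" if "C1c \<Omega> (\<phi>::real^'d => real^'m)" for \<phi>
  using cutoff_equation(2)[OF L(2) a f \<rho> _ \<eta> sub alt weak that, of U c] LO \<kappa> \<rho> by (simp add: F_def O1_def[abs_def] \<Phi>_def \<gamma>_def)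
 then have E: "nint (%x. ennreal (\<sigma> x * (norm (\<eta> x *\<^sub>R G x + O1 x))^2)) <= ennreal Ce * nint (%x. ennreal (\<sigma> x * (norm (F x))^2))"
  using est[unfolded energy_est_def, rule_format, OF hZ LF] by blast
 let ?W = "sint S (%x. ennreal (\<sigma> x))"
 let ?X = "ennreal (\<tau>^2) * energy \<sigma> S G + ennreal (1 / (\<tau> * \<rho>) ^ (2 * ?d)) * (mass S G)^2 * ?W"
 let ?Y = "ennreal (1 / \<tau> ^ (2 * ?d)) * energy \<sigma> S f"
 have \<Phi>e: "energy \<sigma> UNIV \<Phi> <= ennreal (288 * Cp * (cf + M^2)) * (?X + ?Y)" unfolding \<Phi>_def Cp_def cf_def S_def
  by (rule energy_potential[OF w a L(2) f \<tau> \<rho> \<kappa> \<eta>, folded \<gamma>_def, OF dp[OF C0]])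
 have Pe: "energy \<sigma> S (%x. U x - c) <= ennreal (6 * Cp * \<rho>^2) * ?X"
  unfolding S_def Cp_def c_def by (rule poincare_weighted[OF w h \<tau> \<rho> \<kappa> sub])
 have "energy \<sigma> (ball x0 \<rho>) G <= nint (%x. ennreal (\<sigma> x * (norm (\<eta> x *\<^sub>R G x + O1 x))^2))"
 proof (rule nn_integral_mono)
  fix x
  have "\<eta> x *\<^sub>R G x + O1 x = G x" if "x \<in> ball x0 \<rho>"
   using that \<eta> cutoff_derivative_zero[OF \<eta> that] by (simp add: cutoff_def O1_def outer_def vec_eq_iff)
  then show "ennreal (\<sigma> x * (norm (G x))^2) * indicator (ball x0 \<rho>) x <= ennreal (\<sigma> x * (norm (\<eta> x *\<^sub>R G x + O1 x))^2)"
   by (auto simp: indicator_def)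
 qed
 also note E
 finally have GE: "energy \<sigma> (ball x0 \<rho>) G <= ennreal Ce * nint (%x. ennreal (\<sigma> x * (norm (F x))^2))" .
 have "nint (%x. ennreal (\<sigma> x * (norm (F x))^2)) <=
   (nint (%x. 3 * (ennreal (\<sigma> x * (norm (f x))^2) * indicator S x) + (3 * (ennreal (\<sigma> x * (norm (\<Phi> x))^2) * indicator UNIV x)
    + ennreal (432 * M^2 / \<rho>^2) * (ennreal (\<sigma> x * (norm (U x - c))^2) * indicator S x))))"
 proof (rule nn_integral_mono)
  fix x
  have z: "\<eta> x = 0" "d\<eta> x = 0" if "x \<notin> S"
  proof -
   have "x \<notin> cball x0 (3/2 * \<rho>)" using that \<rho> by (auto simp: S_def)
   then show "\<eta> x = 0" "d\<eta> x = 0" using \<eta> by (simp_all add: cutoff_def)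
  qed
  have 1: "(norm (\<eta> x *\<^sub>R f x))^2 <= (norm (f x))^2 * indicator S x"
  proof (cases "x \<in> S")
   case True
   have "norm (\<eta> x *\<^sub>R f x) <= norm (f x)" using \<eta>1[of x] by (simp add: mult_left_le_one_le)
   then show ?thesis using True by (simp add: power_mono)
  qed (simp add: z)
  have 2: "(norm (a x (O1 x)))^2 <= 144 * M^2 / \<rho>^2 * (norm (U x - c))^2 * indicator S x"
  proof (cases "x \<in> S")
   case True
   have "norm (a x (O1 x)) <= M * (norm (U x - c) * norm (d\<eta> x))" using Mb[of x "O1 x"] by (simp add: O1_def norm_outer)
   also have "... <= M * (norm (U x - c) * (12 / \<rho>))" using \<eta> M by (intro mult_left_mono) (auto simp: cutoff_def)
   finally have "(norm (a x (O1 x)))^2 <= (M * (norm (U x - c) * (12 / \<rho>)))^2" by (rule power_mono) simp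
   then show ?thesis using True by (simp add: power_mult_distrib power_divide mult_ac)
  next
   case False
   have "norm (a x (O1 x)) <= 0" using Mb[of x "O1 x"] z[OF False] by (simp add: O1_def norm_outer)
   then show ?thesis using False by simp
  qed
  have "(norm (F x))^2 <= 3 * (norm (\<eta> x *\<^sub>R f x))^2 + 3 * (norm (\<Phi> x))^2 + 3 * (norm (a x (O1 x)))^2"
   using norm_sum3_sq_le[of "\<eta> x *\<^sub>R f x" "\<Phi> x" "- a x (O1 x)"] by (simp add: F_def)
  also have "... <= 3 * ((norm (f x))^2 * indicator S x) + 3 * (norm (\<Phi> x))^2 + 3 * (144 * M^2 / \<rho>^2 * (norm (U x - c))^2 * indicator S x)"
   by (intro add_mono mult_left_mono 1 2) auto
  finally have "\<sigma> x * (norm (F x))^2 <= \<sigma> x * (3 * ((norm (f x))^2 * indicator S x) + 3 * (norm (\<Phi> x))^2 + 3 * (144 * M^2 / \<rho>^2 * (norm (U x - c))^2 * indicator S x))"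
   using nonneg by (rule mult_left_mono)
  then have "ennreal (\<sigma> x * (norm (F x))^2) <= ennreal (\<sigma> x * (3 * ((norm (f x))^2 * indicator S x) + 3 * (norm (\<Phi> x))^2 + 3 * (144 * M^2 / \<rho>^2 * (norm (U x - c))^2 * indicator S x)))"
   by (rule ennreal_leI)
  also have "... = ennreal (3 * (\<sigma> x * (norm (f x))^2 * indicator S x) + (3 * (\<sigma> x * (norm (\<Phi> x))^2) + 432 * M^2 / \<rho>^2 * (\<sigma> x * (norm (U x - c))^2 * indicator S x)))"
   by (rule arg_cong[of _ _ ennreal]) (simp add: algebra_simps)
  also have "... = 3 * (ennreal (\<sigma> x * (norm (f x))^2) * indicator S x) + (3 * (ennreal (\<sigma> x * (norm (\<Phi> x))^2) * indicator UNIV x)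
    + ennreal (432 * M^2 / \<rho>^2) * (ennreal (\<sigma> x * (norm (U x - c))^2) * indicator S x))"
  proof -
   have alg: "ennreal (3 * (s * u * i) + (3 * (s * v) + t * (s * w * i))) = 3 * (ennreal (s * u) * ennreal i) + (3 * (ennreal (s * v)) + ennreal t * (ennreal (s * w) * ennreal i))"
    if "0 <= s" "0 <= u" "0 <= v" "0 <= w" "0 <= t" "0 <= i" for s u v w t i using that by (simp add: ennreal_mult)
   have "ennreal (indicator S x) = indicator S x" by (simp add: indicator_def)
   then show ?thesis using alg[OF nonneg[of x], of "(norm (f x))^2" "(norm (\<Phi> x))^2" "(norm (U x - c))^2" "432 * M^2 / \<rho>^2" "indicator S x"] by simp
  qed
  finally show "ennreal (\<sigma> x * (norm (F x))^2) <= ..." .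
 qed
 also have "... = 3 * energy \<sigma> S f + (3 * energy \<sigma> UNIV \<Phi> + ennreal (432 * M^2 / \<rho>^2) * energy \<sigma> S (%x. U x - c))"
  unfolding \<Phi>_def by (simp add: nn_integral_cmult nn_integral_add)
 also have "... <= 3 * ?Y + (3 * (ennreal (288 * Cp * (cf + M^2)) * (?X + ?Y)) + ennreal (432 * M^2 / \<rho>^2) * (ennreal (6 * Cp * \<rho>^2) * ?X))"
 proof (intro add_mono mult_left_mono \<Phi>e Pe)
  have "\<tau> ^ (2 * ?d) <= 1" using \<tau> by (intro power_le_one) auto
  then have "(1::ennreal) <= ennreal (1 / \<tau> ^ (2 * ?d))" using \<tau> by simp
  from mult_right_mono[OF this, of "energy \<sigma> S f"] show "energy \<sigma> S f <= ?Y" by simp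
 qed auto
 also have "... <= 3 * (?X + ?Y) + (3 * (ennreal (288 * Cp * (cf + M^2)) * (?X + ?Y)) + ennreal (432 * M^2 / \<rho>^2) * (ennreal (6 * Cp * \<rho>^2) * (?X + ?Y)))"
 proof -
  have alg: "3 * Y + (3 * (p * (X + Y)) + q * (r * X)) <= 3 * (X + Y) + (3 * (p * (X + Y)) + q * (r * (X + Y)))" for p q r X Y :: ennreal
   by (intro add_mono mult_left_mono) auto
  show ?thesis by (rule alg)
 qed
 also have "... = ennreal (3 * (1 + Cp * (288 * (cf + M^2) + 864 * M^2))) * (?X + ?Y)"
 proof -
  have alg: "3 * Z + (3 * (ennreal p * Z) + ennreal q * (ennreal r * Z)) = ennreal (3 + 3 * p + q * r) * Z" if "0 <= p" "0 <= q" "0 <= r" for p q r and Z :: ennreal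
   using that by (simp add: ennreal_mult distrib_left mult_ac add_ac)
  have ce: "3 + 3 * (288 * Cp * (cf + M^2)) + (432 * M^2 / \<rho>^2) * (6 * Cp * \<rho>^2) = 3 * (1 + Cp * (288 * (cf + M^2) + 864 * M^2))"
   using \<rho> by (simp add: field_simps)
  show ?thesis unfolding ce[symmetric] by (rule alg) (use Cp cf in auto)
 qed
 finally have FB: "nint (%x. ennreal (\<sigma> x * (norm (F x))^2)) <= ennreal (3 * (1 + Cp * (288 * (cf + M^2) + 864 * M^2))) * (?X + ?Y)" .
 note GE
 also have "ennreal Ce * nint (%x. ennreal (\<sigma> x * (norm (F x))^2)) <= ennreal Ce * (ennreal (3 * (1 + Cp * (288 * (cf + M^2) + 864 * M^2))) * (?X + ?Y))"
  by (rule mult_left_mono[OF FB]) simp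
 also have "ennreal Ce * (ennreal (3 * (1 + Cp * (288 * (cf + M^2) + 864 * M^2))) * (?X + ?Y)) = ennreal (local_const CARD('d) ca M \<kappa> Ce) * (?X + ?Y)"
 proof -
  have alg: "ennreal p * (ennreal q * Z) = ennreal (p * q) * Z" if "0 <= p" "0 <= q" for p q and Z :: ennreal using that by (simp add: ennreal_mult mult_ac)
  have "ennreal Ce * (ennreal (3 * (1 + Cp * (288 * (cf + M^2) + 864 * M^2))) * (?X + ?Y)) = ennreal (Ce * (3 * (1 + Cp * (288 * (cf + M^2) + 864 * M^2)))) * (?X + ?Y)"
   by (rule alg) (use Cp cf Ce in auto)
  also have "Ce * (3 * (1 + Cp * (288 * (cf + M^2) + 864 * M^2))) = local_const CARD('d) ca M \<kappa> Ce" by (simp add: local_const_def Cp_def cf_def)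
  finally show ?thesis .
 qed
 finally show ?thesis .
qed

text \<open>Supplies the averaging ball. If the ball of radius \<open>2 * \<rho>\<close> lies in the
  domain, a concentric small ball serves; if it misses the domain there is nothing to prove;
  otherwise it contains a boundary point p, and an exterior ball near p serves, since
  \<open>ball p \<rho>\<close> still lies in the ball of radius \<open>3 * \<rho>\<close>.\<close>

lemma local_estimate:
 fixes U :: "real^'d => real^'m"
 assumes w: "weight ca N \<sigma>" and h: "h1 \<Omega> U G" and a: "coef M a" and f: "L2 f" and est: "energy_est \<Omega> a \<sigma> Ce" and Ce: "0 <= Ce"
  and \<tau>: "0 < \<tau>" "\<tau> <= 1" and \<rho>: "0 < \<rho>" "\<rho> <= r1" and \<kappa>: "0 < \<kappa>" "\<kappa> <= 1/2" and out: "outer_balls \<Omega> \<kappa> r1"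
  and weak: "weak_on (\<Omega> \<inter> ball x0 (3 * \<rho>)) a f G"
 defines "S \<equiv> ball x0 (3 * \<rho>)"
 shows "energy \<sigma> (ball x0 \<rho>) G <= ennreal (local_const CARD('d) ca M \<kappa> Ce) * (ennreal (\<tau>^2) * energy \<sigma> S G
   + ennreal (1 / (\<tau> * \<rho>) ^ (2 * CARD('d))) * (mass S G)^2 * sint S (%x. ennreal (\<sigma> x)) + ennreal (1 / \<tau> ^ (2 * CARD('d))) * energy \<sigma> S f)"
proof -
 note loc = local_estimate_ball[OF w h a f est Ce \<tau> \<rho>(1) \<kappa>(1) _ _ weak, folded S_def]
 consider "ball x0 (2 * \<rho>) \<subseteq> \<Omega>" | "ball x0 (2 * \<rho>) \<inter> \<Omega> = {}" | "ball x0 (2 * \<rho>) \<inter> \<Omega> \<noteq> {}" "ball x0 (2 * \<rho>) - \<Omega> \<noteq> {}"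
  by blast
 then show ?thesis
 proof cases
  case 1
  have "\<kappa> * \<rho> <= 1 / 2 * \<rho>" using \<kappa> \<rho> by (intro mult_right_mono) auto
  then have "ball x0 (\<kappa> * \<rho>) \<subseteq> ball x0 (3 * \<rho>)" using \<rho> by (intro subset_ball) linarith
  moreover have "cball x0 (3/2 * \<rho>) \<subseteq> ball x0 (2 * \<rho>)" using \<rho> by auto
  ultimately show ?thesis using 1 by (intro loc) (auto simp: S_def)
 next
  case 2
  have "G x = 0" if "x \<in> ball x0 \<rho>" for x
  proof -
   have "x \<in> ball x0 (2 * \<rho>)" using that \<rho> by auto
   then show ?thesis using h 2 unfolding h1_def by blast
  qed
  then have "energy \<sigma> (ball x0 \<rho>) G = (\<integral>\<^sup>+x. 0 \<partial>(lborel :: (real^'d) measure))" by (intro nn_integral_cong) (auto simp: indicator_def)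
  then show ?thesis by simp
 next
  case 3
  have "ball x0 (2 * \<rho>) \<inter> frontier \<Omega> \<noteq> {}" by (rule connected_Int_frontier[OF connected_ball 3])
  then obtain p where p: "p \<in> frontier \<Omega>" "p \<in> ball x0 (2 * \<rho>)" by blast
  obtain q where q: "ball q (\<kappa> * \<rho>) \<subseteq> ball p \<rho>" "ball q (\<kappa> * \<rho>) \<inter> \<Omega> = {}"
   using out p(1) \<rho> unfolding outer_balls_def by blast
  have "ball p \<rho> \<subseteq> ball x0 (3 * \<rho>)"
  proof
   fix y assume "y \<in> ball p \<rho>"
   then show "y \<in> ball x0 (3 * \<rho>)" using p(2) dist_triangle[of x0 y p] by simp
  qed
  then show ?thesis using q by (intro loc) (auto simp: S_def)
 qed
qed

definition rh_const :: "nat => real => real" where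
 "rh_const d C = 2 * 24 ^ d * C * 5 ^ (2 * d) * (24 / sqrt (1 / (1 + 2 * 24 ^ d * C * (9/7) ^ (2 * d)))) ^ (2 * d)"

lemma local_const_nonneg: "0 <= ca ==> 0 < \<kappa> ==> 0 <= Ce ==> 0 <= local_const d ca M \<kappa> Ce" by (simp add: local_const_def)

lemma rh_const_nonneg: "0 <= C ==> 0 <= rh_const d C" by (simp add: rh_const_def)

text \<open>The local estimate holds on every ball inside \<open>ball x0 (4 * r)\<close> and for
  every \<tau>, which is the hypothesis of \<open>reverse_holder_absorb\<close>; boundedness of
  \<sigma> gives the finite energy needed there. The size restriction \<open>4 * r <= 3 * r1\<close>
  keeps all radii in the range of the exterior balls.\<close>

lemma reverse_holder:
 fixes U :: "real^'d => real^'m"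
 assumes w: "weight ca N \<sigma>" and h: "h1 \<Omega> U G" and a: "coef M a" and f: "L2 f" and est: "energy_est \<Omega> a \<sigma> Ce" and Ce: "0 <= Ce"
  and r: "0 < r" "4 * r <= 3 * r1" and \<kappa>: "0 < \<kappa>" "\<kappa> <= 1/2" and out: "outer_balls \<Omega> \<kappa> r1"
  and weak: "weak_on (\<Omega> \<inter> ball x0 (4 * r)) a f G"
 shows "energy \<sigma> (ball x0 r) G <= ennreal (rh_const CARD('d) (local_const CARD('d) ca M \<kappa> Ce)) *
   (ennreal (1 / r ^ (2 * CARD('d))) * (mass (ball x0 (4 * r)) G)^2 * sint (ball x0 (4 * r)) (%x. ennreal (\<sigma> x)) + energy \<sigma> (ball x0 (4 * r)) f)"
proof -
 interpret weight ca N \<sigma> by (rule w)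
 have [measurable]: "borel_fun f" "borel_fun G" using f h1_L2[OF h] by (auto simp: L2_def)
 have e: "ennreal (\<sigma> x * (norm (F x))^2) = ennreal (\<sigma> x) * (ennreal (norm (F x)))^2" for F :: "real^'d => real^'d^'m" and x
  using nonneg by (simp add: ennreal_mult ennreal_power)
 show ?thesis unfolding e rh_const_def
 proof (rule reverse_holder_absorb[where 'a="real^'d", unfolded DIM_cart DIM_real mult_1_right])
  show "0 <= local_const CARD('d) ca M \<kappa> Ce" by (rule local_const_nonneg[OF ca \<kappa>(1) Ce])
  have "energy \<sigma> (ball x0 (4 * r)) G <= nint (%x. ennreal (\<sigma> x * (norm (G x))^2))" by (intro nn_integral_mono) (auto simp: indicator_def)
  also have "... <= ennreal (N * (n2 G)^2)" by (rule L2_weight_bound[OF h1_L2(2)[OF h]])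
  also have "... < top" by simp
  finally show "sint (ball x0 (4 * r)) (%x. ennreal (\<sigma> x) * (ennreal (norm (G x)))^2) < top" unfolding e .
 next
  fix x and \<rho> \<tau> :: real assume \<rho>: "0 < \<rho>" and sub: "ball x (3 * \<rho>) \<subseteq> ball x0 (4 * r)" and \<tau>: "0 < \<tau>" "\<tau> <= 1"
  have "3 * \<rho> <= 4 * r" using sub \<rho> using zero_le_dist[of x x0] by (simp add: ball_subset_ball_iff del: zero_le_dist)
  then have "\<rho> <= r1" using r by linarith
  moreover have "weak_on (\<Omega> \<inter> ball x (3 * \<rho>)) a f G" unfolding weak_on_def
  proof (intro allI impI)
   fix \<phi> :: "real^'d => real^'m" assume "C1c (\<Omega> \<inter> ball x (3 * \<rho>)) \<phi>"
   then have "C1c (\<Omega> \<inter> ball x0 (4 * r)) \<phi>" using sub unfolding C1c_def by blast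
   then show "ip (%x. a x (G x) + f x) (jac \<phi>) = 0" using weak by (simp add: weak_on_def)
  qed
  ultimately show "sint (ball x \<rho>) (%y. ennreal (\<sigma> y) * (ennreal (norm (G y)))^2) <= ennreal (local_const CARD('d) ca M \<kappa> Ce) *
    (ennreal (\<tau>^2) * sint (ball x (3 * \<rho>)) (%y. ennreal (\<sigma> y) * (ennreal (norm (G y)))^2)
    + ennreal (1 / (\<tau> * \<rho>) ^ (2 * CARD('d))) * (mass (ball x (3 * \<rho>)) G)^2 * sint (ball x (3 * \<rho>)) (%y. ennreal (\<sigma> y))
    + ennreal (1 / \<tau> ^ (2 * CARD('d))) * sint (ball x (3 * \<rho>)) (%y. ennreal (\<sigma> y) * (ennreal (norm (f y)))^2))"
   using local_estimate[OF w h a f est Ce \<tau> \<rho> _ \<kappa> out] unfolding e by blast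
 qed (use r in auto)
qed

section \<open>Constant coefficients\<close>

definition ell :: "real => real => ('a::euclidean_space => 'b::euclidean_space => 'b) => bool" where
 "ell \<mu> M a \<longleftrightarrow> 0 < \<mu> & coef M a & (\<forall>x \<xi>. \<mu> * (norm \<xi>)^2 <= a x \<xi> \<bullet> \<xi>)"

lemma weight_one: "weight 1 1 (%_::'a::euclidean_space. 1)" using A1_const[of 1] by unfold_locales (auto simp: ennreal_1[symmetric] simp del: ennreal_1)

text \<open>Testing with the solution itself: coercivity on the left, Cauchy-Schwarz on the right.
  It makes all weighted results available for the constant weight 1.\<close>

lemma energy_est_one:
 assumes e: "ell \<mu> M (a :: real^'d => real^'d^'m => real^'d^'m)"
 shows "energy_est \<Omega> a (%_. 1) (1 / \<mu>^2)" unfolding energy_est_def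
proof (intro allI impI)
 fix Z :: "real^'d => real^'m" and GZ F assume h: "h1 \<Omega> Z GZ" and F: "L2 F"
  and eq: "\<forall>\<phi>. C1c \<Omega> \<phi> --> ip (%x. a x (GZ x) + F x) (jac \<phi>) = 0"
 have \<mu>: "0 < \<mu>" and a: "coef M a" and co: "!!x \<xi>. \<mu> * (norm \<xi>)^2 <= a x \<xi> \<bullet> \<xi>" using e by (auto simp: ell_def)
 note LG = h1_L2(2)[OF h]
 note La = coef_L2[OF a LG]
 have "ip (%x. a x (GZ x) + F x) GZ = 0" by (rule h1_test[OF L2_add[OF La F] _ h]) (use eq in blast)
 then have 0: "ip (%x. a x (GZ x)) GZ = - ip F GZ" using ip_add(1)[OF La F LG] by simp
 have "\<mu> * (n2 GZ)^2 = (LINT x|lborel. \<mu> * (norm (GZ x))^2)" by (simp add: n2_sq ip_def power2_norm_eq_inner)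
 also have "... <= ip (%x. a x (GZ x)) GZ" unfolding ip_def by (intro integral_mono L2_inner_integrable La LG co integrable_mult_right L2_sq_integrable)
 also have "... <= n2 F * n2 GZ" unfolding 0 using ip_CS[OF F LG] by linarith
 finally have 1: "\<mu> * n2 GZ * n2 GZ <= n2 F * n2 GZ" by (simp add: power2_eq_square)
 have "\<mu> * n2 GZ <= n2 F" using 1 n2_nonneg[of GZ] n2_nonneg[of F] by (cases "n2 GZ = 0") (auto simp: mult_le_cancel_right)
 then have "(\<mu> * n2 GZ)^2 <= (n2 F)^2" using \<mu> n2_nonneg[of GZ] by (intro power_mono) auto
 then have "(n2 GZ)^2 <= 1 / \<mu>^2 * (n2 F)^2" using \<mu> by (simp add: field_simps power_mult_distrib)
 then show "nint (%x. ennreal (1 * (norm (GZ x))^2)) <= ennreal (1 / \<mu>^2) * nint (%x. ennreal (1 * (norm (F x))^2))"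
  using \<mu> by (simp add: nn_integral_n2[OF LG] nn_integral_n2[OF F] ennreal_mult'[symmetric])
qed

section \<open>Existence of weak solutions for constant coefficients\<close>

lemma C1c_outside:
 assumes "C1c \<Omega> (\<phi> :: real^'d => real^'m)" "x \<notin> \<Omega>"
 shows "\<phi> x = 0" "jac \<phi> x = 0" by (rule C1cD[OF assms(1)], use assms(2) in blast)+

lemma h1_C1c:
 assumes "C1c \<Omega> (\<phi> :: real^'d => real^'m)" shows "h1 \<Omega> \<phi> (jac \<phi>)"
proof -
 show ?thesis unfolding h1_def
  using C1c_regular(5,6)[OF assms] C1c_outside[OF assms] assms by (intro conjI allI impI exI[of _ "%_. \<phi>"]) (auto simp: n2_def ip_def)
qed

text \<open>The Poincare inequality with an averaging ball outside the domain, where the mean is 0.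
  The domain lies in the ball of radius \<rho>, and the averaging ball of radius
  \<open>\<rho> / 2\<close> is centred at distance \<open>2 * \<rho>\<close> from the
  origin.\<close>

lemma friedrichs:
 fixes \<Omega> :: "(real^'d) set"
 assumes "bounded \<Omega>"
 shows "\<exists>C\<ge>0. \<forall>\<phi> :: real^'d => real^'m. C1c \<Omega> \<phi> --> n2 \<phi> <= C * n2 (jac \<phi>)"
proof -
 obtain \<rho> where \<rho>: "0 < \<rho>" "\<Omega> \<subseteq> ball 0 \<rho>" using assms by (metis bounded_subset_ballD)
 let ?S = "ball (0::real^'d) (3 * \<rho>)" and ?d = "CARD('d)"
 obtain e :: "real^'d" where e: "norm e = 1" using vector_choose_size[of 1] by auto
 define q where "q = (2 * \<rho>) *\<^sub>R e"
 have nq: "norm q = 2 * \<rho>" using e \<rho> by (simp add: q_def)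
 have sub: "ball q (1/2 * \<rho>) \<subseteq> ?S"
 proof
  fix y assume "y \<in> ball q (1/2 * \<rho>)"
  then show "y \<in> ?S" using nq \<rho> norm_triangle_sub[of y q] by (simp add: dist_norm norm_minus_commute)
 qed
 have dis: "ball q (1/2 * \<rho>) \<inter> \<Omega> = {}"
 proof -
  have "y \<notin> ball 0 \<rho>" if "y \<in> ball q (1/2 * \<rho>)" for y using that nq \<rho> norm_triangle_sub[of q y] by (simp add: dist_norm)
  then show ?thesis using \<rho> by blast
 qed
 obtain V where V: "0 <= V" "vol ?S = ennreal V" using emeasure_ball_fin[of 0 "3 * \<rho>"] by (metis ennreal_cases less_irrefl)
 define B where "B = 6 * (72 / (1/2) ^ (2 * ?d) * (1 * 6 ^ (2 * ?d) + 1 / (unit_ball_vol (real ?d))^2)) * \<rho>^2"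
 define D where "D = B * (1 + 1 / \<rho> ^ (2 * ?d) * V * V)"
 have B: "0 <= B" by (simp add: B_def)
 have D: "0 <= D" using B V \<rho> by (simp add: D_def)
 have "n2 \<phi> <= sqrt D * n2 (jac \<phi>)" if \<phi>: "C1c \<Omega> \<phi>" for \<phi> :: "real^'d => real^'m"
 proof -
  note reg = C1c_regular[OF \<phi>]
  note [measurable] = reg(3,4)
  note z = C1c_outside(1)[OF \<phi>]
  have "indicator (ball q (1/2 * \<rho>)) x *\<^sub>R \<phi> x = 0" for x
  proof (cases "x \<in> ball q (1/2 * \<rho>)")
   case True
   then have "x \<notin> \<Omega>" using dis by blast
   then show ?thesis using z by simp
  qed simp
  then have "(%x. indicator (ball q (1/2 * \<rho>)) x *\<^sub>R \<phi> x) = (%x. 0)" by blast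
  then have avg0: "bavg (ball q (1/2 * \<rho>)) \<phi> = 0" by (simp add: bavg_def)
  let ?E = "esq ?S (jac \<phi>)"
  have EJ: "?E <= ennreal ((n2 (jac \<phi>))^2)" unfolding nn_integral_n2[OF reg(6), symmetric] by (intro nn_integral_mono) (auto simp: indicator_def)
  have "(mass ?S (jac \<phi>))^2 <= vol ?S * ?E" using nn_integral_square_le[of "%x. ennreal (norm (jac \<phi> x))" ?S] by (simp add: ennreal_power)
  then have m2: "(mass ?S (jac \<phi>))^2 <= ennreal V * ?E" unfolding V(2) .
  have "ennreal ((n2 \<phi>)^2) = esq ?S (%x. \<phi> x - bavg (ball q (1/2 * \<rho>)) \<phi>)" unfolding nn_integral_n2[OF reg(5), symmetric] avg0
  proof (intro nn_integral_cong)
   fix x show "ennreal ((norm (\<phi> x))^2) = ennreal (1 * (norm (\<phi> x - 0))^2) * indicator ?S x"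
   proof (cases "x \<in> ?S")
    case False
    then have "x \<notin> \<Omega>" using \<rho> subset_ball[of \<rho> "3 * \<rho>" "0::real^'d"] by auto
    then show ?thesis by (simp add: z)
   qed simp
  qed
  also have "... <= ennreal B * (ennreal (1^2) * ?E + ennreal (1 / (1 * \<rho>) ^ (2 * ?d)) * (mass ?S (jac \<phi>))^2 * sint ?S (%x. ennreal 1))"
   unfolding B_def by (rule poincare_weighted[OF weight_one h1_C1c[OF \<phi>] _ _ \<rho>(1) _ sub]) auto
  also have "... <= ennreal B * (ennreal (1^2) * ?E + ennreal (1 / (1 * \<rho>) ^ (2 * ?d)) * (ennreal V * ?E) * ennreal V)"
   using V(2) by (intro mult_left_mono add_mono mult_right_mono mult_mono m2) auto
  also have "... = ennreal D * ?E"
  proof -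
   have alg: "ennreal B * (ennreal (1^2) * E + ennreal t * (ennreal V * E) * ennreal V) = ennreal (B * (1 + t * V * V)) * E" if "0 <= t" for t and E :: ennreal
    using that B V by (simp add: ennreal_mult distrib_left distrib_right mult_ac)
   show ?thesis unfolding D_def using alg[of "1 / \<rho> ^ (2 * ?d)" ?E] \<rho> by simp
  qed
  also have "... <= ennreal D * ennreal ((n2 (jac \<phi>))^2)" by (intro mult_left_mono EJ) simp
  finally have "(n2 \<phi>)^2 <= D * (n2 (jac \<phi>))^2" using D by (simp add: ennreal_mult'[symmetric])
  also have "... = (sqrt D * n2 (jac \<phi>))^2" using D by (simp add: power_mult_distrib)
  finally show ?thesis by (rule power2_le_imp_le) (simp add: D n2_nonneg)
 qed
 then show ?thesis using D by (intro exI[of _ "sqrt D"]) auto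
qed

lemma n2_vanishing_le:
 assumes "L2 F" "L2 H" "!!x. x \<notin> \<Omega> ==> F x = 0" "\<Omega> \<in> sets borel"
 shows "n2 (%x. F x - indicator \<Omega> x *\<^sub>R H x) <= n2 (%x. F x - H x)"
proof -
 have [measurable]: "borel_fun H" "\<Omega> \<in> sets borel" using assms by (auto simp: L2_def)
 have i: "L2 (%x. indicator \<Omega> x *\<^sub>R H x)" by (rule L2_dominated[OF _ _ assms(2), of _ 1]) (auto simp: indicator_def)
 show ?thesis using n2_mono[OF L2_diff[OF assms(1) i] L2_diff[OF assms(1,2)], of 1] assms(3) by (auto simp: indicator_def)
qed

text \<open>Lax-Milgram works on the closure of the space of gradients alone and yields a gradient
  without its function. Friedrichs' inequality makes the functions belonging to a fast approximating
  sequence of gradients converge as well. Multiplication with the indicator of the domain produces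
  the representatives that \<open>h1\<close> asks for.\<close>

lemma weak_solution_exists:
 fixes \<Omega> :: "(real^'d) set" and a :: "real^'d^'m => real^'d^'m"
 assumes e: "ell \<mu> M (%_ :: real^'d. a :: real^'d^'m => real^'d^'m)" and F: "L2 F" and \<Omega>: "open \<Omega>" "bounded \<Omega>"
  and ne: "C1c \<Omega> (\<phi>0 :: real^'d => real^'m)"
 shows "\<exists>U G. h1 \<Omega> U G & weak_on \<Omega> (%_. a) F G"
proof -
 let ?V = "{jac \<phi> | \<phi> :: real^'d => real^'m. C1c \<Omega> \<phi>}"
 have [measurable]: "\<Omega> \<in> sets borel" using \<Omega> by simp
 have comb: "\<exists>\<theta>. (%x. c *\<^sub>R jac \<phi> x + d *\<^sub>R jac \<psi> x) = jac \<theta> & C1c \<Omega> \<theta>"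
  if "C1c \<Omega> \<phi>" "C1c \<Omega> \<psi>" for \<phi> \<psi> :: "real^'d => real^'m" and c d
  using C1c_comb[OF that, of c d] by (intro exI[of _ "%x. c *\<^sub>R \<phi> x + d *\<^sub>R \<psi> x"]) simp
 have V: "L2_subspace ?V" unfolding L2_subspace_def
 proof (intro conjI ballI allI)
  show "(%x. 0) \<in> ?V" using comb[OF ne ne, of 0 0] by auto
 qed (use comb C1c_regular(6) in blast)+
 have lin: "linear a" "0 < \<mu>" "!!\<xi>. norm (a \<xi>) <= M * norm \<xi>" "!!\<xi>. \<mu> * (norm \<xi>)^2 <= a \<xi> \<bullet> \<xi>"
  using e by (auto simp: ell_def coef_def)
 obtain G where G: "G \<in> L2_closure ?V" and eq: "\<forall>H\<in>?V. ip (%x. a (G x) + F x) H = 0" using lax_milgram[OF V F lin] by blast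
 have LG: "L2 G" using G by (simp add: L2_closure_def)
 have "\<exists>\<psi>. C1c \<Omega> \<psi> & n2 (%x. jac \<psi> x - G x) <= (1/2) ^ n" for n :: nat
 proof -
  obtain \<Phi> where \<Phi>: "\<forall>k. \<Phi> k \<in> ?V" "(%k. n2 (%x. \<Phi> k x - G x)) ~~~> 0" using G by (auto simp: L2_closure_def)
  have "eventually (%k. n2 (%x. \<Phi> k x - G x) < (1/2) ^ n) sequentially" by (rule order_tendstoD(2)[OF \<Phi>(2)]) simp
  then obtain k where k: "n2 (%x. \<Phi> k x - G x) < (1/2) ^ n" by (auto simp: eventually_sequentially)
  have "\<Phi> k \<in> ?V" using \<Phi>(1) by blast
  then obtain \<psi> where "C1c \<Omega> \<psi>" "\<Phi> k = jac \<psi>" by blast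
  then show ?thesis using k by (intro exI[of _ \<psi>]) simp
 qed
 then obtain \<psi> where \<psi>: "!!n. C1c \<Omega> (\<psi> n)" "!!n. n2 (%x. jac (\<psi> n) x - G x) <= (1/2) ^ n" by metis
 obtain C where C: "0 <= C" "!!\<phi> :: real^'d => real^'m. C1c \<Omega> \<phi> ==> n2 \<phi> <= C * n2 (jac \<phi>)" using friedrichs[OF \<Omega>(2)] by blast
 note L\<psi> = C1c_regular(5)[OF \<psi>(1)] and Lj = C1c_regular(6)[OF \<psi>(1)]
 have fast: "n2 (%x. \<psi> (Suc n) x - \<psi> n x) <= (2 * C) * (1/2) ^ n" for n
 proof -
  note c = C1c_comb[OF \<psi>(1)[of "Suc n"] \<psi>(1)[of n], of 1 "-1"]
  have "n2 (%x. \<psi> (Suc n) x - \<psi> n x) <= C * n2 (%x. jac (\<psi> (Suc n)) x - jac (\<psi> n) x)" using C(2)[OF c(1)] unfolding c(2) by simp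
  also have "... <= C * ((1/2) ^ Suc n + (1/2) ^ n)"
   using n2_diff_triangle[OF Lj[of "Suc n"] LG Lj[of n]] \<psi>(2)[of "Suc n"] \<psi>(2)[of n] n2_diff_commute[of G "jac (\<psi> n)"]
   by (intro mult_left_mono C) simp
  also have "... <= (2 * C) * (1/2) ^ n" using C(1) by (simp add: mult_left_mono algebra_simps)
  finally show ?thesis .
 qed
 obtain U where U: "L2 U" "(%n. n2 (%x. \<psi> n x - U x)) ~~~> 0" using L2_complete[OF L\<psi> _ _ _ fast] C(1) by auto
 note z = C1c_outside[OF \<psi>(1)]
 let ?U = "%x. indicator \<Omega> x *\<^sub>R U x" and ?G = "%x. indicator \<Omega> x *\<^sub>R G x"
 have [measurable]: "borel_fun U" "borel_fun G" using U LG by (auto simp: L2_def)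
 have LU': "L2 ?U" by (rule L2_dominated[OF _ _ U(1), of _ 1]) (auto simp: indicator_def)
 have LG': "L2 ?G" by (rule L2_dominated[OF _ _ LG, of _ 1]) (auto simp: indicator_def)
 have half: "(%n::nat. (1/2::real) ^ n) ~~~> 0" by (rule LIMSEQ_power_zero) simp
 have conv: "(%n. n2 (%x. \<psi> n x - ?U x)) ~~~> 0" "(%n. n2 (%x. jac (\<psi> n) x - ?G x)) ~~~> 0"
  using n2_tendsto_zeroI[OF n2_vanishing_le[OF L\<psi> U(1) z(1)] U(2)]
   n2_tendsto_zeroI[OF order_trans[OF n2_vanishing_le[OF Lj LG z(2)] \<psi>(2)] half] by auto
 have h: "h1 \<Omega> ?U ?G" unfolding h1_def using LU' LG' conv \<psi>(1) by (intro conjI exI[of _ \<psi>]) auto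
 have "weak_on \<Omega> (%_. a) F ?G" unfolding weak_on_def
 proof (intro allI impI)
  fix \<phi> :: "real^'d => real^'m" assume \<phi>: "C1c \<Omega> \<phi>"
  have "(a (?G x) + F x) \<bullet> jac \<phi> x = (a (G x) + F x) \<bullet> jac \<phi> x" for x using C1c_outside[OF \<phi>] by (cases "x \<in> \<Omega>") auto
  then have "ip (%x. a (?G x) + F x) (jac \<phi>) = ip (%x. a (G x) + F x) (jac \<phi>)" unfolding ip_def by simp
  also have "... = 0" using eq \<phi> by blast
  finally show "ip (%x. a (?G x) + F x) (jac \<phi>) = 0" .
 qed
 with h show ?thesis by blast
qed

section \<open>From bounded data and the full weight to square integrable data and truncated
  weights\<close>

text \<open>The part of the data where \<open>w > N\<close> is handled by the unweighted estimate: there \<open>min w N = N\<close> is constant.\<close>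

lemma energy_est_truncate:
 fixes \<Omega> :: "(real^'d) set" and a :: "real^'d^'m => real^'d^'m" and w :: "real^'d => real"
 assumes e: "ell \<mu> M (%_ :: real^'d. a :: real^'d^'m => real^'d^'m)" and \<Omega>: "open \<Omega>" "bounded \<Omega>"
  and wm[measurable]: "borel_fun w" and w0: "!!x. 0 <= w x" and N: "0 <= N"
  and bd: "!!F (U :: real^'d => real^'m) G. L2 F ==> \<exists>B. \<forall>x. norm (F x) <= B ==> h1 \<Omega> U G ==> weak_on \<Omega> (%_. a) F G ==>
    energy w UNIV G <= ennreal C1 * energy w UNIV F"
 shows "energy_est \<Omega> (%_. a) (%x. min (w x) N) (2 * max C1 (1 / \<mu>^2))" unfolding energy_est_def
proof (intro allI impI)
 fix Z :: "real^'d => real^'m" and GZ F assume h: "h1 \<Omega> Z GZ" and F: "L2 F"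
  and eq: "\<forall>\<phi>. C1c \<Omega> \<phi> --> ip (%x. a (GZ x) + F x) (jac \<phi>) = 0"
 define C where "C = max C1 (1 / \<mu>^2)"
 have C: "0 <= C" "C1 <= C" "1 / \<mu>^2 <= C" by (auto simp: C_def le_max_iff_disj)
 let ?\<sigma> = "%x. min (w x) N"
 have co: "coef M (%_. a)" and lin: "linear a" using e by (auto simp: ell_def coef_def)
 note LG = h1_L2(2)[OF h]
 have [measurable]: "borel_fun F" "borel_fun GZ" using F LG by (auto simp: L2_def)
 obtain \<phi>0 :: "nat => real^'d => real^'m" where "\<forall>k. C1c \<Omega> (\<phi>0 k)" using h unfolding h1_def by blast
 then have ne: "C1c \<Omega> (\<phi>0 0)" by (rule spec)
 \<comment> \<open>Where \<open>w <= N\<close>, large values of F have to be cut off as well, since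
   the hypothesis covers bounded data only. What is cut off is charged to the unweighted estimate,
   at the cost of N times a quantity that vanishes as k grows.\<close>
 define tail where "tail k = nint (%x. ennreal ((norm (F x))^2) * indicator {x. real k < norm (F x)} x)" for k :: nat
 have step: "energy ?\<sigma> UNIV GZ <= ennreal (2 * C) * (energy ?\<sigma> UNIV F + ennreal N * tail k)" for k
 proof -
  \<comment> \<open>On the support of \<open>F1\<close> the truncated and the full weight agree, so
    the full weighted energy of \<open>F1\<close> is bounded by the truncated energy of F.\<close>
  define F1 where "F1 x = indicator {x. w x <= N & norm (F x) <= real k} x *\<^sub>R F x" for x
  have [measurable]: "borel_fun F1" unfolding F1_def by measurable
  have L1: "L2 F1" by (rule L2_dominated[OF _ _ F, of _ 1]) (auto simp: F1_def indicator_def)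
  obtain U1 G1 where 1: "h1 \<Omega> (U1 :: real^'d => real^'m) G1" "weak_on \<Omega> (%_. a) F1 G1" using weak_solution_exists[OF e L1 \<Omega> ne] by blast
  note LG1 = h1_L2(2)[OF 1(1)]
  have [measurable]: "borel_fun G1" using LG1 by (auto simp: L2_def)
  have "norm (F1 x) <= real k" for x by (auto simp: F1_def indicator_def)
  then have E1: "energy w UNIV G1 <= ennreal C1 * energy w UNIV F1" by (intro bd[OF L1 _ 1]) blast
  have "energy ?\<sigma> UNIV G1 <= energy w UNIV G1" by (intro nn_integral_mono mult_right_mono ennreal_leI) auto
  also note E1
  also have "ennreal C1 * energy w UNIV F1 <= ennreal C * energy w UNIV F1" using C by (intro mult_right_mono ennreal_leI) auto
  finally have E1: "energy ?\<sigma> UNIV G1 <= ennreal C * energy w UNIV F1" .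
  have h2: "h1 \<Omega> (%x. Z x - U1 x) (%x. GZ x - G1 x)" by (rule h1_diff[OF h 1(1)])
  have L2F: "L2 (%x. F x - F1 x)" by (rule L2_diff[OF F L1])
  have eq2: "ip (%x. a (GZ x - G1 x) + (F x - F1 x)) (jac \<phi>) = 0" if \<phi>: "C1c \<Omega> \<phi>" for \<phi> :: "real^'d => real^'m"
  proof -
   have "ip (%x. (a (GZ x) + F x) - (a (G1 x) + F1 x)) (jac \<phi>) = 0"
    using eq 1(2) \<phi> by (subst ip_diff(1)) (auto simp: weak_on_def intro!: L2_add coef_L2[OF co] LG LG1 F L1 C1c_regular(6)[OF \<phi>])
   moreover have "(a (GZ x) + F x) - (a (G1 x) + F1 x) = a (GZ x - G1 x) + (F x - F1 x)" for x using lin by (simp add: linear_diff)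
   ultimately show ?thesis by simp
  qed
  have "energy ?\<sigma> UNIV (%x. GZ x - G1 x) <= nint (%x. ennreal N * ennreal (1 * (norm (GZ x - G1 x))^2))"
   using N by (intro nn_integral_mono) (simp add: ennreal_mult[symmetric] ennreal_leI mult_right_mono)
  also have "... = ennreal N * nint (%x. ennreal (1 * (norm (GZ x - G1 x))^2))" by (rule nn_integral_cmult) measurable
  also have "... <= ennreal N * (ennreal (1 / \<mu>^2) * nint (%x. ennreal (1 * (norm (F x - F1 x))^2)))"
   using energy_est_one[OF e, unfolded energy_est_def, rule_format, OF h2 L2F] eq2 by (intro mult_left_mono) auto
  also have "... <= ennreal N * (ennreal C * nint (%x. ennreal (1 * (norm (F x - F1 x))^2)))" using C by (intro mult_left_mono mult_right_mono ennreal_leI) auto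
  also have "... = ennreal C * nint (%x. ennreal N * ennreal ((norm (F x - F1 x))^2))" by (simp add: nn_integral_cmult mult_ac)
  finally have E2: "energy ?\<sigma> UNIV (%x. GZ x - G1 x) <= ennreal C * nint (%x. ennreal N * ennreal ((norm (F x - F1 x))^2))" .
  have "energy ?\<sigma> UNIV GZ <= nint (%x. 2 * (ennreal (?\<sigma> x * (norm (G1 x))^2) * indicator UNIV x) + 2 * (ennreal (?\<sigma> x * (norm (GZ x - G1 x))^2) * indicator UNIV x))"
  proof (rule nn_integral_mono)
   fix x
   have \<sigma>: "0 <= ?\<sigma> x" using w0 N by simp
   have "?\<sigma> x * (norm (GZ x))^2 <= ?\<sigma> x * (2 * (norm (G1 x))^2 + 2 * (norm (GZ x - G1 x))^2)"
    using norm_add_square_le[of "G1 x" "GZ x - G1 x"] by (intro mult_left_mono \<sigma>) simp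
   also have "... = 2 * (?\<sigma> x * (norm (G1 x))^2) + 2 * (?\<sigma> x * (norm (GZ x - G1 x))^2)" by (simp add: algebra_simps)
   finally have "ennreal (?\<sigma> x * (norm (GZ x))^2) <= ennreal (2 * (?\<sigma> x * (norm (G1 x))^2) + 2 * (?\<sigma> x * (norm (GZ x - G1 x))^2))" by (rule ennreal_leI)
   also have "... = 2 * ennreal (?\<sigma> x * (norm (G1 x))^2) + 2 * ennreal (?\<sigma> x * (norm (GZ x - G1 x))^2)"
    using \<sigma> by (subst ennreal_plus) (auto simp: ennreal_mult)
   finally show "ennreal (?\<sigma> x * (norm (GZ x))^2) * indicator UNIV x <= 2 * (ennreal (?\<sigma> x * (norm (G1 x))^2) * indicator UNIV x) + 2 * (ennreal (?\<sigma> x * (norm (GZ x - G1 x))^2) * indicator UNIV x)"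
    by simp
  qed
  also have "... = 2 * energy ?\<sigma> UNIV G1 + 2 * energy ?\<sigma> UNIV (%x. GZ x - G1 x)" by (simp add: nn_integral_add nn_integral_cmult)
  also have "... <= 2 * (ennreal C * energy w UNIV F1) + 2 * (ennreal C * nint (%x. ennreal N * ennreal ((norm (F x - F1 x))^2)))"
   by (intro add_mono mult_left_mono E1 E2) auto
  also have "... = ennreal (2 * C) * nint (%x. ennreal (w x * (norm (F1 x))^2) + ennreal N * ennreal ((norm (F x - F1 x))^2))"
  proof -
   have alg: "2 * (ennreal c * X) + 2 * (ennreal c * Y) = ennreal (2 * c) * (X + Y)" if "0 <= c" for c and X Y :: ennreal
    using that by (simp add: ennreal_mult distrib_left mult_ac)
   show ?thesis unfolding alg[OF C(1)] by (simp add: nn_integral_add)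
  qed
  also have "... <= ennreal (2 * C) * nint (%x. ennreal (?\<sigma> x * (norm (F x))^2) * indicator UNIV x + ennreal N * (ennreal ((norm (F x))^2) * indicator {x. real k < norm (F x)} x))"
  proof (intro mult_left_mono nn_integral_mono)
   fix x
   show "ennreal (w x * (norm (F1 x))^2) + ennreal N * ennreal ((norm (F x - F1 x))^2)
    <= ennreal (?\<sigma> x * (norm (F x))^2) * indicator UNIV x + ennreal N * (ennreal ((norm (F x))^2) * indicator {x. real k < norm (F x)} x)"
    using N by (cases "w x <= N"; cases "norm (F x) <= real k") (auto simp: F1_def ennreal_mult not_le min_def intro: add_increasing)
  qed simp
  also have "... = ennreal (2 * C) * (energy ?\<sigma> UNIV F + ennreal N * tail k)" unfolding tail_def by (simp add: nn_integral_add nn_integral_cmult)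
  finally show ?thesis .
 qed
 \<comment> \<open>With N fixed the error disappears in the limit, so the final constant is
   independent of N.\<close>
 have "(%k. tail k) ~~~> (\<integral>\<^sup>+x. 0 \<partial>(lborel :: (real^'d) measure))" unfolding tail_def
 proof (rule nn_integral_dominated_convergence[where w="%x. ennreal ((norm (F x))^2)"])
  show "AE x in lborel. (%k. ennreal ((norm (F x))^2) * indicator {x. real k < norm (F x)} x) ~~~> 0"
  proof (rule AE_I2)
   fix x
   obtain k0 :: nat where k0: "norm (F x) <= real k0" using real_arch_simple by blast
   have "eventually (%k. ennreal ((norm (F x))^2) * indicator {x. real k < norm (F x)} x = 0) sequentially"
    unfolding eventually_sequentially using k0 by (intro exI[of _ k0]) (auto simp: indicator_def)
   then show "(%k. ennreal ((norm (F x))^2) * indicator {x. real k < norm (F x)} x) ~~~> 0" by (rule tendsto_eventually)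
  qed
 qed (use F in \<open>auto simp: L2_def indicator_def\<close>)
 then have t0: "tail ~~~> 0" by simp
 have "(%k. ennreal (2 * C) * (energy ?\<sigma> UNIV F + ennreal N * tail k)) ~~~> ennreal (2 * C) * (energy ?\<sigma> UNIV F + ennreal N * 0)"
  by (intro ennreal_tendsto_cmult tendsto_add tendsto_const t0) auto
 then have "energy ?\<sigma> UNIV GZ <= ennreal (2 * C) * (energy ?\<sigma> UNIV F + ennreal N * 0)" by (rule LIMSEQ_le_const) (use step in blast)
 then show "nint (%x. ennreal (min (w x) N * (norm (GZ x))^2)) <= ennreal (2 * max C1 (1 / \<mu>^2)) * nint (%x. ennreal (min (w x) N * (norm (F x))^2))"
  by (simp add: C_def)
qed

section \<open>Comparison with averaged coefficients\<close>

lemma h1_nonempty: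
 assumes "h1 \<Omega> (U :: real^'d => real^'m) G"
 obtains \<phi> :: "real^'d => real^'m" where "C1c \<Omega> \<phi>" using assms unfolding h1_def by blast

lemma frozen_comparison:
 fixes U :: "real^'d => real^'m" and ab :: "real^'d^'m => real^'d^'m"
 assumes h: "h1 \<Omega> U G" and a: "coef M a" and f: "L2 f" and weak: "weak_on \<Omega> a f G" and \<Omega>: "open \<Omega>" "bounded \<Omega>"
  and eb: "ell \<mu> M (%_ :: real^'d. ab)" and \<rho>: "0 < \<rho>"
 shows "\<exists>Uz Gz. h1 \<Omega> (Uz :: real^'d => real^'m) Gz & weak_on (\<Omega> \<inter> ball x0 (4 * \<rho>)) (%_. ab) (%_. 0) (%x. G x - Gz x) &
   esq UNIV Gz <= ennreal (2 / \<mu>^2) * (esq (ball x0 (8 * \<rho>)) (%x. a x (G x) - ab (G x)) + esq (ball x0 (8 * \<rho>)) f)"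
proof -
 let ?S = "ball x0 (8 * \<rho>)"
 have "0 < 4 * \<rho>" using \<rho> by simp
 from cutoff_exists[OF this] obtain \<eta> d\<eta> where \<eta>: "cutoff x0 (4 * \<rho>) \<eta> d\<eta>" by blast
 have [measurable]: "borel_fun \<eta>" using cutoff_regular[OF \<eta>] by auto
 have cb: "coef M (%_ :: real^'d. ab)" and lin: "linear ab" and \<mu>: "0 < \<mu>" using eb by (auto simp: ell_def coef_def)
 note LG = h1_L2(2)[OF h]
 define D where "D x = a x (G x) - ab (G x)" for x
 have De: "D = (%x. a x (G x) - ab (G x))" by (simp add: D_def fun_eq_iff)
 have LD: "L2 D" unfolding De by (intro L2_diff coef_L2[OF a] coef_L2[OF cb] LG)
 have [measurable]: "borel_fun D" "borel_fun f" using LD f by (auto simp: L2_def)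
 \<comment> \<open>The cutoff equals 1 on the ball of radius \<open>4 * \<rho>\<close> and vanishes
   beyond \<open>6 * \<rho>\<close>, hence on the complement of
   \<open>ball x0 (8 * \<rho>)\<close>.\<close>
 define F where "F x = \<eta> x *\<^sub>R (D x + f x)" for x
 have LF: "L2 F" by (rule L2_dominated[OF _ _ L2_add[OF LD f], of _ 1]) (use \<eta> in \<open>auto simp: F_def[abs_def] cutoff_def mult_left_le_one_le\<close>)
 obtain \<phi>0 :: "real^'d => real^'m" where ne: "C1c \<Omega> \<phi>0" using h1_nonempty[OF h] .
 obtain Uz Gz where z: "h1 \<Omega> (Uz :: real^'d => real^'m) Gz" "weak_on \<Omega> (%_. ab) F Gz" using weak_solution_exists[OF eb LF \<Omega> ne] by blast
 note LGz = h1_L2(2)[OF z(1)]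
 have "weak_on (\<Omega> \<inter> ball x0 (4 * \<rho>)) (%_. ab) (%_. 0) (%x. G x - Gz x)" unfolding weak_on_def
 proof (intro allI impI)
  fix \<phi> :: "real^'d => real^'m" assume \<phi>: "C1c (\<Omega> \<inter> ball x0 (4 * \<rho>)) \<phi>"
  then have \<phi>': "C1c \<Omega> \<phi>" unfolding C1c_def by blast
  have pt: "(ab (G x - Gz x) + 0) \<bullet> jac \<phi> x = ((a x (G x) + f x) - (ab (Gz x) + F x)) \<bullet> jac \<phi> x" for x
  proof (cases "x \<in> \<Omega> \<inter> ball x0 (4 * \<rho>)")
   case True
   then have "\<eta> x = 1" using \<eta> by (simp add: cutoff_def)
   then show ?thesis by (simp add: F_def D_def linear_diff[OF lin])
  qed (use C1c_outside(2)[OF \<phi>] in simp)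
  have "ip (%x. (a x (G x) + f x) - (ab (Gz x) + F x)) (jac \<phi>) = 0"
   using weak z(2) \<phi>' by (subst ip_diff(1)) (auto simp: weak_on_def intro!: L2_add coef_L2[OF a] coef_L2[OF cb] LG LGz f LF C1c_regular(6)[OF \<phi>'])
  then show "ip (%x. ab (G x - Gz x) + 0) (jac \<phi>) = 0" unfolding ip_def pt .
 qed
 moreover have "esq UNIV Gz <= ennreal (2 / \<mu>^2) * (esq ?S D + esq ?S f)"
 proof -
  have "esq UNIV Gz <= ennreal (1 / \<mu>^2) * nint (%x. ennreal (1 * (norm (F x))^2))"
   using energy_est_one[OF eb, unfolded energy_est_def, rule_format, OF z(1) LF] z(2) by (simp add: weak_on_def)
  also have "... <= ennreal (1 / \<mu>^2) * nint (%x. 2 * (ennreal (1 * (norm (D x))^2) * indicator ?S x) + 2 * (ennreal (1 * (norm (f x))^2) * indicator ?S x))"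
  proof (intro mult_left_mono nn_integral_mono)
   fix x
   show "ennreal (1 * (norm (F x))^2) <= 2 * (ennreal (1 * (norm (D x))^2) * indicator ?S x) + 2 * (ennreal (1 * (norm (f x))^2) * indicator ?S x)"
   proof (cases "x \<in> ?S")
    case True
    have "norm (F x) <= norm (D x + f x)" using \<eta> by (auto simp: F_def cutoff_def mult_left_le_one_le)
    then have "(norm (F x))^2 <= (norm (D x + f x))^2" by (intro power_mono) auto
    then have "(norm (F x))^2 <= 2 * (norm (D x))^2 + 2 * (norm (f x))^2" using norm_add_square_le[of "D x" "f x"] by linarith
    then have "ennreal ((norm (F x))^2) <= ennreal (2 * (norm (D x))^2 + 2 * (norm (f x))^2)" by (rule ennreal_leI)
    then show ?thesis using True by (simp add: ennreal_mult)
   next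
    case False
    then have "x \<notin> cball x0 (3/2 * (4 * \<rho>))" using \<rho> by auto
    then have "\<eta> x = 0" using \<eta> unfolding cutoff_def by blast
    then show ?thesis by (simp add: F_def)
   qed
  qed simp
  also have "... = ennreal (1 / \<mu>^2) * (2 * (esq ?S D + esq ?S f))" by (simp add: nn_integral_add nn_integral_cmult distrib_left)
  also have "... = ennreal (2 / \<mu>^2) * (esq ?S D + esq ?S f)"
  proof -
   have "ennreal (2 / \<mu>^2) = ennreal (1 / \<mu>^2) * 2" using ennreal_mult[of "1 / \<mu>^2" 2] by simp
   then show ?thesis by (simp only: mult.assoc)
  qed
  finally show ?thesis .
 qed
 ultimately show ?thesis using z(1) unfolding De by blast
qed

text \<open>By A1, \<open>2^j s\<close> is at most \<open>ca * \<sigma> y\<close> for each level set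
  containing y, and a dyadic sum is at most twice its largest admissible term. That the bound does
  not depend on K is decisive for the whole argument.\<close>

lemma (in weight) level_sum_le:
 fixes g :: "'a => ennreal"
 assumes [measurable]: "borel_fun g" "B \<in> sets borel" and s: "0 < s"
 shows "(\<Sum>j\<le>K. ennreal (2 ^ j * s) * sint (B \<inter> maxlevel (%x. ennreal (\<sigma> x)) (2 ^ j * s)) g)
  <= ennreal (2 * ca) * sint B (%y. ennreal (\<sigma> y) * g y)"
proof -
 let ?V = "%j. maxlevel (%x. ennreal (\<sigma> x)) (2 ^ j * s)"
 have "(\<Sum>j\<le>K. ennreal (2 ^ j * s) * sint (B \<inter> ?V j) g)
   = nint (%y. (\<Sum>j\<le>K. ennreal (2 ^ j * s) * (g y * indicator (B \<inter> ?V j) y)))" by (subst nn_integral_sum) (auto simp: nn_integral_cmult)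
 also have "... <= nint (%y. ennreal (2 * ca) * (ennreal (\<sigma> y) * g y * indicator B y))"
 proof (rule nn_integral_mono_AE)
  show "AE y in lborel. (\<Sum>j\<le>K. ennreal (2 ^ j * s) * (g y * indicator (B \<inter> ?V j) y)) <= ennreal (2 * ca) * (ennreal (\<sigma> y) * g y * indicator B y)"
   using AE_A1_maxlevel[OF A1]
  proof eventually_elim
   fix y assume y: "\<forall>s. y \<in> maxlevel (%x. ennreal (\<sigma> x)) s --> ennreal s <= ennreal ca * ennreal (\<sigma> y)"
   define S where "S = (\<Sum>j\<le>K. 2 ^ j * s * indicator (?V j) y)"
   have "S <= 2 * (ca * \<sigma> y)"
   \<comment> \<open>The A1 bound is not strict while \<open>dyadic_sum_below\<close> needs strict
     inequalities; an arbitrarily small excess bridges the gap and preserves the factor 2.\<close>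
   proof (rule field_le_epsilon)
    fix e :: real assume e: "0 < e"
    have cs: "0 <= ca * \<sigma> y" using ca nonneg by simp
    have "S <= (\<Sum>k<Suc K. 2 ^ k * s * (if 2 ^ k * s < ca * \<sigma> y + e / 2 then 1 else 0))" unfolding S_def lessThan_Suc_atMost
    proof (intro sum_mono mult_left_mono)
     fix j
     have "2 ^ j * s <= ca * \<sigma> y" if "y \<in> ?V j" using y[rule_format, OF that] cs ca by (simp add: ennreal_mult'[symmetric])
     then show "indicator (?V j) y <= (if 2 ^ j * s < ca * \<sigma> y + e / 2 then 1 else (0::real))" using e by (auto simp: indicator_def)
    qed (use s in auto)
    also have "... <= 2 * (ca * \<sigma> y + e / 2)" by (rule dyadic_sum_below) (use s cs e in auto)
    finally show "S <= 2 * (ca * \<sigma> y) + e" by simp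
   qed
   then have S: "ennreal S <= ennreal (2 * ca) * ennreal (\<sigma> y)" using ca nonneg[of y] by (simp add: ennreal_mult'[symmetric] ennreal_leI mult.assoc)
   have "(\<Sum>j\<le>K. ennreal (2 ^ j * s) * (g y * indicator (B \<inter> ?V j) y)) = (\<Sum>j\<le>K. ennreal (2 ^ j * s * indicator (?V j) y)) * (g y * indicator B y)"
    unfolding sum_distrib_right using s by (intro sum.cong) (auto simp: indicator_def)
   also have "(\<Sum>j\<le>K. ennreal (2 ^ j * s * indicator (?V j) y)) = ennreal S" unfolding S_def using s by (intro sum_ennreal) auto
   also have "ennreal S * (g y * indicator B y) <= ennreal (2 * ca) * ennreal (\<sigma> y) * (g y * indicator B y)" by (intro mult_right_mono S) simp
   finally show "(\<Sum>j\<le>K. ennreal (2 ^ j * s) * (g y * indicator (B \<inter> ?V j) y)) <= ennreal (2 * ca) * (ennreal (\<sigma> y) * g y * indicator B y)"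
    by (simp only: mult.assoc)
  qed
 qed
 also have "... = ennreal (2 * ca) * sint B (%y. ennreal (\<sigma> y) * g y)" by (rule nn_integral_cmult) measurable
 finally show ?thesis .
qed

text \<open>The reverse Hoelder inequality with weight 1 is fed into
  \<open>gehring_small_sets\<close>. The ball of radius \<open>32 * \<rho>\<close> appears because
  the sets E fill up balls of radius \<open>8 * \<rho>\<close> and the reverse inequality loses a
  factor 4.\<close>

lemma gehring_solution:
 fixes a :: "real^'d => real^'d^'m => real^'d^'m"
 assumes e: "ell \<mu> M a" and \<kappa>: "0 < \<kappa>" "\<kappa> <= 1/2" and out: "outer_balls \<Omega> \<kappa> r1" and \<epsilon>: "0 < \<epsilon>"
 defines "D \<equiv> 32 ^ CARD('d) * rh_const CARD('d) (local_const CARD('d) 1 M \<kappa> (1 / \<mu>^2))"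
 shows "\<exists>\<eta>>0. \<forall>x0 \<rho> (U :: real^'d => real^'m) G f E. 0 < \<rho> --> 32 * \<rho> <= 3 * r1 --> h1 \<Omega> U G --> L2 f --> weak_on \<Omega> a f G -->
  E \<in> sets borel --> E \<subseteq> ball x0 (8 * \<rho>) --> vol E <= ennreal (\<eta> * (8 * \<rho>) ^ CARD('d)) -->
  esq E G <= ennreal \<epsilon> * esq (ball x0 (32 * \<rho>)) G + ennreal D * esq (ball x0 (32 * \<rho>)) f"
proof -
 let ?d = "CARD('d)"
 define C where "C = rh_const ?d (local_const ?d 1 M \<kappa> (1 / \<mu>^2))"
 have C: "0 <= C" unfolding C_def using \<kappa> by (intro rh_const_nonneg local_const_nonneg) auto
 have a: "coef M a" using e by (simp add: ell_def)
 obtain \<eta> where \<eta>: "0 < \<eta>" and gs: "!!(x0::real^'d) r h F E. 0 < r ==> h \<in> borel_measurable borel ==> F \<in> borel_measurable borel ==>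
  (!!x. 0 <= h x) ==> (!!x. x \<notin> ball x0 (4 * r) ==> h x = 0) ==> reverse_holder_on x0 r C h F ==>
  (nint (%y. (ennreal (h y))^2)) < top ==> E \<in> sets borel ==> E \<subseteq> ball x0 r ==>
  vol E <= ennreal (\<eta> * r ^ ?d) ==>
  (sint E (%y. (ennreal (h y))^2)) <= ennreal \<epsilon> * nint (%y. (ennreal (h y))^2)
   + ennreal (32 ^ ?d * C) * sint (ball x0 (4 * r)) F" using gehring_small_sets[where 'a="real^'d", OF C \<epsilon>] by auto
 show ?thesis
 proof (intro exI[of _ \<eta>] conjI \<eta> allI impI)
  fix x0 \<rho> and U :: "real^'d => real^'m" and G f and E :: "(real^'d) set"
  assume \<rho>: "0 < \<rho>" "32 * \<rho> <= 3 * r1" and h: "h1 \<Omega> U G" and f: "L2 f" and weak: "weak_on \<Omega> a f G"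
   and E: "E \<in> sets borel" "E \<subseteq> ball x0 (8 * \<rho>)" "vol E <= ennreal (\<eta> * (8 * \<rho>) ^ ?d)"
  let ?S = "ball x0 (4 * (8 * \<rho>))"
  note LG = h1_L2(2)[OF h]
  have [measurable]: "borel_fun f" "borel_fun G" "E \<in> sets borel" using f LG E by (auto simp: L2_def)
  \<comment> \<open>The gradient is set to 0 off the large ball to meet the support condition;
    inside, the reverse Hoelder inequality is unaffected.\<close>
  let ?h = "%x. indicator ?S x * norm (G x)" and ?F = "%x. ennreal (1 * (norm (f x))^2)"
  have sq: "(ennreal (?h y))^2 = ennreal (1 * (norm (G y))^2) * indicator ?S y" for y by (cases "y \<in> ?S") (simp_all add: ennreal_power)
  have rh: "reverse_holder_on x0 (8 * \<rho>) C ?h ?F" unfolding reverse_holder_on_def DIM_cart DIM_real mult_1_right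
  proof (intro allI impI)
   fix x and r :: real assume r: "0 < r" and sub: "ball x (4 * r) \<subseteq> ?S"
   have r4: "4 * r <= 3 * r1" using sub r \<rho> zero_le_dist[of x x0] by (simp add: ball_subset_ball_iff del: zero_le_dist)
   have wk: "weak_on (\<Omega> \<inter> ball x (4 * r)) a f G" using weak unfolding weak_on_def C1c_def by blast
   have sub1: "ball x r \<subseteq> ?S" using sub subset_ball[of r "4 * r" x] r by auto
   have 1: "sint (ball x r) (%y. (ennreal (?h y))^2) = esq (ball x r) G" unfolding sq using sub1 by (intro nn_integral_cong) (auto simp: indicator_def)
   have 2: "sint (ball x (4 * r)) (%y. ennreal (?h y)) = mass (ball x (4 * r)) G" using sub by (intro nn_integral_cong) (auto simp: indicator_def)
   have 3: "sint (ball x (4 * r)) (%y. ennreal 1) = vol (ball x (4 * r))" by simp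
   show "sint (ball x r) (%y. (ennreal (?h y))^2) <= ennreal C * (ennreal (1 / r ^ (2 * ?d)) * (sint (ball x (4 * r)) (%y. ennreal (?h y)))^2 * vol (ball x (4 * r))
     + sint (ball x (4 * r)) ?F)" unfolding 1 2 3[symmetric] C_def by (rule reverse_holder[OF weight_one h a f energy_est_one[OF e] _ r r4 \<kappa> out wk]) simp
  qed
  have fin: "nint (%y. (ennreal (?h y))^2) < top"
  proof -
   have "nint (%y. (ennreal (?h y))^2) <= nint (%y. ennreal ((norm (G y))^2))" unfolding sq by (intro nn_integral_mono) (auto simp: indicator_def)
   also have "... < top" using LG by (simp add: L2_def)
   finally show ?thesis .
  qed
  have "E \<subseteq> ?S" using E(2) subset_ball[of "8 * \<rho>" "4 * (8 * \<rho>)" x0] \<rho> by auto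
  then have "esq E G = sint E (%y. (ennreal (?h y))^2)" unfolding sq by (intro nn_integral_cong) (auto simp: indicator_def)
  also have "... <= ennreal \<epsilon> * nint (%y. (ennreal (?h y))^2) + ennreal (32 ^ ?d * C) * esq ?S f" by (rule gs[OF _ _ _ _ _ rh fin E]) (use \<rho> in auto)
  finally show "esq E G <= ennreal \<epsilon> * esq (ball x0 (32 * \<rho>)) G + ennreal D * esq (ball x0 (32 * \<rho>)) f" unfolding sq by (simp add: D_def C_def)
 qed
qed

text \<open>The local form of the level estimate. G is split into \<open>Gv\<close>, the gradient of
  a local solution of the homogeneous frozen equation, and the corrector \<open>Gz\<close>. For
  \<open>Gv\<close> the level sum is bounded by its weighted energy and then, by reverse Hoelder and
  the bound on the mass of \<sigma>, by s times a plain energy. For \<open>Gz\<close> each level is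
  bounded trivially and smallness pays for the sum of the levels.\<close>

lemma comparison_step:
 fixes U :: "real^'d => real^'m" and ab :: "real^'d^'m => real^'d^'m"
 assumes w: "weight ca N \<sigma>" and h: "h1 \<Omega> U G" and e: "ell \<mu> M a" and f: "L2 f" and weak: "weak_on \<Omega> a f G" and \<Omega>: "open \<Omega>" "bounded \<Omega>"
  and \<kappa>: "0 < \<kappa>" "\<kappa> <= 1/2" and out: "outer_balls \<Omega> \<kappa> r1"
  and eb: "ell \<mu> M (%_ :: real^'d. ab)" and est: "energy_est \<Omega> (%_. ab) \<sigma> Ce" and Ce: "0 <= Ce"
  and \<rho>: "0 < \<rho>" "32 * \<rho> <= 3 * r1" and s: "0 < s" and W: "0 <= W" "sint (ball x0 (4 * \<rho>)) (%x. ennreal (\<sigma> x)) <= ennreal (W * s * \<rho> ^ CARD('d))"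
  and E: "E \<in> sets borel" and close: "!!x \<xi>. x \<in> ball x0 (8 * \<rho>) - E ==> norm (a x \<xi> - ab \<xi>) <= \<delta> * norm \<xi>"
  and ge: "esq E G <= ennreal \<epsilon> * esq (ball x0 (32 * \<rho>)) G + ennreal D * esq (ball x0 (32 * \<rho>)) f"
  and D: "0 <= D" and \<epsilon>: "0 <= \<epsilon>" and small: "2 / \<mu>^2 * (\<delta>^2 + 4 * M^2 * \<epsilon>) <= (1/2) ^ (K + 2)"
 defines "Rv \<equiv> rh_const CARD('d) (local_const CARD('d) ca M \<kappa> Ce) * unit_ball_vol (real CARD('d)) * 4 ^ CARD('d) * W"
  and "D' \<equiv> 2 / \<mu>^2 * (4 * M^2 * D + 1)"
 shows "(\<Sum>j\<le>K. ennreal (2 ^ j * s) * esq (ball x0 \<rho> \<inter> maxlevel (%x. ennreal (\<sigma> x)) (2 ^ j * s)) G)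
   <= ennreal ((16 * ca * Rv + 1) * s) * esq (ball x0 (32 * \<rho>)) G
   + ennreal ((8 * ca * Rv + 2 ^ (K + 2)) * D' * s) * esq (ball x0 (32 * \<rho>)) f"
proof -
 interpret weight ca N \<sigma> by (rule w)
 let ?d = "CARD('d)" let ?v = "unit_ball_vol (real CARD('d))"
 let ?B = "ball x0 \<rho>" and ?B4 = "ball x0 (4 * \<rho>)" and ?S = "ball x0 (8 * \<rho>)" and ?L = "ball x0 (32 * \<rho>)"
 let ?g = "esq ?L G" and ?f = "esq ?L f"
 define Q where "Q = rh_const ?d (local_const ?d ca M \<kappa> Ce)"
 have Q: "0 <= Q" unfolding Q_def by (intro rh_const_nonneg local_const_nonneg ca \<kappa> Ce)
 have Rv: "0 <= Rv" unfolding Rv_def Q_def[symmetric] using Q W by simp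
 have \<mu>: "0 < \<mu>" and a: "coef M a" and cb: "coef M (%_ :: real^'d. ab)" using e eb by (auto simp: ell_def)
 have M: "0 <= M" and Mb: "!!x \<xi>. norm (a x \<xi>) <= M * norm \<xi>" "!!\<xi>. norm (ab \<xi>) <= M * norm \<xi>" using a cb by (auto simp: coef_def)
 have D': "0 <= D'" using D by (simp add: D'_def)
 have sub: "?B4 \<subseteq> ?L" "?S \<subseteq> ?L" using \<rho> by (auto intro!: subset_ball)
 obtain Uz Gz where z: "h1 \<Omega> (Uz :: real^'d => real^'m) Gz" "weak_on (\<Omega> \<inter> ?B4) (%_. ab) (%_. 0) (%x. G x - Gz x)"
  "esq UNIV Gz <= ennreal (2 / \<mu>^2) * (esq ?S (%x. a x (G x) - ab (G x)) + esq ?S f)" using frozen_comparison[OF h a f weak \<Omega> eb \<rho>(1)] by blast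
 define Gv where "Gv x = G x - Gz x" for x
 have Gve: "Gv = (%x. G x - Gz x)" by (simp add: Gv_def fun_eq_iff)
 have hv: "h1 \<Omega> (%x. U x - Uz x) Gv" unfolding Gve by (rule h1_diff[OF h z(1)])
 have [measurable]: "borel_fun G" "borel_fun f" "borel_fun Gz" "borel_fun Gv" "E \<in> sets borel"
  using h1_L2(2)[OF h] h1_L2(2)[OF z(1)] h1_L2(2)[OF hv] f E by (auto simp: L2_def)
 let ?Z = "esq UNIV Gz"
 have Z: "?Z <= ennreal ((1/2) ^ (K + 2)) * ?g + ennreal D' * ?f"
 proof -
  have "esq ?S (%x. a x (G x) - ab (G x)) <=
    (nint (%x. ennreal (\<delta>^2) * (ennreal (1 * (norm (G x))^2) * indicator ?L x) + ennreal (4 * M^2) * (ennreal (1 * (norm (G x))^2) * indicator E x)))"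
  proof (rule nn_integral_mono)
   fix x
   let ?D = "norm (a x (G x) - ab (G x))"
   have 1: "?D^2 <= \<delta>^2 * (norm (G x))^2" if "x \<in> ?S - E" using power_mono[OF close[OF that, of "G x"], of 2] by (simp add: power_mult_distrib)
   have 2: "?D^2 <= 4 * M^2 * (norm (G x))^2"
   proof -
    have "?D <= 2 * M * norm (G x)" using norm_triangle_ineq4[of "a x (G x)" "ab (G x)"] Mb(1)[of x "G x"] Mb(2)[of "G x"] by linarith
    then have "?D^2 <= (2 * M * norm (G x))^2" by (rule power_mono) simp
    then show ?thesis by (simp add: power_mult_distrib)
   qed
   show "ennreal (1 * ?D^2) * indicator ?S x <= ennreal (\<delta>^2) * (ennreal (1 * (norm (G x))^2) * indicator ?L x) + ennreal (4 * M^2) * (ennreal (1 * (norm (G x))^2) * indicator E x)"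
   proof (cases "x \<in> ?S")
    case True
    then have "x \<in> ?L" using sub by blast
    then show ?thesis using True ennreal_leI[OF 1] ennreal_leI[OF 2] by (cases "x \<in> E") (auto simp: ennreal_mult intro: add_increasing)
   qed simp
  qed
  also have "... = ennreal (\<delta>^2) * ?g + ennreal (4 * M^2) * esq E G" by (simp add: nn_integral_add nn_integral_cmult)
  also have "... <= ennreal (\<delta>^2) * ?g + ennreal (4 * M^2) * (ennreal \<epsilon> * ?g + ennreal D * ?f)" by (intro add_mono mult_left_mono ge) auto
  finally have 1: "esq ?S (%x. a x (G x) - ab (G x)) <= ennreal (\<delta>^2) * ?g + ennreal (4 * M^2) * (ennreal \<epsilon> * ?g + ennreal D * ?f)" .
  have 2: "esq ?S f <= ?f" using sub by (intro nn_integral_mono) (auto simp: indicator_def)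
  have "?Z <= ennreal (2 / \<mu>^2) * ((ennreal (\<delta>^2) * ?g + ennreal (4 * M^2) * (ennreal \<epsilon> * ?g + ennreal D * ?f)) + ?f)"
   by (rule order_trans[OF z(3)]) (intro mult_left_mono add_mono 1 2, simp)
  also have "... = ennreal (2 / \<mu>^2 * (\<delta>^2 + 4 * M^2 * \<epsilon>)) * ?g + ennreal D' * ?f"
  proof -
   have alg: "ennreal p * ((ennreal q * X + ennreal m * (ennreal \<epsilon> * X + ennreal D * Y)) + Y) = ennreal (p * (q + m * \<epsilon>)) * X + ennreal (p * (m * D + 1)) * Y"
    if "0 <= p" "0 <= q" "0 <= m" for p q m and X Y :: ennreal using that D \<epsilon> by (simp add: ennreal_mult distrib_left distrib_right mult_ac add_ac)
   show ?thesis unfolding D'_def by (rule alg) auto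
  qed
  also have "... <= ennreal ((1/2) ^ (K + 2)) * ?g + ennreal D' * ?f" by (intro add_mono mult_right_mono ennreal_leI small order_refl) auto
  finally show ?thesis .
 qed
 \<comment> \<open>The data of the homogeneous equation vanish, so only the mean term of the reverse
   Hoelder inequality remains. Cauchy-Schwarz for the mean and the bound on the mass of \<sigma>
   cancel all powers of \<rho>.\<close>
 have V: "energy \<sigma> ?B Gv <= ennreal (Rv * s) * (2 * ?g + 2 * ?Z)"
 proof -
  have "(mass ?B4 Gv)^2 <= vol ?B4 * esq ?B4 Gv" using nn_integral_square_le[of "%x. ennreal (norm (Gv x))" ?B4] by (simp add: ennreal_power)
  also have "vol ?B4 = ennreal (?v * (4 * \<rho>) ^ ?d)" using \<rho> by (simp add: emeasure_ball)
  also have "esq ?B4 Gv <= nint (%x. 2 * (ennreal (1 * (norm (G x))^2) * indicator ?L x) + 2 * (ennreal (1 * (norm (Gz x))^2) * indicator UNIV x))"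
  proof (rule nn_integral_mono)
   fix x
   have "(norm (Gv x))^2 <= 2 * (norm (G x))^2 + 2 * (norm (Gz x))^2" using norm_add_square_le[of "G x" "- Gz x"] by (simp add: Gv_def)
   from ennreal_leI[OF this] show "ennreal (1 * (norm (Gv x))^2) * indicator ?B4 x <= 2 * (ennreal (1 * (norm (G x))^2) * indicator ?L x) + 2 * (ennreal (1 * (norm (Gz x))^2) * indicator UNIV x)"
    using sub(1) by (cases "x \<in> ?B4") (auto simp: ennreal_mult)
  qed
  also have "... = 2 * ?g + 2 * ?Z" by (simp add: nn_integral_add nn_integral_cmult)
  finally have m: "(mass ?B4 Gv)^2 <= ennreal (?v * (4 * \<rho>) ^ ?d) * (2 * ?g + 2 * ?Z)" by (simp add: mult_left_mono)
  have "energy \<sigma> ?B Gv <= ennreal Q * (ennreal (1 / \<rho> ^ (2 * ?d)) * (mass ?B4 Gv)^2 * sint ?B4 (%x. ennreal (\<sigma> x)) + energy \<sigma> ?B4 (%_. 0 :: real^'d^'m))"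
   unfolding Q_def by (rule reverse_holder[OF w hv cb L2_zero est Ce \<rho>(1) _ \<kappa> out]) (use \<rho> z(2) Gve in auto)
  also have "... <= ennreal Q * (ennreal (1 / \<rho> ^ (2 * ?d)) * (ennreal (?v * (4 * \<rho>) ^ ?d) * (2 * ?g + 2 * ?Z)) * ennreal (W * s * \<rho> ^ ?d) + 0)"
   by (intro mult_left_mono add_mono mult_mono m W) auto
  also have "... = ennreal (Q * (1 / \<rho> ^ (2 * ?d)) * (?v * (4 * \<rho>) ^ ?d) * (W * s * \<rho> ^ ?d)) * (2 * ?g + 2 * ?Z)"
  proof -
   have alg: "ennreal p * (ennreal q * (ennreal r * X) * ennreal t + 0) = ennreal (p * q * r * t) * X" if "0 <= p" "0 <= q" "0 <= r" "0 <= t" for p q r t and X :: ennreal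
    using that by (simp add: ennreal_mult mult_ac)
   show ?thesis by (rule alg) (use Q \<rho> W s in auto)
  qed
  also have "Q * (1 / \<rho> ^ (2 * ?d)) * (?v * (4 * \<rho>) ^ ?d) * (W * s * \<rho> ^ ?d) = Rv * s"
  proof -
   have "\<rho> ^ (?d * 2) = \<rho> ^ ?d * \<rho> ^ ?d" by (simp add: power_mult power2_eq_square)
   then show ?thesis using \<rho> by (simp add: Rv_def Q_def[symmetric] power_mult_distrib field_simps)
  qed
  finally show ?thesis .
 qed
 let ?V = "%j. maxlevel (%x. ennreal (\<sigma> x)) (2 ^ j * s)"
 have "(\<Sum>j\<le>K. ennreal (2 ^ j * s) * esq (?B \<inter> ?V j) G)
   <= (\<Sum>j\<le>K. 2 * (ennreal (2 ^ j * s) * esq (?B \<inter> ?V j) Gv) + 2 * (ennreal (2 ^ j * s) * ?Z))"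
 proof (rule sum_mono)
  fix j
  have "esq (?B \<inter> ?V j) G <= nint (%x. 2 * (ennreal (1 * (norm (Gv x))^2) * indicator (?B \<inter> ?V j) x) + 2 * (ennreal (1 * (norm (Gz x))^2) * indicator UNIV x))"
  proof (rule nn_integral_mono)
   fix x
   have "(norm (G x))^2 <= 2 * (norm (Gv x))^2 + 2 * (norm (Gz x))^2" using norm_add_square_le[of "Gv x" "Gz x"] by (simp add: Gv_def)
   from ennreal_leI[OF this] show "ennreal (1 * (norm (G x))^2) * indicator (?B \<inter> ?V j) x <= 2 * (ennreal (1 * (norm (Gv x))^2) * indicator (?B \<inter> ?V j) x) + 2 * (ennreal (1 * (norm (Gz x))^2) * indicator UNIV x)"
    by (cases "x \<in> ?B \<inter> ?V j") (auto simp: ennreal_mult)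
  qed
  also have "... = 2 * esq (?B \<inter> ?V j) Gv + 2 * ?Z" by (simp add: nn_integral_add nn_integral_cmult)
  finally have "ennreal (2 ^ j * s) * esq (?B \<inter> ?V j) G <= ennreal (2 ^ j * s) * (2 * esq (?B \<inter> ?V j) Gv + 2 * ?Z)" by (rule mult_left_mono) simp
  then show "ennreal (2 ^ j * s) * esq (?B \<inter> ?V j) G <= 2 * (ennreal (2 ^ j * s) * esq (?B \<inter> ?V j) Gv) + 2 * (ennreal (2 ^ j * s) * ?Z)"
   by (simp only: distrib_left mult_ac)
 qed
 also have "... = 2 * (\<Sum>j\<le>K. ennreal (2 ^ j * s) * esq (?B \<inter> ?V j) Gv) + 2 * ((\<Sum>j\<le>K. ennreal (2 ^ j * s)) * ?Z)"
  by (simp only: sum.distrib sum_distrib_left sum_distrib_right)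
 also have "... <= 2 * (ennreal (2 * ca) * (ennreal (Rv * s) * (2 * ?g + 2 * ?Z))) + 2 * (ennreal (2 ^ (K + 1) * s) * ?Z)"
 proof (intro add_mono mult_left_mono mult_right_mono)
  have "(\<Sum>j\<le>K. ennreal (2 ^ j * s) * esq (?B \<inter> ?V j) Gv) <= ennreal (2 * ca) * sint ?B (%y. ennreal (\<sigma> y) * ennreal (1 * (norm (Gv y))^2))"
   by (rule level_sum_le[OF _ _ s]) measurable
  also have "sint ?B (%y. ennreal (\<sigma> y) * ennreal (1 * (norm (Gv y))^2)) = energy \<sigma> ?B Gv" using nonneg by (simp add: ennreal_mult)
  also have "ennreal (2 * ca) * energy \<sigma> ?B Gv <= ennreal (2 * ca) * (ennreal (Rv * s) * (2 * ?g + 2 * ?Z))" by (intro mult_left_mono V) simp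
  finally show "(\<Sum>j\<le>K. ennreal (2 ^ j * s) * esq (?B \<inter> ?V j) Gv) <= ennreal (2 * ca) * (ennreal (Rv * s) * (2 * ?g + 2 * ?Z))" .
  have "(\<Sum>j\<le>K. 2 ^ j * s) <= 2 ^ (K + 1) * s"
  proof -
   have "(\<Sum>j\<le>K. (2::real) ^ j) <= 2 ^ (K + 1)" by (induction K) auto
   then show ?thesis unfolding sum_distrib_right[symmetric] using s by (intro mult_right_mono) auto
  qed
  then show "(\<Sum>j\<le>K. ennreal (2 ^ j * s)) <= ennreal (2 ^ (K + 1) * s)" using s by (subst sum_ennreal) (auto intro: ennreal_leI)
 qed auto
 also have "... = ennreal (8 * ca * Rv * s) * ?g + ennreal ((8 * ca * Rv + 2 ^ (K + 2)) * s) * ?Z"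
 proof -
  have alg: "2 * (ennreal (2 * c) * (ennreal r * (2 * X + 2 * Y))) + 2 * (ennreal q * Y) = ennreal (8 * c * r) * X + ennreal (8 * c * r + 2 * q) * Y"
   if "0 <= c" "0 <= r" "0 <= q" for c r q and X Y :: ennreal using that by (simp add: ennreal_mult distrib_left distrib_right mult_ac add_ac)
  have "8 * ca * (Rv * s) + 2 * (2 ^ (K + 1) * s) = (8 * ca * Rv + 2 ^ (K + 2)) * s" by (simp add: algebra_simps)
  then show ?thesis using alg[OF ca, of "Rv * s" "2 ^ (K + 1) * s" ?g ?Z] Rv s by (simp add: mult.assoc)
 qed
 also have "... <= ennreal (8 * ca * Rv * s) * ?g + ennreal ((8 * ca * Rv + 2 ^ (K + 2)) * s) * (ennreal ((1/2) ^ (K + 2)) * ?g + ennreal D' * ?f)"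
  by (intro add_mono mult_left_mono Z order_refl) auto
 also have "... = ennreal (8 * ca * Rv * s + (8 * ca * Rv + 2 ^ (K + 2)) * s * (1/2) ^ (K + 2)) * ?g + ennreal ((8 * ca * Rv + 2 ^ (K + 2)) * s * D') * ?f"
 proof -
  have alg: "ennreal p * X + ennreal q * (ennreal t * X + ennreal r * Y) = ennreal (p + q * t) * X + ennreal (q * r) * Y"
   if "0 <= p" "0 <= q" "0 <= t" "0 <= r" for p q t r and X Y :: ennreal using that by (simp add: ennreal_mult distrib_left distrib_right mult_ac add_ac)
  show ?thesis by (rule alg) (use ca Rv s D' in auto)
 qed
 also have "... <= ennreal ((16 * ca * Rv + 1) * s) * ?g + ennreal ((8 * ca * Rv + 2 ^ (K + 2)) * D' * s) * ?f"
 proof (intro add_mono mult_right_mono ennreal_leI)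
  have "(1/2::real) ^ (K + 2) <= 1" by (rule power_le_one) auto
  then have "8 * ca * Rv * (1/2) ^ (K + 2) <= 8 * ca * Rv * 1" using ca Rv by (intro mult_left_mono) auto
  \<comment> \<open>The cost of K levels against the smallness of the corrector: the product is 1,
    so no power of 2 with exponent K survives in front of the energy of G. It survives in front of
    the data, where it is harmless.\<close>
  moreover have "(2::real) ^ (K + 2) * (1/2) ^ (K + 2) = 1" by (simp only: power_mult_distrib[symmetric]) simp
  ultimately have "8 * ca * Rv + (8 * ca * Rv + 2 ^ (K + 2)) * (1/2) ^ (K + 2) <= 16 * ca * Rv + 1" unfolding distrib_right by linarith
  from mult_right_mono[OF this, of s] show "8 * ca * Rv * s + (8 * ca * Rv + 2 ^ (K + 2)) * s * (1/2) ^ (K + 2) <= (16 * ca * Rv + 1) * s"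
   using s by (simp add: algebra_simps)
  show "(8 * ca * Rv + 2 ^ (K + 2)) * s * D' <= (8 * ca * Rv + 2 ^ (K + 2)) * D' * s" by (simp add: mult_ac)
 qed auto
 finally show ?thesis .
qed

text \<open>Where \<open>w z <= N\<close>, the truncated integral is at most the full one. Where
  \<open>w z > N\<close>, the truncated average is at most N, the value of the truncated weight at
  z; here \<open>1 <= c\<close> is used. The A1 constant is unchanged, as uniformity in N
  requires.\<close>

lemma A1_truncate:
 fixes w :: "'a::euclidean_space => real"
 assumes A: "A1 c (%x. ennreal (w x))" and c: "1 <= c" and [measurable]: "borel_fun w" and w: "!!x. 0 <= w x" and N: "0 <= N"
 shows "weight c N (%x. min (w x) N)"
proof
 show "A1 c (%x. ennreal (min (w x) N))" unfolding A1_def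
 proof (intro conjI allI impI)
  fix x :: 'a and r :: real assume r: "0 < r"
  have "AE z in lborel. z \<in> ball x r --> sint (ball x r) (%y. ennreal (w y)) <= ennreal c * vol (ball x r) * ennreal (w z)" using A r by (simp add: A1_def)
  then show "AE z in lborel. z \<in> ball x r --> sint (ball x r) (%y. ennreal (min (w y) N)) <= ennreal c * vol (ball x r) * ennreal (min (w z) N)"
  proof (eventually_elim, intro impI)
   fix z assume *: "z \<in> ball x r --> sint (ball x r) (%y. ennreal (w y)) <= ennreal c * vol (ball x r) * ennreal (w z)" and z: "z \<in> ball x r"
   show "sint (ball x r) (%y. ennreal (min (w y) N)) <= ennreal c * vol (ball x r) * ennreal (min (w z) N)"
   proof (cases "w z <= N")
    case True
    have "sint (ball x r) (%y. ennreal (min (w y) N)) <= sint (ball x r) (%y. ennreal (w y))" by (intro nn_integral_mono mult_right_mono ennreal_leI) auto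
    then show ?thesis using * z True by (simp add: min_def)
   next
    case False
    have "sint (ball x r) (%y. ennreal (min (w y) N)) <= nint (%y. ennreal N * indicator (ball x r) y)" by (intro nn_integral_mono mult_right_mono ennreal_leI) auto
    also have "... = 1 * (vol (ball x r) * ennreal N)" by (simp add: nn_integral_cmult_indicator mult.commute)
    also have "... <= ennreal c * (vol (ball x r) * ennreal N)" using c by (intro mult_right_mono) auto
    finally show ?thesis using False by (simp add: min_def mult.assoc)
   qed
  qed
 qed measurable
qed (use c w N in auto)

section \<open>Assembly of the estimate for truncated weights\<close>

definition good_average :: "(real^'d) set => (real^'d => real) => real => real => real => (real^'d^'m => real^'d^'m) => bool" where
 "good_average \<Omega> w \<mu> M C1 ab \<longleftrightarrow> ell \<mu> M (%_ :: real^'d. ab) &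
  (\<forall>F (U :: real^'d => real^'m) G. L2 F --> (\<exists>B. \<forall>x. norm (F x) <= B) --> h1 \<Omega> U G --> weak_on \<Omega> (%_. ab) F G -->
    energy w UNIV G <= ennreal C1 * energy w UNIV F)"

text \<open>The form in which vanishing mean oscillation is used: on small balls the coefficients
  are uniformly close to an admissible constant matrix off a set of small relative volume. Uniform
  closeness is needed because the error is multiplied with a gradient known only to be square
  integrable.\<close>

definition near_averages :: "(real^'d) set => (real^'d => real) => real => real => real => (real^'d => real^'d^'m => real^'d^'m) => bool" where
 "near_averages \<Omega> w \<mu> M C1 a \<longleftrightarrow> (\<forall>\<delta>>0. \<forall>\<eta>>0. \<exists>R>0. \<forall>x0 r. 0 < r & r <= R -->
   (\<exists>ab E. good_average \<Omega> w \<mu> M C1 ab & E \<in> sets borel & E \<subseteq> ball x0 r & vol E <= ennreal (\<eta> * r ^ CARD('d))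
    & (\<forall>x\<in>ball x0 r - E. \<forall>\<xi>. norm (a x \<xi> - ab \<xi>) <= \<delta> * norm \<xi>)))"

text \<open>The order in which the constants are chosen is essential. The weighted constants, up to
  \<open>C3\<close>, are independent of K, so K can be chosen from them; then \<delta> and
  \<epsilon> from K, then \<eta> from the Gehring estimate, then the maximal radius R from the
  oscillation, and at last the starting level \<open>s0\<close>. None of them involves N. The
  unweighted energy of G remains on the right because the level sums start at a positive
  level.\<close>

lemma truncated_estimate:
 fixes \<Omega> :: "(real^'d) set" and a :: "real^'d => real^'d^'m => real^'d^'m" and w :: "real^'d => real"
 assumes \<Omega>: "open \<Omega>" "bounded \<Omega>" and e: "ell \<mu> M a" and wm[measurable]: "borel_fun w" and w0: "!!x. 0 <= w x"
  and A: "A1 c (%x. ennreal (w x))" and c: "1 <= c" and wfin: "!!R. (sint (ball 0 R) (%x. ennreal (w x))) < top"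
  and near: "near_averages \<Omega> w \<mu> M C1 a" and \<kappa>: "0 < \<kappa>" "\<kappa> <= 1/2" and r1: "0 < r1" and out: "outer_balls \<Omega> \<kappa> r1"
 shows "\<exists>C\<ge>0. \<forall>N\<ge>0. \<forall>(U :: real^'d => real^'m) G f. h1 \<Omega> U G --> L2 f --> weak_on \<Omega> a f G -->
   energy (%x. min (w x) N) UNIV G <= ennreal C * (esq UNIV G + energy (%x. min (w x) N) UNIV f)"
proof -
 let ?d = "CARD('d)" let ?v = "unit_ball_vol (real CARD('d))"
 define Ce where "Ce = 2 * max C1 (1 / \<mu>^2)"
 have Ce: "0 <= Ce" by (simp add: Ce_def le_max_iff_disj)
 have \<mu>: "0 < \<mu>" using e by (simp add: ell_def)
 \<comment> \<open>The constant of \<open>level_step\<close> with L = 32; the comparison on a ball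
   of radius \<rho> uses G on the ball of radius \<open>32 * \<rho>\<close>.\<close>
 define W where "W = ?v * (16 * 32) ^ ?d"
 have W: "0 < W" by (simp add: W_def)
 define Rv where "Rv = rh_const ?d (local_const ?d c M \<kappa> Ce) * ?v * 4 ^ ?d * W"
 have Rv: "0 <= Rv" unfolding Rv_def using c \<kappa> Ce W by (intro mult_nonneg_nonneg rh_const_nonneg local_const_nonneg) auto
 define C2 where "C2 = 16 * c * Rv + 1"
 define C3 where "C3 = (8 * 32) ^ ?d * C2"
 have C2: "0 <= C2" "0 <= C3" using c Rv by (auto simp: C2_def C3_def)
 obtain K0 :: nat where "2 * C3 <= real K0" using real_arch_simple by blast
 then obtain K :: nat where K: "1 <= K" "2 * C3 <= real K" by (intro that[of "Suc K0"]) auto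
 \<comment> \<open>With these choices \<delta> and \<epsilon> each contribute at most half of the
   admissible error \<open>2^-(K+2)\<close>.\<close>
 define \<delta> where "\<delta> = sqrt (\<mu>^2 * (1/2) ^ (K + 2) / 4)"
 define \<epsilon> where "\<epsilon> = \<mu>^2 * (1/2) ^ (K + 2) / (16 * (M^2 + 1))"
 have M1: "0 < M^2 + 1" by (simp add: add_nonneg_pos)
 have \<delta>: "0 < \<delta>" "\<delta>^2 = \<mu>^2 * (1/2) ^ (K + 2) / 4" using \<mu> by (auto simp: \<delta>_def)
 have \<epsilon>: "0 < \<epsilon>" using \<mu> M1 by (simp add: \<epsilon>_def)
 have small: "2 / \<mu>^2 * (\<delta>^2 + 4 * M^2 * \<epsilon>) <= (1/2) ^ (K + 2)"
 proof -
  have "4 * M^2 * \<epsilon> = \<mu>^2 * (1/2) ^ (K + 2) / 4 * (M^2 / (M^2 + 1))"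
  proof -
   have "4 * x * (y / (16 * z)) = y / 4 * (x / z)" for x y z :: real by simp
   then show ?thesis unfolding \<epsilon>_def .
  qed
  also have "... <= \<mu>^2 * (1/2) ^ (K + 2) / 4 * 1" using M1 by (intro mult_left_mono) (auto simp: divide_le_eq)
  finally have "2 / \<mu>^2 * (\<delta>^2 + 4 * M^2 * \<epsilon>) <= 2 / \<mu>^2 * (\<mu>^2 * (1/2) ^ (K + 2) / 4 + \<mu>^2 * (1/2) ^ (K + 2) / 4)"
   unfolding \<delta>(2) by (intro mult_left_mono) auto
  also have "... = (1/2) ^ (K + 2)" using \<mu> by (simp add: field_simps)
  finally show ?thesis .
 qed
 define D where "D = 32 ^ ?d * rh_const ?d (local_const ?d 1 M \<kappa> (1 / \<mu>^2))"
 have D: "0 <= D" unfolding D_def using \<kappa> by (intro mult_nonneg_nonneg rh_const_nonneg local_const_nonneg) auto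
 obtain \<eta> where \<eta>: "0 < \<eta>" and ge: "!!x0 \<rho> (U :: real^'d => real^'m) G f E. 0 < \<rho> ==> 32 * \<rho> <= 3 * r1 ==> h1 \<Omega> U G ==> L2 f ==> weak_on \<Omega> a f G ==>
  E \<in> sets borel ==> E \<subseteq> ball x0 (8 * \<rho>) ==> vol E <= ennreal (\<eta> * (8 * \<rho>) ^ ?d) ==>
  esq E G <= ennreal \<epsilon> * esq (ball x0 (32 * \<rho>)) G + ennreal D * esq (ball x0 (32 * \<rho>)) f"
  using gehring_solution[OF e \<kappa> out \<epsilon>] unfolding D_def[symmetric] by blast
 obtain Rn where Rn: "0 < Rn" and av: "!!x0 r. 0 < r ==> r <= Rn ==>
   \<exists>ab E. good_average \<Omega> w \<mu> M C1 ab & E \<in> sets borel & E \<subseteq> ball x0 r & vol E <= ennreal (\<eta> * r ^ ?d)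
    & (\<forall>x\<in>ball x0 r - E. \<forall>\<xi>. norm (a x \<xi> - ab \<xi>) <= \<delta> * norm \<xi>)"
  using near[unfolded near_averages_def, rule_format, OF \<delta>(1) \<eta>] by blast
 \<comment> \<open>Balls of radius \<open>8 * \<rho>\<close> must be in the range where averages
   approximate the coefficients, balls of radius \<open>32 * \<rho>\<close> in the range of the
   reverse Hoelder inequality.\<close>
 define R where "R = min (Rn / 8) (3 * r1 / 32)"
 have R: "0 < R" "8 * R <= Rn" "32 * R <= 3 * r1" using Rn r1 by (auto simp: R_def min_def)
 define C4 where "C4 = (8 * c * Rv + 2 ^ (K + 2)) * (2 / \<mu>^2 * (4 * M^2 * D + 1))"
 have C4: "0 <= C4" using c Rv D by (simp add: C4_def)
 obtain R0 where R0: "0 < R0" "\<Omega> \<subseteq> ball 0 R0" using \<Omega>(2) by (metis bounded_subset_ballD)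
 obtain m where m: "0 <= m" "sint (ball 0 (R0 + 5 * R)) (%x. ennreal (w x)) = ennreal m" by (rule nn_integral_set_finite_real[OF wfin[of "R0 + 5 * R"]])
 \<comment> \<open>From this level on, balls of the largest scale R that meet the domain have
   admissible averages. The number m is taken from the full weight w, so that \<open>s0\<close> does
   not depend on N.\<close>
 define s0 where "s0 = m / (W * R ^ ?d) + 1"
 have s0: "0 < s0" using m W R by (simp add: s0_def add_nonneg_pos)
 define cd where "cd = ?v * real ((?d + 1) ^ ?d)"
 have cd: "0 <= cd" by (simp add: cd_def)
 define CF where "CF = max (cd * s0 * (1 + 4 * C3)) (32 * cd * ((8 * 32) ^ ?d * C4) * c)"
 show ?thesis
 proof (intro exI[of _ CF] conjI allI impI)
  show "0 <= CF" using cd s0 C2 by (simp add: CF_def le_max_iff_disj)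
  fix N :: real and U :: "real^'d => real^'m" and G f assume N: "0 <= N" and h: "h1 \<Omega> U G" and f: "L2 f" and weak: "weak_on \<Omega> a f G"
  let ?\<sigma> = "%x. min (w x) N"
  have wt: "weight c N ?\<sigma>" by (rule A1_truncate[OF A c wm w0 N])
  interpret weight c N ?\<sigma> by (rule wt)
  note LG = h1_L2(2)[OF h]
  have [measurable]: "borel_fun G" "borel_fun f" using LG f by (auto simp: L2_def)
  let ?g = "%x. ennreal (1 * (norm (G x))^2)" and ?F = "%x. ennreal (1 * (norm (f x))^2)"
  have step: "(\<Sum>j\<le>K. ennreal (2 ^ j * s) * esq (maxlevel (%x. ennreal (?\<sigma> x)) (2 ^ j * s)) G)
   <= ennreal (C3 * s) * esq (maxlevel (%x. ennreal (?\<sigma> x)) s) G + ennreal ((8 * 32) ^ ?d * C4 * s) * esq (maxlevel (%x. ennreal (?\<sigma> x)) s) f"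
   if s: "s0 <= s" for s
  proof -
   have sp: "0 < s" using s s0 by linarith
   have "(\<Sum>j\<le>K. ennreal (2 ^ j * s) * esq (maxlevel (%x. ennreal (?\<sigma> x)) (2 ^ j * s)) G)
    <= ennreal ((8 * 32) ^ ?d) * (ennreal (C2 * s) * esq (maxlevel (%x. ennreal (?\<sigma> x)) s) G + ennreal (C4 * s) * esq (maxlevel (%x. ennreal (?\<sigma> x)) s) f)"
   proof (rule level_step[where 'a="real^'d" and L=32 and R=R and \<Omega>=\<Omega>, unfolded DIM_cart DIM_real mult_1_right])
    show "?g x = 0" if "x \<notin> \<Omega>" for x using h that by (simp add: h1_def)
    fix x assume "ball x R \<inter> \<Omega> \<noteq> {}"
    then obtain y where y: "y \<in> ball x R" "y \<in> ball 0 R0" using R0 by blast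
    have "ball x (4 * R) \<subseteq> ball 0 (R0 + 5 * R)"
    proof
     fix z assume "z \<in> ball x (4 * R)"
     then show "z \<in> ball 0 (R0 + 5 * R)" using y dist_triangle[of 0 z y] dist_triangle[of y z x] by (simp add: dist_commute)
    qed
    then have "sint (ball x (4 * R)) (%y. ennreal (?\<sigma> y)) <= ennreal m"
     unfolding m(2)[symmetric] by (intro nn_integral_mono mult_mono ennreal_leI) (auto simp: indicator_def)
    also have "m <= W * s * R ^ ?d"
    proof -
     have "m / (W * R ^ ?d) <= s" using s by (simp add: s0_def)
     then show ?thesis using W R by (simp add: field_simps)
    qed
    finally show "sint (ball x (4 * R)) (%y. ennreal (?\<sigma> y)) <= ennreal (?v * (16 * 32) ^ ?d * s * R ^ ?d)" unfolding W_def by (simp add: ennreal_leI)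
   next
    fix x and \<rho> :: real assume \<rho>: "0 < \<rho>" "\<rho> <= R" and wb: "sint (ball x (4 * \<rho>)) (%y. ennreal (?\<sigma> y)) <= ennreal (?v * (16 * 32) ^ ?d * s * \<rho> ^ ?d)"
    have \<rho>1: "32 * \<rho> <= 3 * r1" "8 * \<rho> <= Rn" "0 < 8 * \<rho>" using \<rho> R by auto
    obtain ab E where ab: "good_average \<Omega> w \<mu> M C1 ab" and E: "E \<in> sets borel" "E \<subseteq> ball x (8 * \<rho>)" "vol E <= ennreal (\<eta> * (8 * \<rho>) ^ ?d)"
     and close: "\<forall>y\<in>ball x (8 * \<rho>) - E. \<forall>\<xi>. norm (a y \<xi> - ab \<xi>) <= \<delta> * norm \<xi>" using av[OF \<rho>1(3,2)] by blast
    have eb: "ell \<mu> M (%_ :: real^'d. ab)" using ab by (simp add: good_average_def)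
    have est: "energy_est \<Omega> (%_. ab) ?\<sigma> Ce" unfolding Ce_def
     by (rule energy_est_truncate[OF eb \<Omega> wm w0 N]) (use ab in \<open>auto simp: good_average_def\<close>)
    show "(\<Sum>j\<le>K. ennreal (2 ^ j * s) * esq (ball x \<rho> \<inter> maxlevel (%x. ennreal (?\<sigma> x)) (2 ^ j * s)) G)
     <= ennreal (C2 * s) * esq (ball x (32 * \<rho>)) G + ennreal (C4 * s) * esq (ball x (32 * \<rho>)) f" unfolding C2_def C4_def Rv_def
     by (rule comparison_step[OF wt h e f weak \<Omega> \<kappa> out eb est Ce \<rho>(1) \<rho>1(1) sp _ wb[folded W_def] E(1) _ ge[OF \<rho>(1) \<rho>1(1) h f weak E] D _ small])
      (use W close \<epsilon> in auto)
   qed (use R C2 C4 sp in auto)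
   also have "... = ennreal (C3 * s) * esq (maxlevel (%x. ennreal (?\<sigma> x)) s) G + ennreal ((8 * 32) ^ ?d * C4 * s) * esq (maxlevel (%x. ennreal (?\<sigma> x)) s) f"
   proof -
    have alg: "ennreal p * (ennreal (q * s) * X + ennreal (r * s) * Y) = ennreal (p * q * s) * X + ennreal (p * r * s) * Y" if "0 <= p" "0 <= q" "0 <= r" for p q r and X Y :: ennreal
     using that sp by (simp add: ennreal_mult distrib_left mult_ac)
    show ?thesis unfolding C3_def by (rule alg) (use C2 C4 in auto)
   qed
   finally show ?thesis .
  qed
  have gs: "energy ?\<sigma> UNIV H = nint (%x. ennreal (1 * (norm (H x))^2) * ennreal (?\<sigma> x))" for H :: "real^'d => real^'d^'m"
   using nonneg by (intro nn_integral_cong) (simp add: ennreal_mult mult.commute)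
  have "energy ?\<sigma> UNIV G <= ennreal (cd * s0 * (1 + 4 * C3)) * nint ?g + ennreal (32 * cd * ((8 * 32) ^ ?d * C4) * c) * energy ?\<sigma> UNIV f"
   unfolding gs cd_def by (rule weighted_energy_sum[where 'a="real^'d", unfolded DIM_cart DIM_real mult_1_right, OF A1 ca nonneg bdd meas _ _ _ _ s0 C2(2) _ K step])
    (use LG f C4 in \<open>auto simp: L2_def add.commute\<close>)
  also have "... <= ennreal CF * esq UNIV G + ennreal CF * energy ?\<sigma> UNIV f" by (intro add_mono mult_mono ennreal_leI) (auto simp: CF_def)
  finally show "energy ?\<sigma> UNIV G <= ennreal CF * (esq UNIV G + energy ?\<sigma> UNIV f)" by (simp only: distrib_left)
 qed
qed

section \<open>Borel representatives and VMO coefficients\<close>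

lemma lebesgue_borel_version:
 fixes f :: "'a::euclidean_space => 'b::euclidean_space"
 assumes "f \<in> borel_measurable lebesgue"
 shows "\<exists>g. g \<in> borel_measurable borel & (AE x in lborel. f x = g x)"
proof -
 have "\<exists>g. g \<in> borel_measurable lborel & (AE x in lborel. f x \<bullet> b = g x)" for b
  using completion_ex_borel_measurable_real[of "%x. f x \<bullet> b" lborel] assms by auto
 then obtain g where g: "!!b. g b \<in> borel_measurable lborel" "!!b. AE x in lborel. f x \<bullet> b = g b x" by metis
 let ?g = "%x. \<Sum>b\<in>Basis. g b x *\<^sub>R b"
 have "AE x in lborel. \<forall>b\<in>Basis. f x \<bullet> b = g b x" using g(2) by (intro AE_finite_allI) auto
 then have "AE x in lborel. f x = ?g x"
 proof eventually_elim
  fix x assume "\<forall>b\<in>Basis. f x \<bullet> b = g b x"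
  then have "?g x = (\<Sum>b\<in>Basis. (f x \<bullet> b) *\<^sub>R b)" by simp
  then show "f x = ?g x" by (simp add: euclidean_representation)
 qed
 moreover have "borel_fun ?g" using g(1) by auto
 ultimately show ?thesis by blast
qed

lemma set_integral_borel_version:
 fixes h :: "'a::euclidean_space => real"
 assumes [measurable]: "h \<in> borel_measurable lebesgue" and h': "borel_fun h'" and eq: "AE x in lborel. x \<in> S --> h x = h' x" and S: "S \<in> sets borel"
 shows "(LINT x:S|lebesgue. h x) = (LINT x|lborel. indicator S x * h' x)"
proof -
 have [measurable]: "h' \<in> borel_measurable lebesgue" "S \<in> sets lebesgue" using h' S by (auto intro: measurable_completion)
 have m: "(%x. indicator S x * h' x) \<in> borel_measurable lborel" using h' S by measurable
 have "(LINT x:S|lebesgue. h x) = (LINT x|lebesgue. indicator S x * h' x)" unfolding set_lebesgue_integral_def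
  by (rule integral_cong_AE) (use eq in \<open>auto simp: AE_completion_iff indicator_def\<close>)
 also have "... = (LINT x|lborel. indicator S x * h' x)" by (rule integral_completion[OF m])
 finally show ?thesis .
qed

lemma avg_borel_version:
 assumes "h \<in> borel_measurable lebesgue" "borel_fun h'" "AE x in lborel. h x = h' x"
 shows "avg (ball x0 r) h = (LINT x|lborel. indicator (ball x0 r) x * h' x) / measure lborel (ball x0 r)"
 unfolding avg_def by (subst set_integral_borel_version[OF assms(1,2)]) (use assms(3) in auto)

section \<open>Coefficient tensors as linear maps on matrices\<close>

definition tact :: "('m::finite => 'm => 'd::finite => 'd => real) => real^'d^'m => real^'d^'m" where
 "tact T \<xi> = (\<chi> \<alpha> i. \<Sum>\<beta>\<in>UNIV. \<Sum>j\<in>UNIV. T \<alpha> \<beta> i j * \<xi>$\<beta>$j)"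

lemma tact_inner: "tact T \<xi> \<bullet> \<eta> = (sum4 (%\<alpha> \<beta> i j. T \<alpha> \<beta> i j * \<eta>$\<alpha>$i * \<xi>$\<beta>$j))"
proof -
 have "tact T \<xi> \<bullet> \<eta> = (\<Sum>\<alpha>\<in>UNIV. \<Sum>i\<in>UNIV. \<Sum>\<beta>\<in>UNIV. \<Sum>j\<in>UNIV. T \<alpha> \<beta> i j * \<eta>$\<alpha>$i * \<xi>$\<beta>$j)"
  by (simp add: tact_def inner_vec_def sum_distrib_left sum_distrib_right mult_ac)
 also have "... = (sum4 (%\<alpha> \<beta> i j. T \<alpha> \<beta> i j * \<eta>$\<alpha>$i * \<xi>$\<beta>$j))" by (intro sum.cong refl sum.swap)
 finally show ?thesis .
qed

lemma linear_tact: "linear (tact T)" by (rule linearI) (simp_all add: tact_def vec_eq_iff sum.distrib sum_distrib_left algebra_simps)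

lemma tact_diff: "tact T \<xi> - tact T' \<xi> = tact (%\<alpha> \<beta> i j. T \<alpha> \<beta> i j - T' \<alpha> \<beta> i j) \<xi>"
 by (simp add: tact_def vec_eq_iff sum_subtractf algebra_simps)

lemma sum_delta2: "(\<Sum>\<beta>\<in>UNIV. \<Sum>j\<in>UNIV. if \<beta> = a then if j = b then c else 0 else 0) = (c::real)" for a :: "'m::finite" and b :: "'d::finite"
proof -
 have "(\<Sum>j\<in>UNIV. if \<beta> = a then if j = b then c else 0 else 0) = (if \<beta> = a then c else 0)" for \<beta> by (cases "\<beta> = a") simp_all
 then show ?thesis by simp
qed

lemma tact_entry: "tact T (axis \<beta> (axis j 1)) $ \<alpha> $ i = T \<alpha> \<beta> i j"
proof -
 have "T \<alpha> \<beta>' i j' * axis \<beta> (axis j 1) $ \<beta>' $ j' = (if \<beta>' = \<beta> then if j' = j then T \<alpha> \<beta> i j else 0 else 0)" for \<beta>' j'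
  by (simp add: axis_def)
 then show ?thesis by (simp add: tact_def sum_delta2)
qed

text \<open>The crude bound by the sum of the absolute entries suffices: it only converts entrywise
  oscillation into closeness of linear maps.\<close>

lemma norm_tact_le:
 fixes T :: "'m::finite => 'm => 'd::finite => 'd => real"
 shows "norm (tact T \<xi>) <= (sum4 (%\<alpha> \<beta> i j. \<bar>T \<alpha> \<beta> i j\<bar>)) * norm \<xi>"
proof -
 let ?S = "sum4 (%\<alpha> \<beta> i j. \<bar>T \<alpha> \<beta> i j\<bar>)"
 define \<eta> where "\<eta> = tact T \<xi>"
 have c: "\<bar>\<zeta>$\<alpha>$i\<bar> <= norm \<zeta>" for \<zeta> :: "real^'d^'m" and \<alpha> i
  by (rule order_trans[OF component_le_norm_cart Finite_Cartesian_Product.norm_nth_le])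
 have "norm \<eta> * norm \<eta> = tact T \<xi> \<bullet> \<eta>" by (simp add: \<eta>_def norm_eq_sqrt_inner)
 also have "... <= (sum4 (%\<alpha> \<beta> i j. \<bar>T \<alpha> \<beta> i j\<bar> * (norm \<eta> * norm \<xi>)))" unfolding tact_inner
 proof (intro sum_mono)
  fix \<alpha> \<beta> i j
  have "T \<alpha> \<beta> i j * \<eta>$\<alpha>$i * \<xi>$\<beta>$j <= \<bar>T \<alpha> \<beta> i j * \<eta>$\<alpha>$i * \<xi>$\<beta>$j\<bar>" by (rule abs_ge_self)
  also have "... = \<bar>T \<alpha> \<beta> i j\<bar> * (\<bar>\<eta>$\<alpha>$i\<bar> * \<bar>\<xi>$\<beta>$j\<bar>)" by (simp add: abs_mult)
  also have "... <= \<bar>T \<alpha> \<beta> i j\<bar> * (norm \<eta> * norm \<xi>)" by (intro mult_left_mono mult_mono c) auto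
  finally show "T \<alpha> \<beta> i j * \<eta>$\<alpha>$i * \<xi>$\<beta>$j <= \<bar>T \<alpha> \<beta> i j\<bar> * (norm \<eta> * norm \<xi>)" .
 qed
 also have "... = norm \<eta> * (?S * norm \<xi>)" by (simp only: sum_distrib_right[symmetric]) (simp only: mult_ac)
 finally have "norm \<eta> * norm \<eta> <= norm \<eta> * (?S * norm \<xi>)" .
 moreover have "0 <= ?S * norm \<xi>" by (intro mult_nonneg_nonneg sum_nonneg) auto
 ultimately show ?thesis unfolding \<eta>_def[symmetric] by (cases "norm \<eta> = 0") (auto simp: mult_le_cancel_left)
qed

lemma tact_measurable:
 fixes A :: "real^'d => 'm::finite => 'm => 'd::finite => 'd => real"
 assumes [measurable]: "!!\<alpha> \<beta> i j. borel_fun (%x. A x \<alpha> \<beta> i j)"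
 shows "borel_fun (%x. tact (A x) \<xi>)" unfolding borel_measurable_euclidean_space[where 'c="real^'d^'m"] tact_inner by measurable

lemma ell_tactI:
 fixes A :: "real^'d => 'm::finite => 'm => 'd::finite => 'd => real"
 assumes "!!\<alpha> \<beta> i j. borel_fun (%x. A x \<alpha> \<beta> i j)" and \<mu>: "0 < \<mu>" and M: "0 <= M"
  and co: "!!x \<xi>. \<mu> * (norm \<xi>)^2 <= tact (A x) \<xi> \<bullet> \<xi>" and bd: "!!x \<xi> \<eta>. tact (A x) \<xi> \<bullet> \<eta> <= M * norm \<xi> * norm \<eta>"
 shows "ell \<mu> M (%x. tact (A x))"
proof -
 have "norm (tact (A x) \<xi>) <= M * norm \<xi>" for x \<xi> using bd[of x \<xi> "tact (A x) \<xi>"] M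
  by (cases "norm (tact (A x) \<xi>) = 0") (auto simp: power2_norm_eq_inner[symmetric] power2_eq_square mult_le_cancel_right)
 moreover have "borel_fun (%x. tact (A x) \<xi>)" for \<xi> by (rule tact_measurable) (rule assms(1))
 ultimately show ?thesis using \<mu> M co by (simp add: ell_def coef_def linear_tact)
qed

text \<open>Ellipticity holds almost everywhere only, while \<open>ell\<close> asks for it at every
  point. On a Borel null set that contains all exceptions the tensor is replaced by \<mu> times the
  identity; the maximum in the upper bound covers this value.\<close>

lemma elliptic_borel_version:
 fixes A :: "real^'d => 'm::finite => 'm => 'd::finite => 'd => real"
 assumes e: "elliptic \<mu> A"
 obtains A' where "!!\<alpha> \<beta> i j. borel_fun (%x. A' x \<alpha> \<beta> i j)" "AE x in lborel. A x = A' x" "ell \<mu> (max \<mu> (1 / \<mu>)) (%x. tact (A' x))"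
proof -
 have \<mu>: "0 < \<mu>" using e by (simp add: elliptic_def)
 define B where "B \<alpha> \<beta> i j = (SOME B. B \<in> borel_measurable borel & (AE x in lborel. A x \<alpha> \<beta> i j = B x))" for \<alpha> \<beta> i j
 have BB: "B \<alpha> \<beta> i j \<in> borel_measurable borel & (AE x in lborel. A x \<alpha> \<beta> i j = B \<alpha> \<beta> i j x)" for \<alpha> \<beta> i j
 proof -
  have "(%x. A x \<alpha> \<beta> i j) \<in> borel_measurable lebesgue" using e by (simp add: elliptic_def)
  from someI_ex[OF lebesgue_borel_version[OF this]] show ?thesis unfolding B_def .
 qed
 note B = BB[THEN conjunct1] BB[THEN conjunct2]
 let ?P = "%x. (\<forall>\<alpha> \<beta> i j. A x \<alpha> \<beta> i j = B \<alpha> \<beta> i j x) & (\<forall>\<xi>. \<mu> * (norm \<xi>)^2 <= tact (A x) \<xi> \<bullet> \<xi>) & (\<forall>\<xi> \<eta>. \<bar>tact (A x) \<xi> \<bullet> \<eta>\<bar> <= 1 / \<mu> * norm \<eta> * norm \<xi>)"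
 have ae: "AE x in lborel. ?P x" using e unfolding elliptic_def AE_completion_iff tact_inner by (intro AE_conjI eventually_all_finite B(2)) auto
 define P0 where "P0 x = ?P x" for x
 have "AE x in lborel. P0 x" using ae by (simp only: P0_def)
 then obtain N0 where N0: "N0 \<in> null_sets lborel" and "{x \<in> space lborel. ~ P0 x} \<subseteq> N0" unfolding eventually_ae_filter by blast
 then have "P0 x" if "x \<notin> N0" for x using that by auto
 then have P: "?P x" if "x \<notin> N0" for x using that by (simp only: P0_def)
 define A' where "A' x \<alpha> \<beta> i j = (if x \<in> N0 then if \<alpha> = \<beta> & i = j then \<mu> else 0 else B \<alpha> \<beta> i j x)" for x \<alpha> \<beta> i j
 have AA: "A' x = A x" if "x \<notin> N0" for x using P[OF that] that by (simp add: A'_def fun_eq_iff)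
 have t: "tact (A' x) \<xi> = \<mu> *\<^sub>R \<xi>" if "x \<in> N0" for x \<xi>
 proof -
  have "(\<Sum>\<beta>\<in>UNIV. \<Sum>j\<in>UNIV. A' x \<alpha> \<beta> i j * \<xi>$\<beta>$j) = \<mu> * \<xi>$\<alpha>$i" for \<alpha> i
  proof -
   have "A' x \<alpha> \<beta> i j * \<xi>$\<beta>$j = (if \<beta> = \<alpha> then if j = i then \<mu> * \<xi>$\<alpha>$i else 0 else 0)" for \<beta> j
    using that by (simp add: A'_def)
   then show ?thesis by (simp add: sum_delta2)
  qed
  then show ?thesis by (simp add: tact_def vec_eq_iff)
 qed
 have [measurable]: "N0 \<in> sets borel" using N0 by auto
 have m: "borel_fun (%x. A' x \<alpha> \<beta> i j)" for \<alpha> \<beta> i j unfolding A'_def using B(1) by measurable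
 have "ell \<mu> (max \<mu> (1 / \<mu>)) (%x. tact (A' x))"
 proof (rule ell_tactI[OF m \<mu>])
  fix x \<xi> \<eta>
  show "\<mu> * (norm \<xi>)^2 <= tact (A' x) \<xi> \<bullet> \<xi>" using P[of x] AA[of x] t[of x \<xi>] by (cases "x \<in> N0") (auto simp: power2_norm_eq_inner)
  show "tact (A' x) \<xi> \<bullet> \<eta> <= max \<mu> (1 / \<mu>) * norm \<xi> * norm \<eta>"
  proof (cases "x \<in> N0")
   case True
   have "\<mu> * (\<xi> \<bullet> \<eta>) <= \<mu> * (norm \<xi> * norm \<eta>)" using \<mu> norm_cauchy_schwarz by (intro mult_left_mono) auto
   also have "... <= max \<mu> (1 / \<mu>) * (norm \<xi> * norm \<eta>)" by (intro mult_right_mono) auto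
   finally show ?thesis using True by (simp add: t mult.assoc)
  next
   case False
   have "tact (A' x) \<xi> \<bullet> \<eta> <= 1 / \<mu> * norm \<eta> * norm \<xi>" using P[OF False] AA[OF False] by (metis abs_le_D1)
   also have "... <= max \<mu> (1 / \<mu>) * norm \<xi> * norm \<eta>" unfolding mult.assoc mult.commute[of "norm \<eta>"] by (intro mult_right_mono) auto
   finally show ?thesis .
  qed
 qed (use \<mu> in auto)
 moreover have "AE x in lborel. A x = A' x" using AE_not_in[OF N0] by eventually_elim (simp add: AA)
 ultimately show thesis using that m by blast
qed

definition mean :: "'a::euclidean_space set => ('a => real) => real" where
 "mean B h = (LINT x|lborel. indicator B x * h x) / measure lborel B"

lemma entry_bound:
 assumes "ell \<mu> M (%x :: real^'d. tact (A x :: 'm::finite => 'm => 'd::finite => 'd => real))"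
 shows "\<bar>A x \<alpha> \<beta> i j\<bar> <= M"
proof -
 let ?e = "axis \<beta> (axis j 1) :: real^'d^'m"
 have "\<bar>tact (A x) ?e $ \<alpha> $ i\<bar> <= norm (tact (A x) ?e)" by (rule order_trans[OF component_le_norm_cart Finite_Cartesian_Product.norm_nth_le])
 also have "... <= M * norm ?e" using assms unfolding ell_def coef_def by blast
 also have "norm ?e = 1" by (simp add: norm_eq_sqrt_inner inner_axis)
 finally show ?thesis by (simp add: tact_entry)
qed

lemma ball_bounded_integrable:
 fixes h :: "'a::euclidean_space => real"
 assumes [measurable]: "borel_fun h" and b: "!!x. \<bar>h x\<bar> <= M"
 shows "integrable lborel (%x. indicator (ball x0 r) x * h x)"
proof (rule Bochner_Integration.integrable_bound[where f="%x. M * indicator (ball x0 r) x"])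
 show "integrable lborel (%x. M * indicator (ball x0 r) x)" using emeasure_ball_fin[of x0 r] by (intro integrable_mult_right integrable_real_indicator) auto
qed (use b in \<open>auto simp: indicator_def intro: order_trans[OF b abs_ge_self]\<close>)

lemma mean_tensor_inner:
 fixes A :: "real^'d => 'm::finite => 'm => 'd::finite => 'd => real"
 assumes m: "!!\<alpha> \<beta> i j. borel_fun (%x. A x \<alpha> \<beta> i j)" and e: "ell \<mu> M (%x. tact (A x))"
 shows "tact (%\<alpha> \<beta> i j. mean (ball x0 r) (%y. A y \<alpha> \<beta> i j)) \<xi> \<bullet> \<eta> = mean (ball x0 r) (%y. tact (A y) \<xi> \<bullet> \<eta>)"
proof -
 let ?B = "ball x0 r"
 have i: "integrable lborel (%y. indicator ?B y * (A y \<alpha> \<beta> i j * \<eta>$\<alpha>$i * \<xi>$\<beta>$j))" for \<alpha> \<beta> i j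
 proof -
  have "(%y. indicator ?B y * (A y \<alpha> \<beta> i j * \<eta>$\<alpha>$i * \<xi>$\<beta>$j)) = (%y. indicator ?B y * A y \<alpha> \<beta> i j * (\<eta>$\<alpha>$i * \<xi>$\<beta>$j))" by (simp add: mult_ac)
  then show ?thesis using ball_bounded_integrable[OF m entry_bound[OF e]] by simp
 qed
 have "(LINT y|lborel. indicator ?B y * (tact (A y) \<xi> \<bullet> \<eta>)) = (sum4 (%\<alpha> \<beta> i j. LINT y|lborel. indicator ?B y * (A y \<alpha> \<beta> i j * \<eta>$\<alpha>$i * \<xi>$\<beta>$j)))"
  unfolding tact_inner sum_distrib_left by (simp only: Bochner_Integration.integral_sum Bochner_Integration.integrable_sum i)
 also have "... = (sum4 (%\<alpha> \<beta> i j. (LINT y|lborel. indicator ?B y * A y \<alpha> \<beta> i j) * \<eta>$\<alpha>$i * \<xi>$\<beta>$j))"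
  by (simp add: mult.assoc[symmetric])
 finally show ?thesis unfolding tact_inner mean_def by (simp add: sum_divide_distrib)
qed

lemma mean_mono:
 assumes "integrable lborel (%x. indicator (ball x0 r) x * h x)" "!!x. h x <= c" "0 < r"
 shows "mean (ball x0 r) h <= c"
proof -
 have m: "0 < measure lborel (ball x0 r)" using assms by (simp add: content_ball_pos)
 have "(LINT x|lborel. indicator (ball x0 r) x * h x) <= (LINT x|lborel. c * indicator (ball x0 r) x)"
  using emeasure_ball_fin[of x0 r] assms by (intro integral_mono integrable_mult_right integrable_real_indicator) (auto simp: indicator_def)
 then show ?thesis using m by (simp add: mean_def divide_le_eq)
qed

text \<open>Both bounds are inequalities for quantities linear in the tensor, so they survive
  averaging. An average over a ball thus has the same ellipticity constants.\<close>

lemma ell_mean: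
 fixes A :: "real^'d => 'm::finite => 'm => 'd::finite => 'd => real"
 assumes m: "!!\<alpha> \<beta> i j. borel_fun (%x. A x \<alpha> \<beta> i j)" and e: "ell \<mu> M (%x. tact (A x))" and r: "0 < r"
 shows "ell \<mu> M (%_ :: real^'d. tact (%\<alpha> \<beta> i j. mean (ball x0 r) (%y. A y \<alpha> \<beta> i j)))"
proof -
 let ?T = "%\<alpha> \<beta> i j. mean (ball x0 r) (%y. A y \<alpha> \<beta> i j)"
 have \<mu>: "0 < \<mu>" and M: "0 <= M" and b: "!!x \<xi>. norm (tact (A x) \<xi>) <= M * norm \<xi>" and co: "!!x \<xi>. \<mu> * (norm \<xi>)^2 <= tact (A x) \<xi> \<bullet> \<xi>"
  using e by (auto simp: ell_def coef_def)
 have cs: "\<bar>tact (A x) \<xi> \<bullet> \<eta>\<bar> <= M * norm \<xi> * norm \<eta>" for x \<xi> \<eta>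
  by (rule order_trans[OF Cauchy_Schwarz_ineq2]) (intro mult_right_mono b norm_ge_zero)
 have [measurable]: "borel_fun (%x. tact (A x) \<xi>)" for \<xi> by (rule tact_measurable) (rule m)
 have int: "integrable lborel (%y. indicator (ball x0 r) y * (tact (A y) \<xi> \<bullet> \<eta>))" for \<xi> \<eta>
  by (rule ball_bounded_integrable[OF _ cs]) measurable
 have up: "tact ?T \<xi> \<bullet> \<eta> <= c" if "!!x. tact (A x) \<xi> \<bullet> \<eta> <= c" for \<xi> \<eta> c
  by (subst mean_tensor_inner[OF _ e]) (rule m, rule mean_mono[OF int that r])
 show ?thesis
 proof (rule ell_tactI[OF _ \<mu> M])
  fix \<xi> \<eta> :: "real^'d^'m"
  show "tact ?T \<xi> \<bullet> \<eta> <= M * norm \<xi> * norm \<eta>" by (rule up) (use cs in \<open>blast intro: abs_le_D1\<close>)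
  \<comment> \<open>Coercivity is a lower bound; taking the second argument to be the negative of
    \<xi> turns it into an upper bound, for which \<open>up\<close> is available.\<close>
  have "tact ?T \<xi> \<bullet> (- \<xi>) <= - (\<mu> * (norm \<xi>)^2)" by (rule up) (use co in simp)
  then show "\<mu> * (norm \<xi>)^2 <= tact ?T \<xi> \<bullet> \<xi>" by simp
 qed simp
qed

text \<open>Chebyshev's inequality for the sum S of the entrywise deviations from the mean over the
  ball: small mean oscillation bounds the volume of the set E where S exceeds \<delta>, and off E
  the sum S bounds the norm of the difference of the two maps.\<close>

lemma near_averages_VMO:
 fixes A :: "real^'d => 'm::finite => 'm => 'd::finite => 'd => real"
 assumes mA: "!!\<alpha> \<beta> i j. (%x. A x \<alpha> \<beta> i j) \<in> borel_measurable lebesgue" and vmo: "!!\<alpha> \<beta> i j. VMO (%x. A x \<alpha> \<beta> i j)"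
  and m: "!!\<alpha> \<beta> i j. borel_fun (%x. A' x \<alpha> \<beta> i j)" and eq: "AE x in lborel. A x = A' x" and e: "ell \<mu> M (%x. tact (A' x))"
  and good: "!!x0 r. 0 < r ==> good_average \<Omega> w \<mu> M C1 (tact (%\<alpha> \<beta> i j. mean (ball x0 r) (%y. A' y \<alpha> \<beta> i j)))"
 shows "near_averages \<Omega> w \<mu> M C1 (%x. tact (A' x))" unfolding near_averages_def
proof (intro allI impI)
 fix \<delta> \<eta> :: real assume \<delta>: "0 < \<delta>" and \<eta>: "0 < \<eta>"
 note [measurable] = m
 let ?v = "unit_ball_vol (real CARD('d))"
 let ?c = "\<Sum>\<alpha>\<in>(UNIV::'m set). \<Sum>\<beta>\<in>(UNIV::'m set). \<Sum>i\<in>(UNIV::'d set). \<Sum>j\<in>(UNIV::'d set). (1::real)"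
 have c: "0 < ?c" by simp
 \<comment> \<open>\<open>?c\<close> is the number of entries of the tensor and \<open>?v\<close>
   the volume of the unit ball, so that the integral of S over the ball is at most
   \<open>\<delta> * \<eta> * r^d\<close>.\<close>
 define e0 where "e0 = \<delta> * \<eta> / (?c * ?v)"
 have e0: "0 < e0" using \<delta> \<eta> c by (simp add: e0_def)
 have ent: "avg (ball x0 r) (%x. A x \<alpha> \<beta> i j) = mean (ball x0 r) (%x. A' x \<alpha> \<beta> i j)" for x0 r \<alpha> \<beta> i j
  unfolding mean_def by (rule avg_borel_version[OF mA m]) (use eq in auto)
 \<comment> \<open>Stated with the filter at 0 from the right, so that the radii of the finitely
   many entries combine into one.\<close>
 have "eventually (%R. \<forall>x t. 0 < t & t <= R --> mean (ball x t) (%y. \<bar>A' y \<alpha> \<beta> i j - mean (ball x t) (%y. A' y \<alpha> \<beta> i j)\<bar>) <= e0) (at_right 0)" for \<alpha> \<beta> i j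
 proof -
  obtain R where R: "0 < R" "!!x t. 0 < t ==> t <= R ==> avg (ball x t) (%y. \<bar>A y \<alpha> \<beta> i j - avg (ball x t) (%y. A y \<alpha> \<beta> i j)\<bar>) <= e0"
   using vmo[of \<alpha> \<beta> i j] e0 unfolding VMO_def by blast
  have [measurable]: "(%x. A x \<alpha> \<beta> i j) \<in> borel_measurable lebesgue" by (rule mA)
  have "avg (ball x t) (%y. \<bar>A y \<alpha> \<beta> i j - avg (ball x t) (%y. A y \<alpha> \<beta> i j)\<bar>) = mean (ball x t) (%y. \<bar>A' y \<alpha> \<beta> i j - mean (ball x t) (%y. A' y \<alpha> \<beta> i j)\<bar>)" for x t
   unfolding ent unfolding mean_def[of "ball x t" "%y. \<bar>_ y\<bar>"] by (rule avg_borel_version) (use eq in auto)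
  then show ?thesis using R(2) eventually_at_right_real[OF R(1)] by (auto elim!: eventually_mono)
 qed
 then have "eventually (%R. \<forall>\<alpha> \<beta> i j x t. 0 < t & t <= R --> mean (ball x t) (%y. \<bar>A' y \<alpha> \<beta> i j - mean (ball x t) (%y. A' y \<alpha> \<beta> i j)\<bar>) <= e0) (at_right 0)"
  by (intro eventually_all_finite)
 then have "eventually (%R. 0 < R & (\<forall>\<alpha> \<beta> i j x t. 0 < t & t <= R --> mean (ball x t) (%y. \<bar>A' y \<alpha> \<beta> i j - mean (ball x t) (%y. A' y \<alpha> \<beta> i j)\<bar>) <= e0)) (at_right 0)"
  by (rule eventually_conj[OF eventually_at_right_less])
 then obtain R where R: "0 < R" and osc: "!!\<alpha> \<beta> i j x t. 0 < t ==> t <= R ==> mean (ball x t) (%y. \<bar>A' y \<alpha> \<beta> i j - mean (ball x t) (%y. A' y \<alpha> \<beta> i j)\<bar>) <= e0"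
  using eventually_happens'[OF trivial_limit_at_right_real] by blast
 show "\<exists>R>0. \<forall>x0 r. 0 < r & r <= R --> (\<exists>ab E. good_average \<Omega> w \<mu> M C1 ab & E \<in> sets borel & E \<subseteq> ball x0 r & vol E <= ennreal (\<eta> * r ^ CARD('d))
    & (\<forall>x\<in>ball x0 r - E. \<forall>\<xi>. norm (tact (A' x) \<xi> - ab \<xi>) <= \<delta> * norm \<xi>))"
 proof (intro exI[of _ R] conjI R allI impI)
  fix x0 :: "real^'d" and r assume "0 < r & r <= R"
  then have r: "0 < r" "r <= R" by auto
  let ?B = "ball x0 r"
  define T where "T \<alpha> \<beta> i j = mean ?B (%y. A' y \<alpha> \<beta> i j)" for \<alpha> \<beta> i j
  define S where "S x = (sum4 (%\<alpha> \<beta> i j. \<bar>A' x \<alpha> \<beta> i j - T \<alpha> \<beta> i j\<bar>))" for x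
  define E where "E = {x \<in> ?B. \<delta> < S x}"
  have [measurable]: "borel_fun S" unfolding S_def by measurable
  have [measurable]: "E \<in> sets borel" unfolding E_def by measurable
  have S0: "0 <= S x" for x unfolding S_def by (intro sum_nonneg) auto
  have mB: "measure lborel ?B = ?v * r ^ CARD('d)" using r by (simp add: content_ball)
  have i: "integrable lborel (%x. indicator ?B x * \<bar>A' x \<alpha> \<beta> i j - T \<alpha> \<beta> i j\<bar>)" for \<alpha> \<beta> i j
  proof (rule ball_bounded_integrable)
   show "\<bar>\<bar>A' x \<alpha> \<beta> i j - T \<alpha> \<beta> i j\<bar>\<bar> <= M + \<bar>T \<alpha> \<beta> i j\<bar>" for x using entry_bound[OF e, of x \<alpha> \<beta> i j] by linarith
  qed measurable
  have Si: "integrable lborel (%x. indicator ?B x * S x)" unfolding S_def sum_distrib_left by (intro Bochner_Integration.integrable_sum i)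
  have "(LINT x|lborel. indicator ?B x * S x) = (sum4 (%\<alpha> \<beta> i j. LINT x|lborel. indicator ?B x * \<bar>A' x \<alpha> \<beta> i j - T \<alpha> \<beta> i j\<bar>))"
   unfolding S_def sum_distrib_left by (simp only: Bochner_Integration.integral_sum Bochner_Integration.integrable_sum i)
  also have "... <= (\<Sum>\<alpha>\<in>(UNIV::'m set). \<Sum>\<beta>\<in>(UNIV::'m set). \<Sum>i\<in>(UNIV::'d set). \<Sum>j\<in>(UNIV::'d set). 1 * (e0 * measure lborel ?B))"
  proof (intro sum_mono)
   fix \<alpha> \<beta> i j
   show "(LINT x|lborel. indicator ?B x * \<bar>A' x \<alpha> \<beta> i j - T \<alpha> \<beta> i j\<bar>) <= 1 * (e0 * measure lborel ?B)"
    using osc[OF r, of x0 \<alpha> \<beta> i j] content_ball_pos[OF r(1), of x0] by (simp add: mean_def[of ?B "%y. \<bar>_ y\<bar>"] T_def divide_le_eq)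
  qed
  also have "... = ?c * (e0 * measure lborel ?B)" by (simp only: sum_distrib_right[symmetric])
  also have "... = \<delta> * (\<eta> * r ^ CARD('d))" 
  proof -
   have alg: "k * (p / (k * v) * (v * q)) = p * q" if "0 < k" "0 < v" for k p v q :: real using that by simp
   show ?thesis unfolding mB e0_def by (subst alg[OF c]) (simp_all add: mult.assoc)
  qed
  finally have Sb: "(LINT x|lborel. indicator ?B x * S x) <= \<delta> * (\<eta> * r ^ CARD('d))" .
  have "ennreal \<delta> * vol E = nint (%x. ennreal \<delta> * indicator E x)" by (simp add: nn_integral_cmult_indicator)
  also have "... <= nint (%x. ennreal (indicator ?B x * S x))" by (intro nn_integral_mono) (auto simp: E_def indicator_def intro!: ennreal_leI)
  also have "... = ennreal (LINT x|lborel. indicator ?B x * S x)" by (rule nn_integral_eq_integral[OF Si]) (simp add: S0)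
  also have "... <= ennreal \<delta> * ennreal (\<eta> * r ^ CARD('d))" using Sb \<delta> \<eta> r by (simp add: ennreal_mult'[symmetric] ennreal_leI)
  finally have "ennreal \<delta> * vol E <= ennreal \<delta> * ennreal (\<eta> * r ^ CARD('d))" .
  then have E: "vol E <= ennreal (\<eta> * r ^ CARD('d))" using \<delta> by (subst (asm) ennreal_mult_le_mult_iff) auto
  have "norm (tact (A' x) \<xi> - tact T \<xi>) <= \<delta> * norm \<xi>" if "x \<in> ?B - E" for x \<xi>
  proof -
   have "norm (tact (A' x) \<xi> - tact T \<xi>) <= S x * norm \<xi>" unfolding tact_diff S_def by (rule norm_tact_le)
   also have "... <= \<delta> * norm \<xi>" using that by (intro mult_right_mono) (auto simp: E_def)
   finally show ?thesis .
  qed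
  moreover have "good_average \<Omega> w \<mu> M C1 (tact T)" using good[OF r(1), of x0] by (simp add: T_def[abs_def])
  ultimately show "\<exists>ab E. good_average \<Omega> w \<mu> M C1 ab & E \<in> sets borel & E \<subseteq> ?B & vol E <= ennreal (\<eta> * r ^ CARD('d))
    & (\<forall>x\<in>?B - E. \<forall>\<xi>. norm (tact (A' x) \<xi> - ab \<xi>) <= \<delta> * norm \<xi>)"
   using E by (intro exI[of _ "tact T"] exI[of _ E]) (auto simp: E_def)
 qed
qed

section \<open>Transfer between Lebesgue and Borel formulations\<close>

lemma vec_nth2_measurable[measurable (raw)]:
 "F \<in> borel_measurable M ==> (%x. (F x :: real^'d^'m) $ \<alpha> $ i) \<in> borel_measurable M"
 using borel_measurable_inner[of F M "%_. axis \<alpha> (axis i 1)"] by (simp add: inner_axis)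

lemma weak_form:
 fixes A :: "real^'d => 'm::finite => 'm => 'd::finite => 'd => real"
 assumes [measurable]: "!!\<alpha> \<beta> i j. (%x. A x \<alpha> \<beta> i j) \<in> borel_measurable lebesgue" "G \<in> borel_measurable lebesgue" "f \<in> borel_measurable lebesgue"
  and a: "coef M (%x. tact (A' x))" and G': "L2 G'" and f': "L2 f'" and \<Omega>: "open \<Omega>" and \<phi>: "C1c \<Omega> (\<phi> :: real^'d => real^'m)"
  and eq: "AE x in lborel. x \<in> \<Omega> --> A x = A' x & G x = G' x & f x = f' x"
 shows "(LINT x:\<Omega>|lebesgue. (sum4 (%\<alpha> \<beta> i j. A x \<alpha> \<beta> i j * G x $\<beta>$j * jac \<phi> x $\<alpha>$i))) = ip (%x. tact (A' x) (G' x)) (jac \<phi>)"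
  and "(LINT x:\<Omega>|lebesgue. (\<Sum>\<alpha>\<in>UNIV. \<Sum>i\<in>UNIV. f x $\<alpha>$i * jac \<phi> x $\<alpha>$i)) = ip f' (jac \<phi>)"
proof -
 have j[measurable]: "borel_fun (jac \<phi>)" by (rule C1c_regular(4)[OF \<phi>])
 have [measurable]: "jac \<phi> \<in> borel_measurable lebesgue" using j by (auto intro: measurable_completion)
 have [measurable]: "borel_fun G'" "borel_fun f'" using G' f' by (auto simp: L2_def)
 have [measurable]: "borel_fun (%x. tact (A' x) (G' x))" by (rule coef_measurable[OF a]) measurable
 have out: "indicator \<Omega> x * (H \<bullet> jac \<phi> x) = H \<bullet> jac \<phi> x" for H x using C1c_outside(2)[OF \<phi>, of x] by (cases "x \<in> \<Omega>") auto
 have "(LINT x:\<Omega>|lebesgue. (sum4 (%\<alpha> \<beta> i j. A x \<alpha> \<beta> i j * G x $\<beta>$j * jac \<phi> x $\<alpha>$i)))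
   = (LINT x|lborel. indicator \<Omega> x * (tact (A' x) (G' x) \<bullet> jac \<phi> x))"
 proof (rule set_integral_borel_version)
  show "AE x in lborel. x \<in> \<Omega> --> (sum4 (%\<alpha> \<beta> i j. A x \<alpha> \<beta> i j * G x $\<beta>$j * jac \<phi> x $\<alpha>$i)) = tact (A' x) (G' x) \<bullet> jac \<phi> x"
   using eq by eventually_elim (simp add: tact_inner mult_ac)
 qed (use \<Omega> in auto)
 then show "(LINT x:\<Omega>|lebesgue. (sum4 (%\<alpha> \<beta> i j. A x \<alpha> \<beta> i j * G x $\<beta>$j * jac \<phi> x $\<alpha>$i))) = ip (%x. tact (A' x) (G' x)) (jac \<phi>)"
  by (simp only: out ip_def)
 have "(LINT x:\<Omega>|lebesgue. (\<Sum>\<alpha>\<in>UNIV. \<Sum>i\<in>UNIV. f x $\<alpha>$i * jac \<phi> x $\<alpha>$i)) = (LINT x|lborel. indicator \<Omega> x * (f' x \<bullet> jac \<phi> x))"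
 proof (rule set_integral_borel_version)
  show "AE x in lborel. x \<in> \<Omega> --> (\<Sum>\<alpha>\<in>UNIV. \<Sum>i\<in>UNIV. f x $\<alpha>$i * jac \<phi> x $\<alpha>$i) = f' x \<bullet> jac \<phi> x"
   using eq by eventually_elim (simp add: inner_vec_def)
 qed (use \<Omega> in auto)
 then show "(LINT x:\<Omega>|lebesgue. (\<Sum>\<alpha>\<in>UNIV. \<Sum>i\<in>UNIV. f x $\<alpha>$i * jac \<phi> x $\<alpha>$i)) = ip f' (jac \<phi>)" by (simp only: out ip_def)
qed

lemma set_nn_integral_borel_version:
 assumes "AE x in lborel. x \<in> S --> f x = g x"
 shows "(\<integral>\<^sup>+x\<in>S. f x \<partial>lebesgue) = sint S g"
 unfolding nn_integral_completion using assms by (intro nn_integral_cong_AE) (auto simp: indicator_def)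

lemma h1_H10:
 assumes h: "h1 \<Omega> (U :: real^'d => real^'m) G"
 shows "H10 \<Omega> U G"
proof -
 obtain \<phi> where \<phi>: "!!k. C1c \<Omega> (\<phi> k)" "(%k. n2 (%x. \<phi> k x - U x)) ~~~> 0" "(%k. n2 (%x. jac (\<phi> k) x - G x)) ~~~> 0"
  using h by (auto simp: h1_def)
 have lim: "(%k. \<integral>\<^sup>+x\<in>\<Omega>. ennreal ((norm (F k x - V x))^2) \<partial>lebesgue) ~~~> 0"
  if "!!k. L2 (F k)" "L2 V" "(%k. n2 (%x. F k x - V x)) ~~~> 0" for F :: "nat => real^'d => 'b::euclidean_space" and V
 proof (rule tendsto_sandwich[of "%_. 0" _ _ "%k. ennreal ((n2 (%x. F k x - V x))^2)"])
  have "(%k. ennreal ((n2 (%x. F k x - V x))^2)) ~~~> ennreal (0^2)" by (intro tendsto_intros tendsto_ennrealI that)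
  then show "(%k. ennreal ((n2 (%x. F k x - V x))^2)) ~~~> 0" by simp
  have "(\<integral>\<^sup>+x\<in>\<Omega>. ennreal ((norm (F k x - V x))^2) \<partial>lebesgue) <= ennreal ((n2 (%x. F k x - V x))^2)" for k
   unfolding nn_integral_n2[OF L2_diff[OF that(1,2)], symmetric] nn_integral_completion by (intro nn_integral_mono) (auto simp: indicator_def)
  then show "eventually (%k. (\<integral>\<^sup>+x\<in>\<Omega>. ennreal ((norm (F k x - V x))^2) \<partial>lebesgue) <= ennreal ((n2 (%x. F k x - V x))^2)) sequentially" by simp
 qed auto
 show ?thesis unfolding H10_def
  using h1_L2[OF h] \<phi> lim[OF C1c_regular(5)[OF \<phi>(1)] h1_L2(1)[OF h] \<phi>(2)] lim[OF C1c_regular(6)[OF \<phi>(1)] h1_L2(2)[OF h] \<phi>(3)]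
  by (intro conjI exI[of _ \<phi>]) (auto simp: L2_def intro: measurable_completion)
qed

text \<open>Translates the assumed estimate for an averaged matrix into Borel, whole-space terms.
  Bounded data that are square integrable are admissible there, and their part outside the domain
  only increases the right-hand side.\<close>

lemma good_average_constant:
 fixes T :: "'m::finite => 'm => 'd::finite => 'd => real" and w :: "real^'d => real"
 assumes e: "ell \<mu> M (%_ :: real^'d. tact T)" and est: "weighted_estimate \<Omega> w C1 (%_. T)" and \<Omega>: "open \<Omega>"
  and w': "AE x in lborel. w x = w' x"
 shows "good_average \<Omega> w' \<mu> M C1 (tact T)" unfolding good_average_def
proof (intro conjI e allI impI)
 fix F and U :: "real^'d => real^'m" and G assume F: "L2 F" "\<exists>B. \<forall>x. norm (F x) <= B" and h: "h1 \<Omega> U G" and weak: "weak_on \<Omega> (%_. tact T) F G"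
 have co: "coef M (%_ :: real^'d. tact T)" using e by (simp add: ell_def)
 note LG = h1_L2(2)[OF h]
 have mG: "G \<in> borel_measurable lebesgue" "F \<in> borel_measurable lebesgue" using LG F by (auto simp: L2_def intro: measurable_completion)
 have "Linf \<Omega> F" using F mG by (auto simp: Linf_def)
 moreover have "weak_sol \<Omega> (%_. T) F U G" unfolding weak_sol_def
 proof (intro conjI allI impI h1_H10[OF h])
  fix \<phi> :: "real^'d => real^'m" assume \<phi>: "C1c \<Omega> \<phi>"
  have "ip (%x. tact T (G x) + F x) (jac \<phi>) = 0" using weak \<phi> by (simp add: weak_on_def)
  then have "ip (%x. tact T (G x)) (jac \<phi>) = - ip F (jac \<phi>)" using ip_add(1)[OF coef_L2[OF co LG] F(1) C1c_regular(6)[OF \<phi>]] by simp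
  then show "(LINT x:\<Omega>|lebesgue. (sum4 (%\<alpha> \<beta> i j. T \<alpha> \<beta> i j * G x $\<beta>$j * jac \<phi> x $\<alpha>$i))) = - (LINT x:\<Omega>|lebesgue. (\<Sum>\<alpha>\<in>UNIV. \<Sum>i\<in>UNIV. F x $\<alpha>$i * jac \<phi> x $\<alpha>$i))"
   using weak_form[where A="%_. T" and A'="%_. T", OF _ mG co LG F(1) \<Omega> \<phi>] by simp
 qed
 ultimately have "(\<integral>\<^sup>+x\<in>\<Omega>. ennreal ((norm (G x))^2 * w x) \<partial>lebesgue) <= ennreal C1 * (\<integral>\<^sup>+x\<in>\<Omega>. ennreal ((norm (F x))^2 * w x) \<partial>lebesgue)"
  using est unfolding weighted_estimate_def by blast
 moreover have "(\<integral>\<^sup>+x\<in>\<Omega>. ennreal ((norm (H x))^2 * w x) \<partial>lebesgue) = energy w' \<Omega> H" for H :: "real^'d => real^'d^'m"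
  by (rule set_nn_integral_borel_version) (use w' in eventually_elim, simp add: mult.commute)
 moreover have "energy w' UNIV G = energy w' \<Omega> G" using h by (intro nn_integral_cong) (auto simp: h1_def indicator_def)
 moreover have "energy w' \<Omega> F <= energy w' UNIV F" by (intro nn_integral_mono) (auto simp: indicator_def)
 ultimately show "energy w' UNIV G <= ennreal C1 * energy w' UNIV F" by (simp add: order_trans[OF _ mult_left_mono])
qed

text \<open>Square integrability of the limit is not assumed: it follows because one approximation
  error is eventually below 1 and the approximating fields are square integrable.\<close>

lemma L2_limit_version:
 fixes v :: "'a::euclidean_space => 'b::euclidean_space"
 assumes v: "v \<in> borel_measurable lebesgue" and \<psi>: "!!k::nat. L2 (\<psi> k)" "!!k x. x \<notin> \<Omega> ==> \<psi> k x = 0" and \<Omega>: "open \<Omega>"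
  and lim: "(%k. \<integral>\<^sup>+x\<in>\<Omega>. ennreal ((norm (\<psi> k x - v x))^2) \<partial>lebesgue) ~~~> 0"
 shows "\<exists>V. L2 V & (\<forall>x. x \<notin> \<Omega> --> V x = 0) & (AE x in lborel. x \<in> \<Omega> --> v x = V x) & (%k. n2 (%x. \<psi> k x - V x)) ~~~> 0"
proof -
 obtain g where g[measurable]: "borel_fun g" and vg: "AE x in lborel. v x = g x" using lebesgue_borel_version[OF v] by blast
 define V where "V x = indicator \<Omega> x *\<^sub>R g x" for x
 have [measurable]: "\<Omega> \<in> sets borel" using \<Omega> by simp
 have [measurable]: "borel_fun V" unfolding V_def by measurable
 have eqV: "AE x in lborel. x \<in> \<Omega> --> v x = V x" using vg by eventually_elim (simp add: V_def)
 have [measurable]: "borel_fun (\<psi> k)" for k using \<psi>(1)[of k] by (simp add: L2_def)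
 have I: "(\<integral>\<^sup>+x\<in>\<Omega>. ennreal ((norm (\<psi> k x - v x))^2) \<partial>lebesgue) = nint (%x. ennreal ((norm (\<psi> k x - V x))^2))" for k
 proof -
  have "(\<integral>\<^sup>+x\<in>\<Omega>. ennreal ((norm (\<psi> k x - v x))^2) \<partial>lebesgue) = sint \<Omega> (%x. ennreal ((norm (\<psi> k x - V x))^2))"
   by (rule set_nn_integral_borel_version) (use eqV in eventually_elim, simp)
  also have "... = nint (%x. ennreal ((norm (\<psi> k x - V x))^2))" using \<psi>(2) by (intro nn_integral_cong) (simp add: V_def indicator_def)
  finally show ?thesis .
 qed
 have "eventually (%k. (nint (%x. ennreal ((norm (\<psi> k x - V x))^2))) < 1) sequentially" using order_tendstoD(2)[OF lim, of 1] unfolding I by simp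
 then obtain k where "nint (%x. ennreal ((norm (\<psi> k x - V x))^2)) < 1" by (auto simp: eventually_sequentially)
 then have "L2 (%x. \<psi> k x - V x)" by (auto simp: L2_def intro: less_trans[of _ 1])
 from L2_diff[OF \<psi>(1)[of k] this] have LV: "L2 V" by simp
 have "(%k. ennreal ((n2 (%x. \<psi> k x - V x))^2)) ~~~> ennreal 0" using lim unfolding I nn_integral_n2[OF L2_diff[OF \<psi>(1) LV]] by simp
 then have "(%k. (n2 (%x. \<psi> k x - V x))^2) ~~~> 0" by (subst (asm) tendsto_ennreal_iff) auto
 from tendsto_real_sqrt[OF this] have "(%k. n2 (%x. \<psi> k x - V x)) ~~~> 0" by (simp add: n2_nonneg)
 then show ?thesis using LV eqV by (intro exI[of _ V]) (auto simp: V_def)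
qed

text \<open>Solution, gradient and data are replaced by Borel representatives that vanish outside
  the domain. For f the values above the essential bound are also set to 0, which makes f' bounded
  with bounded support and hence square integrable.\<close>

lemma weak_sol_borel_version:
 fixes A :: "real^'d => 'm::finite => 'm => 'd::finite => 'd => real"
 assumes mA: "!!\<alpha> \<beta> i j. (%x. A x \<alpha> \<beta> i j) \<in> borel_measurable lebesgue" and eq: "AE x in lborel. A x = A' x" and a: "coef M (%x. tact (A' x))"
  and \<Omega>: "open \<Omega>" "bounded \<Omega>" and f: "Linf \<Omega> f" and sol: "weak_sol \<Omega> A f u G"
 shows "\<exists>U G' f'. h1 \<Omega> (U :: real^'d => real^'m) G' & L2 f' & weak_on \<Omega> (%x. tact (A' x)) f' G' & (\<forall>x. x \<notin> \<Omega> --> f' x = 0) & (AE x in lborel. x \<in> \<Omega> --> G x = G' x & f x = f' x)"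
proof -
 obtain \<phi> where mu: "u \<in> borel_measurable lebesgue" "G \<in> borel_measurable lebesgue" and \<phi>: "!!k. C1c \<Omega> (\<phi> k)"
  and l1: "(%k. \<integral>\<^sup>+x\<in>\<Omega>. ennreal ((norm (\<phi> k x - u x))^2) \<partial>lebesgue) ~~~> 0"
  and l2: "(%k. \<integral>\<^sup>+x\<in>\<Omega>. ennreal ((norm (jac (\<phi> k) x - G x))^2) \<partial>lebesgue) ~~~> 0"
  using sol unfolding weak_sol_def H10_def by blast
 obtain U where U: "L2 U" "\<forall>x. x \<notin> \<Omega> --> U x = 0" "(%k. n2 (%x. \<phi> k x - U x)) ~~~> 0"
  using L2_limit_version[OF mu(1) C1c_regular(5)[OF \<phi>] C1c_outside(1)[OF \<phi>] \<Omega>(1) l1] by blast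
 obtain G' where G': "L2 G'" "\<forall>x. x \<notin> \<Omega> --> G' x = 0" "AE x in lborel. x \<in> \<Omega> --> G x = G' x" "(%k. n2 (%x. jac (\<phi> k) x - G' x)) ~~~> 0"
  using L2_limit_version[OF mu(2) C1c_regular(6)[OF \<phi>] C1c_outside(2)[OF \<phi>] \<Omega>(1) l2] by blast
 have h: "h1 \<Omega> U G'" unfolding h1_def using U G' \<phi> by blast
 obtain B where fm: "f \<in> borel_measurable lebesgue" and B: "AE x in lborel. x \<in> \<Omega> --> norm (f x) <= B"
  using f unfolding Linf_def AE_completion_iff by blast
 obtain g where g[measurable]: "borel_fun g" and fg: "AE x in lborel. f x = g x" using lebesgue_borel_version[OF fm] by blast
 define f' where "f' x = (if x \<in> \<Omega> & norm (g x) <= B then g x else 0)" for x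
 have [measurable]: "\<Omega> \<in> sets borel" using \<Omega> by simp
 have "borel_fun f'" unfolding f'_def by measurable
 then have Lf: "L2 f'" by (rule L2_bounded_support[where B="max B 0" and K=\<Omega>]) (use \<Omega> in \<open>auto simp: f'_def\<close>)
 have ff: "AE x in lborel. x \<in> \<Omega> --> f x = f' x" using B fg by eventually_elim (simp add: f'_def)
 have all: "AE x in lborel. x \<in> \<Omega> --> A x = A' x & G x = G' x & f x = f' x" using eq G'(3) ff by eventually_elim simp
 have "weak_on \<Omega> (%x. tact (A' x)) f' G'" unfolding weak_on_def
 proof (intro allI impI)
  fix \<psi> :: "real^'d => real^'m" assume \<psi>: "C1c \<Omega> \<psi>"
  note wf = weak_form[where A=A and A'=A', OF mA mu(2) fm a G'(1) Lf \<Omega>(1) \<psi> all]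
  have "ip (%x. tact (A' x) (G' x)) (jac \<psi>) = - ip f' (jac \<psi>)" unfolding wf[symmetric] using sol \<psi> unfolding weak_sol_def by blast
  then show "ip (%x. tact (A' x) (G' x) + f' x) (jac \<psi>) = 0" using ip_add(1)[OF coef_L2[OF a G'(1)] Lf C1c_regular(6)[OF \<psi>]] by simp
 qed
 moreover have "AE x in lborel. x \<in> \<Omega> --> G x = G' x & f x = f' x" using all by eventually_elim simp
 moreover have "\<forall>x. x \<notin> \<Omega> --> f' x = 0" by (simp add: f'_def)
 ultimately show ?thesis using h Lf by blast
qed

text \<open>Averages do not change under modification on a null set, and local integrability turns
  them into finite extended integrals. Enlarging the constant to at least 1 prepares
  truncation.\<close>

lemma A1_weight_borel_version:
 assumes w: "A1_weight w" and w'm[measurable]: "borel_fun w'" and w'0: "!!x. 0 <= w' x" and eq: "AE x in lborel. w x = w' x"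
 shows "\<exists>c\<ge>1. A1 c (%x. ennreal (w' x))" and "sint (ball x0 r) (%x. ennreal (w' x)) < top"
proof -
 have wm[measurable]: "w \<in> borel_measurable lebesgue" and loc: "loc_integrable w" using w by (auto simp: A1_weight_def)
 obtain C where C: "!!x r. 0 < r ==> AE y in lebesgue. y \<in> ball x r --> avg (ball x r) w <= C * w y" using w unfolding A1_weight_def by blast
 have [measurable]: "w' \<in> borel_measurable lebesgue" by (auto intro: measurable_completion)
 have [measurable]: "ball x0 r \<in> sets lebesgue" for x0 :: 'a and r by auto
 have int: "integrable lborel (%x. indicator (ball x0 r) x * w' x)" for x0 :: 'a and r
 proof -
  have "set_integrable lebesgue (cball x0 r) w" using loc by (simp add: loc_integrable_def)
  then have "set_integrable lebesgue (ball x0 r) w" by (rule set_integrable_subset) auto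
  then have "integrable lebesgue (%x. indicator (ball x0 r) x * w x)" by (simp add: set_integrable_def)
  moreover have "integrable lebesgue (%x. indicator (ball x0 r) x * w x) \<longleftrightarrow> integrable lebesgue (%x. indicator (ball x0 r) x * w' x)"
   by (rule integrable_cong_AE, measurable) (use eq in \<open>auto simp: AE_completion_iff\<close>)
  ultimately show ?thesis by (subst (asm) integrable_completion[symmetric]) (simp_all add: integrable_completion)
 qed
 define J where "J x r = (LINT y|lborel. indicator (ball x r) y * w' y)" for x r
 have J: "sint (ball x r) (%y. ennreal (w' y)) = ennreal (J x r)" for x :: 'a and r
 proof -
  have "sint (ball x r) (%y. ennreal (w' y)) = nint (%y. ennreal (indicator (ball x r) y * w' y))" by (intro nn_integral_cong) (simp add: indicator_def)
  also have "... = ennreal (J x r)" unfolding J_def by (rule nn_integral_eq_integral[OF int]) (simp add: w'0)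
  finally show ?thesis .
 qed
 show "sint (ball x0 r) (%x. ennreal (w' x)) < top" unfolding J by simp
 have "A1 (max 1 C) (%x. ennreal (w' x))" unfolding A1_def
 proof (intro conjI allI impI)
  fix x :: 'a and r :: real assume r: "0 < r"
  have m: "0 < measure lborel (ball x r)" using r by (simp add: content_ball_pos)
  have em: "vol (ball x r) = ennreal (measure lborel (ball x r))" using emeasure_ball_fin[of x r] by (intro emeasure_eq_ennreal_measure) auto
  have av: "avg (ball x r) w = J x r / measure lborel (ball x r)" unfolding J_def by (rule avg_borel_version[OF wm w'm eq])
  show "AE z in lborel. z \<in> ball x r --> sint (ball x r) (%y. ennreal (w' y)) <= ennreal (max 1 C) * vol (ball x r) * ennreal (w' z)"
   using C[OF r, of x, unfolded AE_completion_iff] eq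
  proof (eventually_elim, intro impI)
   fix z assume "z \<in> ball x r --> avg (ball x r) w <= C * w z" "w z = w' z" "z \<in> ball x r"
   then have "J x r <= C * w' z * measure lborel (ball x r)" using m by (simp add: av divide_le_eq)
   also have "... <= max 1 C * w' z * measure lborel (ball x r)" using w'0 by (intro mult_right_mono) auto
   finally have "ennreal (J x r) <= ennreal (max 1 C * measure lborel (ball x r) * w' z)" by (intro ennreal_leI) (simp add: mult_ac)
   then show "sint (ball x r) (%y. ennreal (w' y)) <= ennreal (max 1 C) * vol (ball x r) * ennreal (w' z)" unfolding J em using w'0 by (simp add: ennreal_mult)
  qed
 qed measurable
 then show "\<exists>c\<ge>1. A1 c (%x. ennreal (w' x))" by (intro exI[of _ "max 1 C"]) simp
qed

text \<open>Monotone convergence in the truncation level; this is where the independence of N is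
  cashed in.\<close>

lemma energy_monotone_limit:
 fixes H :: "'a::euclidean_space => 'b::euclidean_space"
 assumes [measurable]: "borel_fun w" "borel_fun H" and b: "!!n::nat. energy (%x. min (w x) (real n)) UNIV H <= B"
 shows "energy w UNIV H <= B"
proof -
 let ?f = "%n x. ennreal (min (w x) (real n) * (norm (H x))^2) * indicator UNIV x"
 have inc: "incseq ?f" by (intro incseq_SucI le_funI mult_right_mono ennreal_leI) auto
 have "energy w UNIV H <= nint (%x. (SUP n. ?f n x))"
 proof (rule nn_integral_mono)
  fix x
  obtain n :: nat where "w x <= real n" using real_arch_simple by blast
  then show "ennreal (w x * (norm (H x))^2) * indicator UNIV x <= (SUP n. ?f n x)" by (intro SUP_upper2[of n]) (auto simp: min_def)
 qed
 also have "... = (SUP n. energy (%x. min (w x) (real n)) UNIV H)" by (rule nn_integral_monotone_convergence_SUP[OF inc]) measurable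
 also have "... <= B" by (intro SUP_least b)
 finally show ?thesis .
qed

text \<open>On a fixed ball A1 bounds the weight below, almost everywhere, by a multiple of its
  average. So it either vanishes there or stays away from 0.\<close>

lemma A1_positive_or_null:
 assumes A: "A1 c (%x. ennreal (w x))" and c: "1 <= c" and wm[measurable]: "borel_fun w" and w0: "!!x. 0 <= w x"
  and fin: "sint (ball 0 R) (%x. ennreal (w x)) < top" and R: "0 < R"
 shows "(AE x in lborel. x \<in> ball 0 R --> w x = 0) \<or> (\<exists>c0>0. AE x in lborel. x \<in> ball 0 R --> c0 <= w x)"
proof -
 obtain J where J: "0 <= J" "sint (ball 0 R) (%x. ennreal (w x)) = ennreal J" by (rule nn_integral_set_finite_real[OF fin])
 let ?m = "measure lborel (ball (0::'a) R)"
 have m: "0 < ?m" using R by (simp add: content_ball_pos)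
 have em: "vol (ball (0::'a) R) = ennreal ?m" using emeasure_ball_fin[of "0::'a" R] by (intro emeasure_eq_ennreal_measure) auto
 show ?thesis
 proof (cases "J = 0")
  case True
  then have "AE x in lborel. ennreal (w x) * indicator (ball 0 R) x = 0" using J(2) nn_integral_0_iff_AE[of "%x. ennreal (w x) * indicator (ball 0 R) x" lborel] by simp
  then have "AE x in lborel. x \<in> ball 0 R --> w x = 0" by eventually_elim (use w0 in \<open>auto simp: ennreal_eq_0_iff antisym\<close>)
  then show ?thesis by blast
 next
  case False
  have "AE z in lborel. z \<in> ball 0 R --> ennreal J <= ennreal c * ennreal ?m * ennreal (w z)" using A R unfolding A1_def em[symmetric] J(2)[symmetric] by blast
  then have "AE z in lborel. z \<in> ball 0 R --> J / (c * ?m) <= w z"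
  proof (eventually_elim, intro impI)
   fix z assume "z \<in> ball 0 R --> ennreal J <= ennreal c * ennreal ?m * ennreal (w z)" "z \<in> ball 0 R"
   then have "J <= c * ?m * w z" using c w0[of z] by (simp add: ennreal_mult'[symmetric])
   then show "J / (c * ?m) <= w z" using c m by (simp add: divide_le_eq mult_ac)
  qed
  moreover have "0 < J / (c * ?m)" using False J c m by simp
  ultimately show ?thesis by blast
 qed
qed

text \<open>The truncated estimate still contains the unweighted energy of the gradient. By the
  unweighted theory it is bounded by the unweighted energy of f, and on a ball around the domain the
  A1 weight has a positive lower bound, so this in turn is bounded by the weighted energy of f. A
  weight vanishing on that ball makes the claim trivial.\<close>

theorem theorem5p1:
  fixes w :: "real^'d \<Rightarrow> real"
    and \<Omega> :: "(real^'d) set"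
    and A :: "real^'d \<Rightarrow> 'm::finite \<Rightarrow> 'm \<Rightarrow> 'd::finite \<Rightarrow> 'd \<Rightarrow> real"
    and \<mu> :: real
  assumes "A1_weight w"
    and "lipschitz_domain \<Omega>" and "bounded \<Omega>" and "diameter \<Omega> \<le> 1"
    and "elliptic \<mu> A"
    and "\<forall>\<alpha> \<beta> i j. VMO (\<lambda>x. A x \<alpha> \<beta> i j)"
    and "\<exists>C1. \<forall>x0 r. 0 < r \<longrightarrow>
           weighted_estimate \<Omega> w C1 (\<lambda>x \<alpha> \<beta> i j. avg (ball x0 r) (\<lambda>y. A y \<alpha> \<beta> i j))"
  shows "\<exists>C. weighted_estimate \<Omega> w C A"
proof -
 note \<Omega> = assms(2,3)
 have op: "open \<Omega>" using \<Omega>(1) by (simp add: lipschitz_domain_def)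
 have mA: "(%x. A x \<alpha> \<beta> i j) \<in> borel_measurable lebesgue" for \<alpha> \<beta> i j using assms(5) by (simp add: elliptic_def)
 obtain A' where m: "!!\<alpha> \<beta> i j. borel_fun (%x. A' x \<alpha> \<beta> i j)" and eqA: "AE x in lborel. A x = A' x" and e: "ell \<mu> (max \<mu> (1 / \<mu>)) (%x. tact (A' x))"
  by (rule elliptic_borel_version[OF assms(5)]) blast
 let ?M = "max \<mu> (1 / \<mu>)"
 have \<mu>: "0 < \<mu>" and co: "coef ?M (%x. tact (A' x))" using e by (auto simp: ell_def)
 have wm: "w \<in> borel_measurable lebesgue" and wp: "!!x. 0 <= w x" using assms(1) by (auto simp: A1_weight_def)
 obtain g where g[measurable]: "borel_fun g" and wg: "AE x in lborel. w x = g x" using lebesgue_borel_version[OF wm] by blast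
 \<comment> \<open>The Borel representative may be negative on a null set; the positive part makes
   it nonnegative at every point.\<close>
 define w' where "w' x = max 0 (g x)" for x
 have w'm[measurable]: "borel_fun w'" unfolding w'_def by measurable
 have w'0: "0 <= w' x" for x by (simp add: w'_def)
 have eqw: "AE x in lborel. w x = w' x" using wg by eventually_elim (use wp in \<open>simp add: w'_def max_def, metis antisym_conv\<close>)
 obtain c where c: "1 <= c" and A1: "A1 c (%x. ennreal (w' x))" using A1_weight_borel_version(1)[OF assms(1) w'm w'0 eqw] by blast
 note fin = A1_weight_borel_version(2)[OF assms(1) w'm w'0 eqw]
 obtain C1 where C1: "!!x0 r. 0 < r ==> weighted_estimate \<Omega> w C1 (%x \<alpha> \<beta> i j. avg (ball x0 r) (%y. A y \<alpha> \<beta> i j))" using assms(7) by blast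
 have ent: "avg (ball x0 r) (%x. A x \<alpha> \<beta> i j) = mean (ball x0 r) (%x. A' x \<alpha> \<beta> i j)" for x0 r \<alpha> \<beta> i j
  unfolding mean_def by (rule avg_borel_version[OF mA m]) (use eqA in auto)
 have good: "good_average \<Omega> w' \<mu> ?M C1 (tact (%\<alpha> \<beta> i j. mean (ball x0 r) (%y. A' y \<alpha> \<beta> i j)))" if "0 < r" for x0 r
  by (rule good_average_constant[OF ell_mean[OF m e that] C1[OF that, unfolded ent] op eqw])
 have near: "near_averages \<Omega> w' \<mu> ?M C1 (%x. tact (A' x))" by (rule near_averages_VMO[OF mA _ m eqA e good]) (use assms(6) in auto)
 obtain \<kappa> r1 where \<kappa>: "0 < \<kappa>" "\<kappa> <= 1/2" "0 < r1" "outer_balls \<Omega> \<kappa> r1" using lipschitz_domain_outer_balls[OF \<Omega>] by blast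
 obtain C where C: "0 <= C" and est: "!!N (U :: real^'d => real^'m) G f. 0 <= N ==> h1 \<Omega> U G ==> L2 f ==> weak_on \<Omega> (%x. tact (A' x)) f G ==>
   energy (%x. min (w' x) N) UNIV G <= ennreal C * (esq UNIV G + energy (%x. min (w' x) N) UNIV f)"
  using truncated_estimate[OF op \<Omega>(2) e w'm w'0 A1 c fin near \<kappa>] by blast
 obtain R where R: "0 < R" "\<Omega> \<subseteq> ball 0 R" using \<Omega>(2) by (metis bounded_subset_ballD)
 have conv: "(\<integral>\<^sup>+x\<in>\<Omega>. ennreal ((norm (H x))^2 * w x) \<partial>lebesgue) = energy w' UNIV H'"
  if "AE x in lborel. x \<in> \<Omega> --> H x = H' x" "\<forall>x. x \<notin> \<Omega> --> H' x = 0" for H H' :: "real^'d => real^'d^'m"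
 proof -
  have "(\<integral>\<^sup>+x\<in>\<Omega>. ennreal ((norm (H x))^2 * w x) \<partial>lebesgue) = energy w' \<Omega> H'"
   by (rule set_nn_integral_borel_version) (use that(1) eqw in eventually_elim, simp add: mult.commute)
  also have "... = energy w' UNIV H'" using that(2) by (intro nn_integral_cong) (simp add: indicator_def)
  finally show ?thesis .
 qed
 have "\<exists>K. \<forall>(U :: real^'d => real^'m) G f. h1 \<Omega> U G --> L2 f --> weak_on \<Omega> (%x. tact (A' x)) f G --> (\<forall>x. x \<notin> \<Omega> --> f x = 0) --> energy w' UNIV G <= ennreal K * energy w' UNIV f"
  using A1_positive_or_null[OF A1 c w'm w'0 fin R(1)]
 proof
  assume null: "AE x in lborel. x \<in> ball 0 R --> w' x = 0"
  have "energy w' UNIV G = 0" if h: "h1 \<Omega> (U :: real^'d => real^'m) G" for U G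
  proof -
   have "energy w' UNIV G = (\<integral>\<^sup>+x. 0 \<partial>(lborel :: (real^'d) measure))"
   proof (rule nn_integral_cong_AE, use null in eventually_elim)
    fix x assume "x \<in> ball 0 R --> w' x = 0"
    then show "ennreal (w' x * (norm (G x))^2) * indicator UNIV x = 0" using h R(2) by (cases "x \<in> \<Omega>") (auto simp: h1_def)
   qed
   then show ?thesis by simp
  qed
  then show ?thesis by auto
 next
  assume "\<exists>c0>0. AE x in lborel. x \<in> ball 0 R --> c0 <= w' x"
  then obtain c0 where c0: "0 < c0" "AE x in lborel. x \<in> ball 0 R --> c0 <= w' x" by blast
  show ?thesis
  \<comment> \<open>The constant collects the truncated estimate, the energy estimate
    \<open>1 / \<mu>^2\<close> and the lower bound \<open>c0\<close> of the weight.\<close>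
  proof (intro exI[of _ "C * (1 / \<mu>^2 * (1 / c0) + 1)"] allI impI)
   fix U :: "real^'d => real^'m" and G f assume h: "h1 \<Omega> U G" and f: "L2 f" and weak: "weak_on \<Omega> (%x. tact (A' x)) f G" and f0: "\<forall>x. x \<notin> \<Omega> --> f x = 0"
   have [measurable]: "borel_fun G" "borel_fun f" using h1_L2(2)[OF h] f by (auto simp: L2_def)
   have f1: "esq UNIV f <= ennreal (1 / c0) * energy w' UNIV f"
   proof -
    have "esq UNIV f <= nint (%x. ennreal (1 / c0) * (ennreal (w' x * (norm (f x))^2) * indicator UNIV x))"
    proof (rule nn_integral_mono_AE, use c0(2) in eventually_elim)
     fix x assume *: "x \<in> ball 0 R --> c0 <= w' x"
     have "1 * (norm (f x))^2 <= 1 / c0 * (w' x * (norm (f x))^2)"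
     proof (cases "x \<in> \<Omega>")
      case True
      then have "c0 * (norm (f x))^2 <= w' x * (norm (f x))^2" using * R by (intro mult_right_mono) auto
      then show ?thesis using c0 by (simp add: field_simps)
     qed (simp add: f0)
     from ennreal_leI[OF this] show "ennreal (1 * (norm (f x))^2) * indicator UNIV x <= ennreal (1 / c0) * (ennreal (w' x * (norm (f x))^2) * indicator UNIV x)"
      using c0 w'0 by (simp add: ennreal_mult'[symmetric])
    qed
    also have "... = ennreal (1 / c0) * energy w' UNIV f" by (rule nn_integral_cmult) measurable
    finally show ?thesis .
   qed
   have "esq UNIV G <= ennreal (1 / \<mu>^2) * esq UNIV f" using energy_est_one[OF e, unfolded energy_est_def, rule_format, OF h f] weak by (simp add: weak_on_def)
   also have "... <= ennreal (1 / \<mu>^2) * (ennreal (1 / c0) * energy w' UNIV f)" by (intro mult_left_mono f1) simp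
   finally have G1: "esq UNIV G <= ennreal (1 / \<mu>^2) * (ennreal (1 / c0) * energy w' UNIV f)" .
   show "energy w' UNIV G <= ennreal (C * (1 / \<mu>^2 * (1 / c0) + 1)) * energy w' UNIV f"
   proof (rule energy_monotone_limit)
    fix n :: nat
    have "energy (%x. min (w' x) (real n)) UNIV G <= ennreal C * (esq UNIV G + energy (%x. min (w' x) (real n)) UNIV f)" by (rule est[OF _ h f weak]) simp
    also have "... <= ennreal C * (ennreal (1 / \<mu>^2) * (ennreal (1 / c0) * energy w' UNIV f) + energy w' UNIV f)"
     by (intro mult_left_mono add_mono G1 nn_integral_mono mult_right_mono ennreal_leI) auto
    also have "... = ennreal (C * (1 / \<mu>^2 * (1 / c0) + 1)) * energy w' UNIV f"
    proof -
     have alg: "ennreal C * (ennreal p * (ennreal q * X) + X) = ennreal (C * (p * q + 1)) * X" if "0 <= p" "0 <= q" for p q and X :: ennreal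
      using that C by (simp add: ennreal_mult distrib_left distrib_right mult_ac)
     show ?thesis by (rule alg) (use c0 in auto)
    qed
    finally show "energy (%x. min (w' x) (real n)) UNIV G <= ennreal (C * (1 / \<mu>^2 * (1 / c0) + 1)) * energy w' UNIV f" .
   qed measurable
  qed
 qed
 then obtain K where K: "!!(U :: real^'d => real^'m) G f. h1 \<Omega> U G ==> L2 f ==> weak_on \<Omega> (%x. tact (A' x)) f G ==> \<forall>x. x \<notin> \<Omega> --> f x = 0 ==> energy w' UNIV G <= ennreal K * energy w' UNIV f"
  by blast
 have "weighted_estimate \<Omega> w K A" unfolding weighted_estimate_def
 proof (intro allI impI)
  fix f u G assume "Linf \<Omega> f" "weak_sol \<Omega> A f u G"
  then obtain U G' f' where s: "h1 \<Omega> (U :: real^'d => real^'m) G'" "L2 f'" "weak_on \<Omega> (%x. tact (A' x)) f' G'" "\<forall>x. x \<notin> \<Omega> --> f' x = 0"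
   and eq: "AE x in lborel. x \<in> \<Omega> --> G x = G' x & f x = f' x" using weak_sol_borel_version[OF mA eqA co op \<Omega>(2)] by blast
  have G0: "\<forall>x. x \<notin> \<Omega> --> G' x = 0" using s(1) by (simp add: h1_def)
  have "(\<integral>\<^sup>+x\<in>\<Omega>. ennreal ((norm (G x))^2 * w x) \<partial>lebesgue) = energy w' UNIV G'" by (rule conv[OF _ G0]) (use eq in eventually_elim, simp)
  moreover have "(\<integral>\<^sup>+x\<in>\<Omega>. ennreal ((norm (f x))^2 * w x) \<partial>lebesgue) = energy w' UNIV f'" by (rule conv[OF _ s(4)]) (use eq in eventually_elim, simp)
  ultimately show "(\<integral>\<^sup>+x\<in>\<Omega>. ennreal ((norm (G x))^2 * w x) \<partial>lebesgue) <= ennreal K * (\<integral>\<^sup>+x\<in>\<Omega>. ennreal ((norm (f x))^2 * w x) \<partial>lebesgue)"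
   using K[OF s] by simp
 qed
 then show ?thesis by blast
qed

end
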